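(* For each $n\ge 1$ let $\boldsymbol N_n$ be a $d$-variate Hawkes process with exogenous density $\boldsymbol\mu_n$ and kernel $\boldsymbol\phi_n$, and let $\{\theta_n\}_{n\ge1}$ be positive numbers with $\theta_n\to\infty$. Assume that $\|\boldsymbol\phi_n\|_{L^1}\to\boldsymbol K$ for some $\ell\in\{1,\dots,d\}$ and $\boldsymbol K\in\mathbb R^{d\times d}_{+,1,\ell}$; that there is $\boldsymbol\varPhi\in C(\mathbb R_+;\mathbb R^{d\times d})$ with $\sqrt{n\theta_n}\,(\boldsymbol K-\mathcal L_{\boldsymbol\phi_n}(\lambda/n))\to\boldsymbol\varPhi(\lambda)$ for every $\lambda\ge0$; that $\boldsymbol\varPhi$ is $\boldsymbol K$-admissible; that $\underline{\boldsymbol\varPi}(0)$ is diagonal; and that $\mathcal I_{\boldsymbol H^{(n)}}\to\boldsymbol\varUpsilon\in D(\mathbb R;\mathbb R_+^d)$ along all continuity points of $\boldsymbol\varUpsilon$. Let $(\boldsymbol\varXi,\boldsymbol M)$ be the limit process, i.e. $\boldsymbol\varXi\in D(\mathbb R_+;\mathbb R_+^d)$ is non-decreasing, $\boldsymbol M\in D(\mathbb R_+;\mathbb R^d)$ is a square-integrable martingale, and $(\mathcal I_{\boldsymbol\varLambda^{(n)}},\boldsymbol N^{(n)},\widetilde{\boldsymbol N}^{(n)})\to(\boldsymbol\varXi,\boldsymbol\varXi,\boldsymbol M)$ in distribution in $D_S(\mathbb R_+;\mathbb R_+^d\times\mathbb R_+^d\times\mathbb R^d)$. Then $(\boldsymbol\varXi,\boldsymbol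 M)$ satisfies (almost surely) the Volterra integration equation $$\boldsymbol\varXi(t)=\boldsymbol\varUpsilon(t)+\boldsymbol\varPi*\boldsymbol M(t),\qquad t\ge0 .$$
   Context: Notation. $\mathtt D=\{1,\dots,d\}$. Limits and inequalities of vectors/matrices are entrywise. Every function on a subset of $\mathbb R$ is extended by $0$ to $\mathbb R$. $D$ denotes càdlàg functions. $\boldsymbol f*\boldsymbol g(t)=\int_{[0,t]}\boldsymbol f(t-s)\boldsymbol g(s)ds$ and $\boldsymbol\varPi*\boldsymbol M(t)=\int_{[0,t]}\boldsymbol\varPi(ds)\boldsymbol M(t-s)$. $\mathcal I_{\boldsymbol f}(t)=\int_{[0,t]}\boldsymbol f(s)ds$, $\|\boldsymbol f\|_{L^1}=(\int_0^\infty|f_{ij}(t)|dt)_{ij}$, $\mathcal L_{\boldsymbol f}(\lambda)=\int_0^\infty e^{-\lambda t}\boldsymbol f(t)dt$. Hawkes processes. A $d$-variate Hawkes process with exogenous density $\boldsymbol\mu\in L^1_{\rm loc}(\mathbb R_+;\mathbb R_+^d)$ and kernel $\boldsymbol\phi\in L^1(\mathbb R_+;\mathbb R_+^{d\times d})$ is a $d$-dimensional point process $\boldsymbol N$ with intensity (column vector) $\boldsymbol\varLambda(t)=\boldsymbol\mu(t)+\int_{[0,t)}\boldsymbol\phi(t-s)d\boldsymbol N(s)$; $\widetilde{\boldsymbol N}=\boldsymbol N-\mathcal I_{\boldsymbol\varLambda}$. The resolvent $\boldsymbol R\in L^1_{\rm loc}(\mathbb R_+;\mathbb R_+^{d\times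 d})$ is the unique solution of $\boldsymbol R=\boldsymbol\phi+\boldsymbol R*\boldsymbol\phi$. Subscript $n$ refers to parameters $(\boldsymbol\mu_n,\boldsymbol\phi_n)$. Rescaling. $\boldsymbol\varLambda^{(n)}(t)=\boldsymbol\varLambda_n(nt)/\theta_n$, $\boldsymbol N^{(n)}(t)=\boldsymbol N_n(nt)/(n\theta_n)$, $\widetilde{\boldsymbol N}^{(n)}(t)=\widetilde{\boldsymbol N}_n(nt)/\sqrt{n\theta_n}$, $\boldsymbol\mu^{(n)}(t)=\sqrt{n/\theta_n}\,\boldsymbol\mu_n(nt)$, $\boldsymbol R^{(n)}(t)=\sqrt{n/\theta_n}\,\boldsymbol R_n(nt)$, $\boldsymbol H^{(n)}=\boldsymbol\mu^{(n)}/\sqrt{n\theta_n}+\boldsymbol R^{(n)}*\boldsymbol\mu^{(n)}$. Admissibility. $\mathbb R^{d\times d}_{+,1,\ell}$ is the set of non-negative $d\times d$ matrices with spectral radius $1$ for which the eigenvalue $1$ has algebraic multiplicity $\ell$. Put $\mathtt I=\{1,\dots,\ell\}$, $\mathtt J=\{\ell+1,\dots,d\}$; $\boldsymbol A_{\mathtt I\mathtt J}$ etc. denote blocks. $\boldsymbol\varPhi$ is $\boldsymbol K$-admissible if there are (auxiliary) $\boldsymbol Q,\boldsymbol U\in\mathbb R^{d\times d}$ and $\lambda^+\ge0$ such that: $\boldsymbol Q$ is orthogonal, $\boldsymbol U_{\mathtt I\mathtt I}=\mathbf{Id}$, $\boldsymbol U_{\mathtt J\mathtt I}=\mathbf 0$,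 $\boldsymbol K=\boldsymbol Q\boldsymbol U\boldsymbol Q^{\rm T}$; and $\boldsymbol\varphi(\lambda)=(\boldsymbol Q^{\rm T}\boldsymbol\varPhi(\lambda)\boldsymbol Q)_{\mathtt I\mathtt I}+\boldsymbol U_{\mathtt I\mathtt J}(\mathbf{Id}-\boldsymbol U_{\mathtt J\mathtt J})^{-1}(\boldsymbol Q^{\rm T}\boldsymbol\varPhi(\lambda)\boldsymbol Q)_{\mathtt J\mathtt I}$ is invertible for all $\lambda\ge\lambda^+$ (here $\mathbf{Id}-\boldsymbol U_{\mathtt J\mathtt J}$ is always invertible). Potential measure. $\boldsymbol\varPi(dt)$ is the unique locally finite $\mathbb R_+^{d\times d}$-valued measure on $\mathbb R_+$ with $$\int_0^\infty e^{-\lambda t}\boldsymbol\varPi(dt)=\boldsymbol Q\begin{pmatrix}\boldsymbol\varphi(\lambda)^{-1}&\boldsymbol\varphi(\lambda)^{-1}\boldsymbol U_{\mathtt I\mathtt J}(\mathbf{Id}-\boldsymbol U_{\mathtt J\mathtt J})^{-1}\\ \mathbf 0&\mathbf 0\end{pmatrix}\boldsymbol Q^{\rm T},\quad\lambda\ge\lambda^+,$$ and $\underline{\boldsymbol\varPi}(t)=\boldsymbol\varPi([0,t])$. $S$-topology. For $f_n,f\in D(\mathbb R_+;\mathbb R^m)$ write $f_n\overset{S}{\to}f$ if for each $T\ge0$ and $\epsilon>0$ there are càdlàg functions of bounded variation $f_n^\epsilon,f^\epsilon$ with $\sup_{[0,T]}|f_n-f_n^\epsilon|\le\epsilon$, $\sup_{[0,T]}|f-f^\epsilon|\le\epsilon$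 and $\int_0^Tg\,df_n^\epsilon\to\int_0^Tg\,df^\epsilon$ for all continuous $g$ on $\mathbb R_+$ (componentwise). The $S$-topology is the (sequential) topology induced by this convergence; $D_S$ is $D$ with this topology. *)

theory Defs
  imports
    "Jordan_Normal_Form.Spectral_Radius"
    "Jordan_Normal_Form.Gauss_Jordan_Elimination"
    "HOL-Probability.Probability"
begin

no_notation Matrix.vec_index (infixl "$" 100)

text \<open>
  The index set \<open>{1, \<dots>, d}\<close> is a type \<open>'d\<close> of class \<open>{finite, linorder}\<close>. Functions on
  \<open>[0, \<infinity>)\<close> are functions on \<open>real\<close>; unless a definition says otherwise, only their values on
  \<open>[0, \<infinity>)\<close> matter.
\<close>

type_synonym 'd rvec = "(real, 'd) Finite_Cartesian_Product.vec"
type_synonym 'd rmat = "((real, 'd) Finite_Cartesian_Product.vec, 'd) Finite_Cartesian_Product.vec"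

section \<open>Deterministic functions\<close>

definition integrable_fun :: "(real \<Rightarrow> 'a::{banach, second_countable_topology}) \<Rightarrow> bool" where
  "integrable_fun f \<longleftrightarrow> set_integrable lborel {0..} f"

definition loc_integrable_fun :: "(real \<Rightarrow> 'a::{banach, second_countable_topology}) \<Rightarrow> bool" where
  "loc_integrable_fun f \<longleftrightarrow> (\<forall>T. set_integrable lborel {0..T} f)"

definition primitive :: "(real \<Rightarrow> 'a::{banach, second_countable_topology}) \<Rightarrow> real \<Rightarrow> 'a" where
  "primitive f t = (LINT s:{0..t}|lborel. f s)"

definition conv_mat_mat ::
    "(real \<Rightarrow> real^'d^'d) \<Rightarrow> (real \<Rightarrow> real^'d^'d) \<Rightarrow> real \<Rightarrow> real^'d^'d" where
  "conv_mat_mat f g t = (LINT s:{0..t}|lborel. f (t - s) ** g s)"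

definition conv_mat_vec ::
    "(real \<Rightarrow> real^'d^'d) \<Rightarrow> (real \<Rightarrow> real^'d) \<Rightarrow> real \<Rightarrow> real^'d" where
  "conv_mat_vec f g t = (LINT s:{0..t}|lborel. f (t - s) *v g s)"

definition L1_norm_mat :: "(real \<Rightarrow> real^'d^'d) \<Rightarrow> real^'d^'d" where
  "L1_norm_mat f = (\<chi> i j. LINT t:{0..}|lborel. \<bar>f t $ i $ j\<bar>)"

definition laplace :: "(real \<Rightarrow> real^'d^'d) \<Rightarrow> real \<Rightarrow> real^'d^'d" where
  "laplace f r = (LINT t:{0..}|lborel. exp (- r * t) *\<^sub>R f t)"

definition cadlag :: "(real \<Rightarrow> 'a::topological_space) \<Rightarrow> bool" where
  "cadlag f \<longleftrightarrow> (\<forall>t. continuous (at_right t) f \<and> (\<exists>l. (f \<longlongrightarrow> l) (at_left t)))"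

text \<open>
  \<open>D(\<real>\<^sub>+; E)\<close>: cadlag functions on \<open>[0, \<infinity>)\<close>, represented by their extension by \<open>0\<close> to
  \<open>real\<close> (which is again cadlag, with a possible jump at \<open>0\<close>).
\<close>

definition cadlag_space :: "'a::euclidean_space set \<Rightarrow> (real \<Rightarrow> 'a) set" where
  "cadlag_space E = {f. cadlag f \<and> (\<forall>t<0. f t = 0) \<and> (\<forall>t\<ge>0. f t \<in> E)}"


section \<open>The S-topology and convergence in distribution\<close>

text \<open>
  Total variation of \<open>f\<close> over \<open>(-\<infinity>, t]\<close>. For \<open>f\<close> vanishing on the negative half-line this is the
  variation over \<open>[0, t]\<close> plus \<open>\<bar>f 0\<bar>\<close>.
\<close>

definition variation_sums :: "(real \<Rightarrow> real) \<Rightarrow> real \<Rightarrow> real set" where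
  "variation_sums f t = {\<Sum>k<m. \<bar>f (x (Suc k)) - f (x k)\<bar> | (m::nat) (x::nat \<Rightarrow> real).
     (\<forall>k<m. x k \<le> x (Suc k)) \<and> (\<forall>k\<le>m. x k \<le> t)}"

definition locally_bounded_variation :: "(real \<Rightarrow> real) \<Rightarrow> bool" where
  "locally_bounded_variation f \<longleftrightarrow> (\<forall>t. bdd_above (variation_sums f t))"

definition total_variation :: "(real \<Rightarrow> real) \<Rightarrow> real \<Rightarrow> real" where
  "total_variation f t = Sup (variation_sums f t)"

text \<open>
  The Lebesgue--Stieltjes integral of \<open>h\<close> over \<open>[0, T]\<close> with respect to a right-continuous \<open>f\<close> of
  locally bounded variation, through the decomposition \<open>f = V - (V - f)\<close> into non-decreasing
  functions, \<open>V\<close> being the total variation of \<open>f\<close>. For \<open>f\<close> vanishing on the negative half-line,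
  the measure \<open>df\<close> has the atom \<open>f 0\<close> at \<open>0\<close>, and this atom is part of the integral.
\<close>

definition stieltjes_integral :: "(real \<Rightarrow> real) \<Rightarrow> (real \<Rightarrow> real) \<Rightarrow> real \<Rightarrow> real" where
  "stieltjes_integral h f T =
     (LINT s:{0..T}|interval_measure (total_variation f). h s)
   - (LINT s:{0..T}|interval_measure (\<lambda>t. total_variation f t - f t). h s)"

definition S_converges :: "(nat \<Rightarrow> real \<Rightarrow> 'a::euclidean_space) \<Rightarrow> (real \<Rightarrow> 'a) \<Rightarrow> bool" where
  "S_converges fs f \<longleftrightarrow> (\<forall>T\<ge>0. \<forall>\<epsilon>>0. \<exists>gs g.
     (\<forall>n. gs n \<in> cadlag_space UNIV
        \<and> (\<forall>b\<in>Basis. locally_bounded_variation (\<lambda>t. gs n t \<bullet> b))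
        \<and> (\<forall>t\<in>{0..T}. norm (fs n t - gs n t) \<le> \<epsilon>))
   \<and> g \<in> cadlag_space UNIV
   \<and> (\<forall>b\<in>Basis. locally_bounded_variation (\<lambda>t. g t \<bullet> b))
   \<and> (\<forall>t\<in>{0..T}. norm (f t - g t) \<le> \<epsilon>)
   \<and> (\<forall>h. continuous_on {0..} h \<longrightarrow> (\<forall>b\<in>Basis.
        (\<lambda>n. stieltjes_integral h (\<lambda>t. gs n t \<bullet> b) T)
          \<longlonglongrightarrow> stieltjes_integral h (\<lambda>t. g t \<bullet> b) T)))"

definition S_open :: "'a::euclidean_space set \<Rightarrow> (real \<Rightarrow> 'a) set \<Rightarrow> bool" where
  "S_open E U \<longleftrightarrow> U \<subseteq> cadlag_space E \<and>
     (\<forall>fs f. (\<forall>n. fs n \<in> cadlag_space E) \<and> f \<in> U \<and> S_converges fs f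
        \<longrightarrow> (\<forall>\<^sub>F n in sequentially. fs n \<in> U))"

definition S_topology :: "'a::euclidean_space set \<Rightarrow> (real \<Rightarrow> 'a) topology" where
  "S_topology E = topology (S_open E)"

lemma istopology_S_open: "istopology (S_open E)"
  unfolding istopology_def
proof (intro conjI allI impI)
  fix U V assume "S_open E U" "S_open E V"
  then show "S_open E (U \<inter> V)"
    unfolding S_open_def by (auto simp: eventually_conj_iff)
next
  fix \<U> assume U: "\<forall>U\<in>\<U>. S_open E U"
  show "S_open E (\<Union>\<U>)"
    unfolding S_open_def
  proof (intro conjI allI impI)
    show "\<Union>\<U> \<subseteq> cadlag_space E"
      using U by (auto simp: S_open_def)
  next
    fix fs f
    assume *: "(\<forall>n. fs n \<in> cadlag_space E) \<and> f \<in> \<Union>\<U> \<and> S_converges fs f"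
    then obtain V where "V \<in> \<U>" "f \<in> V"
      by auto
    with * U have "\<forall>\<^sub>F n in sequentially. fs n \<in> V"
      by (auto simp: S_open_def)
    then show "\<forall>\<^sub>F n in sequentially. fs n \<in> \<Union>\<U>"
      by eventually_elim (use \<open>V \<in> \<U>\<close> in auto)
  qed
qed

lemma openin_S_topology: "openin (S_topology E) = S_open E"
  by (simp add: S_topology_def istopology_S_open topology_inverse')

lemma topspace_S_topology: "topspace (S_topology E) = cadlag_space E"
proof -
  have "S_open E (cadlag_space E)"
    by (auto simp: S_open_def)
  moreover have "S_open E U \<Longrightarrow> U \<subseteq> cadlag_space E" for U
    by (auto simp: S_open_def)
  ultimately show ?thesis
    unfolding topspace_def openin_S_topology by blast
qed

definition borel_of_topology :: "'a topology \<Rightarrow> 'a measure" where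
  "borel_of_topology T = sigma (topspace T) {U. openin T U}"

text \<open>
  Convergence in distribution of random elements of a topological space; the \<open>X n\<close> may live on
  different probability spaces.
\<close>

definition converges_in_distribution ::
    "'x topology \<Rightarrow> (nat \<Rightarrow> 'w measure) \<Rightarrow> (nat \<Rightarrow> 'w \<Rightarrow> 'x) \<Rightarrow> 'v measure \<Rightarrow> ('v \<Rightarrow> 'x) \<Rightarrow> bool" where
  "converges_in_distribution T P X P' X' \<longleftrightarrow>
     (\<forall>\<^sub>F n in sequentially. X n \<in> measurable (P n) (borel_of_topology T))
   \<and> X' \<in> measurable P' (borel_of_topology T)
   \<and> (\<forall>f. continuous_map T euclideanreal f \<and> bounded (f ` topspace T) \<longrightarrow>
        (\<lambda>n. LINT \<omega>|P n. f (X n \<omega>)) \<longlonglongrightarrow> (LINT \<omega>|P'. f (X' \<omega>)))"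


section \<open>Martingales\<close>

text \<open>Processes are functions \<open>X \<omega> t\<close>; only times \<open>t \<ge> 0\<close> are constrained.\<close>

definition martingale ::
    "'w measure \<Rightarrow> (real \<Rightarrow> 'w measure) \<Rightarrow> ('w \<Rightarrow> real \<Rightarrow> 'a::euclidean_space) \<Rightarrow> bool" where
  "martingale P F X \<longleftrightarrow>
     filtration (space P) F \<and> (\<forall>t. subalgebra P (F t))
   \<and> (\<forall>t\<ge>0. (\<lambda>\<omega>. X \<omega> t) \<in> borel_measurable (F t) \<and> integrable P (\<lambda>\<omega>. X \<omega> t))
   \<and> (\<forall>s t. 0 \<le> s \<and> s \<le> t \<longrightarrow>
        (\<forall>b\<in>Basis. AE \<omega> in P. real_cond_exp P (F s) (\<lambda>\<omega>. X \<omega> t \<bullet> b) \<omega> = X \<omega> s \<bullet> b))"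

definition square_integrable_martingale ::
    "'w measure \<Rightarrow> (real \<Rightarrow> 'w measure) \<Rightarrow> ('w \<Rightarrow> real \<Rightarrow> 'a::euclidean_space) \<Rightarrow> bool" where
  "square_integrable_martingale P F X \<longleftrightarrow>
     martingale P F X \<and> (\<forall>t\<ge>0. integrable P (\<lambda>\<omega>. (norm (X \<omega> t))\<^sup>2))"

definition local_martingale ::
    "'w measure \<Rightarrow> (real \<Rightarrow> 'w measure) \<Rightarrow> ('w \<Rightarrow> real \<Rightarrow> 'a::euclidean_space) \<Rightarrow> bool" where
  "local_martingale P F X \<longleftrightarrow> (\<exists>\<tau> :: nat \<Rightarrow> 'w \<Rightarrow> real.
     (\<forall>k. stopping_time F (\<tau> k) \<and> (\<forall>\<omega>\<in>space P. 0 \<le> \<tau> k \<omega>))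
   \<and> (AE \<omega> in P. incseq (\<lambda>k. \<tau> k \<omega>) \<and> filterlim (\<lambda>k. \<tau> k \<omega>) at_top sequentially)
   \<and> (\<forall>k. martingale P F (\<lambda>\<omega> t. X \<omega> (min t (\<tau> k \<omega>)))))"


section \<open>Hawkes processes\<close>

definition hawkes_parameters :: "(real \<Rightarrow> real^'d) \<Rightarrow> (real \<Rightarrow> real^'d^'d) \<Rightarrow> bool" where
  "hawkes_parameters \<mu> \<phi> \<longleftrightarrow>
     (\<forall>t\<ge>0. 0 \<le> \<mu> t) \<and> loc_integrable_fun \<mu> \<and> (\<forall>t\<ge>0. 0 \<le> \<phi> t) \<and> integrable_fun \<phi>"

text \<open>
  Paths of \<open>d\<close>-dimensional point processes: the component \<open>x t $ i\<close> counts the points of type \<open>i\<close>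
  in \<open>[0, t]\<close>. The bound on the jumps of the sum over all components says that points are simple
  and that no two components jump simultaneously.
\<close>

definition counting_path :: "(real \<Rightarrow> real^'d) \<Rightarrow> bool" where
  "counting_path x \<longleftrightarrow>
     x \<in> cadlag_space UNIV \<and> x 0 = 0 \<and> mono x \<and> (\<forall>t i. x t $ i \<in> \<nat>)
   \<and> (\<forall>t>0. (\<Sum>i\<in>UNIV. (x t - Lim (at_left t) x) $ i) \<le> 1)"

definition hawkes_intensity ::
    "(real \<Rightarrow> real^'d) \<Rightarrow> (real \<Rightarrow> real^'d^'d) \<Rightarrow> (real \<Rightarrow> real^'d) \<Rightarrow> real \<Rightarrow> real^'d" where
  "hawkes_intensity \<mu> \<phi> x t =
     (if t < 0 then 0
      else \<mu> t + (\<chi> i. \<Sum>j\<in>UNIV.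
             LINT s:{0..<t}|interval_measure (\<lambda>s. x s $ j). \<phi> (t - s) $ i $ j))"

definition compensated ::
    "(real \<Rightarrow> real^'d) \<Rightarrow> (real \<Rightarrow> real^'d^'d) \<Rightarrow> (real \<Rightarrow> real^'d) \<Rightarrow> real \<Rightarrow> real^'d" where
  "compensated \<mu> \<phi> x t = x t - primitive (hawkes_intensity \<mu> \<phi> x) t"

text \<open>
  That \<open>hawkes_intensity\<close> is the intensity of \<open>N\<close> means that its primitive is the
  compensator of \<open>N\<close>. No predictability has to be required: for an adapted counting process
  the integral over \<open>[0, t)\<close> is predictable.
\<close>

definition hawkes_process ::
    "'w measure \<Rightarrow> (real \<Rightarrow> 'w measure) \<Rightarrow> (real \<Rightarrow> real^'d) \<Rightarrow> (real \<Rightarrow> real^'d^'d)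
      \<Rightarrow> ('w \<Rightarrow> real \<Rightarrow> real^'d) \<Rightarrow> bool" where
  "hawkes_process P F \<mu> \<phi> N \<longleftrightarrow>
     prob_space P \<and> filtration (space P) F \<and> (\<forall>t. subalgebra P (F t))
   \<and> hawkes_parameters \<mu> \<phi>
   \<and> (\<forall>\<omega>\<in>space P. counting_path (N \<omega>))
   \<and> (\<forall>t\<ge>0. (\<lambda>\<omega>. N \<omega> t) \<in> borel_measurable (F t))
   \<and> local_martingale P F (\<lambda>\<omega>. compensated \<mu> \<phi> (N \<omega>))"

text \<open>The resolvent is determined up to Lebesgue-null sets.\<close>

definition is_resolvent :: "(real \<Rightarrow> real^'d^'d) \<Rightarrow> (real \<Rightarrow> real^'d^'d) \<Rightarrow> bool" where
  "is_resolvent \<phi> R \<longleftrightarrow>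
     (\<forall>t\<ge>0. 0 \<le> R t) \<and> loc_integrable_fun R
   \<and> (AE t in lborel. 0 \<le> t \<longrightarrow> R t = \<phi> t + conv_mat_mat R \<phi> t)"


section \<open>Rescaling\<close>

definition rescale_intensity :: "nat \<Rightarrow> real \<Rightarrow> (real \<Rightarrow> real^'d) \<Rightarrow> real \<Rightarrow> real^'d" where
  "rescale_intensity n \<theta> f t = (1 / \<theta>) *\<^sub>R f (real n * t)"

definition rescale_counting :: "nat \<Rightarrow> real \<Rightarrow> (real \<Rightarrow> real^'d) \<Rightarrow> real \<Rightarrow> real^'d" where
  "rescale_counting n \<theta> f t = (1 / (real n * \<theta>)) *\<^sub>R f (real n * t)"

definition rescale_compensated :: "nat \<Rightarrow> real \<Rightarrow> (real \<Rightarrow> real^'d) \<Rightarrow> real \<Rightarrow> real^'d" where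
  "rescale_compensated n \<theta> f t = (1 / sqrt (real n * \<theta>)) *\<^sub>R f (real n * t)"

text \<open>The common rescaling of the exogenous density and of the resolvent.\<close>

definition rescale_density :: "nat \<Rightarrow> real \<Rightarrow> (real \<Rightarrow> 'a::real_vector) \<Rightarrow> real \<Rightarrow> 'a" where
  "rescale_density n \<theta> f t = sqrt (real n / \<theta>) *\<^sub>R f (real n * t)"

definition rescaled_H ::
    "nat \<Rightarrow> real \<Rightarrow> (real \<Rightarrow> real^'d) \<Rightarrow> (real \<Rightarrow> real^'d^'d) \<Rightarrow> real \<Rightarrow> real^'d" where
  "rescaled_H n \<theta> \<mu> R t =
     (1 / sqrt (real n * \<theta>)) *\<^sub>R rescale_density n \<theta> \<mu> t
     + conv_mat_vec (rescale_density n \<theta> R) (rescale_density n \<theta> \<mu>) t"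


section \<open>Admissibility and the potential measure\<close>

text \<open>
  Block decompositions are expressed with the matrices of \<open>Jordan_Normal_Form\<close>, whose dimensions
  are not types. Rows and columns are enumerated along the order of \<open>'d\<close>.
\<close>

definition to_mat :: "('d::{finite, linorder}) rmat \<Rightarrow> real Matrix.mat" where
  "to_mat A = (let e = (\<lambda>k. sorted_list_of_set (UNIV :: 'd::{finite, linorder} set) ! k)
     in Matrix.mat CARD('d) CARD('d) (\<lambda>(r, s). A $ e r $ e s))"

definition critical_matrix :: "nat \<Rightarrow> ('d::{finite, linorder}) rmat \<Rightarrow> bool" where
  "critical_matrix l K \<longleftrightarrow>
     0 \<le> K
   \<and> spectral_radius (map_mat complex_of_real (to_mat K)) = 1
   \<and> Polynomial.order 1 (char_poly (to_mat K)) = l"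

definition block_II :: "nat \<Rightarrow> real Matrix.mat \<Rightarrow> real Matrix.mat" where
  "block_II l A = (case split_block A l l of (A1, A2, A3, A4) \<Rightarrow> A1)"

definition block_IJ :: "nat \<Rightarrow> real Matrix.mat \<Rightarrow> real Matrix.mat" where
  "block_IJ l A = (case split_block A l l of (A1, A2, A3, A4) \<Rightarrow> A2)"

definition block_JI :: "nat \<Rightarrow> real Matrix.mat \<Rightarrow> real Matrix.mat" where
  "block_JI l A = (case split_block A l l of (A1, A2, A3, A4) \<Rightarrow> A3)"

definition block_JJ :: "nat \<Rightarrow> real Matrix.mat \<Rightarrow> real Matrix.mat" where
  "block_JJ l A = (case split_block A l l of (A1, A2, A3, A4) \<Rightarrow> A4)"

abbreviation inv_mat :: "real Matrix.mat \<Rightarrow> real Matrix.mat" where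
  "inv_mat A \<equiv> the (mat_inverse A)"

definition IJ_factor :: "nat \<Rightarrow> real Matrix.mat \<Rightarrow> real Matrix.mat" where
  "IJ_factor l U = block_IJ l U * inv_mat (1\<^sub>m (dim_row U - l) - block_JJ l U)"

definition small_phi ::
    "nat \<Rightarrow> real Matrix.mat \<Rightarrow> real Matrix.mat \<Rightarrow> real Matrix.mat \<Rightarrow> real Matrix.mat" where
  "small_phi l Q U A =
     block_II l (transpose_mat Q * A * Q)
     + IJ_factor l U * block_JI l (transpose_mat Q * A * Q)"

definition admissible ::
    "nat \<Rightarrow> 'd rmat \<Rightarrow> (real \<Rightarrow> ('d::{finite, linorder}) rmat)
      \<Rightarrow> real Matrix.mat \<Rightarrow> real Matrix.mat \<Rightarrow> real \<Rightarrow> bool" where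
  "admissible l K \<Phi> Q U lp \<longleftrightarrow>
     Q \<in> carrier_mat CARD('d) CARD('d) \<and> U \<in> carrier_mat CARD('d) CARD('d) \<and> 0 \<le> lp
   \<and> transpose_mat Q * Q = 1\<^sub>m CARD('d) \<and> Q * transpose_mat Q = 1\<^sub>m CARD('d)
   \<and> block_II l U = 1\<^sub>m l \<and> block_JI l U = 0\<^sub>m (CARD('d) - l) l
   \<and> to_mat K = Q * U * transpose_mat Q
   \<and> (\<forall>r\<ge>lp. invertible_mat (small_phi l Q U (to_mat (\<Phi> r))))"

definition potential_laplace ::
    "nat \<Rightarrow> real Matrix.mat \<Rightarrow> real Matrix.mat \<Rightarrow> real Matrix.mat \<Rightarrow> real Matrix.mat" where
  "potential_laplace l Q U A =
     (let d = dim_row Q; B = inv_mat (small_phi l Q U A)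
      in Q * four_block_mat B (B * IJ_factor l U)
               (0\<^sub>m (d - l) l) (0\<^sub>m (d - l) (d - l)) * transpose_mat Q)"

text \<open>
  A matrix-valued measure is given by its entries. The conditions below determine the
  measure uniquely.
\<close>

definition potential_measure ::
    "nat \<Rightarrow> (real \<Rightarrow> ('d::{finite, linorder}) rmat)
      \<Rightarrow> real Matrix.mat \<Rightarrow> real Matrix.mat \<Rightarrow> real \<Rightarrow> ('d \<Rightarrow> 'd \<Rightarrow> real measure) \<Rightarrow> bool" where
  "potential_measure l \<Phi> Q U lp Pot \<longleftrightarrow>
     (\<forall>i j. sets (Pot i j) = sets borel \<and> emeasure (Pot i j) {..<0} = 0
        \<and> (\<forall>t. emeasure (Pot i j) {0..t} < \<infinity>))
   \<and> (\<forall>r\<ge>lp.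
        (\<forall>i j. integrable (Pot i j) (\<lambda>t. exp (- r * t)))
      \<and> to_mat (\<chi> i j. LINT t|Pot i j. exp (- r * t))
          = potential_laplace l Q U (to_mat (\<Phi> r)))"

definition potential_cumulative :: "('d::finite \<Rightarrow> 'd \<Rightarrow> real measure) \<Rightarrow> real \<Rightarrow> 'd rmat" where
  "potential_cumulative Pot t = (\<chi> i j. measure (Pot i j) {0..t})"

definition potential_conv ::
    "('d::finite \<Rightarrow> 'd \<Rightarrow> real measure) \<Rightarrow> (real \<Rightarrow> 'd rvec) \<Rightarrow> real \<Rightarrow> 'd rvec" where
  "potential_conv Pot m t = (\<chi> i. \<Sum>j\<in>UNIV. LINT s:{0..t}|Pot i j. m (t - s) $ j)"

end

theory Submission
  imports Defs
begin

text \<open>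
  Write \<open>c\<^sub>n = sqrt (n \<theta>\<^sub>n)\<close>. The resolvent inverts the Volterra equation of the intensity: path by path,
  \<open>\<Xi>\<^sub>n = I_H\<^sub>n + R\<^sub>n * M\<^sub>n\<close>, where \<open>\<Xi>\<^sub>n\<close>, \<open>I_H\<^sub>n\<close>, \<open>R\<^sub>n\<close>, \<open>M\<^sub>n\<close> are the rescaled integrated intensity, the
  integral of the forcing term, the resolvent and the compensated process. The theorem is the limit of
  this identity, with the measures \<open>R\<^sub>n(t) dt\<close> tending to the potential measure.

  Neither the kernels nor the paths converge well enough to pass to the limit in the identity
  itself. It is therefore integrated three times: one integration is given to the path, and two to
  the kernel, or to the weight \<open>T - u\<close> where there is no kernel. In this form everything converges.

  \<^item> The S-topology makes \<open>x \<mapsto> \<integral>\<^sub>0\<^sup>t x(s) ds\<close> continuous and locally bounded along convergent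
    sequences (\<open>S_converges_running_integral\<close>, \<open>S_converges_running_integral_bounded\<close>), because
    \<open>\<integral>\<^sub>0\<^sup>t x(s) ds\<close> is the Stieltjes integral of the continuous function \<open>s \<mapsto> (t - s)\<^sup>+\<close> against
    \<open>dx\<close>, up to the uniform error allowed by S-convergence.

  \<^item> The doubly integrated kernels \<open>\<integral> (t - s)\<^sup>+ R\<^sub>n(s) ds\<close> converge to \<open>\<integral> (t - s)\<^sup>+ \<Pi>(ds)\<close> for every
    \<open>t\<close> (\<open>resolvent_double_integral_convergence\<close>). The Laplace transform of \<open>R\<^sub>n\<close> is, up to a term
    of order \<open>1/c\<^sub>n\<close>, the inverse of \<open>c\<^sub>n (Id - L\<^sub>n)\<close>, where \<open>L\<^sub>n\<close> is the transform of the kernel at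
    the argument divided by \<open>n\<close> and \<open>c\<^sub>n (K - L\<^sub>n) \<rightarrow> \<Phi>\<close>. Here
    \<open>Id - K\<close> is singular; after normalisation, a limit point \<open>Z\<close> of the inverses satisfies
    \<open>Z K = Z\<close>, and the block structure of \<open>K\<close> then identifies it (\<open>scaled_inverse_convergence\<close>,
    \<open>potential_transform_algebra\<close>). That the inverse is indeed the transform, namely that the latter is
    finite, follows from the existence of positive vectors \<open>z\<close> with \<open>L\<^sub>n z \<le> s z\<close> and \<open>s < 1\<close>
    (\<open>eventually_subcritical\<close>).

  Let \<open>\<Psi>\<close> be the difference of the two sides of the triply integrated limit equation at a time \<open>T\<close>,
  as a functional of the triple of paths. It is sequentially S-continuous. At the prelimit triple it
  differs from \<open>0\<close> only through the replacement of the prelimit forcing and kernels by their limits,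
  and Young's inequality bounds it by \<open>a\<^sub>n + e\<^sub>n / c + c J\<close> for every \<open>c > 0\<close>, with \<open>a\<^sub>n, e\<^sub>n \<rightarrow> 0\<close>
  deterministic and \<open>J\<close> continuous. Testing the convergence in distribution with
  \<open>min 1 \<bar>\<Psi>\<bar>\<close> and \<open>min 1 (c J)\<close> and letting \<open>c\<close> tend to \<open>0\<close> yields \<open>\<Psi> = 0\<close> almost surely at the limit
  (\<open>vanishing_functional_of_limit\<close>). Finally the equation, known for all rational \<open>T\<close> simultaneously, is
  differentiated three times by right-continuity
  (\<open>volterra_from_triple_integrals\<close>).
\<close>

section \<open>Uniform boundedness and cadlag functions\<close>

text \<open>
  The Baire argument: the closed sets of points where the whole family is bounded by \<open>k\<close> cover the
  space, so one of them contains a ball, and linearity spreads the bound on the ball.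
\<close>

lemma Banach_Steinhaus_real:
  fixes F :: "nat \<Rightarrow> 'a::{real_normed_vector, complete_space} \<Rightarrow> real"
  assumes lin: "\<And>n. bounded_linear (F n)" and bdd: "\<And>x. bounded (range (\<lambda>n. F n x))"
  obtains C where "\<And>n x. \<bar>F n x\<bar> \<le> C * norm x"
proof -
  define A where "A k = {x. \<forall>n. \<bar>F n x\<bar> \<le> real k}" for k :: nat
  have cont: "continuous_on UNIV (F n)" for n
    using lin[of n] by (simp add: linear_continuous_on)
  have closed: "closed (A k)" for k
  proof -
    have "A k = (\<Inter>n. {x. \<bar>F n x\<bar> \<le> real k})"
      by (auto simp: A_def)
    moreover have "closed {x. \<bar>F n x\<bar> \<le> real k}" for n
      by (intro closed_Collect_le continuous_intros cont)
    ultimately show ?thesis by auto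
  qed
  have cover: "(\<Union>k. A k) = UNIV"
  proof (intro equalityI subsetI UNIV_I)
    fix x :: 'a
    obtain B where B: "\<And>n. \<bar>F n x\<bar> \<le> B"
      using bdd[of x] by (auto simp: bounded_iff)
    obtain k :: nat where "B \<le> real k"
      using real_arch_simple by blast
    with B have "x \<in> A k"
      by (auto simp: A_def intro: order_trans)
    then show "x \<in> (\<Union>k. A k)" by blast
  qed
  have "\<exists>k. interior (A k) \<noteq> {}"
  proof (rule ccontr)
    assume "\<not> (\<exists>k. interior (A k) \<noteq> {})"
    then have "euclidean interior_of \<Union>(range A) = {}"
      by (intro Baire_category_alt disjI1 completely_metrizable_space_euclidean)
         (auto simp: closed)
    with cover show False by simp
  qed
  then obtain k x0 where "x0 \<in> interior (A k)" by blast
  then obtain r where r: "r > 0" "cball x0 r \<subseteq> A k"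
    using mem_interior_cball by blast
  show thesis
  proof
    fix n x
    interpret bounded_linear "F n" by (rule lin)
    show "\<bar>F n x\<bar> \<le> (2 * real k / r) * norm x"
    proof (cases "x = 0")
      case True then show ?thesis by simp
    next
      case False
      define y where "y = (r / norm x) *\<^sub>R x"
      have "x0 + y \<in> cball x0 r" "x0 \<in> cball x0 r"
        using r False by (auto simp: y_def dist_norm)
      with r(2) have "x0 + y \<in> A k" "x0 \<in> A k" by auto
      then have "\<bar>F n (x0 + y)\<bar> \<le> real k" "\<bar>F n x0\<bar> \<le> real k"
        by (auto simp: A_def)
      then have "\<bar>F n y\<bar> \<le> 2 * real k"
        by (simp add: add)
      then have "r / norm x * \<bar>F n x\<bar> \<le> 2 * real k"
        using r by (simp add: y_def scaleR abs_mult)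
      then show ?thesis using r False by (simp add: field_simps)
    qed
  qed
qed

text \<open>
  Near any point a cadlag function is nearly constant on each side, so the points with a jump larger
  than a given size have no limit point.
\<close>

lemma cadlag_countable_discontinuities:
  fixes f :: "real \<Rightarrow> 'a::metric_space"
  assumes "cadlag f"
  shows "countable {t. \<not> isCont f t}"
proof -
  obtain L where L: "\<And>t. (f \<longlongrightarrow> L t) (at_left t)"
    using assms unfolding cadlag_def by metis
  have R: "(f \<longlongrightarrow> f t) (at_right t)" for t
    using assms by (auto simp: cadlag_def continuous_within)
  define A where "A m = {t. dist (f t) (L t) > 3 / real (Suc m)}" for m
  have "\<not> z islimpt A m" for z m
  proof
    assume lim: "z islimpt A m"
    define e where "e = 1 / real (Suc m)"
    have e: "e > 0" by (simp add: e_def)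
    obtain b where b: "b > z" "\<And>s. z < s \<Longrightarrow> s < b \<Longrightarrow> dist (f s) (f z) < e"
      using tendstoD[OF R e, of z] by (auto simp: eventually_at_right_field)
    obtain a where a: "a < z" "\<And>s. a < s \<Longrightarrow> s < z \<Longrightarrow> dist (f s) (L z) < e"
      using tendstoD[OF L e, of z] by (auto simp: eventually_at_left_field)
    have near: "dist (f s) (L s) \<le> 2 * e" if "p < s" "s < q" "\<And>u. p < u \<Longrightarrow> u < q \<Longrightarrow> dist (f u) c < e" for p q s c
    proof -
      have "eventually (\<lambda>u. u \<in> {p<..<s}) (at_left s)"
        using that(1) by (rule eventually_at_leftI[rotated]) auto
      then have "eventually (\<lambda>u. dist (f u) c \<le> e) (at_left s)"
        by eventually_elim (use that in \<open>auto intro!: less_imp_le\<close>)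
      then have "dist (L s) c \<le> e"
        by (intro tendsto_upperbound[OF tendsto_dist[OF L tendsto_const]]) auto
      moreover have "dist (f s) c < e" using that by auto
      ultimately show ?thesis
        using dist_triangle2[of "f s" "L s" c] by (simp add: dist_commute)
    qed
    have "open {a<..<b}" "z \<in> {a<..<b}" using a b by auto
    with lim obtain s where s: "s \<in> A m" "s \<in> {a<..<b}" "s \<noteq> z"
      by (meson islimptE)
    have "dist (f s) (L s) \<le> 2 * e"
      using near[of z s b "f z"] near[of a s z "L z"] s a b by (cases "s < z") auto
    moreover have "dist (f s) (L s) > 3 * e" using s by (simp add: A_def e_def)
    ultimately show False using e by simp
  qed
  then have "countable (A m)" for m
    by (intro no_limpt_imp_countable)
  moreover have "{t. \<not> isCont f t} \<subseteq> (\<Union>m. A m)"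
  proof (rule ccontr)
    assume "\<not> ?thesis"
    then obtain t where t: "\<not> isCont f t" "\<And>m. t \<notin> A m" by blast
    have "dist (f t) (L t) = 0"
    proof (rule ccontr)
      assume "dist (f t) (L t) \<noteq> 0"
      then have "dist (f t) (L t) / 3 > 0" by simp
      then obtain m where "inverse (real (Suc m)) < dist (f t) (L t) / 3"
        using reals_Archimedean by blast
      then have "t \<in> A m" by (simp add: A_def field_simps)
      with t show False by blast
    qed
    then have "(f \<longlongrightarrow> f t) (at t)"
      using L[of t] R[of t] by (simp add: filterlim_at_split)
    with t show False by (simp add: isCont_def)
  qed
  ultimately show ?thesis
    by (meson countable_UN countableI_type countable_subset)
qed

lemma cadlag_borel_measurable:
  fixes f :: "real \<Rightarrow> 'a::metric_space"
  assumes "cadlag f"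
  shows "f \<in> borel_measurable borel"
  by (rule borel_measurable_continuous_countable_exceptions[OF cadlag_countable_discontinuities[OF assms]])
     (auto intro!: continuous_at_imp_continuous_on)

lemma cadlag_bounded:
  fixes f :: "real \<Rightarrow> 'a::real_normed_vector"
  assumes "cadlag f"
  obtains B where "B \<ge> 0" "\<And>t. a \<le> t \<Longrightarrow> t \<le> b \<Longrightarrow> norm (f t) \<le> B"
proof -
  have "\<exists>U. open U \<and> z \<in> U \<and> bounded (f ` U)" for z
  proof -
    obtain l where l: "(f \<longlongrightarrow> l) (at_left z)"
      using assms unfolding cadlag_def by metis
    have R: "(f \<longlongrightarrow> f z) (at_right z)"
      using assms by (auto simp: cadlag_def continuous_within)
    obtain q where b: "q > z" "\<And>s. z < s \<Longrightarrow> s < q \<Longrightarrow> dist (f s) (f z) < 1"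
      using tendstoD[OF R, of 1] by (auto simp: eventually_at_right_field)
    obtain p where a: "p < z" "\<And>s. p < s \<Longrightarrow> s < z \<Longrightarrow> dist (f s) l < 1"
      using tendstoD[OF l, of 1] by (auto simp: eventually_at_left_field)
    have "norm (f s) \<le> norm (f z) + norm l + 1" if "s \<in> {p<..<q}" for s
    proof -
      have "norm (f s) \<le> norm (f z) + dist (f s) (f z)" "norm (f s) \<le> norm l + dist (f s) l"
        by (simp_all add: dist_norm norm_triangle_sub)
      moreover have "norm (f s) = norm (f z) \<or> dist (f s) (f z) < 1 \<or> dist (f s) l < 1"
        using a b that by (cases "s < z") force+
      ultimately show ?thesis
        using norm_ge_zero[of "f z"] norm_ge_zero[of l] by linarith
    qed
    then have "bounded (f ` {p<..<q})"
      unfolding bounded_iff by (intro exI[of _ "norm (f z) + norm l + 1"]) blast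
    then show ?thesis using a b by (intro exI[of _ "{p<..<q}"]) auto
  qed
  then obtain U where U: "\<And>z. open (U z)" "\<And>z. z \<in> U z" "\<And>z. bounded (f ` U z)"
    by metis
  have "compact {a..b}" "{a..b} \<subseteq> (\<Union>z\<in>UNIV. U z)"
    using U(2) by auto
  then obtain C where C: "finite C" "{a..b} \<subseteq> (\<Union>z\<in>C. U z)"
    using compactE_image[of "{a..b}" UNIV U] U(1) by (metis subset_UNIV)
  have "bounded (\<Union>z\<in>C. f ` U z)"
    using C U by (intro bounded_UN) auto
  then have "bounded (f ` {a..b})"
    by (rule bounded_subset) (use C(2) in blast)
  then obtain B where "\<forall>x\<in>f ` {a..b}. norm x \<le> B" "B > 0"
    using bounded_pos by blast
  then show thesis
    by (intro that[of B]) auto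
qed

section \<open>Total variation and Stieltjes integrals\<close>

lemma variation_sums_nonempty: "0 \<in> variation_sums f t"
  unfolding variation_sums_def by (rule CollectI, rule exI[of _ 0], rule exI[of _ "\<lambda>_. t"]) simp

text \<open>
  Refining a partition by appending \<open>s\<close> and \<open>t\<close>; the sum may grow by one more increment, hence the
  inequality.
\<close>

lemma variation_sums_snoc:
  assumes "v \<in> variation_sums f s" "s \<le> t"
  shows "v + \<bar>f t - f s\<bar> \<in> {w. \<exists>w'\<in>variation_sums f t. w \<le> w'}"
proof -
  obtain m x where x: "v = (\<Sum>k<m. \<bar>f (x (Suc k)) - f (x k)\<bar>)" "\<forall>k<m. x k \<le> x (Suc k)" "\<forall>k\<le>m. x k \<le> s"
    using assms(1) by (auto simp: variation_sums_def)
  define y where "y k = (if k \<le> m then x k else if k = Suc m then s else t)" for k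
  have "(\<Sum>k<Suc (Suc m). \<bar>f (y (Suc k)) - f (y k)\<bar>) = v + \<bar>f s - f (x m)\<bar> + \<bar>f t - f s\<bar>"
    by (simp add: x(1) y_def)
  moreover have "(\<Sum>k<Suc (Suc m). \<bar>f (y (Suc k)) - f (y k)\<bar>) \<in> variation_sums f t"
    unfolding variation_sums_def
    by (rule CollectI, intro exI[of _ "Suc (Suc m)"] exI[of _ y]) (use x assms(2) in \<open>force simp: y_def not_le less_Suc_eq_le le_Suc_eq\<close>)
  ultimately show ?thesis by (intro CollectI bexI) auto
qed

context
  fixes f :: "real \<Rightarrow> real"
  assumes lbv: "locally_bounded_variation f" and neg: "\<And>t. t < 0 \<Longrightarrow> f t = 0"
    and rc: "\<And>t. continuous (at_right t) f"
begin

lemma total_variation_upper: "v \<in> variation_sums f t \<Longrightarrow> v \<le> total_variation f t"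
  using lbv by (auto simp: locally_bounded_variation_def total_variation_def intro: cSup_upper)

text \<open>
  This makes both \<open>V\<close> and \<open>V - f\<close> nondecreasing, where \<open>V\<close> is the total variation.
\<close>

lemma total_variation_increment:
  assumes "s \<le> t"
  shows "total_variation f s + \<bar>f t - f s\<bar> \<le> total_variation f t"
proof -
  have "v \<le> total_variation f t - \<bar>f t - f s\<bar>" if "v \<in> variation_sums f s" for v
    using variation_sums_snoc[OF that assms] total_variation_upper by force
  then have "total_variation f s \<le> total_variation f t - \<bar>f t - f s\<bar>"
    unfolding total_variation_def[of f s] by (intro cSup_least) (use variation_sums_nonempty in auto)
  then show ?thesis by simp
qed

lemma total_variation_nonneg: "0 \<le> total_variation f t"
  by (rule total_variation_upper[OF variation_sums_nonempty])

lemma total_variation_neg: "t < 0 \<Longrightarrow> total_variation f t = 0"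
proof -
  assume t: "t < 0"
  have "v = 0" if "v \<in> variation_sums f t" for v
    using that t by (auto simp: variation_sums_def neg intro!: sum.neutral)
       (metis Suc_leI neg le_less_trans less_imp_le_nat diff_self abs_zero)
  then have "variation_sums f t = {0}"
    using variation_sums_nonempty[of f t] by auto
  then show ?thesis by (simp add: total_variation_def)
qed

text \<open>
  For right-continuity of the total variation at \<open>t\<close>, one needs to cut a partition sum just after \<open>t\<close>:
  the part up to \<open>t\<close> is at most \<open>V(t)\<close>, the part after \<open>u\<close> is at most \<open>V(x m) - V(u)\<close>, and only the
  increment of \<open>f\<close> between \<open>t\<close> and \<open>u\<close> remains. The induction adds one partition point at a time.
\<close>

lemma variation_sum_split:
  assumes "\<forall>k<m. x k \<le> x (Suc k)"
  shows "(x m \<le> t \<longrightarrow> (\<Sum>k<m. \<bar>f (x (Suc k)) - f (x k)\<bar>) \<le> total_variation f (x m))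
    \<and> (t < x m \<longrightarrow> (\<exists>p>t. p \<le> x m \<and> (\<forall>u. t < u \<and> u < p \<longrightarrow>
        (\<Sum>k<m. \<bar>f (x (Suc k)) - f (x k)\<bar>)
          \<le> total_variation f t + \<bar>f u - f t\<bar> + (total_variation f (x m) - total_variation f u))))"
  using assms
proof (induction m)
  case 0
  show ?case
  proof (intro conjI impI)
    assume t: "t < x 0"
    show "\<exists>p>t. p \<le> x 0 \<and> (\<forall>u. t < u \<and> u < p \<longrightarrow>
        (\<Sum>k<0. \<bar>f (x (Suc k)) - f (x k)\<bar>)
          \<le> total_variation f t + \<bar>f u - f t\<bar> + (total_variation f (x 0) - total_variation f u))"
    proof (intro exI[of _ "x 0"] conjI allI impI t order_refl)
      fix u assume "t < u \<and> u < x 0"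
      then show "(\<Sum>k<0. \<bar>f (x (Suc k)) - f (x k)\<bar>)
          \<le> total_variation f t + \<bar>f u - f t\<bar> + (total_variation f (x 0) - total_variation f u)"
        using total_variation_increment[of u "x 0"] total_variation_nonneg[of t] by auto
    qed
  qed (use total_variation_nonneg in auto)
next
  case (Suc m)
  let ?s = "\<Sum>k<m. \<bar>f (x (Suc k)) - f (x k)\<bar>"
  have le: "x m \<le> x (Suc m)" using Suc.prems by auto
  have inc: "total_variation f (x m) + \<bar>f (x (Suc m)) - f (x m)\<bar> \<le> total_variation f (x (Suc m))"
    by (rule total_variation_increment[OF le])
  have IH: "x m \<le> t \<Longrightarrow> ?s \<le> total_variation f (x m)"
    "t < x m \<Longrightarrow> \<exists>p>t. p \<le> x m \<and> (\<forall>u. t < u \<and> u < p \<longrightarrow>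
        ?s \<le> total_variation f t + \<bar>f u - f t\<bar> + (total_variation f (x m) - total_variation f u))"
    using Suc.IH Suc.prems by auto
  show ?case
  proof (intro conjI impI)
    assume "x (Suc m) \<le> t"
    then show "(\<Sum>k<Suc m. \<bar>f (x (Suc k)) - f (x k)\<bar>) \<le> total_variation f (x (Suc m))"
      using IH(1) inc le by simp
  next
    assume t: "t < x (Suc m)"
    show "\<exists>p>t. p \<le> x (Suc m) \<and> (\<forall>u. t < u \<and> u < p \<longrightarrow>
        (\<Sum>k<Suc m. \<bar>f (x (Suc k)) - f (x k)\<bar>)
          \<le> total_variation f t + \<bar>f u - f t\<bar> + (total_variation f (x (Suc m)) - total_variation f u))"
    proof (cases "x m \<le> t")
      case True
      show ?thesis
      proof (intro exI[of _ "x (Suc m)"] conjI allI impI t order_refl)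
        fix u assume u: "t < u \<and> u < x (Suc m)"
        have "total_variation f (x m) + \<bar>f t - f (x m)\<bar> \<le> total_variation f t"
          using True by (rule total_variation_increment)
        moreover have "total_variation f u + \<bar>f (x (Suc m)) - f u\<bar> \<le> total_variation f (x (Suc m))"
          using u by (intro total_variation_increment) auto
        moreover have "\<bar>f (x (Suc m)) - f (x m)\<bar> \<le> \<bar>f t - f (x m)\<bar> + \<bar>f u - f t\<bar> + \<bar>f (x (Suc m)) - f u\<bar>"
          by linarith
        ultimately show "(\<Sum>k<Suc m. \<bar>f (x (Suc k)) - f (x k)\<bar>)
          \<le> total_variation f t + \<bar>f u - f t\<bar> + (total_variation f (x (Suc m)) - total_variation f u)"
          using IH(1)[OF True] by simp
      qed
    next
      case False
      then obtain p where p: "p > t" "p \<le> x m" "\<And>u. t < u \<and> u < p \<Longrightarrow>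
        ?s \<le> total_variation f t + \<bar>f u - f t\<bar> + (total_variation f (x m) - total_variation f u)"
        using IH(2) by force
      show ?thesis
      proof (intro exI[of _ p] conjI allI impI)
        fix u assume "t < u \<and> u < p"
        from p(3)[OF this] inc show "(\<Sum>k<Suc m. \<bar>f (x (Suc k)) - f (x k)\<bar>)
          \<le> total_variation f t + \<bar>f u - f t\<bar> + (total_variation f (x (Suc m)) - total_variation f u)"
          by simp
      qed (use p le in auto)
    qed
  qed
qed

text \<open>
  Choose a partition that is optimal up to \<open>e/2\<close> and cut it just after \<open>t\<close>. Since the whole variation
  is nearly exhausted by the partition sum, \<open>V(u) - V(t)\<close> is at most \<open>e/2 + \<bar>f u - f t\<bar>\<close>.
\<close>

lemma total_variation_right_continuous: "continuous (at_right t) (total_variation f)"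
proof -
  have "((\<lambda>u. total_variation f u) \<longlongrightarrow> total_variation f t) (at_right t)"
  proof (rule tendstoI)
    fix e :: real assume e: "e > 0"
    have fl: "(f \<longlongrightarrow> f t) (at_right t)"
      using rc by (simp add: continuous_within)
    obtain q where q: "q > t" "\<And>u. t < u \<Longrightarrow> u < q \<Longrightarrow> \<bar>f u - f t\<bar> < e / 2"
      using tendstoD[OF fl, of "e/2"] e by (auto simp: eventually_at_right_field dist_real_def)
    have "\<exists>v\<in>variation_sums f (t + 1). total_variation f (t + 1) - e / 2 < v"
      unfolding total_variation_def using e lbv variation_sums_nonempty
      by (intro less_cSupD) (auto simp: locally_bounded_variation_def)
    then obtain m x where x: "total_variation f (t + 1) - e / 2 < (\<Sum>k<m. \<bar>f (x (Suc k)) - f (x k)\<bar>)"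
       "\<forall>k<m. x k \<le> x (Suc k)" "\<forall>k\<le>m. x k \<le> t + 1"
      by (auto simp: variation_sums_def)
    have xm: "total_variation f (x m) \<le> total_variation f (t + 1)"
      using total_variation_increment[of "x m" "t + 1"] x(3) by auto
    have "\<exists>p>t. \<forall>u. t < u \<and> u < p \<longrightarrow> total_variation f u < total_variation f t + e"
    proof (cases "x m \<le> t")
      case True
      have "total_variation f (x m) \<le> total_variation f t"
        using total_variation_increment[OF True] by auto
      moreover have "(\<Sum>k<m. \<bar>f (x (Suc k)) - f (x k)\<bar>) \<le> total_variation f (x m)"
        using variation_sum_split[OF x(2), of t] True by auto
      ultimately have *: "total_variation f (t + 1) < total_variation f t + e"
        using x(1) e by linarith
      show ?thesis
      proof (intro exI[of _ "t + 1"] conjI allI impI)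
        fix u assume "t < u \<and> u < t + 1"
        then show "total_variation f u < total_variation f t + e"
          using total_variation_increment[of u "t + 1"] * by auto
      qed auto
    next
      case False
      then obtain p where p: "p > t" "p \<le> x m" "\<And>u. t < u \<and> u < p \<Longrightarrow> (\<Sum>k<m. \<bar>f (x (Suc k)) - f (x k)\<bar>)
          \<le> total_variation f t + \<bar>f u - f t\<bar> + (total_variation f (x m) - total_variation f u)"
        using variation_sum_split[OF x(2), of t] by force
      show ?thesis
      proof (intro exI[of _ "min p q"] conjI allI impI)
        fix u assume u: "t < u \<and> u < min p q"
        then show "total_variation f u < total_variation f t + e"
          using p(3)[of u] q(2)[of u] x(1) xm by auto
      qed (use p q in auto)
    qed
    then obtain p where p: "p > t" "\<And>u. t < u \<Longrightarrow> u < p \<Longrightarrow> total_variation f u < total_variation f t + e"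
      by blast
    have "\<bar>total_variation f u - total_variation f t\<bar> < e" if "t < u" "u < p" for u
      using p(2)[OF that] total_variation_increment[of t u] that by auto
    then show "\<forall>\<^sub>F u in at_right t. dist (total_variation f u) (total_variation f t) < e"
      using p(1) by (auto simp: eventually_at_right_field dist_real_def)
  qed
  then show ?thesis by (simp add: continuous_within)
qed

end

text \<open>
  The atom at \<open>0\<close> is included because \<open>{0..t}\<close> is the intersection of the intervals \<open>{-1/(n+1)<..t}\<close> and
  \<open>G\<close> vanishes at their left end points.
\<close>

lemma emeasure_interval_measure_from_zero:
  assumes mono: "\<And>s t. s \<le> t \<Longrightarrow> G s \<le> G t" and rc: "\<And>t. continuous (at_right t) G"
    and neg: "\<And>t. t < 0 \<Longrightarrow> G t = 0" and t: "0 \<le> t"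
  shows "emeasure (interval_measure G) {0..t} = ennreal (G t)"
proof -
  let ?M = "interval_measure G"
  have Ioc: "emeasure ?M {a<..b} = ennreal (G b - G a)" if "a \<le> b" for a b
    by (rule emeasure_interval_measure_Ioc[OF that mono rc])
  have "emeasure ?M (\<Inter>n. {- 1 / real (Suc n)<..t}) = (INF n. emeasure ?M {- 1 / real (Suc n)<..t})"
  proof (rule INF_emeasure_decseq[symmetric])
    show "range (\<lambda>n. {- 1 / real (Suc n)<..t}) \<subseteq> sets ?M" by auto
    have "- 1 / real (Suc n) \<le> - 1 / real (Suc (Suc n))" for n
      by (simp add: divide_simps)
    then show "decseq (\<lambda>n. {- 1 / real (Suc n)<..t})"
      by (intro decseq_SucI) (simp only: Ioc_subset_iff, simp)
    show "emeasure ?M {- 1 / real (Suc n)<..t} \<noteq> \<infinity>" for n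
      using t by (subst Ioc) (auto simp: field_simps intro: order_trans[of _ 0])
  qed
  also have "(\<Inter>n. {- 1 / real (Suc n)<..t}) = {0..t}"
  proof (intro equalityI subsetI)
    fix x assume x: "x \<in> (\<Inter>n. {- 1 / real (Suc n)<..t})"
    have "0 \<le> x"
    proof (rule ccontr)
      assume "\<not> 0 \<le> x"
      then obtain n where "inverse (real (Suc n)) < - x"
        using reals_Archimedean[of "- x"] by auto
      with x show False by (auto simp: field_simps dest!: spec[of _ n])
    qed
    with x show "x \<in> {0..t}" by auto
  qed (auto simp: field_simps intro: order_less_le_trans[of _ 0])
  also have "(INF n. emeasure ?M {- 1 / real (Suc n)<..t}) = (INF n::nat. ennreal (G t))"
  proof (rule INF_cong[OF refl])
    fix n :: nat
    have "- 1 / real (Suc n) < 0" by simp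
    moreover from this t have "- 1 / real (Suc n) \<le> t" by (rule order_trans[OF less_imp_le])
    ultimately show "emeasure ?M {- 1 / real (Suc n)<..t} = ennreal (G t)"
      using t by (subst Ioc) (auto simp: neg)
  qed
  finally show ?thesis by simp
qed

lemma interval_measure_bound:
  assumes mono: "\<And>s t. s \<le> t \<Longrightarrow> G s \<le> G t" and rc: "\<And>t. continuous (at_right t) G"
    and neg: "\<And>t. t < 0 \<Longrightarrow> G t = 0" and T: "0 \<le> T"
    and h: "h \<in> borel_measurable borel" "\<And>s. \<bar>h s\<bar> \<le> B"
  shows "set_integrable (interval_measure G) {0..T} h"
    and "\<bar>LINT s:{0..T}|interval_measure G. h s\<bar> \<le> B * G T"
proof -
  let ?M = "interval_measure G"
  note E = emeasure_interval_measure_from_zero[OF mono rc neg T]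
  have B: "B \<ge> 0" using h(2)[of 0] by linarith
  have ind: "integrable ?M (\<lambda>s. indicator {0..T} s * B)"
    using E by (intro integrable_mult_left integrable_real_indicator) auto
  have "0 \<le> G (-1)" using neg by simp
  then have GT: "G T \<ge> 0" using mono[of "-1" T] T by simp
  have meas: "measure ?M {0..T} = G T"
    using E GT by (simp add: measure_def)
  show I: "set_integrable ?M {0..T} h"
    unfolding set_integrable_def
    by (rule Bochner_Integration.integrable_bound[OF ind]) (use h B in \<open>auto simp: indicator_def intro: order_trans[OF h(2)]\<close>)
  have "\<bar>LINT s:{0..T}|?M. h s\<bar> \<le> (LINT s|?M. indicator {0..T} s * B)"
    unfolding set_lebesgue_integral_def
    using I unfolding set_integrable_def
    by (intro order_trans[OF integral_abs_bound] integral_mono integrable_abs ind)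
       (use h B in \<open>auto simp: indicator_def\<close>)
  also have "\<dots> = B * G T" by (simp add: meas)
  finally show "\<bar>LINT s:{0..T}|?M. h s\<bar> \<le> B * G T" .
qed

text \<open>
  Tonelli's theorem for \<open>(t - s)\<^sup>+ = \<integral> 1_{s \<le> v \<le> t} dv\<close>.
\<close>

lemma interval_measure_integral_by_parts:
  assumes mono: "\<And>s t. s \<le> t \<Longrightarrow> G s \<le> G t" and rc: "\<And>t. continuous (at_right t) G"
    and neg: "\<And>t. t < 0 \<Longrightarrow> G t = 0" and t: "0 \<le> t" "t \<le> T"
  shows "(LINT s:{0..T}|interval_measure G. max 0 (t - s)) = (LINT s:{0..t}|lborel. G s)"
    and "set_integrable lborel {0..t} G"
proof -
  let ?M = "interval_measure G"
  interpret sigma_finite_measure ?M by (rule sigma_finite_interval_measure[OF mono rc])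
  interpret P: pair_sigma_finite lborel ?M ..
  have Gnn: "0 \<le> G s" for s
    using mono[of "min s (-1)" s] neg[of "min s (-1)"] by auto
  have [measurable]: "G \<in> borel_measurable borel"
    using mono by (intro borel_measurable_mono monoI)
  have "(\<integral>\<^sup>+s. ennreal (indicator {0..T} s * max 0 (t - s)) \<partial>?M)
      = (\<integral>\<^sup>+s. (\<integral>\<^sup>+v. indicator {0..T} s * indicator {s..t} v \<partial>lborel) \<partial>?M)"
    by (intro nn_integral_cong, subst nn_integral_cmult)
       (auto simp: emeasure_lborel_Icc_eq max_def split: split_indicator)
  also have "\<dots> = (\<integral>\<^sup>+v. (\<integral>\<^sup>+s. indicator {0..T} s * indicator {s..t} v \<partial>?M) \<partial>lborel)"
  proof (rule P.Fubini')
    have eq: "(\<lambda>(v, s). indicator {0..T} s * indicator {s..t} v :: ennreal)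
        = (\<lambda>x. indicator {0..T} (snd x) * indicator {x \<in> space (lborel \<Otimes>\<^sub>M ?M). snd x \<le> fst x \<and> fst x \<le> t} x)"
      by (auto simp: fun_eq_iff space_pair_measure split: split_indicator)
    show "(\<lambda>(v, s). indicator {0..T} s * indicator {s..t} v :: ennreal) \<in> borel_measurable (lborel \<Otimes>\<^sub>M ?M)"
      unfolding eq by measurable
  qed
  also have "\<dots> = (\<integral>\<^sup>+v. ennreal (indicator {0..t} v * G v) \<partial>lborel)"
  proof (intro nn_integral_cong)
    fix v
    show "(\<integral>\<^sup>+s. indicator {0..T} s * indicator {s..t} v \<partial>?M) = ennreal (indicator {0..t} v * G v)"
    proof (cases "v \<in> {0..t}")
      case True
      then have "(\<integral>\<^sup>+s. indicator {0..T} s * indicator {s..t} v \<partial>?M) = (\<integral>\<^sup>+s. indicator {0..v} s \<partial>?M)"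
        by (intro nn_integral_cong) (use t in \<open>auto simp: indicator_def\<close>)
      also have "\<dots> = ennreal (G v)"
        using True emeasure_interval_measure_from_zero[OF mono rc neg, of v] by simp
      finally show ?thesis using True by simp
    next
      case False
      then have "(\<integral>\<^sup>+s. indicator {0..T} s * indicator {s..t} v \<partial>?M) = (\<integral>\<^sup>+s. 0 \<partial>?M)"
        by (intro nn_integral_cong) (auto simp: indicator_def)
      then show ?thesis using False by simp
    qed
  qed
  finally have *: "(\<integral>\<^sup>+s. ennreal (indicator {0..T} s * max 0 (t - s)) \<partial>?M) = (\<integral>\<^sup>+v. ennreal (indicator {0..t} v * G v) \<partial>lborel)" .
  then show "(LINT s:{0..T}|?M. max 0 (t - s)) = (LINT s:{0..t}|lborel. G s)"
    unfolding set_lebesgue_integral_def by (subst (1 2) integral_eq_nn_integral) (simp_all add: Gnn)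
  have "\<bar>indicator {0..t} s * G s\<bar> \<le> \<bar>indicator {0..t} s * G t\<bar>" for s
    using Gnn mono by (auto simp: indicator_def)
  then have dom: "AE s in lborel. norm (indicator {0..t} s *\<^sub>R G s) \<le> norm (indicator {0..t} s * G t)"
    by simp
  have int: "integrable lborel (\<lambda>s. indicator {0..t} s * G t)"
    using t by (intro integrable_mult_left integrable_real_indicator) auto
  show "set_integrable lborel {0..t} G"
    unfolding set_integrable_def by (rule Bochner_Integration.integrable_bound[OF int _ dom]) measurable
qed

context
  fixes f :: "real \<Rightarrow> real"
  assumes lbv: "locally_bounded_variation f" and neg: "\<And>t. t < 0 \<Longrightarrow> f t = 0"
    and rc: "\<And>t. continuous (at_right t) f"
begin

private lemma V:
  shows "\<And>s t. s \<le> t \<Longrightarrow> total_variation f s \<le> total_variation f t"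
    and "\<And>t. continuous (at_right t) (total_variation f)"
    and "\<And>t. t < 0 \<Longrightarrow> total_variation f t = 0"
proof -
  show "total_variation f s \<le> total_variation f t" if "s \<le> t" for s t
    using total_variation_increment[OF lbv neg rc that] by linarith
  show "continuous (at_right t) (total_variation f)" for t
    by (rule total_variation_right_continuous[OF lbv neg rc])
  show "total_variation f t = 0" if "t < 0" for t
    using total_variation_neg[OF lbv neg rc that] .
qed

private lemma W:
  shows "\<And>s t. s \<le> t \<Longrightarrow> total_variation f s - f s \<le> total_variation f t - f t"
    and "\<And>t. continuous (at_right t) (\<lambda>t. total_variation f t - f t)"
    and "\<And>t. t < 0 \<Longrightarrow> total_variation f t - f t = 0"
proof -
  show "total_variation f s - f s \<le> total_variation f t - f t" if "s \<le> t" for s t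
    using total_variation_increment[OF lbv neg rc that] by linarith
qed (auto intro!: continuous_intros V rc simp: V neg)

text \<open>
  Integrating \<open>(t - s)\<^sup>+\<close> against \<open>df\<close> is one integration of \<open>f\<close>. This is how running integrals become
  test functionals of S-convergence.
\<close>

lemma stieltjes_integral_by_parts:
  assumes t: "0 \<le> t" "t \<le> T"
  shows "stieltjes_integral (\<lambda>s. max 0 (t - s)) f T = (LINT s:{0..t}|lborel. f s)"
proof -
  note A = interval_measure_integral_by_parts[OF V t]
  note B = interval_measure_integral_by_parts[OF W t]
  have "stieltjes_integral (\<lambda>s. max 0 (t - s)) f T
      = (LINT s:{0..t}|lborel. total_variation f s) - (LINT s:{0..t}|lborel. total_variation f s - f s)"
    by (simp add: stieltjes_integral_def A B)
  also have "\<dots> = (LINT s:{0..t}|lborel. total_variation f s - (total_variation f s - f s))"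
    by (rule set_integral_diff(2)[symmetric, OF A(2) B(2)])
  finally show ?thesis by simp
qed

text \<open>
  The form in which the uniform boundedness principle is applied: a Stieltjes integral is a bounded
  functional on the Banach space of bounded continuous integrands.
\<close>

lemma stieltjes_integral_bounded_linear:
  assumes T: "0 \<le> T"
  shows "bounded_linear (\<lambda>h. stieltjes_integral (apply_bcontfun h) f T)"
proof (rule bounded_linear_intro)
  have m: "apply_bcontfun h \<in> borel_measurable borel" for h :: "real \<Rightarrow>\<^sub>C real"
    by (intro borel_measurable_continuous_onI) simp
  have b: "\<bar>apply_bcontfun h s\<bar> \<le> norm h" for h :: "real \<Rightarrow>\<^sub>C real" and s
    using norm_bounded[of h s] by simp
  note A = interval_measure_bound[OF V T m b]
  note B = interval_measure_bound[OF W T m b]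
  show "stieltjes_integral (apply_bcontfun (g + h)) f T
      = stieltjes_integral (apply_bcontfun g) f T + stieltjes_integral (apply_bcontfun h) f T" for g h
    using A(1)[of g] A(1)[of h] B(1)[of g] B(1)[of h] by (simp add: stieltjes_integral_def plus_bcontfun.rep_eq set_integral_add)
  show "stieltjes_integral (apply_bcontfun (r *\<^sub>R h)) f T = r *\<^sub>R stieltjes_integral (apply_bcontfun h) f T" for r h
    by (simp add: stieltjes_integral_def scaleR_bcontfun.rep_eq right_diff_distrib)
  show "norm (stieltjes_integral (apply_bcontfun h) f T)
      \<le> norm h * (total_variation f T + (total_variation f T - f T))" for h
    using A(2)[of h] B(2)[of h] unfolding stieltjes_integral_def real_norm_def distrib_left by linarith
qed

end

lemma cadlag_set_integrable:
  fixes f :: "real \<Rightarrow> 'a::euclidean_space"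
  assumes "cadlag f"
  shows "set_integrable lborel {a..b} f"
proof -
  obtain B where B: "B \<ge> 0" "\<And>t. a \<le> t \<Longrightarrow> t \<le> b \<Longrightarrow> norm (f t) \<le> B"
    using cadlag_bounded[OF assms] by blast
  have [measurable]: "f \<in> borel_measurable borel" by (rule cadlag_borel_measurable[OF assms])
  have "integrable lborel (\<lambda>t. indicator {a..b} t * B)"
    by (cases "a \<le> b") (auto intro!: integrable_mult_left)
  then show ?thesis
    unfolding set_integrable_def
    by (rule Bochner_Integration.integrable_bound) (use B in \<open>auto simp: indicator_def\<close>)
qed

lemma cadlag_inner:
  fixes f :: "real \<Rightarrow> 'a::euclidean_space"
  assumes "cadlag f" shows "cadlag (\<lambda>t. inner (f t) b)"
  unfolding cadlag_def
proof (intro allI conjI)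
  fix t
  have "continuous (at_right t) f" using assms by (simp add: cadlag_def)
  then show "continuous (at_right t) (\<lambda>t. inner (f t) b)"
    by (rule continuous_inner[OF _ continuous_const])
  obtain l where "(f \<longlongrightarrow> l) (at_left t)"
    using assms unfolding cadlag_def by blast
  then show "\<exists>l. ((\<lambda>t. inner (f t) b) \<longlongrightarrow> l) (at_left t)"
    by (intro exI[of _ "inner l b"] tendsto_inner tendsto_const)
qed

section \<open>Running integrals under S-convergence\<close>

definition running_integral :: "(real \<Rightarrow> 'a::euclidean_space) \<Rightarrow> 'a \<Rightarrow> real \<Rightarrow> real" where
  "running_integral x b t = (LINT s:{0..t}|lborel. inner (x s) b)"

lemma running_integral_close:
  fixes f g :: "real \<Rightarrow> 'a::euclidean_space"
  assumes f: "cadlag f" and g: "cadlag g" and b: "b \<in> Basis"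
    and t: "0 \<le> t" and close: "\<And>s. s \<in> {0..t} \<Longrightarrow> norm (f s - g s) \<le> e"
  shows "\<bar>running_integral f b t - running_integral g b t\<bar> \<le> e * t"
proof -
  note F = cadlag_set_integrable[OF cadlag_inner[OF f], of 0 t b]
  note G = cadlag_set_integrable[OF cadlag_inner[OF g], of 0 t b]
  have D: "set_integrable lborel {0..t} (\<lambda>s. inner (f s) b - inner (g s) b)"
    by (rule set_integral_diff(1)[OF F G])
  have "running_integral f b t - running_integral g b t = (LINT s:{0..t}|lborel. inner (f s) b - inner (g s) b)"
    unfolding running_integral_def by (rule set_integral_diff(2)[OF F G, symmetric])
  also have "\<bar>\<dots>\<bar> \<le> (LINT s|lborel. indicator {0..t} s * e)"
    unfolding set_lebesgue_integral_def
  proof (intro order_trans[OF integral_abs_bound] integral_mono integrable_abs)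
    show "integrable lborel (\<lambda>s. indicat_real {0..t} s *\<^sub>R (inner (f s) b - inner (g s) b))"
      using D by (simp add: set_integrable_def)
    show "integrable lborel (\<lambda>s. indicat_real {0..t} s * e)"
      using t by (auto intro!: integrable_mult_left)
    fix s
    show "\<bar>indicat_real {0..t} s *\<^sub>R (inner (f s) b - inner (g s) b)\<bar> \<le> indicat_real {0..t} s * e"
    proof (cases "s \<in> {0..t}")
      case True
      have "\<bar>inner (f s - g s) b\<bar> \<le> norm (f s - g s)" by (rule Basis_le_norm[OF b])
      with close[OF True] True show ?thesis by (simp add: inner_diff_left)
    qed simp
  qed
  also have "\<dots> = e * t" using t by simp
  finally show ?thesis .
qed

lemma cadlag_space_inner:
  assumes "g \<in> cadlag_space E"
  shows "t < 0 \<Longrightarrow> inner (g t) b = 0" "continuous (at_right t) (\<lambda>t. inner (g t) b)" "cadlag g"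
  using assms cadlag_inner[of g b] by (auto simp: cadlag_space_def cadlag_def)

lemma continuous_on_max_diff: "continuous_on A (\<lambda>s::real. max 0 (t - s))"
  by (intro continuous_intros)

text \<open>
  S-convergence approximates both sequence and limit uniformly by functions of bounded variation
  whose Stieltjes integrals converge; the test function \<open>s \<mapsto> (t - s)\<^sup>+\<close> gives the running integral.
\<close>

lemma S_converges_running_integral:
  assumes S: "S_converges fs f" and fs: "\<And>n. fs n \<in> cadlag_space E" and f: "f \<in> cadlag_space E"
    and b: "b \<in> Basis" and t: "0 \<le> t"
  shows "(\<lambda>n. running_integral (fs n) b t) \<longlonglongrightarrow> running_integral f b t"
proof (rule LIMSEQ_I)
  fix r :: real assume r: "r > 0"
  define e where "e = r / (4 * (t + 1))"
  have e: "e > 0" using r t by (simp add: e_def)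
  have et: "e * t \<le> r / 4"
    using r t by (simp add: e_def field_simps)
  obtain gs g where A:
      "\<forall>n. gs n \<in> cadlag_space UNIV \<and> (\<forall>b\<in>Basis. locally_bounded_variation (\<lambda>t. inner (gs n t) b))
        \<and> (\<forall>t\<in>{0..t}. norm (fs n t - gs n t) \<le> e)"
      "g \<in> cadlag_space UNIV" "\<forall>b\<in>Basis. locally_bounded_variation (\<lambda>t. inner (g t) b)"
      "\<forall>t\<in>{0..t}. norm (f t - g t) \<le> e"
      "\<forall>h. continuous_on {0..} h \<longrightarrow> (\<forall>b\<in>Basis.
        (\<lambda>n. stieltjes_integral h (\<lambda>t. inner (gs n t) b) t)
          \<longlonglongrightarrow> stieltjes_integral h (\<lambda>t. inner (g t) b) t)"
    using S[unfolded S_converges_def, rule_format, OF t e] by (elim exE conjE) (rule that)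
  have gs: "\<And>n. gs n \<in> cadlag_space UNIV" "\<And>n. locally_bounded_variation (\<lambda>t. inner (gs n t) b)"
      "\<And>n s. s \<in> {0..t} \<Longrightarrow> norm (fs n s - gs n s) \<le> e"
    and g: "g \<in> cadlag_space UNIV" "locally_bounded_variation (\<lambda>t. inner (g t) b)"
      "\<And>s. s \<in> {0..t} \<Longrightarrow> norm (f s - g s) \<le> e"
    and lim: "\<And>h. continuous_on {0..} h \<Longrightarrow> (\<lambda>n. stieltjes_integral h (\<lambda>t. inner (gs n t) b) t)
        \<longlonglongrightarrow> stieltjes_integral h (\<lambda>t. inner (g t) b) t"
    using A b by simp_all
  have "stieltjes_integral (\<lambda>s. max 0 (t - s)) (\<lambda>t. inner (gs n t) b) t = running_integral (gs n) b t" for n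
    unfolding running_integral_def
    by (rule stieltjes_integral_by_parts[OF gs(2) cadlag_space_inner(1,2)[OF gs(1)] t order_refl])
  moreover have "stieltjes_integral (\<lambda>s. max 0 (t - s)) (\<lambda>t. inner (g t) b) t = running_integral g b t"
    unfolding running_integral_def
    by (rule stieltjes_integral_by_parts[OF g(2) cadlag_space_inner(1,2)[OF g(1)] t order_refl])
  ultimately have "(\<lambda>n. running_integral (gs n) b t) \<longlonglongrightarrow> running_integral g b t"
    using lim[OF continuous_on_max_diff[of _ t]] by simp
  then obtain m where m: "\<And>n. n \<ge> m \<Longrightarrow> \<bar>running_integral (gs n) b t - running_integral g b t\<bar> < r / 2"
    using LIMSEQ_D[of _ _ "r/2"] r by (metis half_gt_zero real_norm_def)
  have fs_close: "\<bar>running_integral (fs n) b t - running_integral (gs n) b t\<bar> \<le> e * t" for n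
    by (rule running_integral_close[OF cadlag_space_inner(3)[OF fs] cadlag_space_inner(3)[OF gs(1)] b t gs(3)])
  have f_close: "\<bar>running_integral f b t - running_integral g b t\<bar> \<le> e * t"
    by (rule running_integral_close[OF cadlag_space_inner(3)[OF f] cadlag_space_inner(3)[OF g(1)] b t g(3)])
  have "norm (running_integral (fs n) b t - running_integral f b t) < r" if "n \<ge> m" for n
  proof -
    have "\<bar>(A :: real) - D\<bar> < r" if "\<bar>A - B\<bar> \<le> e * t" "\<bar>D - C\<bar> \<le> e * t" "\<bar>B - C\<bar> < r / 2" for A B C D
      using that et by (simp only: abs_le_iff abs_less_iff) linarith
    from this[OF fs_close f_close m[OF that]] show ?thesis by simp
  qed
  then show "\<exists>no. \<forall>n\<ge>no. norm (running_integral (fs n) b t - running_integral f b t) < r"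
    by blast
qed

text \<open>
  For every continuous integrand the Stieltjes integrals converge, hence are bounded in \<open>n\<close>; by
  uniform boundedness they are bounded by a multiple of the supremum norm of the integrand. The
  functions \<open>s \<mapsto> (t - s)\<^sup>+\<close> with \<open>t \<le> T\<close> have norm at most \<open>T\<close> on the half-line, which makes the
  bound uniform in \<open>t\<close> as well.
\<close>

lemma S_converges_running_integral_bounded:
  assumes S: "S_converges fs f" and fs: "\<And>n. fs n \<in> cadlag_space E"
    and b: "b \<in> Basis" and T: "0 \<le> T"
  obtains C where "\<And>n t. 0 \<le> t \<Longrightarrow> t \<le> T \<Longrightarrow> \<bar>running_integral (fs n) b t\<bar> \<le> C"
proof -
  have one: "(0 :: real) < 1" by simp
  obtain gs g where A:
      "\<forall>n. gs n \<in> cadlag_space UNIV \<and> (\<forall>b\<in>Basis. locally_bounded_variation (\<lambda>t. inner (gs n t) b))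
        \<and> (\<forall>t\<in>{0..T}. norm (fs n t - gs n t) \<le> 1)"
      "g \<in> cadlag_space UNIV" "\<forall>b\<in>Basis. locally_bounded_variation (\<lambda>t. inner (g t) b)"
      "\<forall>t\<in>{0..T}. norm (f t - g t) \<le> 1"
      "\<forall>h. continuous_on {0..} h \<longrightarrow> (\<forall>b\<in>Basis.
        (\<lambda>n. stieltjes_integral h (\<lambda>t. inner (gs n t) b) T)
          \<longlonglongrightarrow> stieltjes_integral h (\<lambda>t. inner (g t) b) T)"
    using S[unfolded S_converges_def, rule_format, OF T, of 1, OF one] by (elim exE conjE) (rule that)
  have gs: "\<And>n. gs n \<in> cadlag_space UNIV" "\<And>n. locally_bounded_variation (\<lambda>t. inner (gs n t) b)"
      "\<And>n s. s \<in> {0..T} \<Longrightarrow> norm (fs n s - gs n s) \<le> 1"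
    and g: "g \<in> cadlag_space UNIV" "locally_bounded_variation (\<lambda>t. inner (g t) b)"
      "\<And>s. s \<in> {0..T} \<Longrightarrow> norm (f s - g s) \<le> 1"
    and lim: "\<And>h. continuous_on {0..} h \<Longrightarrow> (\<lambda>n. stieltjes_integral h (\<lambda>t. inner (gs n t) b) T)
        \<longlonglongrightarrow> stieltjes_integral h (\<lambda>t. inner (g t) b) T"
    using A b by simp_all
  define F where "F n h = stieltjes_integral (apply_bcontfun h) (\<lambda>t. inner (gs n t) b) T" for n and h :: "real \<Rightarrow>\<^sub>C real"
  have F1: "\<And>n. bounded_linear (F n)"
    unfolding F_def by (rule stieltjes_integral_bounded_linear[OF gs(2) cadlag_space_inner(1,2)[OF gs(1)] T])
  have F2: "\<And>h. bounded (range (\<lambda>n. F n h))"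
    unfolding F_def by (rule convergent_imp_bounded, rule lim) simp
  obtain C where C: "\<And>n h. \<bar>F n h\<bar> \<le> C * norm h"
    by (rule Banach_Steinhaus_real[of F, OF F1 F2]) (rule that)
  show thesis
  proof
    fix n t assume t: "0 \<le> t" "t \<le> T"
    \<comment> \<open>capping at \<open>T\<close> makes the test function bounded on the negative half-line\<close>
    define h where "h = Bcontfun (\<lambda>s. min T (max 0 (t - s)))"
    have hb: "(\<lambda>s. min T (max 0 (t - s))) \<in> bcontfun"
      by (rule bcontfun_normI[where b = T]) (use T in \<open>auto intro!: continuous_intros\<close>)
    have h: "apply_bcontfun h = (\<lambda>s. min T (max 0 (t - s)))"
      unfolding h_def by (rule Bcontfun_inverse[OF hb])
    have "norm h \<le> T"
      by (rule norm_bound) (use T in \<open>auto simp: h\<close>)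
    have "F n h = stieltjes_integral (\<lambda>s. max 0 (t - s)) (\<lambda>t. inner (gs n t) b) T"
      unfolding F_def stieltjes_integral_def h
      by (intro arg_cong2[of _ _ _ _ minus] set_lebesgue_integral_cong) (use t in auto)
    also have "\<dots> = running_integral (gs n) b t"
      unfolding running_integral_def
      by (rule stieltjes_integral_by_parts[OF gs(2) cadlag_space_inner(1,2)[OF gs(1)] t])
    finally have "\<bar>running_integral (gs n) b t\<bar> \<le> \<bar>C\<bar> * norm h"
      using C[of n h] by (metis abs_ge_self mult_right_mono norm_ge_zero order_trans)
    also have "\<dots> \<le> \<bar>C\<bar> * T"
      using \<open>norm h \<le> T\<close> by (intro mult_left_mono) auto
    finally have "\<bar>running_integral (gs n) b t\<bar> \<le> \<bar>C\<bar> * T" .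
    moreover have "\<bar>running_integral (fs n) b t - running_integral (gs n) b t\<bar> \<le> 1 * t"
      by (rule running_integral_close[OF cadlag_space_inner(3)[OF fs] cadlag_space_inner(3)[OF gs(1)] b t(1)])
         (use gs(3) t in auto)
    ultimately show "\<bar>running_integral (fs n) b t\<bar> \<le> \<bar>C\<bar> * T + T"
      using t by linarith
  qed
qed

section \<open>Enumerated matrices\<close>

definition idx :: "nat \<Rightarrow> 'd::{finite, linorder}" where
  "idx k = sorted_list_of_set (UNIV :: 'd set) ! k"

lemma bij_betw_idx: "bij_betw (idx :: nat \<Rightarrow> 'd::{finite, linorder}) {0..<CARD('d)} UNIV"
  unfolding idx_def
  by (rule bij_betw_nth) (auto simp: lessThan_atLeast0)

lemma sum_idx: "(\<Sum>i\<in>UNIV. f i) = (\<Sum>k=0..<CARD('d). f (idx k :: 'd::{finite, linorder}))"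
  by (rule sum.reindex_bij_betw[OF bij_betw_idx, symmetric])

lemma idx_surj: obtains k where "k < CARD('d)" "idx k = (i :: 'd::{finite, linorder})"
  using bij_betw_idx[where 'd='d] unfolding bij_betw_def
  by (metis (no_types, opaque_lifting) UNIV_I atLeastLessThan_iff image_iff)

lemma to_mat_alt: "to_mat (A :: ('d::{finite, linorder}) rmat) = Matrix.mat CARD('d) CARD('d) (\<lambda>(r, s). A $ idx r $ idx s)"
  by (simp add: to_mat_def Let_def idx_def)

lemma to_mat_carrier [simp]: "to_mat (A :: ('d::{finite, linorder}) rmat) \<in> carrier_mat CARD('d) CARD('d)"
  by (simp add: to_mat_alt)

lemma to_mat_index [simp]:
  "r < CARD('d) \<Longrightarrow> s < CARD('d) \<Longrightarrow> to_mat (A :: ('d::{finite, linorder}) rmat) $$ (r, s) = A $ idx r $ idx s"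
  by (simp add: to_mat_alt)

lemma to_mat_inj: "to_mat A = to_mat B \<Longrightarrow> A = (B :: ('d::{finite, linorder}) rmat)"
proof (intro Finite_Cartesian_Product.vec_eq_iff[THEN iffD2] allI)
  fix i j :: 'd
  assume eq: "to_mat A = to_mat B"
  obtain r s where "r < CARD('d)" "idx r = i" "s < CARD('d)" "idx s = j"
    by (metis idx_surj)
  then show "A $ i $ j = B $ i $ j"
    using to_mat_index[of r s A] to_mat_index[of r s B] eq by simp
qed

lemma to_mat_mult: "to_mat (A ** B) = to_mat A * to_mat (B :: ('d::{finite, linorder}) rmat)"
  by (rule eq_matI)
     (auto simp: to_mat_alt matrix_matrix_mult_def scalar_prod_def sum_idx)

text \<open>
  A real eigenvector of \<open>K\<close> is transported to an eigenvector of the enumerated complex matrix, whose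
  spectral radius is \<open>1\<close>.
\<close>

lemma critical_matrix_eigenvalue_le_1:
  fixes K :: "('d::{finite, linorder}) rmat"
  assumes K: "critical_matrix l K" and z: "K *v z = r *\<^sub>R z" "z \<noteq> 0"
  shows "\<bar>r\<bar> \<le> 1"
proof -
  let ?n = "CARD('d)"
  let ?A = "map_mat complex_of_real (to_mat K)"
  define v where "v = Matrix.vec ?n (\<lambda>k. complex_of_real (z $ idx k))"
  have A: "?A \<in> carrier_mat ?n ?n" by simp
  have v0: "v \<noteq> 0\<^sub>v ?n"
  proof
    assume "v = 0\<^sub>v ?n"
    have "z $ i = 0" for i
    proof -
      obtain k where k: "k < ?n" "idx k = i" by (rule idx_surj)
      have "Matrix.vec_index v k = 0" using \<open>v = 0\<^sub>v ?n\<close> k by simp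
      then show ?thesis using k by (simp add: v_def)
    qed
    with z(2) show False by (simp add: Finite_Cartesian_Product.vec_eq_iff)
  qed
  have "?A *\<^sub>v v = complex_of_real r \<cdot>\<^sub>v v"
  proof (rule eq_vecI)
    fix k assume k: "k < dim_vec (complex_of_real r \<cdot>\<^sub>v v)"
    then have k: "k < ?n" by (simp add: v_def)
    have "Matrix.vec_index (?A *\<^sub>v v) k = (\<Sum>s=0..<?n. complex_of_real (K $ idx k $ idx s * z $ idx s))"
      using k by (simp add: v_def scalar_prod_def to_mat_alt)
    also have "\<dots> = complex_of_real (\<Sum>s=0..<?n. K $ idx k $ idx s * z $ idx s)"
      by simp
    also have "(\<Sum>s=0..<?n. K $ idx k $ idx s * z $ idx s) = (K *v z) $ idx k"
      by (simp add: matrix_vector_mult_def sum_idx)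
    also have "\<dots> = r * z $ idx k" by (simp add: z(1))
    finally show "Matrix.vec_index (?A *\<^sub>v v) k = Matrix.vec_index (complex_of_real r \<cdot>\<^sub>v v) k"
      using k by (simp add: v_def)
  qed (simp add: v_def to_mat_alt)
  then have "eigenvector ?A v (complex_of_real r)"
    using v0 by (simp add: eigenvector_def v_def to_mat_alt)
  then have "complex_of_real r \<in> spectrum ?A"
    by (auto simp: spectrum_def eigenvalue_def)
  then have "cmod (complex_of_real r) \<in> cmod ` spectrum ?A"
    by (rule imageI)
  from spectral_radius_mem_max(2)[OF A _ this] K show ?thesis
    by (simp add: critical_matrix_def)
qed

section \<open>The block form of a critical matrix\<close>

lemma unit_mat_inverse:
  fixes A :: "real Matrix.mat"
  assumes A: "A \<in> carrier_mat n n" and unit: "A \<in> Units (ring_mat TYPE(real) n ())"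
  shows "inv_mat A \<in> carrier_mat n n" "A * inv_mat A = 1\<^sub>m n" "inv_mat A * A = 1\<^sub>m n"
proof -
  have "mat_inverse A \<noteq> None"
    using mat_inverse(1)[OF A, of "()"] unit by blast
  then obtain B where "mat_inverse A = Some B" by blast
  with mat_inverse(2)[OF A this]
  show "inv_mat A \<in> carrier_mat n n" "A * inv_mat A = 1\<^sub>m n" "inv_mat A * A = 1\<^sub>m n"
    by auto
qed

lemma invertible_mat_inverse:
  fixes A :: "real Matrix.mat"
  assumes A: "A \<in> carrier_mat n n" and inv: "invertible_mat A"
  shows "inv_mat A \<in> carrier_mat n n" "A * inv_mat A = 1\<^sub>m n" "inv_mat A * A = 1\<^sub>m n"
proof -
  obtain B where B: "A * B = 1\<^sub>m n" "B * A = 1\<^sub>m (dim_row B)"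
    using inv A by (auto simp: invertible_mat_def inverts_mat_def)
  have "dim_col (A * B) = n" "dim_col (B * A) = dim_row B"
    unfolding B by simp_all
  then have "B \<in> carrier_mat n n" using A by auto
  then have "A \<in> Units (ring_mat TYPE(real) n ())"
    using A B by (auto simp: Units_def ring_mat_simps)
  from unit_mat_inverse[OF A this]
  show "inv_mat A \<in> carrier_mat n n" "A * inv_mat A = 1\<^sub>m n" "inv_mat A * A = 1\<^sub>m n" .
qed

lemma char_poly_four_block_upper:
  fixes A B D :: "real Matrix.mat"
  assumes A: "A \<in> carrier_mat n n" and B: "B \<in> carrier_mat n m" and D: "D \<in> carrier_mat m m"
  shows "char_poly (four_block_mat A B (0\<^sub>m m n) D) = char_poly A * char_poly D"
proof -
  have "char_poly_matrix (four_block_mat A B (0\<^sub>m m n) D)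
      = four_block_mat (char_poly_matrix A) (map_mat (\<lambda>a. [:- a:]) B) (0\<^sub>m m n) (char_poly_matrix D)"
    using A B D by (intro eq_matI) (auto simp: char_poly_matrix_def)
  then show ?thesis
    unfolding char_poly_def
    by (simp, intro det_four_block_mat_lower_left_zero) (use A B D in auto)
qed

text \<open>
  The characteristic polynomial is \<open>(X - 1)^l\<close> times that of \<open>D\<close>, so multiplicity exactly \<open>l\<close> leaves no
  root \<open>1\<close> for \<open>D\<close>.
\<close>

lemma det_1_minus_block_nonzero:
  fixes U :: "real Matrix.mat"
  assumes B: "B \<in> carrier_mat l m" and D: "D \<in> carrier_mat m m"
    and order: "Polynomial.order 1 (char_poly (four_block_mat (1\<^sub>m l) B (0\<^sub>m m l) D)) = l"
  shows "(1\<^sub>m m - D) \<in> Units (ring_mat TYPE(real) m ())"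
proof (rule det_non_zero_imp_unit)
  show "1\<^sub>m m - D \<in> carrier_mat m m" using D by auto
  have "diag_mat (1\<^sub>m l :: real Matrix.mat) = replicate l 1"
    by (intro nth_equalityI) (auto simp: diag_mat_def)
  then have cp1: "char_poly (1\<^sub>m l :: real Matrix.mat) = [:- 1, 1:] ^ l"
    using char_poly_upper_triangular[of "1\<^sub>m l :: real Matrix.mat" l]
    by (simp add: prod_list_replicate)
  have cpD: "char_poly D \<noteq> 0"
    using degree_monic_char_poly[OF D] by (metis coeff_0 zero_neq_one)
  show "Determinant.det (1\<^sub>m m - D) \<noteq> 0"
  proof
    assume "Determinant.det (1\<^sub>m m - D) = 0"
    moreover have "- char_matrix D 1 = 1\<^sub>m m - D"
      using D by (intro eq_matI) (auto simp: char_matrix_def)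
    ultimately have "poly (char_poly D) 1 = 0"
      using char_poly_matrix[OF D, of 1] by simp
    then have "Polynomial.order 1 (char_poly D) \<noteq> 0"
      using cpD by (simp add: order_root)
    moreover have "Polynomial.order 1 (char_poly (1\<^sub>m l :: real Matrix.mat) * char_poly D)
        = Polynomial.order 1 (char_poly (1\<^sub>m l :: real Matrix.mat)) + Polynomial.order 1 (char_poly D)"
      by (rule order_mult) (simp add: cp1 cpD)
    moreover have "Polynomial.order 1 (char_poly (1\<^sub>m l :: real Matrix.mat)) = l"
      unfolding cp1 using order_power_n_n[of "1::real" l] by simp
    ultimately show False
      using order char_poly_four_block_upper[OF one_carrier_mat B D] by simp
  qed
qed

lemma four_block_mat_eq_iff:
  assumes "A \<in> carrier_mat n1 m1" "B \<in> carrier_mat n1 m2" "C \<in> carrier_mat n2 m1" "D \<in> carrier_mat n2 m2"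
    "A' \<in> carrier_mat n1 m1" "B' \<in> carrier_mat n1 m2" "C' \<in> carrier_mat n2 m1" "D' \<in> carrier_mat n2 m2"
    and eq: "four_block_mat A B C D = four_block_mat A' B' C' D'"
  shows "A = A'" "B = B'" "C = C'" "D = D'"
proof -
  have i: "four_block_mat A B C D $$ (i, j) = four_block_mat A' B' C' D' $$ (i, j)" for i j
    by (simp add: eq)
  show "A = A'"
  proof (rule eq_matI)
    fix r s assume "r < dim_row A'" "s < dim_col A'"
    then show "A $$ (r, s) = A' $$ (r, s)" using i[of r s] assms(1-8) by auto
  qed (use assms in auto)
  show "B = B'"
  proof (rule eq_matI)
    fix r s assume "r < dim_row B'" "s < dim_col B'"
    then show "B $$ (r, s) = B' $$ (r, s)" using i[of r "m1 + s"] assms(1-8) by auto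
  qed (use assms in auto)
  show "C = C'"
  proof (rule eq_matI)
    fix r s assume "r < dim_row C'" "s < dim_col C'"
    then show "C $$ (r, s) = C' $$ (r, s)" using i[of "n1 + r" s] assms(1-8) by auto
  qed (use assms in auto)
  show "D = D'"
  proof (rule eq_matI)
    fix r s assume "r < dim_row D'" "s < dim_col D'"
    then show "D $$ (r, s) = D' $$ (r, s)" using i[of "n1 + r" "m1 + s"] assms(1-8) by auto
  qed (use assms in auto)
qed

lemma block_decomposition:
  assumes A: "(A :: real Matrix.mat) \<in> carrier_mat n n" and l: "l \<le> n"
  shows "A = four_block_mat (block_II l A) (block_IJ l A) (block_JI l A) (block_JJ l A)"
    "block_II l A \<in> carrier_mat l l" "block_IJ l A \<in> carrier_mat l (n - l)"
    "block_JI l A \<in> carrier_mat (n - l) l" "block_JJ l A \<in> carrier_mat (n - l) (n - l)"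
proof -
  obtain A1 A2 A3 A4 where s: "split_block A l l = (A1, A2, A3, A4)"
    by (metis prod_cases4)
  have "dim_row A = l + (n - l)" "dim_col A = l + (n - l)" using A l by auto
  from split_block[OF s this] s
  show "A = four_block_mat (block_II l A) (block_IJ l A) (block_JI l A) (block_JJ l A)"
    "block_II l A \<in> carrier_mat l l" "block_IJ l A \<in> carrier_mat l (n - l)"
    "block_JI l A \<in> carrier_mat (n - l) l" "block_JJ l A \<in> carrier_mat (n - l) (n - l)"
    by (auto simp: block_II_def block_IJ_def block_JI_def block_JJ_def)
qed

section \<open>The Laplace transform of the potential measure\<close>

text \<open>
  The ring laws of matrices with equations between dimensions as side conditions, which the
  simplifier can discharge in block computations without carrier sets.
\<close>

lemma mat_assoc:
  "dim_col A = dim_row B \<Longrightarrow> dim_col B = dim_row C \<Longrightarrow> (A * B) * C = A * (B * (C :: real Matrix.mat))"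
  by (rule assoc_mult_mat[of _ "dim_row A" "dim_col A" _ "dim_col B" _ "dim_col C"]) auto

lemma mat_distrib_left:
  "dim_col A = dim_row B \<Longrightarrow> dim_row B = dim_row C \<Longrightarrow> dim_col B = dim_col C \<Longrightarrow> A * (B + C) = A * B + A * (C :: real Matrix.mat)"
  by (rule mult_add_distrib_mat[of _ "dim_row A" "dim_col A" _ "dim_col B"]) auto

lemma mat_distrib_right:
  "dim_col A = dim_row C \<Longrightarrow> dim_row A = dim_row B \<Longrightarrow> dim_col A = dim_col B \<Longrightarrow> (A + B) * C = A * C + B * (C :: real Matrix.mat)"
  by (rule add_mult_distrib_mat[of _ "dim_row A" "dim_col A" _ _ "dim_col C"]) auto

lemma mat_one_left: "dim_row A = n \<Longrightarrow> 1\<^sub>m n * A = (A :: real Matrix.mat)"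
  by (rule left_mult_one_mat[of _ _ "dim_col A"]) auto

lemma mat_one_right: "dim_col A = n \<Longrightarrow> A * 1\<^sub>m n = (A :: real Matrix.mat)"
  by (rule right_mult_one_mat[of _ "dim_row A"]) auto

lemma mat_zero_left: "dim_row A = n \<Longrightarrow> 0\<^sub>m m n * A = (0\<^sub>m m (dim_col A) :: real Matrix.mat)"
  by (rule left_mult_zero_mat[of _ _ "dim_col A"]) auto

lemma mat_zero_right: "dim_col A = n \<Longrightarrow> A * 0\<^sub>m n m = (0\<^sub>m (dim_row A) m :: real Matrix.mat)"
  by (rule right_mult_zero_mat[of _ "dim_row A"]) auto

lemma mat_add_zero_left: "dim_row A = n \<Longrightarrow> dim_col A = m \<Longrightarrow> 0\<^sub>m n m + A = (A :: real Matrix.mat)"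
  by (rule left_add_zero_mat) auto

lemma mat_add_zero_right: "dim_row A = n \<Longrightarrow> dim_col A = m \<Longrightarrow> A + 0\<^sub>m n m = (A :: real Matrix.mat)"
  by (rule right_add_zero_mat) auto

lemmas mat_simps = mat_assoc mat_one_left mat_one_right mat_zero_left mat_zero_right
  mat_add_zero_left mat_add_zero_right

lemma mat_diff_one_left:
  assumes D: "(D :: real Matrix.mat) \<in> carrier_mat m m" and Y: "dim_row Y = m"
  shows "(1\<^sub>m m - D) * Y = Y - D * Y"
proof -
  have "Y \<in> carrier_mat m (dim_col Y)" using Y by (rule carrier_matI) simp
  from minus_mult_distrib_mat[OF one_carrier_mat D this] show ?thesis
    by (simp only: mat_one_left[OF Y])
qed

lemma mat_diff_one_right:
  assumes D: "(D :: real Matrix.mat) \<in> carrier_mat m m" and Y: "dim_col Y = m"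
  shows "Y * (1\<^sub>m m - D) = Y - Y * D"
proof -
  have "Y \<in> carrier_mat (dim_row Y) m" using Y by (intro carrier_matI) simp
  from mult_minus_distrib_mat[OF this one_carrier_mat D] show ?thesis
    by (simp only: mat_one_right[OF Y])
qed

lemma mat_diff_eqD:
  assumes "dim_row X = dim_row Y" "dim_col X = dim_col Y" "X - Y = (Z :: real Matrix.mat)"
  shows "Z + Y = X"
  using assms(1,2) unfolding assms(3)[symmetric] by (intro eq_matI) auto

lemma mat_add_eqD:
  assumes "dim_row X = dim_row Y" "dim_col X = dim_col Y" "Z + Y = (X :: real Matrix.mat)"
    "dim_row Z = dim_row Y" "dim_col Z = dim_col Y"
  shows "X - Y = Z"
  using assms(1,2,4,5) unfolding assms(3)[symmetric] by (intro eq_matI) auto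

text \<open>
  The algebra behind the potential measure, in block coordinates: \<open>M\<close> is supported on the eigenvalue
  \<open>1\<close> of \<open>U\<close> and inverts \<open>G\<close> there. Any \<open>Y\<close> with \<open>U Y = Y\<close> has vanishing lower blocks, because \<open>Id - D\<close>
  is invertible, and any \<open>Y\<close> with \<open>Y U = Y\<close> is determined by its left blocks; on such matrices the
  third and fourth identity reduce to \<open>W\<close> being inverse to \<open>F1 + B N F3\<close>.
\<close>

lemma block_projection_algebra:
  fixes B D N F1 F2 F3 F4 W :: "real Matrix.mat"
  assumes B: "B \<in> carrier_mat l m" and D: "D \<in> carrier_mat m m" and N: "N \<in> carrier_mat m m"
    and N1: "(1\<^sub>m m - D) * N = 1\<^sub>m m" and N2: "N * (1\<^sub>m m - D) = 1\<^sub>m m"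
    and F: "F1 \<in> carrier_mat l l" "F2 \<in> carrier_mat l m" "F3 \<in> carrier_mat m l" "F4 \<in> carrier_mat m m"
    and W: "W \<in> carrier_mat l l" and W1: "W * (F1 + B * N * F3) = 1\<^sub>m l" and W2: "(F1 + B * N * F3) * W = 1\<^sub>m l"
  defines "U \<equiv> four_block_mat (1\<^sub>m l) B (0\<^sub>m m l) D"
    and "G \<equiv> four_block_mat F1 F2 F3 F4"
    and "M \<equiv> four_block_mat W (W * (B * N)) (0\<^sub>m m l) (0\<^sub>m m m)"
  shows "M * U = M" "U * M = M"
    and "\<And>Y. Y \<in> carrier_mat (l + m) (l + m) \<Longrightarrow> U * Y = Y \<Longrightarrow> M * G * Y = Y"
    and "\<And>Y. Y \<in> carrier_mat (l + m) (l + m) \<Longrightarrow> Y * U = Y \<Longrightarrow> Y * G * M = Y"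
proof -
  define C where "C = B * N"
  have C: "C \<in> carrier_mat l m" using B N by (simp add: C_def)
  note dims = carrier_matD[OF B] carrier_matD[OF C] carrier_matD[OF D] carrier_matD[OF N] carrier_matD[OF F(1)] carrier_matD[OF F(2)]
    carrier_matD[OF F(3)] carrier_matD[OF F(4)] carrier_matD[OF W]
  have z1: "0\<^sub>m m l \<in> carrier_mat m l" and z2: "0\<^sub>m m m \<in> carrier_mat m m" and z3: "0\<^sub>m l m \<in> carrier_mat l m" and o: "1\<^sub>m l \<in> carrier_mat l l" by auto
  have WC: "W * C \<in> carrier_mat l m" using W C by simp
  have M: "M = four_block_mat W (W * C) (0\<^sub>m m l) (0\<^sub>m m m)" by (simp add: M_def C_def)
  have "C * (1\<^sub>m m - D) = B"
    unfolding C_def using N2 dims by (simp add: mat_simps)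
  then have "C - C * D = B" using mat_diff_one_right[OF D, of C] dims by simp
  then have CD: "B + C * D = C" using dims by (intro mat_diff_eqD) auto
  have "W * B + W * C * D = W * (B + C * D)"
    using dims by (simp add: mat_distrib_left mat_assoc)
  then have WCD: "W * B + W * C * D = W * C" by (simp add: CD)
  show "M * U = M"
    unfolding M U_def
    by (subst mult_four_block_mat[OF W WC z1 z2 o B z1 D], rule cong_four_block_mat)
       (use dims WCD in \<open>simp_all add: mat_simps\<close>)
  show "U * M = M"
    unfolding M U_def
    by (subst mult_four_block_mat[OF o B z1 D W WC z1 z2], rule cong_four_block_mat)
       (use dims in \<open>simp_all add: mat_simps\<close>)
  show "M * G * Y = Y" if Y: "Y \<in> carrier_mat (l + m) (l + m)" and UY: "U * Y = Y" for Y
  proof -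
    obtain Y1 Y2 Y3 Y4 where s: "split_block Y l l = (Y1, Y2, Y3, Y4)" by (metis prod_cases4)
    have dY: "dim_row Y = l + m" "dim_col Y = l + m" using Y by auto
    note Yc = split_block(1-4)[OF s dY] and YY = split_block(5)[OF s dY]
    note ydims = carrier_matD[OF Yc(1)] carrier_matD[OF Yc(2)] carrier_matD[OF Yc(3)] carrier_matD[OF Yc(4)]
    have e: "four_block_mat (1\<^sub>m l * Y1 + B * Y3) (1\<^sub>m l * Y2 + B * Y4) (0\<^sub>m m l * Y1 + D * Y3) (0\<^sub>m m l * Y2 + D * Y4)
        = four_block_mat Y1 Y2 Y3 Y4"
      using UY unfolding YY U_def mult_four_block_mat[OF o B z1 D Yc] .
    have ec: "1\<^sub>m l * Y1 + B * Y3 \<in> carrier_mat l l"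
      "1\<^sub>m l * Y2 + B * Y4 \<in> carrier_mat l m"
      "0\<^sub>m m l * Y1 + D * Y3 \<in> carrier_mat m l"
      "0\<^sub>m m l * Y2 + D * Y4 \<in> carrier_mat m m"
      by (intro carrier_matI; simp add: dims ydims)+
    have "0\<^sub>m m l * Y1 + D * Y3 = Y3" "0\<^sub>m m l * Y2 + D * Y4 = Y4"
      by (rule four_block_mat_eq_iff(3,4)[OF ec Yc e])+
    then have D3: "D * Y3 = Y3" "D * Y4 = Y4"
      using dims ydims by (simp_all add: mat_simps)
    have zero: "X = 0\<^sub>m m (dim_col X)" if X: "dim_row X = m" "D * X = X" for X
    proof -
      have "(1\<^sub>m m - D) * X = 0\<^sub>m m (dim_col X)"
        using X(1) unfolding mat_diff_one_left[OF D X(1)] X(2) by (intro eq_matI) auto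
      then have "N * ((1\<^sub>m m - D) * X) = 0\<^sub>m m (dim_col X)"
        using dims by (simp add: mat_simps)
      moreover have "N * ((1\<^sub>m m - D) * X) = (N * (1\<^sub>m m - D)) * X"
        using dims X by (intro mat_assoc[symmetric]) auto
      ultimately show ?thesis using N2 X by (simp add: mat_one_left)
    qed
    have Y3: "Y3 = 0\<^sub>m m l" and Y4: "Y4 = 0\<^sub>m m m"
      using zero[of Y3] zero[of Y4] D3 ydims by auto
    have "W * F1 + W * C * F3 = W * (F1 + C * F3)"
      using dims by (simp add: mat_distrib_left mat_assoc)
    then have WF: "W * F1 + W * C * F3 = 1\<^sub>m l" using W1 by (simp add: C_def)
    define H where "H = W * F2 + W * C * F4"
    have H: "H \<in> carrier_mat l m" unfolding H_def by (intro carrier_matI; simp add: dims)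
    have "M * G = four_block_mat (1\<^sub>m l) H (0\<^sub>m m l) (0\<^sub>m m m)"
      unfolding M G_def H_def
      by (subst mult_four_block_mat[OF W WC z1 z2 F], rule cong_four_block_mat)
         (use dims WF in \<open>simp_all add: mat_simps\<close>)
    then have "M * G * Y = four_block_mat (1\<^sub>m l) H (0\<^sub>m m l) (0\<^sub>m m m) * four_block_mat Y1 Y2 Y3 Y4"
      by (simp add: YY)
    also have "\<dots> = four_block_mat Y1 Y2 Y3 Y4"
      by (subst mult_four_block_mat[OF o H z1 z2 Yc], rule cong_four_block_mat)
         (use dims ydims carrier_matD[OF H] in \<open>simp_all add: mat_simps Y3 Y4\<close>)
    finally show ?thesis by (simp add: YY)
  qed
  show "Y * G * M = Y" if Y: "Y \<in> carrier_mat (l + m) (l + m)" and YU: "Y * U = Y" for Y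
  proof -
    obtain Y1 Y2 Y3 Y4 where s: "split_block Y l l = (Y1, Y2, Y3, Y4)" by (metis prod_cases4)
    have dY: "dim_row Y = l + m" "dim_col Y = l + m" using Y by auto
    note Yc = split_block(1-4)[OF s dY] and YY = split_block(5)[OF s dY]
    note ydims = carrier_matD[OF Yc(1)] carrier_matD[OF Yc(2)] carrier_matD[OF Yc(3)] carrier_matD[OF Yc(4)]
    have e: "four_block_mat (Y1 * 1\<^sub>m l + Y2 * 0\<^sub>m m l) (Y1 * B + Y2 * D) (Y3 * 1\<^sub>m l + Y4 * 0\<^sub>m m l) (Y3 * B + Y4 * D)
        = four_block_mat Y1 Y2 Y3 Y4"
      using YU unfolding YY U_def mult_four_block_mat[OF Yc o B z1 D] .
    have ec: "Y1 * 1\<^sub>m l + Y2 * 0\<^sub>m m l \<in> carrier_mat l l"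
      "Y1 * B + Y2 * D \<in> carrier_mat l m"
      "Y3 * 1\<^sub>m l + Y4 * 0\<^sub>m m l \<in> carrier_mat m l"
      "Y3 * B + Y4 * D \<in> carrier_mat m m"
      by (intro carrier_matI; simp add: dims ydims)+
    have e2: "Y1 * B + Y2 * D = Y2" "Y3 * B + Y4 * D = Y4"
      by (rule four_block_mat_eq_iff(2,4)[OF ec Yc e])+
    have solve: "X2 = X1 * C" if X: "X1 * B + X2 * D = X2" "dim_col X1 = l" "dim_col X2 = m" "dim_row X1 = dim_row X2" for X1 X2
    proof -
      have "X2 - X2 * D = X1 * B"
        by (rule mat_add_eqD[OF _ _ X(1)]) (use X(2-4) dims in auto)
      then have "X2 * (1\<^sub>m m - D) * N = X1 * B * N"
        using mat_diff_one_right[OF D, of X2] X by simp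
      moreover have "X2 * (1\<^sub>m m - D) * N = X2 * ((1\<^sub>m m - D) * N)"
        using dims X by (intro mat_assoc) auto
      moreover have "X1 * B * N = X1 * C"
        unfolding C_def using dims X by (intro mat_assoc) auto
      ultimately show ?thesis using N1 X by (simp add: mat_one_right)
    qed
    have Y2: "Y2 = Y1 * C" and Y4: "Y4 = Y3 * C"
      using solve[OF e2(1)] solve[OF e2(2)] ydims by auto
    have id: "X * (F1 * W) + X * C * (F3 * W) = X" if "dim_col X = l" for X
    proof -
      have "X * (F1 * W) + X * C * (F3 * W) = X * ((F1 + C * F3) * W)"
        using dims that by (simp add: mat_distrib_left mat_distrib_right mat_assoc)
      then show ?thesis using W2 that by (simp add: C_def mat_one_right)
    qed
    have id2: "X * (F1 * (W * C)) + X * C * (F3 * (W * C)) = X * C" if "dim_col X = l" for X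
    proof -
      have "X * (F1 * (W * C)) + X * C * (F3 * (W * C)) = (X * (F1 * W) + X * C * (F3 * W)) * C"
        using dims that by (simp add: mat_distrib_right mat_assoc)
      then show ?thesis using id[OF that] by simp
    qed
    have GM: "G * M = four_block_mat (F1 * W) (F1 * (W * C)) (F3 * W) (F3 * (W * C))"
      unfolding M G_def
      by (subst mult_four_block_mat[OF F W WC z1 z2], rule cong_four_block_mat)
         (use dims in \<open>simp_all add: mat_simps\<close>)
    have gc: "F1 * W \<in> carrier_mat l l" "F1 * (W * C) \<in> carrier_mat l m" "F3 * W \<in> carrier_mat m l" "F3 * (W * C) \<in> carrier_mat m m"
      by (intro carrier_matI; simp add: dims)+
    have "Y * G * M = Y * (G * M)"
      using Y by (intro mat_assoc) (use dims in \<open>auto simp: G_def M\<close>)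
    also have "\<dots> = four_block_mat Y1 Y2 Y3 Y4 * four_block_mat (F1 * W) (F1 * (W * C)) (F3 * W) (F3 * (W * C))"
      unfolding GM YY ..
    also have "\<dots> = four_block_mat Y1 Y2 Y3 Y4"
      by (subst mult_four_block_mat[OF Yc gc], rule cong_four_block_mat)
         (use ydims(2,6) in \<open>simp_all add: id id2 Y2 Y4\<close>)
    finally show ?thesis by (simp add: YY)
  qed
qed

text \<open>
  Conjugation with \<open>Q\<close> carries the block identities to \<open>K\<close>, \<open>\<Phi> r\<close> and the Laplace transform \<open>Ph\<close>. They
  identify the limit of the inverses of \<open>c (Id - L)\<close> when \<open>c (K - L)\<close> tends to \<open>\<Phi> r\<close>.
\<close>

lemma potential_transform_algebra:
  fixes K :: "('d::{finite, linorder}) rmat"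
  assumes K: "critical_matrix l K" and l: "l \<le> CARD('d)"
    and adm: "admissible l K \<Phi> Q U lp" and pot: "potential_measure l \<Phi> Q U lp Pot" and r: "lp \<le> r"
  defines "Ph \<equiv> (\<chi> i j. LINT t|Pot i j. exp (- r * t)) :: 'd rmat"
  shows "Ph ** K = Ph" "K ** Ph = Ph"
    and "\<And>Z :: 'd rmat. K ** Z = Z \<Longrightarrow> Ph ** (\<Phi> r ** Z) = Z"
    and "\<And>X :: 'd rmat. X ** K = X \<Longrightarrow> X ** (\<Phi> r ** Ph) = X"
    and "0 \<le> Ph"
proof -
  let ?n = "CARD('d)"
  define m where "m = ?n - l"
  have n: "?n = l + m" using l by (simp add: m_def)
  define Qt where "Qt = transpose_mat Q"
  have Q: "Q \<in> carrier_mat ?n ?n" and U: "U \<in> carrier_mat ?n ?n" and Qt: "Qt \<in> carrier_mat ?n ?n"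
    and QtQ: "Qt * Q = 1\<^sub>m ?n" and QQt: "Q * Qt = 1\<^sub>m ?n"
    and UII: "block_II l U = 1\<^sub>m l" and UJI: "block_JI l U = 0\<^sub>m m l"
    and KQ: "to_mat K = Q * U * Qt" and inv: "invertible_mat (small_phi l Q U (to_mat (\<Phi> r)))"
    using adm r by (auto simp: admissible_def Qt_def m_def)
  define F where "F = to_mat (\<Phi> r)"
  have F: "F \<in> carrier_mat ?n ?n" by (simp add: F_def)
  define G where "G = Qt * F * Q"
  have G: "G \<in> carrier_mat ?n ?n" using Qt F Q by (simp add: G_def)
  define B where "B = block_IJ l U"
  define D where "D = block_JJ l U"
  note Ublk = block_decomposition[OF U l, folded m_def B_def D_def, unfolded UII UJI]
  note Gblk = block_decomposition[OF G l, folded m_def]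
  have "similar_mat (to_mat K) U"
    unfolding similar_mat_def similar_mat_wit_def
    by (rule exI[of _ Q], rule exI[of _ Qt]) (use Q U Qt QtQ QQt KQ in auto)
  then have "char_poly (to_mat K) = char_poly U" by (rule char_poly_similar)
  then have order: "Polynomial.order 1 (char_poly (four_block_mat (1\<^sub>m l) B (0\<^sub>m m l) D)) = l"
    using K Ublk(1) by (simp add: critical_matrix_def)
  have E: "1\<^sub>m m - D \<in> carrier_mat m m" by (intro minus_carrier_mat Ublk(5))
  define N where "N = inv_mat (1\<^sub>m m - D)"
  note N = unit_mat_inverse[OF E det_1_minus_block_nonzero[OF Ublk(3,5) order], folded N_def]
  have IJ: "IJ_factor l U = B * N"
    using U by (simp add: IJ_factor_def N_def m_def B_def D_def)
  define S where "S = block_II l G + B * N * block_JI l G"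
  have S: "S \<in> carrier_mat l l" "small_phi l Q U F = S"
    using Gblk(2,4) Ublk(3) N(1) by (auto simp: S_def small_phi_def IJ G_def Qt_def)
  define W where "W = inv_mat S"
  note W = invertible_mat_inverse[OF S(1) inv[folded F_def, unfolded S(2)], folded W_def]
  define M where "M = four_block_mat W (W * (B * N)) (0\<^sub>m m l) (0\<^sub>m m m)"
  have M: "M \<in> carrier_mat ?n ?n" using W(1) by (simp add: M_def n)
  have PM: "to_mat Ph = Q * M * Qt"
    using pot r Q unfolding potential_measure_def Ph_def
    by (simp add: potential_laplace_def Let_def F_def[symmetric] S(2) IJ W_def[symmetric] M_def m_def Qt_def)
  note alg = block_projection_algebra[OF Ublk(3,5) N(1,2,3) Gblk(2-5) W(1) W(3)[unfolded S_def] W(2)[unfolded S_def],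
      folded M_def, folded Ublk(1) Gblk(1) n]
  have dims: "dim_row Q = ?n" "dim_col Q = ?n" "dim_row U = ?n" "dim_col U = ?n" "dim_row Qt = ?n" "dim_col Qt = ?n"
      "dim_row F = ?n" "dim_col F = ?n" "dim_row M = ?n" "dim_col M = ?n"
    using Q U Qt F M by auto
  have tdims: "dim_row (to_mat A) = ?n" "dim_col (to_mat A) = ?n" for A :: "'d rmat"
    by (simp_all add: to_mat_alt)
  have c1: "Qt * (Q * X) = X" if "dim_row X = ?n" for X
    using mat_assoc[of Qt Q X] that dims QtQ by (simp add: mat_one_left)
  have c2: "Q * (Qt * X) = X" if "dim_row X = ?n" for X
    using mat_assoc[of Q Qt X] that dims QQt by (simp add: mat_one_left)
  note simps = dims tdims c1 c2 mat_assoc QQt QtQ mat_one_right mat_one_left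
  show "Ph ** K = Ph"
  proof (rule to_mat_inj)
    have "to_mat (Ph ** K) = Q * (M * U) * Qt"
      unfolding to_mat_mult PM KQ by (simp add: simps)
    then show "to_mat (Ph ** K) = to_mat Ph" by (simp only: alg(1) PM)
  qed
  show "K ** Ph = Ph"
  proof (rule to_mat_inj)
    have "to_mat (K ** Ph) = Q * (U * M) * Qt"
      unfolding to_mat_mult PM KQ by (simp add: simps)
    then show "to_mat (K ** Ph) = to_mat Ph" by (simp only: alg(2) PM)
  qed
  show "Ph ** (\<Phi> r ** Z) = Z" if KZ: "K ** Z = Z" for Z :: "'d rmat"
  proof (rule to_mat_inj)
    define Y where "Y = Qt * to_mat Z * Q"
    have Y: "Y \<in> carrier_mat ?n ?n" by (intro carrier_matI) (simp_all add: Y_def dims)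
    have "U * Y = Qt * (to_mat K * to_mat Z) * Q"
      unfolding KQ Y_def by (simp add: simps)
    also have "\<dots> = Y" unfolding to_mat_mult[symmetric] KZ Y_def ..
    finally have "M * G * Y = Y" by (rule alg(3)[OF Y])
    then have "Q * (M * G * Y) * Qt = Q * Y * Qt" by simp
    also have "Q * (M * G * Y) * Qt = to_mat (Ph ** (\<Phi> r ** Z))"
      unfolding to_mat_mult PM F_def[symmetric] G_def Y_def by (simp add: simps)
    also have "Q * Y * Qt = to_mat Z"
      unfolding Y_def by (simp add: simps)
    finally show "to_mat (Ph ** (\<Phi> r ** Z)) = to_mat Z" .
  qed
  show "X ** (\<Phi> r ** Ph) = X" if XK: "X ** K = X" for X :: "'d rmat"
  proof (rule to_mat_inj)
    define Y where "Y = Qt * to_mat X * Q"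
    have Y: "Y \<in> carrier_mat ?n ?n" by (intro carrier_matI) (simp_all add: Y_def dims)
    have "Y * U = Qt * (to_mat X * to_mat K) * Q"
      unfolding KQ Y_def by (simp add: simps)
    also have "\<dots> = Y" unfolding to_mat_mult[symmetric] XK Y_def ..
    finally have "Y * G * M = Y" by (rule alg(4)[OF Y])
    then have "Q * (Y * G * M) * Qt = Q * Y * Qt" by simp
    also have "Q * (Y * G * M) * Qt = to_mat (X ** (\<Phi> r ** Ph))"
      unfolding to_mat_mult PM F_def[symmetric] G_def Y_def by (simp add: simps)
    also have "Q * Y * Qt = to_mat X"
      unfolding Y_def by (simp add: simps)
    finally show "to_mat (X ** (\<Phi> r ** Ph)) = to_mat X" .
  qed
  show "0 \<le> Ph"
    by (auto simp: Ph_def less_eq_vec_def intro!: integral_nonneg_AE)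
qed

section \<open>Continuity of the Laplace transform\<close>

text \<open>
  The Laplace transforms at \<open>a + k\<close> are the moments of \<open>e\<^sup>-\<^sup>a\<^sup>t \<nu>(dt)\<close> in the variable \<open>x = e\<^sup>-\<^sup>t\<close>, which
  ranges over the compact interval \<open>[0, 1]\<close>. Polynomials being dense there, convergence of all moments
  implies convergence for every continuous \<open>h\<close>.
\<close>

lemma laplace_weak_convergence:
  fixes \<nu> :: "nat \<Rightarrow> real measure" and \<nu>0 :: "real measure"
  assumes sets: "\<And>n. sets (\<nu> n) = sets borel" "sets \<nu>0 = sets borel"
    and pos: "\<And>n. AE t in \<nu> n. 0 \<le> t" "AE t in \<nu>0. 0 \<le> t"
    and int: "\<And>k::nat. \<forall>\<^sub>F n in sequentially. integrable (\<nu> n) (\<lambda>t. exp (- (a + real k) * t))"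
    and int0: "\<And>k::nat. integrable \<nu>0 (\<lambda>t. exp (- (a + real k) * t))"
    and lim: "\<And>k::nat. (\<lambda>n. LINT t|\<nu> n. exp (- (a + real k) * t)) \<longlonglongrightarrow> (LINT t|\<nu>0. exp (- (a + real k) * t))"
    and h: "continuous_on {0..1} h" and hm: "h \<in> borel_measurable borel"
  shows "(\<lambda>n. LINT t|\<nu> n. exp (- a * t) * h (exp (- t))) \<longlonglongrightarrow> (LINT t|\<nu>0. exp (- a * t) * h (exp (- t)))"
proof (rule LIMSEQ_I)
  fix r :: real assume r: "r > 0"
  have hmeas: "(\<lambda>t. exp (- a * t) * h (exp (- t))) \<in> borel_measurable M" if "sets M = sets borel" for M :: "real measure"
    unfolding measurable_cong_sets[OF that refl] using hm by measurable
  define A where "A = (LINT t|\<nu>0. exp (- a * t))"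
  have A: "A \<ge> 0" by (simp add: A_def)
  \<comment> \<open>\<open>A + 1\<close> bounds the masses \<open>\<integral> e\<^sup>-\<^sup>a\<^sup>t \<nu>(dt)\<close> eventually\<close>
  define e where "e = r / (4 * (A + 1))"
  have e: "e > 0" using r A by (simp add: e_def)
  have eA: "e * (A + 1) = r / 4" using A by (simp add: e_def divide_simps)
  obtain p where p: "real_polynomial_function p" "\<And>x. x \<in> {0..1} \<Longrightarrow> \<bar>h x - p x\<bar> < e"
    using Stone_Weierstrass_real_polynomial_function[OF compact_Icc h e] by metis
  obtain c d where c: "p = (\<lambda>x. \<Sum>i\<le>(d::nat). c i * x ^ i)"
    using p(1) unfolding real_polynomial_function_iff_sum by blast
  have pe: "exp (- a * t) * p (exp (- t)) = (\<Sum>i\<le>d. c i * exp (- (a + real i) * t))" for t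
    unfolding c sum_distrib_left
    by (intro sum.cong refl) (simp add: exp_of_nat_mult[symmetric] exp_add[symmetric] algebra_simps flip: mult.assoc)
  have close: "\<bar>(LINT t|M. exp (- a * t) * h (exp (- t))) - (\<Sum>i\<le>d. c i * (LINT t|M. exp (- (a + real i) * t)))\<bar>
      \<le> e * (LINT t|M. exp (- a * t))"
    if M: "sets M = sets borel" "AE t in M. 0 \<le> t" and I: "\<And>i. i \<le> d \<Longrightarrow> integrable M (\<lambda>t. exp (- (a + real i) * t))" for M :: "real measure"
  proof -
    have I0: "integrable M (\<lambda>t. exp (- a * t))" using I[of 0] by simp
    have Ip: "integrable M (\<lambda>t. exp (- a * t) * p (exp (- t)))"
      unfolding pe using I by (intro Bochner_Integration.integrable_sum integrable_mult_right) auto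
    have bd: "AE t in M. \<bar>exp (- a * t) * h (exp (- t)) - exp (- a * t) * p (exp (- t))\<bar> \<le> e * exp (- a * t)"
      using M(2)
    proof eventually_elim
      case (elim t)
      have "\<bar>h (exp (- t)) - p (exp (- t))\<bar> \<le> e"
        using p(2)[of "exp (- t)"] elim by auto
      then have "exp (- a * t) * \<bar>h (exp (- t)) - p (exp (- t))\<bar> \<le> exp (- a * t) * e"
        by (intro mult_left_mono) auto
      then show ?case
        by (simp only: right_diff_distrib[symmetric] abs_mult abs_exp_cancel mult.commute[of e])
    qed
    have Id: "integrable M (\<lambda>t. exp (- a * t) * h (exp (- t)) - exp (- a * t) * p (exp (- t)))"
    proof (rule Bochner_Integration.integrable_bound)
      show "integrable M (\<lambda>t. e * exp (- a * t))" using I0 by (rule integrable_mult_right)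
      show "(\<lambda>t. exp (- a * t) * h (exp (- t)) - exp (- a * t) * p (exp (- t))) \<in> borel_measurable M"
        by (intro borel_measurable_diff hmeas M borel_measurable_integrable Ip)
    qed (use bd e in auto)
    have Ih: "integrable M (\<lambda>t. exp (- a * t) * h (exp (- t)))"
      using Bochner_Integration.integrable_add[OF Id Ip] by simp
    have "(LINT t|M. exp (- a * t) * h (exp (- t))) - (\<Sum>i\<le>d. c i * (LINT t|M. exp (- (a + real i) * t)))
        = (LINT t|M. exp (- a * t) * h (exp (- t))) - (LINT t|M. exp (- a * t) * p (exp (- t)))"
      unfolding pe using I by (subst Bochner_Integration.integral_sum) auto
    also have "\<dots> = (LINT t|M. exp (- a * t) * h (exp (- t)) - exp (- a * t) * p (exp (- t)))"
      by (rule Bochner_Integration.integral_diff[symmetric, OF Ih Ip])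
    also have "\<bar>\<dots>\<bar> \<le> (LINT t|M. e * exp (- a * t))"
      by (intro order_trans[OF integral_abs_bound] integral_mono_AE integrable_abs Id integrable_mult_right I0 bd)
    finally show ?thesis by simp
  qed
  have ev1: "\<forall>\<^sub>F n in sequentially. \<forall>i\<in>{..d}. integrable (\<nu> n) (\<lambda>t. exp (- (a + real i) * t))"
    using int by (intro eventually_ball_finite) auto
  have "(\<lambda>n. LINT t|\<nu> n. exp (- a * t)) \<longlonglongrightarrow> A"
    using lim[of 0] by (simp add: A_def)
  then have ev2: "\<forall>\<^sub>F n in sequentially. (LINT t|\<nu> n. exp (- a * t)) < A + 1"
    by (rule order_tendstoD) simp
  have "(\<lambda>n. \<Sum>i\<le>d. c i * (LINT t|\<nu> n. exp (- (a + real i) * t))) \<longlonglongrightarrow> (\<Sum>i\<le>d. c i * (LINT t|\<nu>0. exp (- (a + real i) * t)))"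
    by (intro tendsto_sum tendsto_mult tendsto_const lim)
  from tendstoD[OF this, of "r / 4"] r
  have ev3: "\<forall>\<^sub>F n in sequentially. \<bar>(\<Sum>i\<le>d. c i * (LINT t|\<nu> n. exp (- (a + real i) * t))) - (\<Sum>i\<le>d. c i * (LINT t|\<nu>0. exp (- (a + real i) * t)))\<bar> < r / 4"
    by (simp add: dist_real_def)
  have c0: "\<bar>(LINT t|\<nu>0. exp (- a * t) * h (exp (- t))) - (\<Sum>i\<le>d. c i * (LINT t|\<nu>0. exp (- (a + real i) * t)))\<bar> \<le> e * A"
    unfolding A_def by (rule close[OF sets(2) pos(2) int0])
  have "e * A \<le> r / 4" using eA e by (simp add: distrib_left)
  from ev1 ev2 ev3 have "\<forall>\<^sub>F n in sequentially. norm ((LINT t|\<nu> n. exp (- a * t) * h (exp (- t))) - (LINT t|\<nu>0. exp (- a * t) * h (exp (- t)))) < r"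
  proof eventually_elim
    case (elim n)
    have c1: "\<bar>(LINT t|\<nu> n. exp (- a * t) * h (exp (- t))) - (\<Sum>i\<le>d. c i * (LINT t|\<nu> n. exp (- (a + real i) * t)))\<bar> \<le> e * (LINT t|\<nu> n. exp (- a * t))"
      by (rule close[OF sets(1) pos(1)]) (use elim in auto)
    have "e * (LINT t|\<nu> n. exp (- a * t)) \<le> e * (A + 1)"
      using elim(2) e by (intro mult_left_mono) auto
    then have c2: "\<bar>(LINT t|\<nu> n. exp (- a * t) * h (exp (- t))) - (\<Sum>i\<le>d. c i * (LINT t|\<nu> n. exp (- (a + real i) * t)))\<bar> \<le> r / 4"
      using c1 eA by linarith
    from c0 \<open>e * A \<le> r / 4\<close> have c3: "\<bar>(LINT t|\<nu>0. exp (- a * t) * h (exp (- t))) - (\<Sum>i\<le>d. c i * (LINT t|\<nu>0. exp (- (a + real i) * t)))\<bar> \<le> r / 4"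
      by linarith
    have gen: "\<bar>x - y\<bar> < r" if "\<bar>x - x'\<bar> \<le> r / 4" "\<bar>y - y'\<bar> \<le> r / 4" "\<bar>x' - y'\<bar> < r / 4" for x y x' y' :: real
      using that r by (simp only: abs_le_iff abs_less_iff) linarith
    show ?case unfolding real_norm_def by (rule gen[OF c2 c3 elim(3)])
  qed
  then show "\<exists>no. \<forall>n\<ge>no. norm ((LINT t|\<nu> n. exp (- a * t) * h (exp (- t))) - (LINT t|\<nu>0. exp (- a * t) * h (exp (- t)))) < r"
    by (simp add: eventually_sequentially)
qed

text \<open>
  \<open>(t - s)\<^sup>+\<close> is of the form \<open>e\<^sup>-\<^sup>a\<^sup>s h(e\<^sup>-\<^sup>s)\<close> with \<open>h\<close> continuous on \<open>[0, 1]\<close>: although \<open>h\<close> involves a logarithm,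
  it vanishes below \<open>e\<^sup>-\<^sup>t\<close>.
\<close>

lemma laplace_imp_integrated_tail_convergence:
  fixes \<nu> :: "nat \<Rightarrow> real measure" and \<nu>0 :: "real measure"
  assumes sets: "\<And>n. sets (\<nu> n) = sets borel" "sets \<nu>0 = sets borel"
    and pos: "\<And>n. AE t in \<nu> n. 0 \<le> t" "AE t in \<nu>0. 0 \<le> t"
    and int: "\<And>k::nat. \<forall>\<^sub>F n in sequentially. integrable (\<nu> n) (\<lambda>t. exp (- (a + real k) * t))"
    and int0: "\<And>k::nat. integrable \<nu>0 (\<lambda>t. exp (- (a + real k) * t))"
    and lim: "\<And>k::nat. (\<lambda>n. LINT t|\<nu> n. exp (- (a + real k) * t)) \<longlonglongrightarrow> (LINT t|\<nu>0. exp (- (a + real k) * t))"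
    and t: "0 \<le> t"
  shows "(\<lambda>n. LINT s|\<nu> n. max 0 (t - s)) \<longlonglongrightarrow> (LINT s|\<nu>0. max 0 (t - s))"
proof -
  define h where "h x = max 0 (t + ln (max x (exp (- t)))) * exp (- a * ln (max x (exp (- t))))" for x :: real
  have pos': "max x (exp (- t)) > 0" for x :: real
    by (rule less_le_trans[OF _ max.cobounded2]) simp
  have cont: "continuous_on X h" for X
    unfolding h_def using pos' by (intro continuous_intros) (auto simp: less_imp_neq[symmetric] not_less[symmetric])
  have "h \<in> borel_measurable borel"
    by (rule borel_measurable_continuous_onI[OF cont])
  note * = laplace_weak_convergence[OF sets pos int int0 lim cont this]
  have eq: "exp (- a * s) * h (exp (- s)) = max 0 (t - s)" if "0 \<le> s" for s
  proof (cases "s \<le> t")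
    case True
    then have m: "max (exp (- s)) (exp (- t)) = exp (- s)" by simp
    have "exp (- a * s) * exp (- a * - s) = 1" by (simp flip: exp_add)
    then have "exp (- a * s) * (max 0 (t - s) * exp (- a * - s)) = max 0 (t - s)"
      by (metis mult.left_commute mult.right_neutral)
    then show ?thesis unfolding h_def m ln_exp by simp
  next
    case False
    then have m: "max (exp (- s)) (exp (- t)) = exp (- t)" by simp
    show ?thesis unfolding h_def m ln_exp using False by simp
  qed
  have "(LINT s|M. exp (- a * s) * h (exp (- s))) = (LINT s|M. max 0 (t - s))" if "sets M = sets borel" "AE t in M. 0 \<le> t" for M :: "real measure"
  proof (rule integral_cong_AE)
    show "AE s in M. exp (- a * s) * h (exp (- s)) = max 0 (t - s)"
      using that(2) by eventually_elim (rule eq)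
    show "(\<lambda>s. exp (- a * s) * h (exp (- s))) \<in> borel_measurable M" "(\<lambda>s. max 0 (t - s)) \<in> borel_measurable M"
      unfolding measurable_cong_sets[OF that(1) refl]
      by (intro borel_measurable_continuous_onI continuous_intros continuous_on_compose2[OF cont[of UNIV]]; simp)+
  qed
  with * sets pos show ?thesis by simp
qed

section \<open>Inverses of nearly singular matrices\<close>

lemma LIMSEQ_via_subsequences:
  fixes X :: "nat \<Rightarrow> 'a::metric_space"
  assumes "\<And>f :: nat \<Rightarrow> nat. strict_mono f \<Longrightarrow> \<exists>g :: nat \<Rightarrow> nat. strict_mono g \<and> (\<lambda>n. X (f (g n))) \<longlonglongrightarrow> L"
  shows "X \<longlonglongrightarrow> L"
proof (rule ccontr)
  assume "\<not> X \<longlonglongrightarrow> L"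
  then obtain e where e: "e > 0" "\<not> (\<forall>\<^sub>F n in sequentially. dist (X n) L < e)"
    by (auto simp: tendsto_iff)
  then have "infinite {n. dist (X n) L \<ge> e}"
    by (auto simp: not_eventually not_less frequently_cofinite simp flip: cofinite_eq_sequentially)
  then obtain f :: "nat \<Rightarrow> nat" where f: "strict_mono f" "\<And>n. f n \<in> {n. dist (X n) L \<ge> e}"
    using infinite_enumerate by blast
  obtain g where g: "strict_mono g" "(\<lambda>n. X (f (g n))) \<longlonglongrightarrow> L"
    using assms[OF f(1)] by blast
  have "\<forall>\<^sub>F n in sequentially. dist (X (f (g n))) L < e"
    using tendstoD[OF g(2) e(1)] .
  then obtain n where "dist (X (f (g n))) L < e"
    by (auto simp: eventually_sequentially)
  then show False using f(2)[of "g n"] by simp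
qed

lemma tendsto_matrix_matrix_mult:
  fixes X Y :: "'a \<Rightarrow> real^'n^'n"
  assumes "(X \<longlongrightarrow> A) F" "(Y \<longlongrightarrow> B) F"
  shows "((\<lambda>n. X n ** Y n) \<longlongrightarrow> A ** B) F"
  unfolding matrix_matrix_mult_def
  by (intro tendsto_vec_lambda tendsto_sum tendsto_mult tendsto_vec_nth assms)

lemma tendsto_matrix_vector_mult:
  fixes X :: "'a \<Rightarrow> real^'n^'n"
  assumes "(X \<longlongrightarrow> A) F" "(y \<longlongrightarrow> b) F"
  shows "((\<lambda>n. X n *v y n) \<longlongrightarrow> A *v b) F"
  unfolding matrix_vector_mult_def
  by (intro tendsto_vec_lambda tendsto_sum tendsto_mult tendsto_vec_nth assms)

lemma matrix_mult_left_diff: "A ** (B - C) = A ** B - A ** (C :: real^'n^'n)"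
  by (simp add: matrix_matrix_mult_def Finite_Cartesian_Product.vec_eq_iff algebra_simps sum_subtractf)

lemma matrix_mult_right_diff: "(A - B) ** C = A ** C - B ** (C :: real^'n^'n)"
  by (simp add: matrix_matrix_mult_def Finite_Cartesian_Product.vec_eq_iff algebra_simps sum_subtractf)

lemma matrix_mult_scaleR_right: "A ** (c *\<^sub>R B) = c *\<^sub>R (A ** (B :: real^'n^'n))"
  by (simp add: matrix_matrix_mult_def Finite_Cartesian_Product.vec_eq_iff sum_distrib_left algebra_simps)

lemma matrix_mult_scaleR_left: "(c *\<^sub>R A) ** B = c *\<^sub>R (A ** (B :: real^'n^'n))"
  by (simp add: matrix_matrix_mult_def Finite_Cartesian_Product.vec_eq_iff sum_distrib_left algebra_simps)

text \<open>
  The inverses \<open>X n\<close> are not known to be bounded, so normalise them: \<open>a n = 1 / (1 + norm (X n))\<close> and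
  \<open>Y n = a n X n\<close> stay bounded. Along a subsequence \<open>(a, Y)\<close> tends to some \<open>(b, Z)\<close> with
  \<open>norm Z = 1 - b\<close>. Dividing the inverse relation by \<open>c n\<close> gives \<open>Z K = Z\<close>; multiplying it by \<open>P\<close>, on which
  \<open>Id\<close> and \<open>K\<close> agree, gives \<open>Z A P = b P\<close>. Hence \<open>Z = b P\<close>, so \<open>b = 0\<close> would force \<open>Z = 0\<close> against
  \<open>norm Z = 1\<close>. Therefore \<open>X = Y / a\<close> tends to \<open>Z / b = P\<close>.
\<close>

lemma scaled_inverse_convergence:
  fixes X L :: "nat \<Rightarrow> real^'n^'n" and c :: "nat \<Rightarrow> real"
  assumes c: "filterlim c at_top sequentially"
    and lim: "(\<lambda>n. c n *\<^sub>R (K - L n)) \<longlonglongrightarrow> A"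
    and inv: "\<forall>\<^sub>F n in sequentially. X n ** (c n *\<^sub>R (mat 1 - L n)) = mat 1"
    and KP: "K ** P = P" and left: "\<And>Y :: real^'n^'n. Y ** K = Y \<Longrightarrow> Y ** (A ** P) = Y"
  shows "X \<longlonglongrightarrow> P"
proof (rule LIMSEQ_via_subsequences)
  fix f :: "nat \<Rightarrow> nat" assume f: "strict_mono f"
  define a where "a n = 1 / (1 + norm (X n))" for n
  define Y where "Y n = a n *\<^sub>R X n" for n
  have a01: "0 < a n" "a n \<le> 1" for n
    by (auto simp: a_def add_pos_nonneg)
  have nY: "norm (Y n) = 1 - a n" for n
    using norm_ge_zero[of "X n"] by (simp add: Y_def a_def field_simps del: norm_ge_zero)
  have "bounded (range (\<lambda>n. (a (f n), Y (f n))))"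
  proof (rule boundedI)
    fix z assume "z \<in> range (\<lambda>n. (a (f n), Y (f n)))"
    then obtain n where z: "z = (a (f n), Y (f n))" by blast
    have "norm z \<le> norm (a (f n)) + norm (Y (f n))" unfolding z by (rule norm_Pair_le)
    then show "norm z \<le> 2" using a01[of "f n"] nY[of "f n"] by simp
  qed
  then obtain l g where g: "strict_mono g" and l: "((\<lambda>n. (a (f n), Y (f n))) \<circ> g) \<longlonglongrightarrow> l"
    using bounded_imp_convergent_subsequence by blast
  define h where "h = (\<lambda>n. f (g n))"
  have h: "strict_mono h" unfolding h_def using f g by (simp add: strict_mono_def)
  obtain b Z where bZ: "l = (b, Z)" by (cases l)
  have alim: "(\<lambda>n. a (h n)) \<longlonglongrightarrow> b" and Ylim: "(\<lambda>n. Y (h n)) \<longlonglongrightarrow> Z"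
    using tendsto_fst[OF l] tendsto_snd[OF l] by (simp_all add: o_def bZ h_def)
  have sub: "(\<lambda>n. u (h n)) \<longlonglongrightarrow> v" if "u \<longlonglongrightarrow> v" for u :: "nat \<Rightarrow> 'z::topological_space" and v
    using LIMSEQ_subseq_LIMSEQ[OF that h] by (simp add: o_def)
  have c': "filterlim (\<lambda>n. c (h n)) at_top sequentially"
    using filterlim_compose[OF c filterlim_subseq[OF h]] by (simp add: o_def)
  have invc: "(\<lambda>n. inverse (c (h n))) \<longlonglongrightarrow> 0"
    by (rule tendsto_inverse_0_at_top[OF c'])
  have cpos: "\<forall>\<^sub>F n in sequentially. 0 < c (h n)"
    using c' by (rule filterlim_at_top_dense[THEN iffD1, rule_format])
  have inv': "\<forall>\<^sub>F n in sequentially. X (h n) ** (c (h n) *\<^sub>R (mat 1 - L (h n))) = mat 1"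
    using inv filterlim_subseq[OF h] by (rule eventually_compose_filterlim)
  have Alim: "(\<lambda>n. c (h n) *\<^sub>R (K - L (h n))) \<longlonglongrightarrow> A"
    by (rule sub[OF lim])
  have KL0: "(\<lambda>n. inverse (c (h n)) *\<^sub>R (c (h n) *\<^sub>R (K - L (h n)))) \<longlonglongrightarrow> 0"
    using tendsto_scaleR[OF invc Alim] by (simp only: scaleR_zero_left)
  have KL: "(\<lambda>n. K - L (h n)) \<longlonglongrightarrow> 0"
    by (rule Lim_transform_eventually[OF KL0], use cpos in eventually_elim) simp
  have LK: "(\<lambda>n. L (h n)) \<longlonglongrightarrow> K"
    using tendsto_diff[OF tendsto_const[of K] KL] by simp
  have "(\<lambda>n. Y (h n) ** (mat 1 - L (h n))) \<longlonglongrightarrow> Z ** (mat 1 - K)"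
    by (intro tendsto_matrix_matrix_mult Ylim tendsto_diff tendsto_const LK)
  moreover have "(\<lambda>n. Y (h n) ** (mat 1 - L (h n))) \<longlonglongrightarrow> 0"
  proof -
    have "(\<lambda>n. (a (h n) * inverse (c (h n))) *\<^sub>R (mat 1 :: real^'n^'n)) \<longlonglongrightarrow> (b * 0) *\<^sub>R mat 1"
      by (intro tendsto_scaleR tendsto_mult alim invc tendsto_const)
    then have "(\<lambda>n. (a (h n) * inverse (c (h n))) *\<^sub>R (mat 1 :: real^'n^'n)) \<longlonglongrightarrow> 0"
      by (simp only: mult_zero_right scaleR_zero_left)
    moreover have "\<forall>\<^sub>F n in sequentially. (a (h n) * inverse (c (h n))) *\<^sub>R mat 1 = Y (h n) ** (mat 1 - L (h n))"
      using inv' cpos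
    proof eventually_elim
      case (elim n)
      have "(a (h n) * inverse (c (h n))) *\<^sub>R (mat 1 :: real^'n^'n)
          = (a (h n) * inverse (c (h n))) *\<^sub>R (X (h n) ** (c (h n) *\<^sub>R (mat 1 - L (h n))))"
        by (simp only: elim)
      also have "\<dots> = Y (h n) ** (mat 1 - L (h n))"
        using elim(2) by (simp add: Y_def matrix_mult_scaleR_right matrix_mult_scaleR_left)
      finally show ?case .
    qed
    ultimately show ?thesis by (rule Lim_transform_eventually)
  qed
  ultimately have "Z ** (mat 1 - K) = 0" by (rule LIMSEQ_unique)
  then have ZK: "Z ** K = Z" by (simp add: matrix_mult_left_diff)
  have "(\<lambda>n. Y (h n) ** ((c (h n) *\<^sub>R (K - L (h n))) ** P)) \<longlonglongrightarrow> Z ** (A ** P)"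
    by (intro tendsto_matrix_matrix_mult Ylim Alim tendsto_const)
  moreover have "(\<lambda>n. Y (h n) ** ((c (h n) *\<^sub>R (K - L (h n))) ** P)) \<longlonglongrightarrow> b *\<^sub>R P"
  proof -
    have "(\<lambda>n. a (h n) *\<^sub>R P) \<longlonglongrightarrow> b *\<^sub>R P"
      by (intro tendsto_scaleR alim tendsto_const)
    moreover have "\<forall>\<^sub>F n in sequentially. a (h n) *\<^sub>R P = Y (h n) ** ((c (h n) *\<^sub>R (K - L (h n))) ** P)"
      using inv'
    proof eventually_elim
      case (elim n)
      have "(K - L (h n)) ** P = (mat 1 - L (h n)) ** P"
        by (simp add: matrix_mult_right_diff KP)
      then have "Y (h n) ** ((c (h n) *\<^sub>R (K - L (h n))) ** P)
          = a (h n) *\<^sub>R ((X (h n) ** (c (h n) *\<^sub>R (mat 1 - L (h n)))) ** P)"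
        by (simp add: Y_def matrix_mult_scaleR_right matrix_mult_scaleR_left matrix_mul_assoc)
      then show ?case by (simp add: elim)
    qed
    ultimately show ?thesis by (rule Lim_transform_eventually)
  qed
  ultimately have "Z ** (A ** P) = b *\<^sub>R P" by (rule LIMSEQ_unique)
  with left[OF ZK] have ZP: "Z = b *\<^sub>R P" by simp
  have "(\<lambda>n. norm (Y (h n))) \<longlonglongrightarrow> norm Z" by (intro tendsto_norm Ylim)
  moreover have "(\<lambda>n. norm (Y (h n))) \<longlonglongrightarrow> 1 - b"
    unfolding nY by (intro tendsto_diff tendsto_const alim)
  ultimately have nZ: "norm Z = 1 - b" by (rule LIMSEQ_unique)
  have "b \<noteq> 0" using nZ ZP by auto
  then have "(\<lambda>n. inverse (a (h n)) *\<^sub>R Y (h n)) \<longlonglongrightarrow> inverse b *\<^sub>R Z"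
    by (intro tendsto_scaleR tendsto_inverse alim Ylim)
  moreover have "inverse (a (h n)) *\<^sub>R Y (h n) = X (h n)" for n
    using a01[of "h n"] by (simp add: Y_def)
  moreover have "inverse b *\<^sub>R Z = P" using ZP \<open>b \<noteq> 0\<close> by simp
  ultimately have "(\<lambda>n. X (h n)) \<longlonglongrightarrow> P" by simp
  then show "\<exists>g. strict_mono g \<and> (\<lambda>n. X (f (g n))) \<longlonglongrightarrow> P"
    using g by (auto simp: h_def)
qed

text \<open>
  Brouwer's theorem for \<open>z \<mapsto> (L z + e) / t(z)\<close> on the standard simplex, \<open>t(z)\<close> being the sum of the
  coordinates of \<open>L z + e\<close>. The perturbation by \<open>e\<close> makes the fixed point strictly positive even if \<open>L\<close>
  is reducible.
\<close>

lemma perturbed_Perron_vector: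
  fixes L :: "real^'n^'n"
  assumes L: "0 \<le> L" and e: "e > 0"
  obtains z s where "\<And>i. 0 < z $ i" "(\<Sum>i\<in>UNIV. z $ i) = 1" "L *v z + (\<chi> i. e) = s *\<^sub>R z"
proof -
  define S where "S = {z :: real^'n. (\<forall>i. 0 \<le> z $ i) \<and> (\<Sum>i\<in>UNIV. z $ i) = 1}"
  have Lnn: "0 \<le> L $ i $ j" for i j using L by (simp add: less_eq_vec_def)
  define w where "w z = L *v z + (\<chi> i. e)" for z
  define t where "t z = (\<Sum>i\<in>UNIV. w z $ i)" for z
  have wpos: "0 < w z $ i" if "z \<in> S" for z i
    using that e Lnn by (auto simp: w_def S_def matrix_vector_mult_def intro!: add_nonneg_pos sum_nonneg)
  have tpos: "0 < t z" if "z \<in> S" for z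
    unfolding t_def using wpos[OF that] by (intro sum_pos) auto
  have "S = (\<Inter>i. {z. 0 \<le> z $ i}) \<inter> {z. (\<Sum>i\<in>UNIV. z $ i) = 1}"
    by (auto simp: S_def)
  moreover have "closed {z :: real^'n. 0 \<le> z $ i}" for i
    by (intro closed_Collect_le continuous_intros)
  moreover have "closed {z :: real^'n. (\<Sum>i\<in>UNIV. z $ i) = 1}"
    by (intro closed_Collect_eq continuous_intros)
  ultimately have "closed S" by auto
  moreover have "bounded S"
  proof (rule boundedI)
    fix z assume z: "z \<in> S"
    have "norm z \<le> (\<Sum>i\<in>UNIV. \<bar>z $ i\<bar>)" by (rule norm_le_l1_cart)
    also have "\<dots> = 1" using z by (simp add: S_def)
    finally show "norm z \<le> 1" .
  qed
  ultimately have "compact S" by (simp add: compact_eq_bounded_closed)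
  moreover have "convex S"
    by (auto simp: convex_def S_def sum.distrib sum_distrib_left[symmetric])
  moreover have "S \<noteq> {}"
  proof -
    have "(\<chi> i. 1 / real CARD('n)) \<in> S" by (simp add: S_def)
    then show ?thesis by blast
  qed
  moreover have "continuous_on S (\<lambda>z. inverse (t z) *\<^sub>R w z)"
  proof -
    have cw: "continuous_on S w"
      unfolding w_def matrix_vector_mult_def by (intro continuous_intros continuous_on_vec_lambda)
    moreover have "continuous_on S t"
      unfolding t_def using cw by (intro continuous_intros)
    ultimately show ?thesis
      by (intro continuous_intros) (use tpos in force)+
  qed
  moreover have "(\<lambda>z. inverse (t z) *\<^sub>R w z) \<in> S \<rightarrow> S"
  proof
    fix z assume z: "z \<in> S"
    have "(\<Sum>i\<in>UNIV. (inverse (t z) *\<^sub>R w z) $ i) = inverse (t z) * t z"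
      by (simp add: t_def sum_distrib_left)
    then show "inverse (t z) *\<^sub>R w z \<in> S"
      using tpos[OF z] wpos[OF z] by (auto simp: S_def less_imp_le)
  qed
  ultimately obtain z where z: "z \<in> S" "inverse (t z) *\<^sub>R w z = z"
    by (rule brouwer)
  show thesis
  proof (rule that[of z "t z"])
    show "0 < z $ i" for i
      using wpos[OF z(1), of i] tpos[OF z(1)] arg_cong[OF z(2), of "\<lambda>v. v $ i"]
      by (metis inverse_positive_iff_positive real_scaleR_def vector_scaleR_component zero_less_mult_iff)
    show "(\<Sum>i\<in>UNIV. z $ i) = 1" using z(1) by (simp add: S_def)
    have "t z *\<^sub>R z = t z *\<^sub>R (inverse (t z) *\<^sub>R w z)" by (simp only: z(2))
    then show "L *v z + (\<chi> i. e) = t z *\<^sub>R z"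
      using tpos[OF z(1)] by (simp add: w_def)
  qed
qed

text \<open>
  Otherwise, for infinitely many \<open>n\<close>, the perturbed Perron vectors \<open>z\<close> of \<open>L n\<close> with a perturbation of
  size \<open>o(1 / c n)\<close> have factor \<open>s \<ge> 1\<close>. A limit point \<open>v\<close> is a nonnegative eigenvector of \<open>K\<close> for an
  eigenvalue that is at least \<open>1\<close>, hence equal to \<open>1\<close>. Since \<open>P K = P\<close>, applying \<open>P\<close> to \<open>c n (K - L n) z\<close>
  gives \<open>c n (1 - s) P z\<close> up to an error that vanishes in the limit, so \<open>P (A v) \<le> 0\<close>; but
  \<open>P (A v) = v\<close>, whose coordinates sum to \<open>1\<close>.
\<close>

lemma eventually_subcritical:
  fixes L :: "nat \<Rightarrow> real^'n^'n" and c :: "nat \<Rightarrow> real"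
  assumes c: "filterlim c at_top sequentially"
    and Lnn: "\<forall>\<^sub>F n in sequentially. 0 \<le> L n"
    and lim: "(\<lambda>n. c n *\<^sub>R (K - L n)) \<longlonglongrightarrow> A"
    and P: "0 \<le> P" "P ** K = P"
    and eig: "\<And>z r. K *v z = r *\<^sub>R z \<Longrightarrow> z \<noteq> 0 \<Longrightarrow> \<bar>r\<bar> \<le> 1"
    and right: "\<And>z. K *v z = z \<Longrightarrow> P *v (A *v z) = z"
  shows "\<forall>\<^sub>F n in sequentially. \<exists>z s. (\<forall>i. 0 < z $ i) \<and> s < 1 \<and> L n *v z \<le> s *\<^sub>R z"
proof (rule ccontr)
  assume no: "\<not> ?thesis"
  let ?good = "\<lambda>n. \<exists>z s. (\<forall>i. 0 < z $ i) \<and> s < 1 \<and> L n *v z \<le> s *\<^sub>R z"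
  have cpos: "\<forall>\<^sub>F n in sequentially. 0 < c n"
    using c by (rule filterlim_at_top_dense[THEN iffD1, rule_format])
  have "\<exists>\<^sub>F n in sequentially. \<not> ?good n"
    using no by (simp add: not_eventually)
  from frequently_eventually_frequently[OF this eventually_conj[OF Lnn cpos]]
  have "\<exists>\<^sub>F n in cofinite. \<not> ?good n \<and> 0 \<le> L n \<and> 0 < c n"
    by (simp add: cofinite_eq_sequentially)
  then have "infinite {n. \<not> ?good n \<and> 0 \<le> L n \<and> 0 < c n}"
    unfolding frequently_cofinite .
  then obtain f :: "nat \<Rightarrow> nat" where f: "strict_mono f" "\<And>n. f n \<in> {n. \<not> ?good n \<and> 0 \<le> L n \<and> 0 < c n}"
    using infinite_enumerate by blast
  \<comment> \<open>the extra factor \<open>Suc n\<close> makes the perturbation negligible after multiplication by \<open>c\<close>\<close>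
  have "\<exists>z s. (\<forall>i. 0 < z $ i) \<and> (\<Sum>i\<in>UNIV. z $ i) = 1 \<and> L (f n) *v z + (\<chi> i. 1 / (c (f n) * real (Suc n))) = s *\<^sub>R z" for n
  proof -
    have 1: "0 \<le> L (f n)" and 2: "1 / (c (f n) * real (Suc n)) > 0" using f(2)[of n] by auto
    show ?thesis by (rule perturbed_Perron_vector[OF 1 2]) blast
  qed
  then obtain z s where zpos: "\<And>n i. 0 < z n $ i" and z1: "\<And>n. (\<Sum>i\<in>UNIV. z n $ i) = 1"
    and zs: "\<And>n. L (f n) *v z n + (\<chi> i. 1 / (c (f n) * real (Suc n))) = s n *\<^sub>R z n"
    by metis
  have s1: "s n \<ge> 1" for n
  proof (rule ccontr)
    assume "\<not> s n \<ge> 1"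
    moreover have "L (f n) *v z n \<le> s n *\<^sub>R z n"
      unfolding zs[symmetric] using f(2)[of n] by (auto simp: less_eq_vec_def)
    ultimately have "?good (f n)" using zpos[of n] by (intro exI[of _ "z n"] exI[of _ "s n"]) auto
    then show False using f(2)[of n] by blast
  qed
  have "bounded (range z)"
  proof (rule boundedI)
    fix v assume "v \<in> range z"
    then obtain n where v: "v = z n" by blast
    have "norm v \<le> (\<Sum>i\<in>UNIV. \<bar>v $ i\<bar>)" by (rule norm_le_l1_cart)
    also have "\<dots> = 1" using z1[of n] zpos[of n] by (simp add: v less_imp_le)
    finally show "norm v \<le> 1" .
  qed
  then obtain v g where g: "strict_mono g" and v: "(z \<circ> g) \<longlonglongrightarrow> v"
    using bounded_imp_convergent_subsequence by blast
  define h where "h = (\<lambda>n. f (g n))"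
  have h: "strict_mono h" unfolding h_def using f(1) g by (simp add: strict_mono_def)
  have vlim: "(\<lambda>n. z (g n)) \<longlonglongrightarrow> v" using v by (simp add: o_def)
  have cp: "0 < c (h n)" for n using f(2)[of "g n"] by (simp add: h_def)
  have c': "filterlim (\<lambda>n. c (h n)) at_top sequentially"
    using filterlim_compose[OF c filterlim_subseq[OF h]] by (simp add: o_def)
  have invc: "(\<lambda>n. inverse (c (h n))) \<longlonglongrightarrow> 0"
    by (rule tendsto_inverse_0_at_top[OF c'])
  have Alim: "(\<lambda>n. c (h n) *\<^sub>R (K - L (h n))) \<longlonglongrightarrow> A"
    using LIMSEQ_subseq_LIMSEQ[OF lim h] by (simp add: o_def)
  have "(\<lambda>n. inverse (c (h n)) *\<^sub>R (c (h n) *\<^sub>R (K - L (h n)))) \<longlonglongrightarrow> 0 *\<^sub>R A"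
    by (intro tendsto_scaleR invc Alim)
  then have KL: "(\<lambda>n. K - L (h n)) \<longlonglongrightarrow> 0" using cp by (simp add: less_imp_neq[symmetric])
  have LK: "(\<lambda>n. L (h n)) \<longlonglongrightarrow> K"
    using tendsto_diff[OF tendsto_const[of K] KL] by simp
  define e where "e n = 1 / real (Suc (g n))" for n
  have e0: "e \<longlonglongrightarrow> 0"
    unfolding e_def using LIMSEQ_subseq_LIMSEQ[OF LIMSEQ_inverse_real_of_nat g] by (simp add: o_def inverse_eq_divide)
  have zs': "L (h n) *v z (g n) + (\<chi> i. inverse (c (h n)) * e n) = s (g n) *\<^sub>R z (g n)" for n
    using zs[of "g n"] by (simp add: h_def e_def field_simps)
  have lhs: "(\<lambda>n. L (h n) *v z (g n) + (\<chi> i. inverse (c (h n)) * e n)) \<longlonglongrightarrow> K *v v + (\<chi> i. 0 * 0)"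
    by (intro tendsto_add tendsto_matrix_vector_mult LK vlim tendsto_vec_lambda tendsto_mult invc e0)
  have v1: "(\<Sum>i\<in>UNIV. v $ i) = 1"
  proof (rule LIMSEQ_unique)
    show "(\<lambda>n. \<Sum>i\<in>UNIV. z (g n) $ i) \<longlonglongrightarrow> (\<Sum>i\<in>UNIV. v $ i)"
      by (intro tendsto_sum tendsto_vec_nth vlim)
  qed (simp add: z1)
  have v0: "v \<noteq> 0" using v1 by auto
  define r where "r = (\<Sum>i\<in>UNIV. (K *v v) $ i)"
  have sr: "(\<lambda>n. s (g n)) \<longlonglongrightarrow> r"
  proof -
    have "(\<lambda>n. \<Sum>i\<in>UNIV. (L (h n) *v z (g n) + (\<chi> i. inverse (c (h n)) * e n)) $ i) \<longlonglongrightarrow> (\<Sum>i\<in>UNIV. (K *v v + (\<chi> i. 0 * 0)) $ i)"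
      by (intro tendsto_sum tendsto_vec_nth lhs)
    moreover have "(\<Sum>i\<in>UNIV. (s (g n) *\<^sub>R z (g n)) $ i) = s (g n)" for n
      using z1[of "g n"] by (simp flip: sum_distrib_left)
    ultimately show ?thesis unfolding zs' r_def by simp
  qed
  have "(\<lambda>n. s (g n) *\<^sub>R z (g n)) \<longlonglongrightarrow> r *\<^sub>R v"
    by (intro tendsto_scaleR sr vlim)
  then have "K *v v = r *\<^sub>R v"
    using LIMSEQ_unique[OF lhs[unfolded zs']] by (simp add: zero_vec_def[symmetric])
  moreover have "r \<ge> 1"
    by (rule LIMSEQ_le_const[OF sr]) (use s1 in auto)
  ultimately have Kv: "K *v v = v" using eig[OF _ v0, of r] by simp
  have Pnn: "0 \<le> P $ i $ j" for i j using P(1) by (simp add: less_eq_vec_def)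
  have bound: "(P *v ((c (h n) *\<^sub>R (K - L (h n))) *v z (g n))) $ i \<le> e n * (P *v (\<chi> i. 1)) $ i" for n i
  proof -
    have "(c (h n) *\<^sub>R (K - L (h n))) *v z (g n)
        = c (h n) *\<^sub>R (K *v z (g n)) - c (h n) *\<^sub>R (s (g n) *\<^sub>R z (g n) - (\<chi> i. inverse (c (h n)) * e n))"
      unfolding zs'[symmetric] by (simp add: scaleR_matrix_vector_assoc[symmetric] matrix_vector_mult_diff_rdistrib scaleR_diff_right)
    also have "\<dots> = c (h n) *\<^sub>R (K *v z (g n)) - (c (h n) * s (g n)) *\<^sub>R z (g n) + e n *\<^sub>R (\<chi> i. 1)"
      using cp[of n] by (simp add: Finite_Cartesian_Product.vec_eq_iff field_simps)
    finally have "P *v ((c (h n) *\<^sub>R (K - L (h n))) *v z (g n))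
        = c (h n) *\<^sub>R (P *v (K *v z (g n))) - (c (h n) * s (g n)) *\<^sub>R (P *v z (g n)) + e n *\<^sub>R (P *v (\<chi> i. 1))"
      by (simp add: matrix_vector_right_distrib matrix_vector_mult_diff_distrib matrix_vector_mult_scaleR)
    also have "P *v (K *v z (g n)) = P *v z (g n)"
      by (simp add: matrix_vector_mul_assoc P(2))
    finally have eq: "P *v ((c (h n) *\<^sub>R (K - L (h n))) *v z (g n))
        = (c (h n) * (1 - s (g n))) *\<^sub>R (P *v z (g n)) + e n *\<^sub>R (P *v (\<chi> i. 1))"
      by (simp add: algebra_simps)
    have "c (h n) * (1 - s (g n)) \<le> 0"
      using cp[of n] s1[of "g n"] by (simp add: mult_le_0_iff)
    moreover have "0 \<le> (P *v z (g n)) $ i"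
      using Pnn zpos[of "g n"] by (auto simp: matrix_vector_mult_def less_imp_le intro!: sum_nonneg)
    ultimately have "c (h n) * (1 - s (g n)) * (P *v z (g n)) $ i \<le> 0"
      by (rule mult_nonpos_nonneg)
    then show ?thesis unfolding eq by simp
  qed
  have "v $ i \<le> 0" for i
  proof -
    have "(\<lambda>n. (P *v ((c (h n) *\<^sub>R (K - L (h n))) *v z (g n))) $ i) \<longlonglongrightarrow> (P *v (A *v v)) $ i"
      by (intro tendsto_vec_nth tendsto_matrix_vector_mult tendsto_const Alim vlim)
    moreover have "(\<lambda>n. e n * (P *v (\<chi> i. 1)) $ i) \<longlonglongrightarrow> 0 * (P *v (\<chi> i. 1)) $ i"
      by (intro tendsto_mult e0 tendsto_const)
    ultimately have "(P *v (A *v v)) $ i \<le> 0 * (P *v (\<chi> i. 1)) $ i"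
      by (rule LIMSEQ_le) (use bound in auto)
    then show ?thesis by (simp add: right[OF Kv])
  qed
  then have "(\<Sum>i\<in>UNIV. v $ i) \<le> 0" by (intro sum_nonpos) auto
  with v1 show False by simp
qed

section \<open>Causal convolution\<close>

text \<open>
  Convolution takes values in the extended nonnegative reals, where it is associative and commutative
  by Tonelli's theorem alone, without integrability conditions.
\<close>

definition conv :: "(real \<Rightarrow> ennreal) \<Rightarrow> (real \<Rightarrow> ennreal) \<Rightarrow> real \<Rightarrow> ennreal" where
  "conv f g t = (\<integral>\<^sup>+s. f (t - s) * g s \<partial>lborel)"

definition heaviside :: "real \<Rightarrow> ennreal" where
  "heaviside = indicator {0..}"

text \<open>
  Truncation at \<open>0\<close> turns functions of which only the values on \<open>[0, \<infinity>)\<close> matter into causal ones.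
\<close>

definition ext :: "(real \<Rightarrow> real) \<Rightarrow> real \<Rightarrow> ennreal" where
  "ext f t = ennreal (indicator {0..} t * f t)"

definition causal :: "(real \<Rightarrow> ennreal) \<Rightarrow> bool" where
  "causal f \<longleftrightarrow> (\<forall>t<0. f t = 0)"

lemma heaviside_measurable [measurable]: "heaviside \<in> borel_measurable borel"
  by (simp add: heaviside_def)

lemma nn_integral_lborel_reflect:
  fixes f :: "real \<Rightarrow> ennreal"
  assumes [measurable]: "f \<in> borel_measurable borel"
  shows "(\<integral>\<^sup>+s. f (t - s) \<partial>lborel) = (\<integral>\<^sup>+s. f s \<partial>lborel)"
  using nn_integral_real_affine[of f "-1" t] by simp

lemma nn_integral_lborel_shift:
  fixes f :: "real \<Rightarrow> ennreal"
  assumes [measurable]: "f \<in> borel_measurable borel"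
  shows "(\<integral>\<^sup>+s. f (t + s) \<partial>lborel) = (\<integral>\<^sup>+s. f s \<partial>lborel)"
  using nn_integral_real_affine[of f 1 t] by simp

lemma conv_measurable [measurable]:
  assumes [measurable]: "f \<in> borel_measurable borel" "g \<in> borel_measurable borel"
  shows "conv f g \<in> borel_measurable borel"
  unfolding conv_def by measurable

lemma conv_commute:
  assumes [measurable]: "f \<in> borel_measurable borel" "g \<in> borel_measurable borel"
  shows "conv f g = conv g f"
proof
  fix t
  have "conv f g t = (\<integral>\<^sup>+s. f (t - (t - s)) * g (t - s) \<partial>lborel)"
    unfolding conv_def by (rule nn_integral_lborel_reflect[symmetric]) measurable
  then show "conv f g t = conv g f t" by (simp add: conv_def mult.commute)
qed

lemma conv_assoc:
  assumes [measurable]: "f \<in> borel_measurable borel" "g \<in> borel_measurable borel" "h \<in> borel_measurable borel"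
  shows "conv (conv f g) h = conv f (conv g h)"
proof
  fix t
  have "conv (conv f g) h t = (\<integral>\<^sup>+s. (\<integral>\<^sup>+u. f (t - s - u) * g u * h s \<partial>lborel) \<partial>lborel)"
    unfolding conv_def by (simp add: nn_integral_multc)
  also have "\<dots> = (\<integral>\<^sup>+s. (\<integral>\<^sup>+u. f (t - u) * g (u - s) * h s \<partial>lborel) \<partial>lborel)"
  proof (rule nn_integral_cong)
    fix s
    have "(\<integral>\<^sup>+u. f (t - (s + u)) * g ((s + u) - s) * h s \<partial>lborel) = (\<integral>\<^sup>+u. f (t - u) * g (u - s) * h s \<partial>lborel)"
      by (rule nn_integral_lborel_shift) measurable
    then show "(\<integral>\<^sup>+u. f (t - s - u) * g u * h s \<partial>lborel) = (\<integral>\<^sup>+u. f (t - u) * g (u - s) * h s \<partial>lborel)"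
      by (simp add: algebra_simps)
  qed
  also have "\<dots> = (\<integral>\<^sup>+u. (\<integral>\<^sup>+s. f (t - u) * g (u - s) * h s \<partial>lborel) \<partial>lborel)"
    by (rule lborel_pair.Fubini') measurable
  also have "\<dots> = conv f (conv g h) t"
    unfolding conv_def by (simp add: nn_integral_cmult mult.assoc)
  finally show "conv (conv f g) h t = conv f (conv g h) t" .
qed

lemma conv_add_right:
  assumes [measurable]: "f \<in> borel_measurable borel" "g \<in> borel_measurable borel" "h \<in> borel_measurable borel"
  shows "conv f (\<lambda>t. g t + h t) t = conv f g t + conv f h t"
  unfolding conv_def by (simp add: distrib_left nn_integral_add)

lemma conv_sum_right:
  assumes [measurable]: "f \<in> borel_measurable borel" "\<And>i. i \<in> I \<Longrightarrow> g i \<in> borel_measurable borel"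
  shows "conv f (\<lambda>t. \<Sum>i\<in>I. g i t) t = (\<Sum>i\<in>I. conv f (g i) t)"
  unfolding conv_def by (simp add: sum_distrib_left nn_integral_sum)

lemma conv_cmult_right:
  assumes [measurable]: "f \<in> borel_measurable borel" "g \<in> borel_measurable borel"
  shows "conv f (\<lambda>t. c * g t) t = c * conv f g t"
  unfolding conv_def by (simp add: nn_integral_cmult mult.left_commute)

lemma conv_cmult_left:
  assumes [measurable]: "f \<in> borel_measurable borel" "g \<in> borel_measurable borel"
  shows "conv (\<lambda>t. c * f t) g t = c * conv f g t"
  unfolding conv_def by (simp add: nn_integral_cmult mult.assoc)

lemma conv_cong_AE:
  assumes [measurable]: "f \<in> borel_measurable borel" "g \<in> borel_measurable borel" "h \<in> borel_measurable borel"
    and "AE s in lborel. g s = h s"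
  shows "conv f g t = conv f h t"
  unfolding conv_def by (rule nn_integral_cong_AE) (use assms(4) in eventually_elim, simp)

lemma conv_scale:
  assumes [measurable]: "f \<in> borel_measurable borel" "g \<in> borel_measurable borel" and n: "0 < n"
  shows "conv f g (n * t) = ennreal n * conv (\<lambda>s. f (n * s)) (\<lambda>s. g (n * s)) t"
proof -
  have "conv f g (n * t) = ennreal n * (\<integral>\<^sup>+s. f (n * t - n * s) * g (n * s) \<partial>lborel)"
    unfolding conv_def using nn_integral_real_affine[of "\<lambda>s. f (n * t - s) * g s" n 0] n by simp
  then show ?thesis by (simp add: conv_def right_diff_distrib)
qed

lemma causal_heaviside [simp]: "causal heaviside" by (simp add: causal_def heaviside_def)
lemma causal_ext [simp]: "causal (ext f)" by (simp add: causal_def ext_def)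

lemma conv_causal:
  assumes "causal f" "causal g"
  shows "conv f g t = (\<integral>\<^sup>+s. indicator {0..t} s * (f (t - s) * g s) \<partial>lborel)"
  unfolding conv_def by (rule nn_integral_cong) (use assms in \<open>auto simp: causal_def indicator_def not_le\<close>)

lemma causal_conv [simp]:
  assumes "causal f" "causal g"
  shows "causal (conv f g)"
  using conv_causal[OF assms] by (simp add: causal_def)

text \<open>
  Convolution with \<open>heaviside\<close> is integration from \<open>0\<close>.
\<close>

lemma conv_heaviside:
  assumes "causal g"
  shows "conv heaviside g t = (\<integral>\<^sup>+s. indicator {0..t} s * g s \<partial>lborel)"
  unfolding conv_def
  by (rule nn_integral_cong) (use assms in \<open>auto simp: causal_def heaviside_def indicator_def not_le\<close>)

lemma conv_heaviside_mono:
  assumes "causal g" "s \<le> t"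
  shows "conv heaviside g s \<le> conv heaviside g t"
  unfolding conv_heaviside[OF assms(1)] by (rule nn_integral_mono) (use assms(2) in \<open>auto simp: indicator_def\<close>)

definition loc_bounded :: "(real \<Rightarrow> real) \<Rightarrow> bool" where
  "loc_bounded f \<longleftrightarrow> (\<forall>T. \<exists>B. \<forall>t. 0 \<le> t \<and> t \<le> T \<longrightarrow> \<bar>f t\<bar> \<le> B)"

lemma loc_measurable:
  fixes f :: "real \<Rightarrow> 'a::{banach, second_countable_topology}"
  assumes "\<And>T. set_integrable lborel {0..T} f"
  shows "(\<lambda>t. indicator {0..} t *\<^sub>R f t) \<in> borel_measurable borel"
proof (rule borel_measurable_LIMSEQ_metric)
  show "(\<lambda>t. indicator {0..real n} t *\<^sub>R f t) \<in> borel_measurable borel" for n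
    using assms[of "real n"] by (auto simp: set_integrable_def dest: borel_measurable_integrable)
  fix t :: real
  obtain N :: nat where N: "t \<le> real N" using real_arch_simple by blast
  have "\<forall>\<^sub>F n in sequentially. indicator {0..real n} t *\<^sub>R f t = indicator {0..} t *\<^sub>R f t"
    using eventually_ge_at_top[of N] by eventually_elim (use N in \<open>auto simp: indicator_def\<close>)
  then show "(\<lambda>n. indicator {0..real n} t *\<^sub>R f t) \<longlonglongrightarrow> indicator {0..} t *\<^sub>R f t"
    by (rule tendsto_eventually)
qed

lemma ext_measurable:
  assumes "\<And>T. set_integrable lborel {0..T} f"
  shows "ext f \<in> borel_measurable borel"
  using loc_measurable[OF assms] unfolding ext_def by simp

lemma conv_heaviside_ext:
  assumes f: "\<And>T. set_integrable lborel {0..T} f" and nn: "\<And>t. 0 \<le> t \<Longrightarrow> 0 \<le> f t"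
  shows "conv heaviside (ext f) t = ennreal (LINT s:{0..t}|lborel. f s)"
proof -
  have "conv heaviside (ext f) t = (\<integral>\<^sup>+s. ennreal (indicator {0..t} s *\<^sub>R f s) \<partial>lborel)"
    unfolding conv_heaviside[OF causal_ext] by (rule nn_integral_cong) (auto simp: ext_def indicator_def)
  also have "\<dots> = ennreal (LINT s:{0..t}|lborel. f s)"
    unfolding set_lebesgue_integral_def
    using f[of t] by (intro nn_integral_eq_integral) (auto simp: set_integrable_def indicator_def nn)
  finally show ?thesis .
qed

lemma set_integrable_of_conv_heaviside:
  assumes m: "(\<lambda>t. indicator {0..} t * f t) \<in> borel_measurable borel" and nn: "\<And>t. 0 \<le> t \<Longrightarrow> 0 \<le> f t"
    and fin: "conv heaviside (ext f) T < \<infinity>"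
  shows "set_integrable lborel {0..T} f"
proof -
  have eq: "indicator {0..T} s *\<^sub>R f s = indicator {0..T} s * (indicator {0..} s * f s)" for s :: real
    by (auto simp: indicator_def)
  have "(\<integral>\<^sup>+s. ennreal (norm (indicator {0..T} s *\<^sub>R f s)) \<partial>lborel) = conv heaviside (ext f) T"
    unfolding conv_heaviside[OF causal_ext] by (rule nn_integral_cong) (auto simp: ext_def indicator_def nn)
  moreover have "(\<lambda>s. indicator {0..T} s *\<^sub>R f s) \<in> borel_measurable lborel"
    unfolding eq using m by measurable
  ultimately show ?thesis
    unfolding set_integrable_def using fin by (intro integrableI_bounded) auto
qed

lemma conv_heaviside_finite_AE:
  assumes [measurable]: "f \<in> borel_measurable borel" and f: "causal f"
    and fin: "\<And>T. conv heaviside f T < \<infinity>"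
  shows "AE t in lborel. f t < \<infinity>"
proof -
  have "AE t in lborel. \<forall>n::nat. indicator {0..real n} t * f t < \<infinity>"
  proof (rule AE_all_countable[THEN iffD2], rule allI)
    fix n :: nat
    have "(\<integral>\<^sup>+s. indicator {0..real n} s * f s \<partial>lborel) \<noteq> \<infinity>"
      using fin[of "real n"] by (simp add: conv_heaviside[OF f] less_top)
    then have "AE t in lborel. indicator {0..real n} t * f t \<noteq> \<infinity>"
      by (intro nn_integral_PInf_AE) simp_all
    then show "AE t in lborel. indicator {0..real n} t * f t < \<infinity>"
      by eventually_elim (simp add: less_top)
  qed
  then show "AE t in lborel. f t < \<infinity>"
  proof eventually_elim
    case (elim t)
    obtain N :: nat where N: "t \<le> real N" using real_arch_simple by blast
    show ?case
      using elim[rule_format, of N] N f by (cases "t < 0") (auto simp: causal_def)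
  qed
qed

text \<open>
  By associativity, integrating \<open>conv f g\<close> means convolving \<open>f\<close> with the nondecreasing finite function
  \<open>conv heaviside g\<close>.
\<close>

lemma conv_finite_AE:
  assumes [measurable]: "f \<in> borel_measurable borel" "g \<in> borel_measurable borel"
    and neg: "causal f" "causal g"
    and fin: "\<And>T. conv heaviside f T < \<infinity>" "\<And>T. conv heaviside g T < \<infinity>"
  shows "\<And>T. conv heaviside (conv f g) T < \<infinity>" "AE t in lborel. conv f g t < \<infinity>"
proof -
  show *: "conv heaviside (conv f g) T < \<infinity>" for T
  proof -
    have "conv heaviside (conv f g) T = conv (conv heaviside f) g T"
      by (simp add: conv_assoc)
    also have "\<dots> = (\<integral>\<^sup>+s. indicator {0..T} s * (conv heaviside f (T - s) * g s) \<partial>lborel)"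
      by (rule conv_causal) (auto simp: neg)
    also have "\<dots> \<le> (\<integral>\<^sup>+s. conv heaviside f T * (indicator {0..T} s * g s) \<partial>lborel)"
      by (rule nn_integral_mono) (auto simp: indicator_def intro!: mult_right_mono conv_heaviside_mono neg)
    also have "\<dots> = conv heaviside f T * conv heaviside g T"
      by (simp add: nn_integral_cmult conv_heaviside[OF neg(2)])
    also have "\<dots> < \<infinity>" using fin by (simp add: ennreal_mult_less_top)
    finally show ?thesis .
  qed
  show "AE t in lborel. conv f g t < \<infinity>"
    by (intro conv_heaviside_finite_AE conv_measurable causal_conv assms(1,2) neg *)
qed

text \<open>
  The bridge back from extended nonnegative convolution to integrals of real functions.
\<close>

lemma conv_ext_bounded:
  assumes m: "ext f \<in> borel_measurable borel" "ext g \<in> borel_measurable borel"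
    and mf: "(\<lambda>t. indicator {0..} t * f t) \<in> borel_measurable borel" "(\<lambda>t. indicator {0..} t * g t) \<in> borel_measurable borel"
    and nn: "\<And>t. 0 \<le> t \<Longrightarrow> 0 \<le> f t" "\<And>t. 0 \<le> t \<Longrightarrow> 0 \<le> g t"
    and b: "loc_bounded f" "loc_bounded g"
  shows "set_integrable lborel {0..T} (\<lambda>s. f (T - s) * g s)"
    and "conv (ext f) (ext g) T = ennreal (LINT s:{0..T}|lborel. f (T - s) * g s)"
proof -
  note [measurable] = mf
  obtain A where A: "\<And>t. 0 \<le> t \<Longrightarrow> t \<le> T \<Longrightarrow> \<bar>f t\<bar> \<le> A" using b(1) unfolding loc_bounded_def by meson
  obtain B where B: "\<And>t. 0 \<le> t \<Longrightarrow> t \<le> T \<Longrightarrow> \<bar>g t\<bar> \<le> B" using b(2) unfolding loc_bounded_def by meson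
  have eq: "indicator {0..T} s *\<^sub>R (f (T - s) * g s) = indicator {0..T} s * ((indicator {0..} (T - s) * f (T - s)) * (indicator {0..} s * g s))" for s
    by (auto simp: indicator_def)
  have int: "integrable lborel (\<lambda>s. indicator {0..T} s * (A * B))"
    by (cases "0 \<le> T") (auto intro!: integrable_mult_left)
  show I: "set_integrable lborel {0..T} (\<lambda>s. f (T - s) * g s)"
    unfolding set_integrable_def
  proof (rule Bochner_Integration.integrable_bound[OF int])
    show "(\<lambda>s. indicator {0..T} s *\<^sub>R (f (T - s) * g s)) \<in> borel_measurable lborel"
      unfolding eq by measurable
    show "AE s in lborel. norm (indicator {0..T} s *\<^sub>R (f (T - s) * g s)) \<le> norm (indicator {0..T} s * (A * B))"
    proof (rule AE_I2)
      fix s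
      show "norm (indicator {0..T} s *\<^sub>R (f (T - s) * g s)) \<le> norm (indicator {0..T} s * (A * B))"
      proof (cases "s \<in> {0..T}")
        case True
        then have "\<bar>f (T - s)\<bar> * \<bar>g s\<bar> \<le> A * B"
          using A[of "T - s"] B[of s] by (intro mult_mono) auto
        then show ?thesis using True abs_ge_self[of "A * B"] by (simp add: abs_mult)
      qed simp
    qed
  qed
  have "conv (ext f) (ext g) T = (\<integral>\<^sup>+s. ennreal (indicator {0..T} s *\<^sub>R (f (T - s) * g s)) \<partial>lborel)"
    unfolding conv_causal[OF causal_ext causal_ext]
    by (rule nn_integral_cong) (auto simp: ext_def indicator_def ennreal_mult[symmetric] nn)
  also have "\<dots> = ennreal (LINT s:{0..T}|lborel. f (T - s) * g s)"
    unfolding set_lebesgue_integral_def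
    using I by (intro nn_integral_eq_integral) (auto simp: set_integrable_def indicator_def nn)
  finally show "conv (ext f) (ext g) T = ennreal (LINT s:{0..T}|lborel. f (T - s) * g s)" .
qed

section \<open>Entrywise form of the resolvent equation\<close>

lemma integrable_vec_nth: "integrable M f \<Longrightarrow> integrable M (\<lambda>x. f x $ i)"
  for f :: "'a \<Rightarrow> ('b::euclidean_space)^'n"
  by (rule integrable_bounded_linear[OF bounded_linear_vec_nth])

lemma integral_vec_nth: "integrable M f \<Longrightarrow> integral\<^sup>L M f $ i = (LINT x|M. f x $ i)"
  for f :: "'a \<Rightarrow> ('b::euclidean_space)^'n"
  by (rule integral_bounded_linear[OF bounded_linear_vec_nth, symmetric])

lemma vec_eq_sum_axis: "(x :: ('b::euclidean_space)^'n) = (\<Sum>i\<in>UNIV. axis i (x $ i))"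
  by (simp add: Finite_Cartesian_Product.vec_eq_iff axis_def)

lemma bounded_linear_axis: "bounded_linear (axis i :: 'b::euclidean_space \<Rightarrow> 'b^'n)"
  unfolding linear_conv_bounded_linear[symmetric]
  by (rule linearI) (auto simp: Finite_Cartesian_Product.vec_eq_iff axis_def)

lemma integrable_vecI:
  fixes f :: "'a \<Rightarrow> ('b::euclidean_space)^'n"
  assumes "\<And>i. integrable M (\<lambda>x. f x $ i)"
  shows "integrable M f"
proof -
  have "integrable M (\<lambda>x. \<Sum>i\<in>UNIV. axis i (f x $ i))"
    by (intro Bochner_Integration.integrable_sum integrable_bounded_linear[OF bounded_linear_axis] assms)
  then show ?thesis by (simp flip: vec_eq_sum_axis)
qed

lemma set_integrable_vec_nth: "set_integrable M A f \<Longrightarrow> set_integrable M A (\<lambda>x. f x $ i)"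
  for f :: "'a \<Rightarrow> ('b::euclidean_space)^'n"
  unfolding set_integrable_def by (drule integrable_vec_nth[of _ _ i]) simp

lemma set_integrable_vecI: "(\<And>i. set_integrable M A (\<lambda>x. f x $ i)) \<Longrightarrow> set_integrable M A f"
  for f :: "'a \<Rightarrow> ('b::euclidean_space)^'n"
  unfolding set_integrable_def by (intro integrable_vecI) simp

lemma set_integral_vec_nth: "set_integrable M A f \<Longrightarrow> (LINT x:A|M. f x) $ i = (LINT x:A|M. f x $ i)"
  for f :: "'a \<Rightarrow> ('b::euclidean_space)^'n"
  unfolding set_integrable_def set_lebesgue_integral_def by (simp add: integral_vec_nth)

definition entry :: "(real \<Rightarrow> real^'n^'m) \<Rightarrow> 'm \<Rightarrow> 'n \<Rightarrow> real \<Rightarrow> ennreal" where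
  "entry f i j = ext (\<lambda>t. f t $ i $ j)"

lemma entry_measurable:
  assumes "loc_integrable_fun f" shows "entry f i j \<in> borel_measurable borel"
  unfolding entry_def using assms
  by (intro ext_measurable) (auto simp: loc_integrable_fun_def intro!: set_integrable_vec_nth)

lemma causal_entry [simp]: "causal (entry f i j)" by (simp add: entry_def)

lemma integrable_imp_loc_integrable: "integrable_fun f \<Longrightarrow> loc_integrable_fun f"
  unfolding integrable_fun_def loc_integrable_fun_def
  by (auto intro: set_integrable_subset)

lemma conv_heaviside_entry_finite:
  assumes f: "loc_integrable_fun f" "\<And>t. 0 \<le> t \<Longrightarrow> 0 \<le> f t"
  shows "conv heaviside (entry f i j) T < \<infinity>"
  unfolding entry_def
  by (subst conv_heaviside_ext) (use f in \<open>auto simp: loc_integrable_fun_def less_eq_vec_def intro!: set_integrable_vec_nth\<close>)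

lemma AE_all_finite_index:
  assumes "\<And>i :: 'n::finite. AE x in M. P i x"
  shows "AE x in M. \<forall>i. P i x"
proof -
  have "AE x in M. \<forall>i\<in>UNIV. P i x"
    by (rule AE_finite_allI) (simp_all add: assms)
  then show ?thesis by simp
qed

lemma conv_real_of_finite:
  assumes mf: "(\<lambda>t. indicator {0..} t * f t) \<in> borel_measurable borel" "(\<lambda>t. indicator {0..} t * g t) \<in> borel_measurable borel"
    and nn: "\<And>t. 0 \<le> t \<Longrightarrow> 0 \<le> f t" "\<And>t. 0 \<le> t \<Longrightarrow> 0 \<le> g t"
    and fin: "conv (ext f) (ext g) t < \<infinity>"
  shows "set_integrable lborel {0..t} (\<lambda>s. f (t - s) * g s)"
    and "ennreal (LINT s:{0..t}|lborel. f (t - s) * g s) = conv (ext f) (ext g) t"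
proof -
  note [measurable] = mf
  have eq: "indicator {0..t} s *\<^sub>R (f (t - s) * g s) = indicator {0..t} s * ((indicator {0..} (t - s) * f (t - s)) * (indicator {0..} s * g s))" for s
    by (auto simp: indicator_def)
  have m: "(\<lambda>s. indicator {0..t} s *\<^sub>R (f (t - s) * g s)) \<in> borel_measurable lborel"
    unfolding eq by measurable
  have nn': "0 \<le> indicator {0..t} s *\<^sub>R (f (t - s) * g s)" for s
    using nn by (auto simp: indicator_def)
  have c: "conv (ext f) (ext g) t = (\<integral>\<^sup>+s. ennreal (indicator {0..t} s *\<^sub>R (f (t - s) * g s)) \<partial>lborel)"
    unfolding conv_causal[OF causal_ext causal_ext]
    by (rule nn_integral_cong) (auto simp: ext_def indicator_def ennreal_mult[symmetric] nn)
  show I: "set_integrable lborel {0..t} (\<lambda>s. f (t - s) * g s)"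
    unfolding set_integrable_def using m nn' fin unfolding c
    by (intro integrableI_nonneg) auto
  then show "ennreal (LINT s:{0..t}|lborel. f (t - s) * g s) = conv (ext f) (ext g) t"
    unfolding c set_lebesgue_integral_def set_integrable_def
    by (intro nn_integral_eq_integral[symmetric]) (auto simp: nn' simp del: real_scaleR_def)
qed

text \<open>
  The resolvent equation is stated with Bochner integrals of matrices, which are \<open>0\<close> where they diverge.
  Local integrability of \<open>R\<close> and \<open>\<phi>\<close> makes the convolutions finite almost everywhere, so the equation
  holds entrywise in extended nonnegative form.
\<close>

lemma resolvent_entry_equation:
  fixes \<phi> R :: "real \<Rightarrow> real^'d^'d"
  assumes \<phi>: "\<And>t. 0 \<le> t \<Longrightarrow> 0 \<le> \<phi> t" "loc_integrable_fun \<phi>" and R: "is_resolvent \<phi> R"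
  shows "AE t in lborel. entry R i k t = entry \<phi> i k t + (\<Sum>j\<in>UNIV. conv (entry R i j) (entry \<phi> j k) t)"
proof -
  have Rl: "loc_integrable_fun R" and Rn: "\<And>t. 0 \<le> t \<Longrightarrow> 0 \<le> R t"
    and Req: "AE t in lborel. 0 \<le> t \<longrightarrow> R t = \<phi> t + conv_mat_mat R \<phi> t"
    using R by (auto simp: is_resolvent_def)
  have fin: "AE t in lborel. conv (entry R a j) (entry \<phi> j b) t < \<infinity>" for a b j
    by (intro conv_finite_AE(2) causal_entry entry_measurable conv_heaviside_entry_finite Rl Rn \<phi>)
  have fin': "AE t in lborel. \<forall>a b j. conv (entry R a j) (entry \<phi> j b) t < \<infinity>"
    by (intro AE_all_finite_index fin)
  have nn: "0 \<le> R t $ a $ b" "0 \<le> \<phi> t $ a $ b" if "0 \<le> t" for a b t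
    using Rn[OF that] \<phi>(1)[OF that] by (auto simp: less_eq_vec_def)
  have mR: "(\<lambda>t. indicator {0..} t * R t $ a $ b) \<in> borel_measurable borel"
    and mp: "(\<lambda>t. indicator {0..} t * \<phi> t $ a $ b) \<in> borel_measurable borel" for a b
    using loc_measurable[of "\<lambda>t. R t $ a $ b"] loc_measurable[of "\<lambda>t. \<phi> t $ a $ b"] Rl \<phi>(2)
    by (simp_all add: loc_integrable_fun_def set_integrable_vec_nth)
  from Req fin' show ?thesis
  proof eventually_elim
    case (elim t)
    show ?case
    proof (cases "0 \<le> t")
      case False
      have "causal (conv (entry R i j) (entry \<phi> j k))" for j by simp
      then have "conv (entry R i j) (entry \<phi> j k) t = 0" for j
        using False by (simp add: causal_def)
      then show ?thesis using False by (simp add: entry_def ext_def)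
    next
      case True
      have fin: "conv (ext (\<lambda>t. R t $ a $ j)) (ext (\<lambda>t. \<phi> t $ j $ b)) t < \<infinity>" for a b j
        using elim(2) by (simp add: entry_def)
      have I: "set_integrable lborel {0..t} (\<lambda>s. R (t - s) $ a $ j * \<phi> s $ j $ b)"
        and E: "ennreal (LINT s:{0..t}|lborel. R (t - s) $ a $ j * \<phi> s $ j $ b) = conv (entry R a j) (entry \<phi> j b) t" for a b j
        using conv_real_of_finite[OF mR mp nn fin] by (simp_all add: entry_def)
      have C: "(R (t - s) ** \<phi> s) $ a $ b = (\<Sum>j\<in>UNIV. R (t - s) $ a $ j * \<phi> s $ j $ b)" for s a b
        by (simp add: matrix_matrix_mult_def)
      have Ib: "set_integrable lborel {0..t} (\<lambda>s. (R (t - s) ** \<phi> s) $ a $ b)" for a b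
        unfolding C using I unfolding set_integrable_def scaleR_sum_right
        by (intro Bochner_Integration.integrable_sum) auto
      have Im: "set_integrable lborel {0..t} (\<lambda>s. R (t - s) ** \<phi> s)"
        by (intro set_integrable_vecI Ib)
      have "conv_mat_mat R \<phi> t $ i $ k = (LINT s:{0..t}|lborel. (R (t - s) ** \<phi> s) $ i $ k)"
        unfolding conv_mat_mat_def
        by (simp add: set_integral_vec_nth Im set_integrable_vec_nth)
      also have "\<dots> = (\<Sum>j\<in>UNIV. (LINT s:{0..t}|lborel. R (t - s) $ i $ j * \<phi> s $ j $ k))"
        unfolding C set_lebesgue_integral_def scaleR_sum_right
        using I by (intro Bochner_Integration.integral_sum) (auto simp: set_integrable_def)
      finally have c: "conv_mat_mat R \<phi> t $ i $ k = (\<Sum>j\<in>UNIV. (LINT s:{0..t}|lborel. R (t - s) $ i $ j * \<phi> s $ j $ k))" .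
      have nnI: "0 \<le> (LINT s:{0..t}|lborel. R (t - s) $ i $ j * \<phi> s $ j $ k)" for j
        unfolding set_lebesgue_integral_def using nn by (intro integral_nonneg_AE) (auto simp: indicator_def)
      have "R t $ i $ k = \<phi> t $ i $ k + conv_mat_mat R \<phi> t $ i $ k"
        using elim(1) True by (metis vector_add_component)
      then have "ennreal (R t $ i $ k) = ennreal (\<phi> t $ i $ k) + (\<Sum>j\<in>UNIV. ennreal (LINT s:{0..t}|lborel. R (t - s) $ i $ j * \<phi> s $ j $ k))"
        unfolding c using nn[OF True] nnI by (simp add: ennreal_plus sum_nonneg flip: sum_ennreal)
      then show ?thesis unfolding E using True by (simp add: entry_def ext_def)
    qed
  qed
qed

section \<open>Laplace transforms of resolvents\<close>

definition lap :: "real \<Rightarrow> (real \<Rightarrow> ennreal) \<Rightarrow> ennreal" where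
  "lap r f = (\<integral>\<^sup>+t. ennreal (exp (- r * t)) * f t \<partial>lborel)"

lemma lap_conv:
  assumes [measurable]: "f \<in> borel_measurable borel" "g \<in> borel_measurable borel"
  shows "lap r (conv f g) = lap r f * lap r g"
proof -
  have "lap r (conv f g) = (\<integral>\<^sup>+t. (\<integral>\<^sup>+s. (ennreal (exp (- r * (t - s))) * f (t - s)) * (ennreal (exp (- r * s)) * g s) \<partial>lborel) \<partial>lborel)"
  proof -
    have "ennreal (exp (- r * t)) * (f (t - s) * g s) = (ennreal (exp (- r * (t - s))) * f (t - s)) * (ennreal (exp (- r * s)) * g s)" for s t
    proof -
      have "ennreal (exp (- r * t)) = ennreal (exp (- r * (t - s))) * ennreal (exp (- r * s))"
        by (simp add: ennreal_mult[symmetric] exp_add[symmetric] algebra_simps)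
      then show ?thesis by (simp add: mult_ac)
    qed
    then show ?thesis
      unfolding lap_def conv_def by (simp add: nn_integral_cmult[symmetric])
  qed
  also have "\<dots> = (\<integral>\<^sup>+s. (\<integral>\<^sup>+t. (ennreal (exp (- r * (t - s))) * f (t - s)) * (ennreal (exp (- r * s)) * g s) \<partial>lborel) \<partial>lborel)"
    by (rule lborel_pair.Fubini') measurable
  also have "\<dots> = (\<integral>\<^sup>+s. lap r f * (ennreal (exp (- r * s)) * g s) \<partial>lborel)"
  proof (rule nn_integral_cong)
    fix s
    have "(\<integral>\<^sup>+t. ennreal (exp (- r * (t - s))) * f (t - s) \<partial>lborel) = lap r f"
      using nn_integral_lborel_shift[of "\<lambda>t. ennreal (exp (- r * t)) * f t" "- s"] by (simp add: lap_def add.commute)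
    then show "(\<integral>\<^sup>+t. (ennreal (exp (- r * (t - s))) * f (t - s)) * (ennreal (exp (- r * s)) * g s) \<partial>lborel)
        = lap r f * (ennreal (exp (- r * s)) * g s)"
      by (simp add: nn_integral_multc)
  qed
  also have "\<dots> = lap r f * lap r g"
    by (simp add: lap_def nn_integral_cmult)
  finally show ?thesis .
qed

lemma laplace_integrable:
  assumes "integrable_fun \<phi>" "0 \<le> r"
  shows "set_integrable lborel {0..} (\<lambda>t. exp (- r * t) *\<^sub>R \<phi> t)"
proof -
  have i: "integrable lborel (\<lambda>t. indicator {0..} t *\<^sub>R \<phi> t)"
    using assms(1) by (simp add: integrable_fun_def set_integrable_def)
  have eq: "indicator {0..} t *\<^sub>R exp (- r * t) *\<^sub>R \<phi> t = exp (- r * t) *\<^sub>R (indicator {0..} t *\<^sub>R \<phi> t)" for t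
    by simp
  show ?thesis
    unfolding set_integrable_def eq
  proof (rule Bochner_Integration.integrable_bound[OF i])
    show "(\<lambda>t. exp (- r * t) *\<^sub>R (indicator {0..} t *\<^sub>R \<phi> t)) \<in> borel_measurable lborel"
      by (intro borel_measurable_scaleR borel_measurable_integrable[OF i]) measurable
    show "AE t in lborel. norm (exp (- r * t) *\<^sub>R (indicator {0..} t *\<^sub>R \<phi> t)) \<le> norm (indicator {0..} t *\<^sub>R \<phi> t)"
      using assms(2) by (auto simp: indicator_def mult_nonneg_nonneg intro!: mult_left_le_one_le)
  qed
qed

lemma lap_entry:
  fixes \<phi> :: "real \<Rightarrow> real^'d^'d"
  assumes \<phi>: "\<And>t. 0 \<le> t \<Longrightarrow> 0 \<le> \<phi> t" "integrable_fun \<phi>" and r: "0 \<le> r"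
  shows "lap r (entry \<phi> i j) = ennreal (laplace \<phi> r $ i $ j)" "0 \<le> laplace \<phi> r $ i $ j"
proof -
  note I = laplace_integrable[OF \<phi>(2) r]
  have nn: "0 \<le> \<phi> t $ i $ j" if "0 \<le> t" for t using \<phi>(1)[OF that] by (simp add: less_eq_vec_def)
  have e: "laplace \<phi> r $ i $ j = (LINT t:{0..}|lborel. exp (- r * t) * \<phi> t $ i $ j)"
    unfolding laplace_def set_integral_vec_nth[OF I] set_integral_vec_nth[OF set_integrable_vec_nth[OF I]]
    by simp
  show "0 \<le> laplace \<phi> r $ i $ j"
    unfolding e set_lebesgue_integral_def using nn by (intro integral_nonneg_AE) (auto simp: indicator_def)
  have Ij: "set_integrable lborel {0..} (\<lambda>t. exp (- r * t) * \<phi> t $ i $ j)"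
    using set_integrable_vec_nth[OF set_integrable_vec_nth[OF I, of i], of j] by simp
  have "lap r (entry \<phi> i j) = (\<integral>\<^sup>+t. ennreal (indicator {0..} t *\<^sub>R (exp (- r * t) * \<phi> t $ i $ j)) \<partial>lborel)"
    unfolding lap_def by (rule nn_integral_cong) (auto simp: entry_def ext_def indicator_def ennreal_mult[symmetric] nn)
  also have "\<dots> = ennreal (laplace \<phi> r $ i $ j)"
    unfolding e set_lebesgue_integral_def using Ij nn
    by (intro nn_integral_eq_integral) (auto simp: set_integrable_def indicator_def)
  finally show "lap r (entry \<phi> i j) = ennreal (laplace \<phi> r $ i $ j)" .
qed

context
  fixes \<phi> R :: "real \<Rightarrow> real^'d^'d" and r :: real
  assumes \<phi>: "\<And>t. 0 \<le> t \<Longrightarrow> 0 \<le> \<phi> t" "integrable_fun \<phi>" and R: "is_resolvent \<phi> R" and r: "0 \<le> r"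
begin

private lemma meas: "entry \<phi> i j \<in> borel_measurable borel" "entry R i j \<in> borel_measurable borel"
  using R by (auto intro!: entry_measurable integrable_imp_loc_integrable[OF \<phi>(2)] simp: is_resolvent_def)

private lemma equation:
  "AE t in lborel. entry R i k t = entry \<phi> i k t + (\<Sum>j\<in>UNIV. conv (entry R i j) (entry \<phi> j k) t)"
  by (rule resolvent_entry_equation) (simp_all add: \<phi>(1) integrable_imp_loc_integrable[OF \<phi>(2)] R)

text \<open>
  Truncate the resolvent at \<open>T\<close>, which makes row \<open>i\<close> of the transform a finite vector \<open>x\<close> with
  \<open>x \<le> L\<^sub>i + x L\<close> by the resolvent equation. Pairing with \<open>z\<close> gives
  \<open>x z \<le> (L z)\<^sub>i + s (x z)\<close>, a bound on \<open>x\<close> independent of \<open>T\<close>; monotone convergence removes the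
  truncation.
\<close>

lemma lap_resolvent_finite:
  assumes z: "\<And>i. 0 < z $ i" and s: "s < 1" and Lz: "laplace \<phi> r *v z \<le> s *\<^sub>R z"
  shows "lap r (entry R i j) < \<infinity>"
proof -
  note [measurable] = meas
  define L where "L = laplace \<phi> r"
  have L: "0 \<le> L $ a $ b" "lap r (entry \<phi> a b) = ennreal (L $ a $ b)" for a b
    unfolding L_def using lap_entry[OF \<phi> r] by auto
  have Lz: "(\<Sum>k\<in>UNIV. L $ a $ k * z $ k) \<le> s * z $ a" for a
    using Lz by (simp add: less_eq_vec_def matrix_vector_mult_def L_def)
  define b where "b = (\<Sum>k\<in>UNIV. L $ i $ k * z $ k) / (1 - s)"
  have bound: "lap r (\<lambda>t. indicator {..T} t * entry R i k t) \<le> ennreal (b / z $ k)" for T k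
  proof -
    define x where "x a = enn2real (lap r (\<lambda>t. indicator {..T} t * entry R i a t))" for a
    have fin: "lap r (\<lambda>t. indicator {..T} t * entry R i a t) < \<infinity>" for a
    proof -
      have "lap r (\<lambda>t. indicator {..T} t * entry R i a t) \<le> conv heaviside (entry R i a) T"
        unfolding conv_heaviside[OF causal_entry] lap_def
      proof (rule nn_integral_mono)
        fix t :: real
        have "ennreal (exp (- r * t)) \<le> 1" if "0 \<le> t"
          using that r by (simp add: ennreal_le_1)
        then have "ennreal (exp (- r * t)) * entry R i a t \<le> 1 * entry R i a t" if "0 \<le> t"
          using that by (intro mult_right_mono) auto
        then show "ennreal (exp (- r * t)) * (indicator {..T} t * entry R i a t) \<le> indicator {0..T} t * entry R i a t"
          by (cases "0 \<le> t") (simp_all add: entry_def ext_def indicator_def)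
      qed
      also have "\<dots> < \<infinity>"
        using R by (intro conv_heaviside_entry_finite) (auto simp: is_resolvent_def)
      finally show ?thesis .
    qed
    have xe: "lap r (\<lambda>t. indicator {..T} t * entry R i a t) = ennreal (x a)" and x0: "0 \<le> x a" for a
      using fin[of a] by (auto simp: x_def less_top)
    have eq: "x k \<le> L $ i $ k + (\<Sum>j\<in>UNIV. x j * L $ j $ k)" for k
    proof -
      have "AE t in lborel. indicator {..T} t * entry R i k t
          \<le> entry \<phi> i k t + (\<Sum>j\<in>UNIV. conv (\<lambda>t. indicator {..T} t * entry R i j t) (entry \<phi> j k) t)"
        using equation[of i k]
      proof eventually_elim
        case (elim t)
        show ?case
        proof (cases "t \<le> T")
          case True
          have "conv (\<lambda>t. indicator {..T} t * entry R i j t) (entry \<phi> j k) t = conv (entry R i j) (entry \<phi> j k) t" for j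
            unfolding conv_def
            by (rule nn_integral_cong) (use True in \<open>auto simp: entry_def ext_def indicator_def\<close>)
          then show ?thesis using elim True by simp
        qed simp
      qed
      then have "AE t in lborel. ennreal (exp (- r * t)) * (indicator {..T} t * entry R i k t)
          \<le> ennreal (exp (- r * t)) * (entry \<phi> i k t + (\<Sum>j\<in>UNIV. conv (\<lambda>t. indicator {..T} t * entry R i j t) (entry \<phi> j k) t))"
        by eventually_elim (rule mult_left_mono, simp_all)
      then have "lap r (\<lambda>t. indicator {..T} t * entry R i k t)
          \<le> lap r (\<lambda>t. entry \<phi> i k t + (\<Sum>j\<in>UNIV. conv (\<lambda>t. indicator {..T} t * entry R i j t) (entry \<phi> j k) t))"
        unfolding lap_def by (rule nn_integral_mono_AE)
      also have "\<dots> = lap r (entry \<phi> i k) + (\<Sum>j\<in>UNIV. lap r (conv (\<lambda>t. indicator {..T} t * entry R i j t) (entry \<phi> j k)))"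
        unfolding lap_def by (simp add: distrib_left sum_distrib_left nn_integral_add nn_integral_sum)
      also have "\<dots> = ennreal (L $ i $ k) + (\<Sum>j\<in>UNIV. ennreal (x j) * ennreal (L $ j $ k))"
        by (simp add: lap_conv L(2) xe)
      also have "\<dots> = ennreal (L $ i $ k + (\<Sum>j\<in>UNIV. x j * L $ j $ k))"
        using L(1) x0 by (simp add: ennreal_mult[symmetric] ennreal_plus sum_nonneg)
      finally show ?thesis
        unfolding xe using L(1) x0 by (subst (asm) ennreal_le_iff) (auto intro!: add_nonneg_nonneg sum_nonneg)
    qed
    have "(\<Sum>k\<in>UNIV. x k * z $ k) \<le> (\<Sum>k\<in>UNIV. (L $ i $ k + (\<Sum>j\<in>UNIV. x j * L $ j $ k)) * z $ k)"
      using eq z by (intro sum_mono mult_right_mono) (auto simp: less_imp_le)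
    also have "\<dots> = (\<Sum>k\<in>UNIV. L $ i $ k * z $ k) + (\<Sum>k\<in>UNIV. \<Sum>j\<in>UNIV. x j * (L $ j $ k * z $ k))"
      by (simp add: distrib_right sum.distrib sum_distrib_right mult.assoc)
    also have "(\<Sum>k\<in>UNIV. \<Sum>j\<in>UNIV. x j * (L $ j $ k * z $ k)) = (\<Sum>j\<in>UNIV. x j * (\<Sum>k\<in>UNIV. L $ j $ k * z $ k))"
      by (subst sum.swap) (simp add: sum_distrib_left)
    also have "\<dots> \<le> (\<Sum>j\<in>UNIV. x j * (s * z $ j))"
      by (intro sum_mono mult_left_mono Lz x0)
    also have "\<dots> = s * (\<Sum>j\<in>UNIV. x j * z $ j)"
      by (simp add: sum_distrib_left mult_ac)
    finally have "(1 - s) * (\<Sum>k\<in>UNIV. x k * z $ k) \<le> (\<Sum>k\<in>UNIV. L $ i $ k * z $ k)"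
      by (simp add: left_diff_distrib)
    then have S: "(\<Sum>k\<in>UNIV. x k * z $ k) \<le> b"
      using s by (simp add: b_def pos_le_divide_eq mult.commute)
    have "x k * z $ k \<le> (\<Sum>k\<in>UNIV. x k * z $ k)"
      using x0 z by (intro member_le_sum) (auto simp: less_imp_le)
    with S have "x k \<le> b / z $ k" using z[of k] by (simp add: pos_le_divide_eq)
    then show ?thesis unfolding xe by (rule ennreal_leI)
  qed
  have "(\<lambda>n. lap r (\<lambda>t. indicator {..real n} t * entry R i j t)) \<longlonglongrightarrow> lap r (entry R i j)"
    unfolding lap_def
  proof (rule nn_integral_LIMSEQ)
    show "incseq (\<lambda>n t. ennreal (exp (- r * t)) * (indicator {..real n} t * entry R i j t))"
      by (auto simp: incseq_def le_fun_def indicator_def)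
    fix t :: real
    obtain N :: nat where N: "t \<le> real N" using real_arch_simple by blast
    have "\<forall>\<^sub>F n in sequentially. ennreal (exp (- r * t)) * (indicator {..real n} t * entry R i j t) = ennreal (exp (- r * t)) * entry R i j t"
      using eventually_ge_at_top[of N] by eventually_elim (use N in \<open>auto simp: indicator_def\<close>)
    then show "(\<lambda>n. ennreal (exp (- r * t)) * (indicator {..real n} t * entry R i j t)) \<longlonglongrightarrow> ennreal (exp (- r * t)) * entry R i j t"
      by (rule tendsto_eventually)
  qed measurable
  then have "lap r (entry R i j) \<le> ennreal (b / z $ j)"
    by (rule LIMSEQ_le_const2) (use bound in auto)
  then show ?thesis using le_less_trans by fastforce
qed

lemma matrix_mult_right_add: "(A + B) ** C = A ** C + B ** (C :: real^'n^'n)"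
  by (simp add: matrix_matrix_mult_def Finite_Cartesian_Product.vec_eq_iff algebra_simps sum.distrib)

text \<open>
  The Laplace transform of the resolvent equation, \<open>X = L + X L\<close>.
\<close>

lemma lap_resolvent_inverse:
  assumes fin: "\<And>i j. lap r (entry R i j) < \<infinity>"
  defines "X \<equiv> (\<chi> i j. enn2real (lap r (entry R i j)))"
  shows "(mat 1 + X) ** (mat 1 - laplace \<phi> r) = mat 1"
proof -
  note [measurable] = meas
  define L where "L = laplace \<phi> r"
  have L: "0 \<le> L $ a $ b" "lap r (entry \<phi> a b) = ennreal (L $ a $ b)" for a b
    unfolding L_def using lap_entry[OF \<phi> r] by auto
  have xe: "lap r (entry R a b) = ennreal (X $ a $ b)" and x0: "0 \<le> X $ a $ b" for a b
    using fin[of a b] by (auto simp: X_def less_top)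
  have entries: "X $ i $ k = L $ i $ k + (\<Sum>j\<in>UNIV. X $ i $ j * L $ j $ k)" for i k
  proof -
    have "AE t in lborel. ennreal (exp (- r * t)) * entry R i k t
        = ennreal (exp (- r * t)) * (entry \<phi> i k t + (\<Sum>j\<in>UNIV. conv (entry R i j) (entry \<phi> j k) t))"
      using equation[of i k]
      by eventually_elim simp
    then have "lap r (entry R i k) = lap r (\<lambda>t. entry \<phi> i k t + (\<Sum>j\<in>UNIV. conv (entry R i j) (entry \<phi> j k) t))"
      unfolding lap_def by (rule nn_integral_cong_AE)
    also have "\<dots> = lap r (entry \<phi> i k) + (\<Sum>j\<in>UNIV. lap r (conv (entry R i j) (entry \<phi> j k)))"
      unfolding lap_def by (simp add: distrib_left sum_distrib_left nn_integral_add nn_integral_sum)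
    also have "\<dots> = ennreal (L $ i $ k) + (\<Sum>j\<in>UNIV. ennreal (X $ i $ j) * ennreal (L $ j $ k))"
      by (simp add: lap_conv L(2) xe)
    also have "\<dots> = ennreal (L $ i $ k + (\<Sum>j\<in>UNIV. X $ i $ j * L $ j $ k))"
      using L(1) x0 by (simp add: ennreal_mult[symmetric] ennreal_plus sum_nonneg)
    finally show ?thesis
      unfolding xe using L(1) x0 by (subst (asm) ennreal_inj) (auto intro!: add_nonneg_nonneg sum_nonneg)
  qed
  have X: "L + X ** L = X"
    unfolding Finite_Cartesian_Product.vec_eq_iff matrix_matrix_mult_def vector_add_component vec_lambda_beta
    by (intro allI) (rule entries[symmetric])
  have "(mat 1 + X) ** (mat 1 - L) = (mat 1 + X) - (L + X ** L)"
    by (simp add: matrix_mult_left_diff matrix_mult_right_add)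
  also have "\<dots> = mat 1" unfolding X by simp
  finally show ?thesis unfolding L_def .
qed

end

section \<open>Convergence of the rescaled resolvents\<close>

lemma loc_integrable_rescale_density:
  fixes f :: "real \<Rightarrow> 'a::{banach, second_countable_topology}"
  assumes f: "loc_integrable_fun f" and n: "1 \<le> n"
  shows "loc_integrable_fun (rescale_density n \<theta> f)"
  unfolding loc_integrable_fun_def
proof
  fix T
  have "integrable lborel (\<lambda>t. indicator {0..real n * T} t *\<^sub>R f t)"
    using f by (simp add: loc_integrable_fun_def set_integrable_def)
  then have "integrable lborel (\<lambda>t. indicator {0..real n * T} (0 + real n * t) *\<^sub>R f (0 + real n * t))"
    by (rule lborel_integrable_real_affine) (use n in simp)
  moreover have "indicator {0..real n * T} (0 + real n * t) = (indicator {0..T} t :: real)" for t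
    using n by (auto simp: indicator_def zero_le_mult_iff)
  ultimately have "integrable lborel (\<lambda>t. indicator {0..T} t *\<^sub>R f (real n * t))"
    by simp
  then have "integrable lborel (\<lambda>t. sqrt (real n / \<theta>) *\<^sub>R (indicator {0..T} t *\<^sub>R f (real n * t)))"
    by (rule integrable_scaleR_right)
  then show "set_integrable lborel {0..T} (rescale_density n \<theta> f)"
    unfolding set_integrable_def rescale_density_def by (simp add: mult.commute)
qed

lemma entry_rescale_density:
  assumes "1 \<le> n" "\<And>t. 0 \<le> t \<Longrightarrow> 0 \<le> R t"
  shows "entry (rescale_density n \<theta> R) i j t = ennreal (sqrt (real n / \<theta>)) * entry R i j (real n * t)"
  using assms by (auto simp: entry_def ext_def rescale_density_def indicator_def less_eq_vec_def zero_le_mult_iff intro: ennreal_mult'')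

lemma lap_entry_rescale_density:
  assumes n: "1 \<le> n" and \<theta>: "0 < \<theta>" and R: "loc_integrable_fun R" "\<And>t. 0 \<le> t \<Longrightarrow> 0 \<le> R t"
  shows "lap r (entry (rescale_density n \<theta> R) i j) = ennreal (1 / sqrt (real n * \<theta>)) * lap (r / real n) (entry R i j)"
proof -
  have [measurable]: "entry R i j \<in> borel_measurable borel" by (rule entry_measurable[OF R(1)])
  have sq: "sqrt (real n / \<theta>) = (1 / sqrt (real n * \<theta>)) * real n"
    using n \<theta> by (simp add: real_sqrt_divide real_sqrt_mult field_simps)
  have e: "entry (rescale_density n \<theta> R) i j t = ennreal (sqrt (real n / \<theta>)) * entry R i j (real n * t)" for t
    by (rule entry_rescale_density[OF n]) (rule R(2))
  have "lap (r / real n) (entry R i j) = ennreal (real n) * (\<integral>\<^sup>+t. ennreal (exp (- r * t)) * entry R i j (real n * t) \<partial>lborel)"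
    unfolding lap_def
    using nn_integral_real_affine[of "\<lambda>t. ennreal (exp (- (r / real n) * t)) * entry R i j t" "real n" 0] n by simp
  moreover have "lap r (entry (rescale_density n \<theta> R) i j)
      = ennreal (sqrt (real n / \<theta>)) * (\<integral>\<^sup>+t. ennreal (exp (- r * t)) * entry R i j (real n * t) \<partial>lborel)"
    unfolding lap_def e
    by (simp add: nn_integral_cmult[symmetric] mult.left_commute)
  moreover have "ennreal (sqrt (real n / \<theta>)) = ennreal (1 / sqrt (real n * \<theta>)) * ennreal (real n)"
    unfolding sq by (rule ennreal_mult) (use \<theta> in auto)
  ultimately show ?thesis by (simp only: mult.assoc)
qed

text \<open>
  The rescaled transform is \<open>X n - Id / c n\<close>, where \<open>X n\<close> is the inverse of \<open>c n (Id - L n)\<close> once finiteness of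
  the transform is known. The matrix limit theorem applies with the identities satisfied by the
  transform of the potential measure.
\<close>

lemma resolvent_laplace_convergence:
  fixes \<phi> R :: "nat \<Rightarrow> real \<Rightarrow> ('d::{finite, linorder}) rmat"
  assumes \<phi>: "\<And>n t. n \<ge> 1 \<Longrightarrow> 0 \<le> t \<Longrightarrow> 0 \<le> \<phi> n t" "\<And>n. n \<ge> 1 \<Longrightarrow> integrable_fun (\<phi> n)"
    and R: "\<And>n. n \<ge> 1 \<Longrightarrow> is_resolvent (\<phi> n) (R n)"
    and theta_pos: "\<And>n. n \<ge> 1 \<Longrightarrow> \<theta> n > 0"
    and theta_lim: "filterlim \<theta> at_top sequentially"
    and l: "l \<le> CARD('d)" and K: "critical_matrix l K"
    and Phi_lim: "\<And>r. r \<ge> 0 \<Longrightarrow>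
      (\<lambda>n. sqrt (real n * \<theta> n) *\<^sub>R (K - laplace (\<phi> n) (r / real n))) \<longlonglongrightarrow> \<Phi> r"
    and adm: "admissible l K \<Phi> Q U lp" and pot: "potential_measure l \<Phi> Q U lp Pot" and r: "lp \<le> r"
  shows "\<forall>\<^sub>F n in sequentially. lap r (entry (rescale_density n (\<theta> n) (R n)) i j) < \<infinity>"
    and "(\<lambda>n. enn2real (lap r (entry (rescale_density n (\<theta> n) (R n)) i j))) \<longlonglongrightarrow> (LINT t|Pot i j. exp (- r * t))"
proof -
  define P where "P = ((\<chi> i j. LINT t|Pot i j. exp (- r * t)) :: 'd rmat)"
  note alg = potential_transform_algebra[OF K l adm pot r, folded P_def]
  have r0: "0 \<le> r" using adm r by (simp add: admissible_def)
  define c where "c n = sqrt (real n * \<theta> n)" for n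
  define L where "L n = laplace (\<phi> n) (r / real n)" for n
  have ge1: "\<forall>\<^sub>F n in sequentially. n \<ge> (1 :: nat)" by (rule eventually_ge_at_top)
  have c: "filterlim c at_top sequentially"
    unfolding c_def
    by (rule filterlim_compose[OF sqrt_at_top filterlim_at_top_mult_at_top[OF filterlim_real_sequentially theta_lim]])
  have lim: "(\<lambda>n. c n *\<^sub>R (K - L n)) \<longlonglongrightarrow> \<Phi> r"
    unfolding c_def L_def by (rule Phi_lim[OF r0])
  have Lnn: "\<forall>\<^sub>F n in sequentially. 0 \<le> L n"
    using ge1
  proof eventually_elim
    case (elim n)
    have "0 \<le> laplace (\<phi> n) (r / real n) $ a $ b" for a b
      by (rule lap_entry(2)) (use \<phi> elim r0 in auto)
    then show ?case by (simp add: L_def less_eq_vec_def)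
  qed
  have eig: "\<bar>s\<bar> \<le> 1" if "K *v z = s *\<^sub>R z" "z \<noteq> 0" for z s
    by (rule critical_matrix_eigenvalue_le_1[OF K that])
  have right: "P *v (\<Phi> r *v z) = z" if Kz: "K *v z = z" for z
  proof -
    \<comment> \<open>the matrix all of whose columns are \<open>z\<close>, to which the matrix identity applies\<close>
    define Z :: "'d rmat" where "Z = (\<chi> i j. z $ i)"
    have mv: "(A ** Z) $ a $ b = (A *v z) $ a" for A :: "'d rmat" and a b
      by (simp add: matrix_matrix_mult_def matrix_vector_mult_def Z_def)
    have mZ: "A ** Z = (\<chi> i j. (A *v z) $ i)" for A :: "'d rmat"
      using mv by (simp add: Finite_Cartesian_Product.vec_eq_iff)
    have "K ** Z = Z" by (simp only: mZ Kz) (simp only: Z_def)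
    from alg(3)[OF this] have "(P ** \<Phi> r) ** Z = Z" by (simp only: matrix_mul_assoc)
    then have "((P ** \<Phi> r) *v z) $ a = z $ a" for a
      using mv[of "P ** \<Phi> r" a a] by (simp add: Z_def)
    then show ?thesis by (simp add: Finite_Cartesian_Product.vec_eq_iff matrix_vector_mul_assoc)
  qed
  have sub: "\<forall>\<^sub>F n in sequentially. \<exists>z s. (\<forall>i. 0 < z $ i) \<and> s < 1 \<and> L n *v z \<le> s *\<^sub>R z"
    by (rule eventually_subcritical[OF c Lnn lim alg(5) alg(1) eig right])
  have fin: "\<forall>\<^sub>F n in sequentially. \<forall>i j. lap (r / real n) (entry (R n) i j) < \<infinity>"
    using sub ge1
  proof eventually_elim
    case (elim n)
    then obtain z s where z: "\<And>i. 0 < z $ i" "s < 1" "laplace (\<phi> n) (r / real n) *v z \<le> s *\<^sub>R z"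
      by (auto simp: L_def)
    show ?case
    proof (intro allI)
      fix i j
      have \<phi>n: "\<And>t. 0 \<le> t \<Longrightarrow> 0 \<le> \<phi> n t" and rn: "0 \<le> r / real n" using \<phi>(1) elim r0 by auto
      show "lap (r / real n) (entry (R n) i j) < \<infinity>"
        by (rule lap_resolvent_finite[OF \<phi>n \<phi>(2) R rn z]) (use elim in auto)
    qed
  qed
  define X where "X n = (1 / c n) *\<^sub>R (mat 1 + (\<chi> i j. enn2real (lap (r / real n) (entry (R n) i j))))" for n
  have cpos: "\<forall>\<^sub>F n in sequentially. 0 < c n"
    using c by (rule filterlim_at_top_dense[THEN iffD1, rule_format])
  have inv: "\<forall>\<^sub>F n in sequentially. X n ** (c n *\<^sub>R (mat 1 - L n)) = mat 1"
    using fin ge1 cpos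
  proof eventually_elim
    case (elim n)
    have \<phi>n: "\<And>t. 0 \<le> t \<Longrightarrow> 0 \<le> \<phi> n t" and rn: "0 \<le> r / real n" using \<phi>(1) elim r0 by auto
    have "(mat 1 + (\<chi> i j. enn2real (lap (r / real n) (entry (R n) i j)))) ** (mat 1 - laplace (\<phi> n) (r / real n)) = mat 1"
      by (rule lap_resolvent_inverse[OF \<phi>n \<phi>(2) R rn]) (use elim in auto)
    then show ?case
      unfolding X_def L_def using elim(3) by (simp add: matrix_mult_scaleR_right matrix_mult_scaleR_left)
  qed
  have XP: "X \<longlonglongrightarrow> P"
    by (rule scaled_inverse_convergence[OF c lim inv alg(2) alg(4)])
  have scale: "\<forall>\<^sub>F n in sequentially. lap r (entry (rescale_density n (\<theta> n) (R n)) i j) = ennreal (1 / c n) * lap (r / real n) (entry (R n) i j)"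
    using ge1
  proof eventually_elim
    case (elim n)
    have "loc_integrable_fun (R n)" "\<And>t. 0 \<le> t \<Longrightarrow> 0 \<le> R n t"
      using R[OF elim] by (auto simp: is_resolvent_def)
    from lap_entry_rescale_density[OF elim theta_pos[OF elim] this] show ?case by (simp add: c_def)
  qed
  from scale fin show "\<forall>\<^sub>F n in sequentially. lap r (entry (rescale_density n (\<theta> n) (R n)) i j) < \<infinity>"
    by eventually_elim (simp add: ennreal_mult_less_top)
  have "(\<lambda>n. (X n - inverse (c n) *\<^sub>R mat 1) $ i $ j) \<longlonglongrightarrow> (P - 0 *\<^sub>R mat 1) $ i $ j"
    by (intro tendsto_vec_nth tendsto_diff tendsto_scaleR XP tendsto_inverse_0_at_top[OF c] tendsto_const)
  then have "(\<lambda>n. (X n - inverse (c n) *\<^sub>R mat 1) $ i $ j) \<longlonglongrightarrow> P $ i $ j" by simp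
  moreover have "\<forall>\<^sub>F n in sequentially. (X n - inverse (c n) *\<^sub>R mat 1) $ i $ j = enn2real (lap r (entry (rescale_density n (\<theta> n) (R n)) i j))"
    using scale cpos
    by eventually_elim (simp add: X_def inverse_eq_divide algebra_simps enn2real_mult)
  ultimately have "(\<lambda>n. enn2real (lap r (entry (rescale_density n (\<theta> n) (R n)) i j))) \<longlonglongrightarrow> P $ i $ j"
    by (rule Lim_transform_eventually)
  then show "(\<lambda>n. enn2real (lap r (entry (rescale_density n (\<theta> n) (R n)) i j))) \<longlonglongrightarrow> (LINT t|Pot i j. exp (- r * t))"
    by (simp add: P_def)
qed

text \<open>
  The Laplace transforms converge at \<open>lp + k\<close> for every natural \<open>k\<close>, which is enough for the integrals of
  \<open>s \<mapsto> (t - s)\<^sup>+\<close>. No exceptional times occur because this function is continuous.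
\<close>

lemma resolvent_double_integral_convergence:
  fixes \<phi> R :: "nat \<Rightarrow> real \<Rightarrow> ('d::{finite, linorder}) rmat"
  assumes \<phi>: "\<And>n t. n \<ge> 1 \<Longrightarrow> 0 \<le> t \<Longrightarrow> 0 \<le> \<phi> n t" "\<And>n. n \<ge> 1 \<Longrightarrow> integrable_fun (\<phi> n)"
    and R: "\<And>n. n \<ge> 1 \<Longrightarrow> is_resolvent (\<phi> n) (R n)"
    and theta_pos: "\<And>n. n \<ge> 1 \<Longrightarrow> \<theta> n > 0"
    and theta_lim: "filterlim \<theta> at_top sequentially"
    and l: "l \<le> CARD('d)" and K: "critical_matrix l K"
    and Phi_lim: "\<And>r. r \<ge> 0 \<Longrightarrow>
      (\<lambda>n. sqrt (real n * \<theta> n) *\<^sub>R (K - laplace (\<phi> n) (r / real n))) \<longlonglongrightarrow> \<Phi> r"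
    and adm: "admissible l K \<Phi> Q U lp" and pot: "potential_measure l \<Phi> Q U lp Pot" and t: "0 \<le> t"
  shows "(\<lambda>n. enn2real (conv (conv heaviside heaviside) (entry (rescale_density n (\<theta> n) (R n)) i j) t))
    \<longlonglongrightarrow> (LINT s|Pot i j. max 0 (t - s))"
proof -
  \<comment> \<open>the hypotheses start at \<open>n = 1\<close>; the value at \<open>0\<close> only keeps \<open>f\<close> measurable\<close>
  define f where "f n = (if n \<ge> 1 then entry (rescale_density n (\<theta> n) (R n)) i j else (\<lambda>_. 0))" for n
  define \<nu> where "\<nu> n = density lborel (f n)" for n
  have ge1: "\<forall>\<^sub>F n in sequentially. n \<ge> (1 :: nat)" by (rule eventually_ge_at_top)
  have fm [measurable]: "f n \<in> borel_measurable borel" for n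
    using R[of n] by (auto simp: f_def is_resolvent_def intro!: entry_measurable loc_integrable_rescale_density)
  have fc: "causal (f n)" for n by (simp add: f_def causal_def) (simp add: entry_def ext_def)
  have nn: "(\<integral>\<^sup>+t. ennreal (exp (- a * t)) \<partial>\<nu> n) = lap a (f n)" for a n
    unfolding \<nu>_def lap_def by (subst nn_integral_density) (auto simp: mult.commute)
  have exp_meas: "(\<lambda>t. exp (- a * t)) \<in> borel_measurable (\<nu> n)" for a n
    unfolding \<nu>_def by measurable
  have integ: "(LINT t|\<nu> n. exp (- a * t)) = enn2real (lap a (f n))" for a n
    unfolding nn[symmetric] by (rule integral_eq_nn_integral[OF exp_meas]) simp
  have lpk: "lp \<le> lp + real k" for k by simp
  have lap_fin: "\<forall>\<^sub>F n in sequentially. lap a (entry (rescale_density n (\<theta> n) (R n)) i j) < \<infinity>" if "lp \<le> a" for a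
    by (rule resolvent_laplace_convergence(1)[OF \<phi> R theta_pos theta_lim l K Phi_lim adm pot that])
  have lap_lim: "(\<lambda>n. enn2real (lap a (entry (rescale_density n (\<theta> n) (R n)) i j))) \<longlonglongrightarrow> (LINT t|Pot i j. exp (- a * t))"
    if "lp \<le> a" for a
    by (rule resolvent_laplace_convergence(2)[OF \<phi> R theta_pos theta_lim l K Phi_lim adm pot that])
  have ev: "\<forall>\<^sub>F n in sequentially. integrable (\<nu> n) (\<lambda>t. exp (- (lp + real k) * t))" for k
    using lap_fin[OF lpk[of k]] ge1
  proof eventually_elim
    case (elim n)
    then have "(\<integral>\<^sup>+t. ennreal (exp (- (lp + real k) * t)) \<partial>\<nu> n) < \<infinity>"
      unfolding nn by (simp add: f_def)
    then show ?case
      by (intro integrableI_nonneg exp_meas) (rule AE_I2, simp)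
  qed
  have lim: "(\<lambda>n. LINT t|\<nu> n. exp (- (lp + real k) * t)) \<longlonglongrightarrow> (LINT t|Pot i j. exp (- (lp + real k) * t))" for k
    unfolding integ
    by (rule Lim_transform_eventually[OF lap_lim[OF lpk[of k]]])
       (use ge1 in eventually_elim, simp add: f_def)
  have pos: "AE t in \<nu> n. 0 \<le> t" for n
    unfolding \<nu>_def using fc[of n] by (subst AE_density) (auto simp: causal_def not_le[symmetric] intro!: AE_I2)
  have Pot_sets: "sets (Pot i j) = sets borel" and Pot_neg: "emeasure (Pot i j) {..<0} = 0"
    using pot by (auto simp: potential_measure_def)
  have Pot_int: "integrable (Pot i j) (\<lambda>t. exp (- (lp + real k) * t))" for k
    using pot lpk[of k] unfolding potential_measure_def by blast
  have Pot_pos: "AE t in Pot i j. 0 \<le> t"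
    by (rule AE_I[of _ _ "{..<0}"]) (auto simp: Pot_neg Pot_sets)
  have "(\<lambda>n. LINT s|\<nu> n. max 0 (t - s)) \<longlonglongrightarrow> (LINT s|Pot i j. max 0 (t - s))"
    by (rule laplace_imp_integrated_tail_convergence[OF _ Pot_sets pos Pot_pos ev Pot_int lim t]) (simp add: \<nu>_def)
  moreover have "\<forall>\<^sub>F n in sequentially. (LINT s|\<nu> n. max 0 (t - s)) = enn2real (conv (conv heaviside heaviside) (entry (rescale_density n (\<theta> n) (R n)) i j) t)"
    using ge1
  proof eventually_elim
    case (elim n)
    have hh: "conv heaviside heaviside u = ennreal (max 0 u)" for u
    proof -
      have "conv heaviside heaviside u = (\<integral>\<^sup>+s. indicator {0..u} s \<partial>lborel)"
        unfolding conv_heaviside[OF causal_heaviside]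
        by (rule nn_integral_cong) (auto simp: heaviside_def indicator_def)
      then show ?thesis by (auto simp: max_def)
    qed
    have "(LINT s|\<nu> n. max 0 (t - s)) = enn2real (\<integral>\<^sup>+s. ennreal (max 0 (t - s)) \<partial>\<nu> n)"
      by (subst integral_eq_nn_integral) (auto simp: \<nu>_def)
    also have "(\<integral>\<^sup>+s. ennreal (max 0 (t - s)) \<partial>\<nu> n) = conv (conv heaviside heaviside) (f n) t"
      unfolding \<nu>_def conv_def[of "conv heaviside heaviside"] hh by (subst nn_integral_density) (auto simp: mult.commute)
    finally show ?case using elim by (simp add: f_def)
  qed
  ultimately show ?thesis by (rule Lim_transform_eventually)
qed

section \<open>Intensities of Hawkes paths\<close>

text \<open>
  Integrating \<open>\<integral> p(t - s) dx(s)\<close> over time moves the integration to \<open>x\<close> and yields an ordinary convolution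
  of \<open>p\<close> with \<open>x\<close>; this is Tonelli's theorem for \<open>dx \<otimes> dt\<close>. Excluding the end point \<open>s = t\<close> costs
  nothing, as it changes the inner time integral only on a null set.
\<close>

lemma conv_stieltjes:
  fixes x :: "real \<Rightarrow> real" and p :: "real \<Rightarrow> ennreal"
  assumes mono: "\<And>s t. s \<le> t \<Longrightarrow> x s \<le> x t" and rc: "\<And>t. continuous (at_right t) x"
    and neg: "\<And>t. t < 0 \<Longrightarrow> x t = 0"
    and p [measurable]: "p \<in> borel_measurable borel" and pc: "causal p"
  defines "J \<equiv> \<lambda>t. \<integral>\<^sup>+s. indicator {0..<t} s * p (t - s) \<partial>interval_measure x"
  shows "J \<in> borel_measurable borel" "causal J" "conv heaviside J t = conv p (ext x) t"
proof -
  let ?M = "interval_measure x"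
  interpret sigma_finite_measure ?M by (rule sigma_finite_interval_measure[OF mono rc])
  interpret P: pair_sigma_finite lborel ?M ..
  have eq1: "indicator {0..<t} s * p (t - s) = indicator {y \<in> space (borel \<Otimes>\<^sub>M ?M). 0 \<le> snd y \<and> snd y < fst y} (t, s) * p (t - s)" for t s
    by (auto simp: indicator_def space_pair_measure)
  have [measurable]: "(\<lambda>(t, s). indicator {0..<t} s * p (t - s)) \<in> borel_measurable (borel \<Otimes>\<^sub>M ?M)"
    unfolding eq1 by measurable
  show Jm [measurable]: "J \<in> borel_measurable borel"
    unfolding J_def by (rule borel_measurable_nn_integral) measurable
  show Jc: "causal J" by (auto simp: causal_def J_def)
  have xm: "x \<in> borel_measurable borel"
    using mono by (intro borel_measurable_mono monoI)
  have extm [measurable]: "ext x \<in> borel_measurable borel"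
    unfolding ext_def using xm by measurable
  have eq2: "indicator {0..t} u * (indicator {0..<u} s * p (u - s))
      = indicator {y \<in> space (lborel \<Otimes>\<^sub>M ?M). 0 \<le> snd y \<and> snd y < fst y \<and> fst y \<le> t} (u, s) * p (u - s)" for u s
    by (auto simp: indicator_def space_pair_measure)
  have eq3: "indicator {0..} s * (indicator {0<..t - s} v * p v)
      = indicator {y \<in> space (lborel \<Otimes>\<^sub>M ?M). 0 \<le> snd y \<and> 0 < fst y \<and> fst y \<le> t - snd y} (v, s) * p v" for v s
    by (auto simp: indicator_def space_pair_measure)
  have "conv heaviside J t = (\<integral>\<^sup>+u. (\<integral>\<^sup>+s. indicator {0..t} u * (indicator {0..<u} s * p (u - s)) \<partial>?M) \<partial>lborel)"
    unfolding conv_heaviside[OF Jc]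
  proof (rule nn_integral_cong)
    fix u
    have "(\<lambda>s. indicator {0..<u} s * p (u - s)) \<in> borel_measurable ?M" by measurable
    then show "indicator {0..t} u * J u = (\<integral>\<^sup>+s. indicator {0..t} u * (indicator {0..<u} s * p (u - s)) \<partial>?M)"
      unfolding J_def by (rule nn_integral_cmult[symmetric])
  qed
  also have "\<dots> = (\<integral>\<^sup>+s. (\<integral>\<^sup>+u. indicator {0..t} u * (indicator {0..<u} s * p (u - s)) \<partial>lborel) \<partial>?M)"
    unfolding eq2 by (rule P.Fubini'[symmetric]) measurable
  also have "\<dots> = (\<integral>\<^sup>+s. (\<integral>\<^sup>+v. indicator {0..} s * (indicator {0<..t - s} v * p v) \<partial>lborel) \<partial>?M)"
  proof (rule nn_integral_cong)
    fix s
    have "(\<integral>\<^sup>+u. indicator {0..t} u * (indicator {0..<u} s * p (u - s)) \<partial>lborel)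
        = (\<integral>\<^sup>+v. indicator {0..t} (s + v) * (indicator {0<..} v * (indicator {0..} s * p v)) \<partial>lborel)"
      using nn_integral_lborel_shift[of "\<lambda>u. indicator {0..t} u * (indicator {0<..} (u - s) * (indicator {0..} s * p (u - s)))" s]
      by (auto intro!: nn_integral_cong simp: indicator_def)
    also have "\<dots> = (\<integral>\<^sup>+v. indicator {0..} s * (indicator {0<..t - s} v * p v) \<partial>lborel)"
      by (rule nn_integral_cong) (auto simp: indicator_def)
    finally show "(\<integral>\<^sup>+u. indicator {0..t} u * (indicator {0..<u} s * p (u - s)) \<partial>lborel)
        = (\<integral>\<^sup>+v. indicator {0..} s * (indicator {0<..t - s} v * p v) \<partial>lborel)" .
  qed
  also have "\<dots> = (\<integral>\<^sup>+v. (\<integral>\<^sup>+s. indicator {0..} s * (indicator {0<..t - s} v * p v) \<partial>?M) \<partial>lborel)"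
    unfolding eq3 by (rule P.Fubini') measurable
  also have "\<dots> = (\<integral>\<^sup>+v. ext x (t - v) * p v \<partial>lborel)"
  proof (rule nn_integral_cong_AE)
    have "AE v in lborel. v \<noteq> (0 :: real)" by (rule AE_lborel_singleton)
    then show "AE v in lborel. (\<integral>\<^sup>+s. indicator {0..} s * (indicator {0<..t - s} v * p v) \<partial>?M) = ext x (t - v) * p v"
    proof eventually_elim
      case (elim v)
      show ?case
      proof (cases "0 < v \<and> v \<le> t")
        case True
        have "(\<integral>\<^sup>+s. indicator {0..} s * (indicator {0<..t - s} v * p v) \<partial>?M) = (\<integral>\<^sup>+s. p v * indicator {0..t - v} s \<partial>?M)"
          by (rule nn_integral_cong) (use True in \<open>auto simp: indicator_def\<close>)
        also have "\<dots> = p v * emeasure ?M {0..t - v}"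
          by (rule nn_integral_cmult_indicator) simp
        also have "emeasure ?M {0..t - v} = ennreal (x (t - v))"
          by (rule emeasure_interval_measure_from_zero[OF mono rc neg]) (use True in auto)
        finally show ?thesis using True by (simp add: ext_def mult.commute)
      next
        case False
        have "(\<integral>\<^sup>+s. indicator {0..} s * (indicator {0<..t - s} v * p v) \<partial>?M) = (\<integral>\<^sup>+s. 0 \<partial>?M)"
          by (rule nn_integral_cong) (use False in \<open>auto simp: indicator_def\<close>)
        moreover have "ext x (t - v) * p v = 0"
          using False elim pc by (cases "v < 0") (auto simp: causal_def ext_def)
        ultimately show ?thesis by simp
      qed
    qed
  qed
  also have "\<dots> = conv p (ext x) t"
    by (simp add: conv_commute[of p] conv_def[of "ext x"])
  finally show "conv heaviside J t = conv p (ext x) t" .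
qed

definition component :: "(real \<Rightarrow> real^'n) \<Rightarrow> 'n \<Rightarrow> real \<Rightarrow> ennreal" where
  "component f i = ext (\<lambda>t. f t $ i)"

lemma causal_component [simp]: "causal (component f i)" by (simp add: component_def)

lemma component_measurable:
  assumes "loc_integrable_fun f" shows "component f i \<in> borel_measurable borel"
  unfolding component_def using assms
  by (intro ext_measurable) (auto simp: loc_integrable_fun_def intro!: set_integrable_vec_nth)

lemma conv_heaviside_component:
  assumes f: "loc_integrable_fun f" "\<And>t. 0 \<le> t \<Longrightarrow> 0 \<le> f t"
  shows "conv heaviside (component f i) T = ennreal (primitive f T $ i)"
proof -
  have I: "set_integrable lborel {0..T} f" for T
    using f(1) by (auto simp: loc_integrable_fun_def)
  show ?thesis
    unfolding component_def primitive_def set_integral_vec_nth[OF I]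
    by (rule conv_heaviside_ext) (use f I in \<open>auto simp: less_eq_vec_def intro!: set_integrable_vec_nth\<close>)
qed

text \<open>
  Intensities and forcing terms are given by integrals that may diverge at exceptional times, where
  their default value is \<open>0\<close>. They agree almost everywhere with an extended nonnegative function \<open>e\<close>
  whose primitive is finite, and this determines integrability and primitive.
\<close>

lemma loc_integrable_of_component:
  fixes f :: "real \<Rightarrow> real^'n"
  assumes m: "\<And>i. (\<lambda>t. indicator {0..} t * f t $ i) \<in> borel_measurable borel"
    and nn: "\<And>t. 0 \<le> t \<Longrightarrow> 0 \<le> f t"
    and e: "\<And>i. e i \<in> borel_measurable borel" "\<And>i. AE t in lborel. component f i t = e i t"
    and fin: "\<And>i T. conv heaviside (e i) T < \<infinity>"
  shows "loc_integrable_fun f" "conv heaviside (e i) T = ennreal (primitive f T $ i)"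
proof -
  have cm: "component f i \<in> borel_measurable borel" for i
    using m[of i] unfolding component_def ext_def by measurable
  have eq: "conv heaviside (component f i) T = conv heaviside (e i) T" for i T
    by (rule conv_cong_AE) (auto intro: cm e)
  have nn': "0 \<le> f t $ i" if "0 \<le> t" for t i
    using nn[OF that] by (simp add: less_eq_vec_def)
  have "set_integrable lborel {0..T} (\<lambda>t. f t $ i)" for i T
    by (rule set_integrable_of_conv_heaviside[OF m nn']) (use eq fin in \<open>simp_all add: component_def\<close>)
  then show l: "loc_integrable_fun f"
    unfolding loc_integrable_fun_def by (intro allI set_integrable_vecI)
  show "conv heaviside (e i) T = ennreal (primitive f T $ i)"
    unfolding eq[symmetric] by (rule conv_heaviside_component[OF l nn])
qed

context
  fixes \<mu> :: "real \<Rightarrow> real^'d" and \<phi> :: "real \<Rightarrow> real^'d^'d" and x :: "real \<Rightarrow> real^'d"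
  assumes par: "hawkes_parameters \<mu> \<phi>" and path: "counting_path x"
begin

private lemma x_comp:
  "\<And>s t. s \<le> t \<Longrightarrow> x s $ j \<le> x t $ j" "\<And>t. continuous (at_right t) (\<lambda>t. x t $ j)" "\<And>t. t < 0 \<Longrightarrow> x t $ j = 0" "0 \<le> x t $ j"
proof -
  have mono: "mono x" and cs: "x \<in> cadlag_space UNIV" using path by (auto simp: counting_path_def)
  show m: "x s $ j \<le> x t $ j" if "s \<le> t" for s t
    using monoD[OF mono that] by (simp add: less_eq_vec_def)
  show "continuous (at_right t) (\<lambda>t. x t $ j)" for t
    using cs by (auto simp: cadlag_space_def cadlag_def intro!: continuous_intros)
  show z: "x t $ j = 0" if "t < 0" for t
    using cs that by (auto simp: cadlag_space_def)
  show "0 \<le> x t $ j" using m[of "min t (-1)" t] z[of "min t (-1)"] by simp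
qed

private lemma \<mu>: "loc_integrable_fun \<mu>" "\<And>t. 0 \<le> t \<Longrightarrow> 0 \<le> \<mu> t"
  and \<phi>: "loc_integrable_fun \<phi>" "\<And>t. 0 \<le> t \<Longrightarrow> 0 \<le> \<phi> t"
  using par by (auto simp: hawkes_parameters_def integrable_imp_loc_integrable)

private lemma path_measurable:
  "component \<mu> i \<in> borel_measurable borel" "entry \<phi> i j \<in> borel_measurable borel" "component x i \<in> borel_measurable borel"
proof -
  have "(\<lambda>t. x t $ i) \<in> borel_measurable borel" using x_comp(1) by (intro borel_measurable_mono monoI)
  then show "component x i \<in> borel_measurable borel" unfolding component_def ext_def by measurable
qed (auto intro: component_measurable entry_measurable \<mu> \<phi>)

text \<open>
  The intensity is the sum of \<open>\<mu>\<close> and Stieltjes convolutions of \<open>\<phi>\<close>, and its primitive replaces the latter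
  by ordinary convolutions of \<open>\<phi>\<close> with the path. These are finite because the path is bounded on bounded
  intervals.
\<close>

lemma hawkes_intensity_loc_integrable: "loc_integrable_fun (hawkes_intensity \<mu> \<phi> x)"
  and hawkes_intensity_nonneg: "0 \<le> hawkes_intensity \<mu> \<phi> x t"
  and primitive_hawkes_intensity:
    "ennreal (primitive (hawkes_intensity \<mu> \<phi> x) t $ i)
      = conv heaviside (component \<mu> i) t + (\<Sum>j\<in>UNIV. conv (entry \<phi> i j) (component x j) t)"
proof -
  note [measurable] = path_measurable
  let ?L = "hawkes_intensity \<mu> \<phi> x"
  define J where "J i j = (\<lambda>t. \<integral>\<^sup>+s. indicator {0..<t} s * entry \<phi> i j (t - s) \<partial>interval_measure (\<lambda>s. x s $ j))" for i j
  have J1: "J i j \<in> borel_measurable borel" for i j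
    unfolding J_def by (rule conv_stieltjes(1)[OF x_comp(1-3) path_measurable(2) causal_entry])
  have J2: "causal (J i j)" for i j
    unfolding J_def by (rule conv_stieltjes(2)[OF x_comp(1-3) path_measurable(2) causal_entry])
  have J3: "conv heaviside (J i j) t = conv (entry \<phi> i j) (component x j) t" for i j t
    unfolding J_def component_def by (rule conv_stieltjes(3)[OF x_comp(1-3) path_measurable(2) causal_entry])
  note J = J1 J2 J3
  note [measurable] = J(1)
  have \<phi>nn: "0 \<le> \<phi> t $ i $ j" if "0 \<le> t" for t i j
    using \<phi>(2)[OF that] by (simp add: less_eq_vec_def)
  have m\<phi>: "(\<lambda>t. indicator {0..} t * \<phi> t $ i $ j) \<in> borel_measurable borel" for i j
    using loc_measurable[of "\<lambda>t. \<phi> t $ i $ j"] \<phi>(1)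
    by (simp add: loc_integrable_fun_def set_integrable_vec_nth)
  have m\<mu>: "(\<lambda>t. indicator {0..} t * \<mu> t $ i) \<in> borel_measurable borel" for i
    using loc_measurable[of "\<lambda>t. \<mu> t $ i"] \<mu>(1)
    by (simp add: loc_integrable_fun_def set_integrable_vec_nth)
  have LJ: "(LINT s:{0..<t}|interval_measure (\<lambda>s. x s $ j). \<phi> (t - s) $ i $ j) = enn2real (J i j t)" for i j t
  proof -
    have eq: "indicator {0..<t} s *\<^sub>R \<phi> (t - s) $ i $ j = indicator {0..<t} s * (indicator {0..} (t - s) * \<phi> (t - s) $ i $ j)" for s
      by (auto simp: indicator_def)
    have m: "(\<lambda>s. indicator {0..<t} s *\<^sub>R \<phi> (t - s) $ i $ j) \<in> borel_measurable (interval_measure (\<lambda>s. x s $ j))"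
      unfolding eq using m\<phi>[of i j] by measurable
    have "(LINT s:{0..<t}|interval_measure (\<lambda>s. x s $ j). \<phi> (t - s) $ i $ j)
        = enn2real (\<integral>\<^sup>+s. ennreal (indicator {0..<t} s *\<^sub>R \<phi> (t - s) $ i $ j) \<partial>interval_measure (\<lambda>s. x s $ j))"
      unfolding set_lebesgue_integral_def
      by (rule integral_eq_nn_integral[OF m]) (use \<phi>nn in \<open>auto simp: indicator_def\<close>)
    also have "(\<integral>\<^sup>+s. ennreal (indicator {0..<t} s *\<^sub>R \<phi> (t - s) $ i $ j) \<partial>interval_measure (\<lambda>s. x s $ j)) = J i j t"
      unfolding J_def by (rule nn_integral_cong) (auto simp: entry_def ext_def indicator_def)
    finally show ?thesis .
  qed
  have Li: "?L t $ i = \<mu> t $ i + (\<Sum>j\<in>UNIV. enn2real (J i j t))" if "0 \<le> t" for t i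
    using that by (simp add: hawkes_intensity_def LJ)
  show nn: "0 \<le> ?L t" for t
  proof (cases "0 \<le> t")
    case True
    then show ?thesis using \<mu>(2)[OF True] by (auto simp: less_eq_vec_def Li intro!: add_nonneg_nonneg sum_nonneg)
  qed (simp add: hawkes_intensity_def)
  have eqm: "indicator {0..} t * ?L t $ i = indicator {0..} t * \<mu> t $ i + (\<Sum>j\<in>UNIV. indicator {0..} t * enn2real (J i j t))" for t i
    by (cases "0 \<le> t") (simp_all add: Li)
  have mL: "(\<lambda>t. indicator {0..} t * ?L t $ i) \<in> borel_measurable borel" for i
    unfolding eqm using m\<mu>[of i] by measurable
  define e where "e i t = component \<mu> i t + (\<Sum>j\<in>UNIV. J i j t)" for i t
  have em [measurable]: "e i \<in> borel_measurable borel" for i unfolding e_def by measurable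
  have xfin: "conv (entry \<phi> i j) (component x j) T < \<infinity>" for i j T
  proof -
    have "conv (entry \<phi> i j) (component x j) T = (\<integral>\<^sup>+s. indicator {0..T} s * (component x j (T - s) * entry \<phi> i j s) \<partial>lborel)"
      unfolding conv_commute[OF path_measurable(2,3)] by (rule conv_causal) simp_all
    also have "\<dots> \<le> (\<integral>\<^sup>+s. ennreal (x T $ j) * (indicator {0..T} s * entry \<phi> i j s) \<partial>lborel)"
      by (rule nn_integral_mono) (auto simp: indicator_def component_def ext_def x_comp intro!: mult_right_mono ennreal_leI)
    also have "\<dots> = ennreal (x T $ j) * conv heaviside (entry \<phi> i j) T"
      by (simp add: nn_integral_cmult conv_heaviside)
    also have "\<dots> < \<infinity>"
      using conv_heaviside_entry_finite[OF \<phi>, of i j T] by (simp add: ennreal_mult_less_top)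
    finally show ?thesis .
  qed
  have ce: "conv heaviside (e i) T = conv heaviside (component \<mu> i) T + (\<Sum>j\<in>UNIV. conv (entry \<phi> i j) (component x j) T)" for i T
    unfolding e_def by (subst conv_add_right) (simp_all add: conv_sum_right J)
  have fin: "conv heaviside (e i) T < \<infinity>" for i T
    unfolding ce using xfin conv_heaviside_component[OF \<mu>, of i T] by simp
  have "AE t in lborel. J i j t < \<infinity>" for i j
    by (rule conv_heaviside_finite_AE[OF J(1,2)]) (simp only: J(3) xfin)
  then have "AE t in lborel. \<forall>i j. J i j t < \<infinity>" by (intro AE_all_finite_index)
  then have ae: "AE t in lborel. component ?L i t = e i t" for i
  proof eventually_elim
    case (elim t)
    show ?case
    proof (cases "0 \<le> t")
      case True
      have "ennreal (?L t $ i) = ennreal (\<mu> t $ i) + (\<Sum>j\<in>UNIV. ennreal (enn2real (J i j t)))"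
        using \<mu>(2)[OF True] unfolding Li[OF True]
        by (subst ennreal_plus) (auto simp: less_eq_vec_def sum_nonneg)
      moreover have "(\<Sum>j\<in>UNIV. ennreal (enn2real (J i j t))) = (\<Sum>j\<in>UNIV. J i j t)"
        using elim by (intro sum.cong refl) (simp add: less_top)
      ultimately have "ennreal (?L t $ i) = ennreal (\<mu> t $ i) + (\<Sum>j\<in>UNIV. J i j t)"
        by (simp only:)
      then show ?thesis using True by (simp add: component_def ext_def e_def)
    next
      case False
      then show ?thesis using J(2) by (simp add: component_def ext_def e_def causal_def)
    qed
  qed
  show "loc_integrable_fun ?L" by (rule loc_integrable_of_component(1)[OF mL nn em ae fin])
  show "ennreal (primitive ?L t $ i) = conv heaviside (component \<mu> i) t + (\<Sum>j\<in>UNIV. conv (entry \<phi> i j) (component x j) t)"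
    unfolding ce[symmetric] by (rule loc_integrable_of_component(2)[OF mL nn em ae fin, symmetric])
qed

text \<open>
  With \<open>Y = I_\<mu> + \<phi> * x\<close> and \<open>R * x = \<phi> * x + R * \<phi> * x\<close>, the convolution of \<open>Y\<close> with \<open>R\<close> yields
  \<open>Y + R * Y = I_\<mu> + R * I_\<mu> + R * x\<close>. The identity \<open>Y = I_\<mu> + R * I_\<mu> + R * (x - Y)\<close> is thus expressed
  with nonnegative functions only.
\<close>

lemma hawkes_volterra_path_identity:
  assumes R: "is_resolvent \<phi> R"
  defines "Y \<equiv> component (primitive (hawkes_intensity \<mu> \<phi> x))"
  shows "Y i t + (\<Sum>k\<in>UNIV. conv (entry R i k) (Y k) t)
    = (conv heaviside (component \<mu> i) t + (\<Sum>k\<in>UNIV. conv (entry R i k) (conv heaviside (component \<mu> k)) t))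
      + (\<Sum>k\<in>UNIV. conv (entry R i k) (component x k) t)"
proof -
  note [measurable] = path_measurable
  have Rm [measurable]: "entry R i j \<in> borel_measurable borel" for i j
    using R by (auto intro!: entry_measurable simp: is_resolvent_def)
  have Yeq: "Y i = (\<lambda>t. conv heaviside (component \<mu> i) t + (\<Sum>j\<in>UNIV. conv (entry \<phi> i j) (component x j) t))" for i
  proof
    fix t
    show "Y i t = conv heaviside (component \<mu> i) t + (\<Sum>j\<in>UNIV. conv (entry \<phi> i j) (component x j) t)"
    proof (cases "0 \<le> t")
      case True
      then show ?thesis using primitive_hawkes_intensity[of t i] by (simp add: Y_def component_def ext_def)
    next
      case False
      have "causal (conv heaviside (component \<mu> i))" "causal (conv (entry \<phi> i j) (component x j))" for j by simp_all
      then show ?thesis using False by (simp add: Y_def component_def ext_def causal_def)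
    qed
  qed
  have RN: "conv (entry R i j) (component x j) t = conv (entry \<phi> i j) (component x j) t
      + (\<Sum>k\<in>UNIV. conv (entry R i k) (conv (entry \<phi> k j) (component x j)) t)" for j
  proof -
    have "conv (entry R i j) (component x j) t = conv (component x j) (entry R i j) t"
      by (simp add: conv_commute)
    also have "\<dots> = conv (component x j) (\<lambda>t. entry \<phi> i j t + (\<Sum>k\<in>UNIV. conv (entry R i k) (entry \<phi> k j) t)) t"
      by (rule conv_cong_AE) (use resolvent_entry_equation[of \<phi> R i j] \<phi> R in auto)
    also have "\<dots> = conv (component x j) (entry \<phi> i j) t + (\<Sum>k\<in>UNIV. conv (component x j) (conv (entry R i k) (entry \<phi> k j)) t)"
      by (simp add: conv_add_right conv_sum_right)
    finally show ?thesis
      by (simp add: conv_commute[of "component x j"] conv_assoc)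
  qed
  have "(\<Sum>k\<in>UNIV. conv (entry R i k) (Y k) t)
      = (\<Sum>k\<in>UNIV. conv (entry R i k) (conv heaviside (component \<mu> k)) t)
        + (\<Sum>k\<in>UNIV. \<Sum>j\<in>UNIV. conv (entry R i k) (conv (entry \<phi> k j) (component x j)) t)"
    unfolding Yeq by (simp add: conv_add_right conv_sum_right sum.distrib)
  also have "(\<Sum>k\<in>UNIV. \<Sum>j\<in>UNIV. conv (entry R i k) (conv (entry \<phi> k j) (component x j)) t)
      = (\<Sum>j\<in>UNIV. \<Sum>k\<in>UNIV. conv (entry R i k) (conv (entry \<phi> k j) (component x j)) t)"
    by (rule sum.swap)
  finally have S: "(\<Sum>k\<in>UNIV. conv (entry R i k) (Y k) t)
      = (\<Sum>k\<in>UNIV. conv (entry R i k) (conv heaviside (component \<mu> k)) t)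
        + (\<Sum>j\<in>UNIV. \<Sum>k\<in>UNIV. conv (entry R i k) (conv (entry \<phi> k j) (component x j)) t)" .
  show ?thesis
    unfolding S RN sum.distrib Yeq[of i] by (simp add: ac_simps)
qed

end

section \<open>Nondecreasing functions\<close>

text \<open>
  Nonnegative and nondecreasing on the half-line. All functions to be convolved below are of this
  kind, which provides measurability and local boundedness at once.
\<close>

definition nondecr :: "(real \<Rightarrow> real) \<Rightarrow> bool" where
  "nondecr f \<longleftrightarrow> (\<forall>s t. 0 \<le> s \<longrightarrow> s \<le> t \<longrightarrow> 0 \<le> f s \<and> f s \<le> f t)"

lemma nondecrD: "nondecr f \<Longrightarrow> 0 \<le> s \<Longrightarrow> 0 \<le> f s" "nondecr f \<Longrightarrow> 0 \<le> s \<Longrightarrow> s \<le> t \<Longrightarrow> f s \<le> f t"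
  by (auto simp: nondecr_def)

lemma nondecr_measurable:
  assumes f: "nondecr f" shows "(\<lambda>t. indicator {0..} t * f t) \<in> borel_measurable borel"
proof -
  have "mono (\<lambda>t. indicator {0..} t * f t)"
    using f by (intro monoI) (auto simp: indicator_def nondecr_def)
  then show ?thesis by (rule borel_measurable_mono)
qed

lemma nondecr_ext_measurable: "nondecr f \<Longrightarrow> ext f \<in> borel_measurable borel"
  unfolding ext_def using nondecr_measurable by simp

lemma nondecr_loc_bounded: "nondecr f \<Longrightarrow> loc_bounded f"
  unfolding loc_bounded_def by (intro allI, rule_tac x = "f T" in exI) (auto simp: nondecr_def)

lemma nondecr_set_integrable:
  assumes f: "nondecr f" shows "set_integrable lborel {0..T} f"
proof (cases "0 \<le> T")
  case True
  have i: "integrable lborel (\<lambda>t. indicator {0..T} t * f T)"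
    using True by (intro integrable_mult_left integrable_real_indicator) auto
  have eq: "indicator {0..T} t *\<^sub>R f t = indicator {0..T} t * (indicator {0..} t * f t)" for t
    by (auto simp: indicator_def)
  show ?thesis
    unfolding set_integrable_def
  proof (rule Bochner_Integration.integrable_bound[OF i])
    show "(\<lambda>t. indicator {0..T} t *\<^sub>R f t) \<in> borel_measurable lborel"
      unfolding eq using nondecr_measurable[OF f] by measurable
    show "AE t in lborel. norm (indicator {0..T} t *\<^sub>R f t) \<le> norm (indicator {0..T} t * f T)"
    proof (rule AE_I2)
      fix t show "norm (indicator {0..T} t *\<^sub>R f t) \<le> norm (indicator {0..T} t * f T)"
        using nondecrD[OF f, of t] nondecrD(2)[OF f, of t T] nondecrD(1)[OF f, of T] True
        by (cases "t \<in> {0..T}") auto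
    qed
  qed
qed (simp add: set_integrable_def)

lemma nondecr_conv_heaviside:
  assumes f: "nondecr f" shows "conv heaviside (ext f) = ext (\<lambda>u. LINT s:{0..u}|lborel. f s)"
proof
  fix u
  have "conv heaviside (ext f) u = ennreal (LINT s:{0..u}|lborel. f s)"
    by (rule conv_heaviside_ext[OF nondecr_set_integrable[OF f]]) (rule nondecrD(1)[OF f])
  then show "conv heaviside (ext f) u = ext (\<lambda>u. LINT s:{0..u}|lborel. f s) u"
    by (cases "0 \<le> u") (simp_all add: ext_def set_lebesgue_integral_def)
qed

lemma nondecr_of_conv_heaviside:
  assumes e: "causal e" and f: "\<And>t. 0 \<le> t \<Longrightarrow> 0 \<le> f t" "\<And>t. 0 \<le> t \<Longrightarrow> ennreal (f t) = conv heaviside e t"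
  shows "nondecr f"
  unfolding nondecr_def
proof (intro allI impI conjI)
  fix s t :: real assume st: "0 \<le> s" "s \<le> t"
  then show "0 \<le> f s" using f by auto
  have "ennreal (f s) \<le> ennreal (f t)"
    using st by (simp add: f(2) conv_heaviside_mono[OF e])
  then show "f s \<le> f t" using f(1)[of t] st by (simp add: ennreal_le_iff)
qed

lemma nondecr_integral:
  assumes f: "nondecr f" shows "nondecr (\<lambda>u. LINT s:{0..u}|lborel. f s)"
proof (rule nondecr_of_conv_heaviside[of "ext f"])
  fix t :: real assume t: "0 \<le> t"
  show "0 \<le> (LINT s:{0..t}|lborel. f s)"
    unfolding set_lebesgue_integral_def using nondecrD(1)[OF f] by (intro integral_nonneg_AE) (auto simp: indicator_def)
  show "ennreal (LINT s:{0..t}|lborel. f s) = conv heaviside (ext f) t"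
    by (rule conv_heaviside_ext[symmetric, OF nondecr_set_integrable[OF f]]) (rule nondecrD(1)[OF f])
qed simp

lemma conv_nondecr:
  assumes f: "nondecr f" and g: "nondecr g"
  shows "set_integrable lborel {0..T} (\<lambda>s. f (T - s) * g s)"
    and "conv (ext f) (ext g) T = ennreal (LINT s:{0..T}|lborel. f (T - s) * g s)"
    and "0 \<le> (LINT s:{0..T}|lborel. f (T - s) * g s)"
proof -
  have nn: "\<And>t. 0 \<le> t \<Longrightarrow> 0 \<le> f t" "\<And>t. 0 \<le> t \<Longrightarrow> 0 \<le> g t"
    using nondecrD(1) f g by blast+
  show "set_integrable lborel {0..T} (\<lambda>s. f (T - s) * g s)"
    by (rule conv_ext_bounded(1)[OF nondecr_ext_measurable[OF f] nondecr_ext_measurable[OF g] nondecr_measurable[OF f] nondecr_measurable[OF g] nn nondecr_loc_bounded[OF f] nondecr_loc_bounded[OF g]])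
  show "conv (ext f) (ext g) T = ennreal (LINT s:{0..T}|lborel. f (T - s) * g s)"
    by (rule conv_ext_bounded(2)[OF nondecr_ext_measurable[OF f] nondecr_ext_measurable[OF g] nondecr_measurable[OF f] nondecr_measurable[OF g] nn nondecr_loc_bounded[OF f] nondecr_loc_bounded[OF g]])
  show "0 \<le> (LINT s:{0..T}|lborel. f (T - s) * g s)"
    unfolding set_lebesgue_integral_def using nn by (intro integral_nonneg_AE) (auto simp: indicator_def)
qed

lemma conv_heaviside_heaviside: "conv heaviside heaviside = ext (\<lambda>u. u)"
proof
  fix u
  have "conv heaviside heaviside u = (\<integral>\<^sup>+s. indicator {0..u} s \<partial>lborel)"
    unfolding conv_heaviside[OF causal_heaviside]
    by (rule nn_integral_cong) (auto simp: heaviside_def indicator_def)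
  then show "conv heaviside heaviside u = ext (\<lambda>u. u) u" by (cases "0 \<le> u") (simp_all add: ext_def)
qed

section \<open>The rescaled path identity\<close>

lemma primitive_rescale:
  fixes f :: "real \<Rightarrow> real^'d"
  assumes n: "1 \<le> n"
  shows "primitive (rescale_intensity n \<theta> f) t = (1 / (real n * \<theta>)) *\<^sub>R primitive f (real n * t)"
proof -
  have "primitive f (real n * t) = real n *\<^sub>R (LINT s|lborel. indicator {0..real n * t} (real n * s) *\<^sub>R f (real n * s))"
    unfolding primitive_def set_lebesgue_integral_def
    using lborel_integral_real_affine[of "real n" "\<lambda>s. indicator {0..real n * t} s *\<^sub>R f s" 0] n by simp
  also have "(\<lambda>s. indicator {0..real n * t} (real n * s) *\<^sub>R f (real n * s)) = (\<lambda>s. indicator {0..t} s *\<^sub>R f (real n * s))"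
    using n by (auto simp: indicator_def zero_le_mult_iff)
  finally have p: "primitive f (real n * t) = real n *\<^sub>R (LINT s|lborel. indicator {0..t} s *\<^sub>R f (real n * s))" .
  have "primitive (rescale_intensity n \<theta> f) t = (LINT s|lborel. (1 / \<theta>) *\<^sub>R (indicator {0..t} s *\<^sub>R f (real n * s)))"
    unfolding primitive_def set_lebesgue_integral_def rescale_intensity_def
    by (simp add: mult.commute)
  also have "\<dots> = (1 / \<theta>) *\<^sub>R (LINT s|lborel. indicator {0..t} s *\<^sub>R f (real n * s))"
    by (rule integral_scaleR_right)
  finally show ?thesis unfolding p using n by simp
qed

lemma integral_vec_nonneg:
  fixes f :: "'a \<Rightarrow> real^'n"
  assumes "\<And>x. 0 \<le> f x" shows "0 \<le> integral\<^sup>L M f"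
proof (cases "integrable M f")
  case True
  then show ?thesis using assms by (auto simp: less_eq_vec_def integral_vec_nth intro!: integral_nonneg_AE)
qed (simp add: not_integrable_integral_eq)

lemma measurable_vec_nth:
  fixes f :: "'a \<Rightarrow> ('b::euclidean_space)^'n"
  assumes "f \<in> borel_measurable M" shows "(\<lambda>x. f x $ i) \<in> borel_measurable M"
  by (rule measurable_compose[OF assms borel_measurable_continuous_onI[OF linear_continuous_on[OF bounded_linear_vec_nth]]])

lemma measurable_vecI:
  fixes f :: "'a \<Rightarrow> ('b::euclidean_space)^'n"
  assumes "\<And>i. (\<lambda>x. f x $ i) \<in> borel_measurable M" shows "f \<in> borel_measurable M"
proof -
  have "(\<lambda>x. axis i (f x $ i) :: 'b^'n) \<in> borel_measurable M" for i
    by (rule measurable_compose[OF assms borel_measurable_continuous_onI[OF linear_continuous_on[OF bounded_linear_axis]]])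
  then have "(\<lambda>x. \<Sum>i\<in>UNIV. axis i (f x $ i)) \<in> borel_measurable M" by measurable
  then show ?thesis by (simp flip: vec_eq_sum_axis)
qed

lemma measurable_matrix_vector_mult:
  fixes f :: "'a \<Rightarrow> real^'n^'m"
  assumes f: "f \<in> borel_measurable M" and g: "g \<in> borel_measurable M"
  shows "(\<lambda>x. f x *v g x) \<in> borel_measurable M"
  by (rule measurable_vecI)
     (simp add: matrix_vector_mult_def, intro borel_measurable_sum borel_measurable_times measurable_vec_nth f g)

text \<open>
  The substitution \<open>s = n t\<close> in all convolutions. The convolution in the forcing term may diverge on a null
  set, so the primitive is identified through an almost-everywhere version of its components.
\<close>

lemma primitive_rescaled_H:
  fixes \<mu> :: "real \<Rightarrow> real^'d" and R :: "real \<Rightarrow> real^'d^'d"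
  assumes \<mu>: "loc_integrable_fun \<mu>" "\<And>t. 0 \<le> t \<Longrightarrow> 0 \<le> \<mu> t"
    and R: "loc_integrable_fun R" "\<And>t. 0 \<le> t \<Longrightarrow> 0 \<le> R t" and n: "1 \<le> n" and \<theta>: "0 < \<theta>"
  shows "loc_integrable_fun (rescaled_H n \<theta> \<mu> R)" "\<And>t. 0 \<le> t \<Longrightarrow> 0 \<le> rescaled_H n \<theta> \<mu> R t"
    and "ennreal (primitive (rescaled_H n \<theta> \<mu> R) t $ i)
      = ennreal (1 / (real n * \<theta>)) * (conv heaviside (component \<mu> i) (real n * t)
          + (\<Sum>k\<in>UNIV. conv (entry R i k) (conv heaviside (component \<mu> k)) (real n * t)))"
proof -
  let ?H = "rescaled_H n \<theta> \<mu> R"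
  define a where "a = rescale_density n \<theta> \<mu>"
  define b where "b = rescale_density n \<theta> R"
  define q where "q = sqrt (real n / \<theta>)"
  define c where "c = sqrt (real n * \<theta>)"
  have q: "0 < q" and c: "0 < c" using n \<theta> by (auto simp: q_def c_def)
  have qc: "q / c = 1 / \<theta>" "q * q = real n / \<theta>"
    using n \<theta> by (simp_all add: q_def c_def real_sqrt_divide real_sqrt_mult field_simps)
  have al: "loc_integrable_fun a" and bl: "loc_integrable_fun b"
    unfolding a_def b_def by (intro loc_integrable_rescale_density \<mu> R n)+
  have ann: "0 \<le> a t" and bnn: "0 \<le> b t" if "0 \<le> t" for t
    using \<mu>(2)[of "real n * t"] R(2)[of "real n * t"] that n \<theta>
    by (auto simp: a_def b_def rescale_density_def less_eq_vec_def)
  have ann': "0 \<le> a t $ k" and bnn': "0 \<le> b t $ k $ j" if "0 \<le> t" for t k j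
    using ann[OF that] bnn[OF that] by (auto simp: less_eq_vec_def)
  have [measurable]: "component a k \<in> borel_measurable borel" "entry b k j \<in> borel_measurable borel"
    "component \<mu> k \<in> borel_measurable borel" "entry R k j \<in> borel_measurable borel" for k j
    by (intro component_measurable entry_measurable al bl \<mu> R)+
  have ca: "component a k = (\<lambda>t. ennreal q * component \<mu> k (real n * t))" for k
    using n \<mu>(2) q by (auto simp: fun_eq_iff component_def ext_def a_def rescale_density_def q_def indicator_def less_eq_vec_def zero_le_mult_iff intro: ennreal_mult'')
  have eb: "entry b k j = (\<lambda>t. ennreal q * entry R k j (real n * t))" for k j
    unfolding b_def q_def by (rule ext, rule entry_rescale_density[OF n]) (rule R(2))
  define A where "A t = indicator {0..} t *\<^sub>R a t" for t
  define B where "B t = indicator {0..} t *\<^sub>R b t" for t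
  have [measurable]: "A \<in> borel_measurable borel" "B \<in> borel_measurable borel"
    unfolding A_def B_def using al bl by (auto intro!: loc_measurable simp: loc_integrable_fun_def)
  have ABeq: "indicator {0..t} s *\<^sub>R (b (t - s) *v a s) = B (t - s) *v A s" for t s
    by (auto simp: A_def B_def indicator_def)
  have ABn: "0 \<le> B (t - s) *v A s" for t s
    using ann' bnn' by (auto simp: A_def B_def indicator_def less_eq_vec_def matrix_vector_mult_def intro!: sum_nonneg)
  have cmv: "conv_mat_vec b a t = (LINT s|lborel. B (t - s) *v A s)" for t
    unfolding conv_mat_vec_def set_lebesgue_integral_def ABeq ..
  have cm: "conv_mat_vec b a \<in> borel_measurable borel"
    unfolding cmv
    by (rule lborel.borel_measurable_lebesgue_integral) (simp add: split_def, intro measurable_matrix_vector_mult; measurable)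
  have cnn: "0 \<le> conv_mat_vec b a t" for t
    unfolding cmv by (rule integral_vec_nonneg[OF ABn])
  have H: "?H t $ k = (1 / c) * a t $ k + conv_mat_vec b a t $ k" for t k
    by (simp add: rescaled_H_def a_def b_def c_def)
  show Hnn: "0 \<le> ?H t" if "0 \<le> t" for t
    using ann'[OF that] cnn[of t] c by (auto simp: less_eq_vec_def H intro!: add_nonneg_nonneg)
  have ma: "(\<lambda>t. indicator {0..} t * a t $ k) \<in> borel_measurable borel"
    and mb: "(\<lambda>t. indicator {0..} t * b t $ k $ j) \<in> borel_measurable borel" for k j
    using loc_measurable[of "\<lambda>t. a t $ k"] loc_measurable[of "\<lambda>t. b t $ k $ j"] al bl
    by (simp_all add: loc_integrable_fun_def set_integrable_vec_nth)
  have Hm: "(\<lambda>t. indicator {0..} t * ?H t $ k) \<in> borel_measurable borel" for k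
  proof -
    have "indicator {0..} t * ?H t $ k = (1 / c) * (indicator {0..} t * a t $ k) + indicator {0..} t * conv_mat_vec b a t $ k" for t
      unfolding H by (simp add: algebra_simps)
    then show ?thesis using ma[of k] measurable_vec_nth[OF cm, of k] by simp
  qed
  define e where "e k t = ennreal (1 / c) * component a k t + (\<Sum>j\<in>UNIV. conv (entry b k j) (component a j) t)" for k t
  have em: "e k \<in> borel_measurable borel" for k unfolding e_def by measurable
  have afin: "conv heaviside (component a k) T < \<infinity>" for k T
    by (simp add: conv_heaviside_component[OF al ann])
  have bfin: "conv heaviside (entry b k j) T < \<infinity>" for k j T
    by (rule conv_heaviside_entry_finite[OF bl bnn])
  have bafin: "conv heaviside (conv (entry b k j) (component a j)) T < \<infinity>" for k j T
    by (rule conv_finite_AE(1)) (simp_all add: afin[simplified] bfin[simplified])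
  have ce: "conv heaviside (e k) T = ennreal (1 / c) * conv heaviside (component a k) T
      + (\<Sum>j\<in>UNIV. conv heaviside (conv (entry b k j) (component a j)) T)" for k T
    unfolding e_def by (simp add: conv_add_right conv_sum_right conv_cmult_right)
  have efin: "conv heaviside (e k) T < \<infinity>" for k T
    unfolding ce using afin bafin by (simp add: ennreal_mult_less_top)
  have "AE t in lborel. conv (entry b k j) (component a j) t < \<infinity>" for k j
    by (rule conv_finite_AE(2)) (simp_all add: afin[simplified] bfin[simplified])
  then have "AE t in lborel. \<forall>k j. conv (entry b k j) (component a j) t < \<infinity>" by (intro AE_all_finite_index)
  then have ae: "AE t in lborel. component ?H k t = e k t" for k
  proof eventually_elim
    case (elim t)
    show ?case
    proof (cases "0 \<le> t")
      case False
      have "causal (conv (entry b k j) (component a j))" for j by simp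
      then show ?thesis using False by (simp add: component_def ext_def e_def causal_def)
    next
      case True
      have fin: "conv (ext (\<lambda>t. b t $ k $ j)) (ext (\<lambda>t. a t $ j)) t < \<infinity>" for k j
        using elim by (simp add: entry_def component_def)
      have I: "set_integrable lborel {0..t} (\<lambda>s. b (t - s) $ k $ j * a s $ j)"
        and E: "ennreal (LINT s:{0..t}|lborel. b (t - s) $ k $ j * a s $ j) = conv (entry b k j) (component a j) t" for k j
        using conv_real_of_finite[OF mb ma bnn' ann' fin] by (simp_all add: entry_def component_def)
      have C: "(b (t - s) *v a s) $ k = (\<Sum>j\<in>UNIV. b (t - s) $ k $ j * a s $ j)" for s k
        by (simp add: matrix_vector_mult_def)
      have Ib: "set_integrable lborel {0..t} (\<lambda>s. (b (t - s) *v a s) $ k)" for k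
        unfolding C using I unfolding set_integrable_def scaleR_sum_right
        by (intro Bochner_Integration.integrable_sum) auto
      have Im: "set_integrable lborel {0..t} (\<lambda>s. b (t - s) *v a s)"
        by (intro set_integrable_vecI Ib)
      have "conv_mat_vec b a t $ k = (LINT s:{0..t}|lborel. (b (t - s) *v a s) $ k)"
        unfolding conv_mat_vec_def by (rule set_integral_vec_nth[OF Im])
      also have "\<dots> = (\<Sum>j\<in>UNIV. (LINT s:{0..t}|lborel. b (t - s) $ k $ j * a s $ j))"
        unfolding C set_lebesgue_integral_def scaleR_sum_right
        using I by (intro Bochner_Integration.integral_sum) (auto simp: set_integrable_def)
      finally have cv: "conv_mat_vec b a t $ k = (\<Sum>j\<in>UNIV. (LINT s:{0..t}|lborel. b (t - s) $ k $ j * a s $ j))" .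
      have nnI: "0 \<le> (LINT s:{0..t}|lborel. b (t - s) $ k $ j * a s $ j)" for j
        unfolding set_lebesgue_integral_def using ann' bnn' by (intro integral_nonneg_AE) (auto simp: indicator_def)
      have "ennreal (?H t $ k) = ennreal (1 / c) * ennreal (a t $ k) + (\<Sum>j\<in>UNIV. ennreal (LINT s:{0..t}|lborel. b (t - s) $ k $ j * a s $ j))"
        unfolding H cv using ann'[OF True, of k] c nnI by (simp add: ennreal_plus sum_nonneg flip: ennreal_mult)
      then show ?thesis unfolding E using True by (simp add: component_def ext_def e_def)
    qed
  qed
  show "loc_integrable_fun ?H" by (rule loc_integrable_of_component(1)[OF Hm Hnn em ae efin])
  have hs: "conv heaviside (component a k) = (\<lambda>t. ennreal (q / real n) * conv heaviside (component \<mu> k) (real n * t))" for k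
  proof
    fix t
    have hv: "(\<lambda>s. heaviside (real n * s)) = heaviside" using n by (auto simp: heaviside_def indicator_def fun_eq_iff zero_le_mult_iff)
    have "conv heaviside (component \<mu> k) (real n * t) = ennreal (real n) * conv heaviside (\<lambda>s. component \<mu> k (real n * s)) t"
      using conv_scale[of heaviside "component \<mu> k" "real n" t] n by (simp add: hv)
    moreover have "ennreal (q / real n) * ennreal (real n) = ennreal q"
      using n q by (simp flip: ennreal_mult)
    ultimately show "conv heaviside (component a k) t = ennreal (q / real n) * conv heaviside (component \<mu> k) (real n * t)"
      unfolding ca by (simp add: conv_cmult_right mult.assoc[symmetric])
  qed
  have hb: "conv (entry b i k) (conv heaviside (component a k)) t = ennreal (1 / (real n * \<theta>)) * conv (entry R i k) (conv heaviside (component \<mu> k)) (real n * t)" for k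
  proof -
    have h1: "conv (entry b i k) (conv heaviside (component a k)) t
        = ennreal q * (ennreal (q / real n) * conv (\<lambda>t. entry R i k (real n * t)) (\<lambda>t. conv heaviside (component \<mu> k) (real n * t)) t)"
      unfolding eb hs
      by (simp add: conv_cmult_left conv_cmult_right mult.left_commute)
    have "conv (entry R i k) (conv heaviside (component \<mu> k)) (real n * t)
        = ennreal (real n) * conv (\<lambda>t. entry R i k (real n * t)) (\<lambda>t. conv heaviside (component \<mu> k) (real n * t)) t"
      by (rule conv_scale) (use n in auto)
    then have h2: "ennreal (1 / (real n * \<theta>)) * conv (entry R i k) (conv heaviside (component \<mu> k)) (real n * t)
        = ennreal (1 / (real n * \<theta>)) * ennreal (real n) * conv (\<lambda>t. entry R i k (real n * t)) (\<lambda>t. conv heaviside (component \<mu> k) (real n * t)) t"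
      by (simp add: mult.assoc)
    have h3: "ennreal (1 / (real n * \<theta>)) * ennreal (real n) = ennreal q * ennreal (q / real n)"
    proof -
      have "1 / (real n * \<theta>) * real n = q * (q / real n)"
        using qc(2) n \<theta> by (simp add: field_simps)
      then show ?thesis using n q \<theta> by (simp flip: ennreal_mult)
    qed
    show ?thesis unfolding h1 h2 h3 by (simp only: mult.assoc)
  qed
  have "conv heaviside (conv (entry b i k) (component a k)) t = conv (entry b i k) (conv heaviside (component a k)) t" for k
    by (simp add: conv_assoc[symmetric] conv_commute[of heaviside "entry b i k"])
  moreover have "ennreal (1 / c) * conv heaviside (component a i) t = ennreal (1 / (real n * \<theta>)) * conv heaviside (component \<mu> i) (real n * t)"
  proof -
    have "1 / c * (q / real n) = (q / c) / real n" by simp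
    also have "\<dots> = 1 / (real n * \<theta>)" unfolding qc(1) by simp
    finally show ?thesis unfolding hs using c q n by (simp add: mult.assoc[symmetric] flip: ennreal_mult)
  qed
  ultimately show "ennreal (primitive ?H t $ i)
      = ennreal (1 / (real n * \<theta>)) * (conv heaviside (component \<mu> i) (real n * t)
          + (\<Sum>k\<in>UNIV. conv (entry R i k) (conv heaviside (component \<mu> k)) (real n * t)))"
    using loc_integrable_of_component(2)[OF Hm Hnn em ae efin, of i t] unfolding ce
    by (simp add: hb distrib_left sum_distrib_left)
qed

lemma nondecr_mult: "nondecr f \<Longrightarrow> 0 \<le> c \<Longrightarrow> nondecr (\<lambda>t. c * f t)"
  by (auto simp: nondecr_def intro: mult_left_mono)

lemma nondecr_scale:
  assumes f: "nondecr f" and n: "0 < n" shows "nondecr (\<lambda>t. f (n * t))"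
  unfolding nondecr_def
proof (intro allI impI conjI)
  fix s t :: real assume st: "0 \<le> s" "s \<le> t"
  then have "0 \<le> n * s" "n * s \<le> n * t" using n by auto
  then show "0 \<le> f (n * s)" "f (n * s) \<le> f (n * t)" using nondecrD[OF f] by auto
qed

lemma nondecr_primitive_component:
  assumes f: "loc_integrable_fun f" "\<And>t. 0 \<le> t \<Longrightarrow> 0 \<le> f t"
  shows "nondecr (\<lambda>t. primitive f t $ i)"
proof (rule nondecr_of_conv_heaviside[of "component f i"])
  fix t :: real assume "0 \<le> t"
  show "ennreal (primitive f t $ i) = conv heaviside (component f i) t"
    by (rule conv_heaviside_component[symmetric, OF f])
  have I: "set_integrable lborel {0..t} f" using f(1) by (auto simp: loc_integrable_fun_def)
  have "0 \<le> f s $ i" if "0 \<le> s" for s using f(2)[OF that] by (simp add: less_eq_vec_def)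
  moreover have eq: "primitive f t $ i = (LINT s:{0..t}|lborel. f s $ i)"
    unfolding primitive_def by (rule set_integral_vec_nth[OF I])
  ultimately show "0 \<le> primitive f t $ i"
    unfolding eq set_lebesgue_integral_def by (intro integral_nonneg_AE) (auto simp: indicator_def)
qed simp

definition double_integral :: "(real \<Rightarrow> ennreal) \<Rightarrow> real \<Rightarrow> real" where
  "double_integral f t = enn2real (conv (conv heaviside heaviside) f t)"

text \<open>
  Local integrability makes the double primitive finite, so that passing to real values loses nothing.
\<close>

lemma double_integral_entry:
  assumes f: "loc_integrable_fun f" "\<And>t. 0 \<le> t \<Longrightarrow> 0 \<le> f t"
  shows "nondecr (double_integral (entry f i j))"
    and "ext (double_integral (entry f i j)) = conv (conv heaviside heaviside) (entry f i j)"
proof -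
  have [measurable]: "entry f i j \<in> borel_measurable borel" by (rule entry_measurable[OF f(1)])
  let ?g = "conv heaviside (entry f i j)"
  have fin1: "conv heaviside (entry f i j) T < \<infinity>" for T
    by (rule conv_heaviside_entry_finite[OF f])
  have fin0: "conv heaviside heaviside T < \<infinity>" for T
    by (simp add: conv_heaviside_heaviside ext_def)
  have eq: "conv (conv heaviside heaviside) (entry f i j) = conv heaviside ?g"
    by (simp add: conv_assoc)
  have fin: "conv heaviside ?g T < \<infinity>" for T
    by (rule conv_finite_AE(1)) (simp_all add: fin0[simplified] fin1[simplified])
  have e: "ennreal (double_integral (entry f i j) t) = conv heaviside ?g t" for t
    unfolding double_integral_def eq using fin[of t] by (simp add: less_top)
  show "nondecr (double_integral (entry f i j))"
    by (rule nondecr_of_conv_heaviside[of ?g]) (simp_all add: e, simp add: double_integral_def)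
  show "ext (double_integral (entry f i j)) = conv (conv heaviside heaviside) (entry f i j)"
  proof
    fix t
    have c: "causal (conv heaviside ?g)" by simp
    show "ext (double_integral (entry f i j)) t = conv (conv heaviside heaviside) (entry f i j) t"
      unfolding eq using e[of t] c by (cases "0 \<le> t") (simp_all add: ext_def causal_def)
  qed
qed

text \<open>
  In rescaled variables \<open>m = c (\<nu> - \<xi>)\<close> with \<open>c = sqrt (n \<theta>)\<close> and \<open>\<nu>\<close> the rescaled counting path, so the path
  identity reads \<open>\<xi> + c (B * \<xi>) = Hp + c (B * \<nu>)\<close> with nonnegative terms, \<open>B\<close> being row \<open>i\<close> of the rescaled
  resolvent. It is convolved with three Heaviside functions, of which two are given to \<open>B\<close> and one to
  \<open>\<xi>\<close> and \<open>\<nu>\<close>; only then are the terms subtracted.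
\<close>

lemma rescaled_path_identity:
  fixes \<mu> :: "real \<Rightarrow> real^'d" and \<phi> R :: "real \<Rightarrow> real^'d^'d" and x :: "real \<Rightarrow> real^'d" and i :: 'd
  assumes par: "hawkes_parameters \<mu> \<phi>" and path: "counting_path x" and R: "is_resolvent \<phi> R"
    and n: "1 \<le> n" and \<theta>: "0 < \<theta>" and T: "0 \<le> T"
  defines "\<xi> \<equiv> primitive (rescale_intensity n \<theta> (hawkes_intensity \<mu> \<phi> x))"
    and "m \<equiv> rescale_compensated n \<theta> (compensated \<mu> \<phi> x)"
    and "Hp \<equiv> primitive (rescaled_H n \<theta> \<mu> R)"
    and "\<rho> \<equiv> \<lambda>k. double_integral (entry (rescale_density n \<theta> R) i k)"
  shows "(LINT u:{0..T}|lborel. (T - u) * (LINT s:{0..u}|lborel. \<xi> s $ i))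
    = (LINT u:{0..T}|lborel. (T - u) * (LINT s:{0..u}|lborel. Hp s $ i))
      + (\<Sum>k\<in>UNIV. (LINT u:{0..T}|lborel. \<rho> k (T - u) * (LINT s:{0..u}|lborel. m s $ k)))"
proof -
  let ?L = "hawkes_intensity \<mu> \<phi> x"
  define \<nu> where "\<nu> = rescale_counting n \<theta> x"
  define c where "c = sqrt (real n * \<theta>)"
  define w where "w = 1 / (real n * \<theta>)"
  define q where "q = sqrt (real n / \<theta>)"
  have c: "0 < c" and w: "0 < w" and q: "0 < q" using n \<theta> by (auto simp: c_def w_def q_def)
  have qcw: "q * (c * w) = w * real n" and cw: "c * w = 1 / c"
    using n \<theta> by (simp_all add: q_def c_def w_def real_sqrt_divide real_sqrt_mult field_simps)
  have \<mu>: "loc_integrable_fun \<mu>" "\<And>t. 0 \<le> t \<Longrightarrow> 0 \<le> \<mu> t"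
    using par by (auto simp: hawkes_parameters_def)
  have Rl: "loc_integrable_fun R" "\<And>t. 0 \<le> t \<Longrightarrow> 0 \<le> R t"
    using R by (auto simp: is_resolvent_def)
  define B where "B k = entry (rescale_density n \<theta> R) i k" for k
  have Bl: "loc_integrable_fun (rescale_density n \<theta> R)" by (rule loc_integrable_rescale_density[OF Rl(1) n])
  have Bn: "0 \<le> rescale_density n \<theta> R t" if "0 \<le> t" for t
    using Rl(2)[of "real n * t"] that n \<theta> by (auto simp: rescale_density_def less_eq_vec_def)
  have Bm [measurable]: "B k \<in> borel_measurable borel" and Rm [measurable]: "entry R k j \<in> borel_measurable borel" for k j
    unfolding B_def by (intro entry_measurable Bl Rl)+
  have Be: "B k = (\<lambda>t. ennreal q * entry R i k (real n * t))" for k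
    unfolding B_def q_def by (rule ext, rule entry_rescale_density[OF n]) (rule Rl(2))
  have L: "loc_integrable_fun ?L" "\<And>t. 0 \<le> t \<Longrightarrow> 0 \<le> ?L t"
    using hawkes_intensity_loc_integrable[OF par path] hawkes_intensity_nonneg[OF par path] by auto
  have Ynd: "nondecr (\<lambda>t. primitive ?L t $ k)" for k
    by (rule nondecr_primitive_component[OF L])
  have xi: "\<xi> t $ k = w * primitive ?L (real n * t) $ k" for t k
    unfolding \<xi>_def primitive_rescale[OF n] w_def by simp
  have xind: "nondecr (\<lambda>t. \<xi> t $ k)" for k
    unfolding xi by (intro nondecr_mult nondecr_scale Ynd) (use n w in auto)
  have xnd: "nondecr (\<lambda>t. x t $ k)" for k
  proof -
    have "mono x" "x \<in> cadlag_space UNIV" using path by (auto simp: counting_path_def)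
    then have "x s \<le> x t" "x (-1) = 0" if "s \<le> t" for s t
      using that by (auto simp: cadlag_space_def dest: monoD)
    then have m: "x s $ k \<le> x t $ k" "x (-1) = 0" if "s \<le> t" for s t
      using that by (auto simp: less_eq_vec_def)
    have "0 \<le> x s $ k" if "0 \<le> s" for s
      using m(1)[of "-1" s] m(2)[of 0 0] that by simp
    with m show ?thesis by (simp add: nondecr_def)
  qed
  have nu: "\<nu> t $ k = w * x (real n * t) $ k" for t k
    by (simp add: \<nu>_def rescale_counting_def w_def)
  have nund: "nondecr (\<lambda>t. \<nu> t $ k)" for k
    unfolding nu by (intro nondecr_mult nondecr_scale xnd) (use n w in auto)
  note H = primitive_rescaled_H[OF \<mu> Rl n \<theta>]
  have Hnd: "nondecr (\<lambda>t. Hp t $ k)" for k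
    unfolding Hp_def by (rule nondecr_primitive_component[OF H(1,2)])
  have \<rho>nd: "nondecr (\<rho> k)" and \<rho>e: "ext (\<rho> k) = conv (conv heaviside heaviside) (B k)" for k
    unfolding \<rho>_def B_def using double_integral_entry[OF Bl Bn] by auto
  have cm [measurable]: "component \<xi> k \<in> borel_measurable borel" "component \<nu> k \<in> borel_measurable borel" "component Hp k \<in> borel_measurable borel" for k
    unfolding component_def by (intro nondecr_ext_measurable xind nund Hnd)+
  have scal: "component f k t = ennreal w * component g k (real n * t)"
    if "\<And>t. f t $ k = w * g (real n * t) $ k" for f g :: "real \<Rightarrow> real^'d" and k t
    using n w that by (auto simp: component_def ext_def indicator_def zero_le_mult_iff ennreal_mult')
  have cxi: "component \<xi> k = (\<lambda>t. ennreal w * component (primitive ?L) k (real n * t))" for k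
    by (rule ext, rule scal, rule xi)
  have cnu: "component \<nu> k = (\<lambda>t. ennreal w * component x k (real n * t))" for k
    by (rule ext, rule scal, rule nu)
  have [measurable]: "component (primitive ?L) k \<in> borel_measurable borel" "component x k \<in> borel_measurable borel" for k
    unfolding component_def by (intro nondecr_ext_measurable Ynd xnd)+
  have convB: "ennreal c * conv (B k) (\<lambda>t. ennreal w * g (real n * t)) t = ennreal w * conv (entry R i k) g (real n * t)"
    if [measurable]: "g \<in> borel_measurable borel" for g k t
  proof -
    have "ennreal c * conv (B k) (\<lambda>t. ennreal w * g (real n * t)) t
        = ennreal c * (ennreal q * (ennreal w * conv (\<lambda>t. entry R i k (real n * t)) (\<lambda>t. g (real n * t)) t))"
      unfolding Be by (simp add: conv_cmult_left conv_cmult_right mult.left_commute)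
    also have "\<dots> = ennreal (q * (c * w)) * conv (\<lambda>t. entry R i k (real n * t)) (\<lambda>t. g (real n * t)) t"
      using q c w by (simp add: ennreal_mult mult_ac)
    also have "\<dots> = ennreal w * (ennreal (real n) * conv (\<lambda>t. entry R i k (real n * t)) (\<lambda>t. g (real n * t)) t)"
      unfolding qcw using w by (simp add: ennreal_mult mult_ac)
    also have "ennreal (real n) * conv (\<lambda>t. entry R i k (real n * t)) (\<lambda>t. g (real n * t)) t = conv (entry R i k) g (real n * t)"
      by (rule conv_scale[symmetric]) (use n in auto)
    finally show ?thesis .
  qed
  have base: "component \<xi> i t + (\<Sum>k\<in>UNIV. ennreal c * conv (B k) (component \<xi> k) t)
      = component Hp i t + (\<Sum>k\<in>UNIV. ennreal c * conv (B k) (component \<nu> k) t)" for t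
  proof (cases "0 \<le> t")
    case False
    have "causal (conv (B k) (component \<xi> k))" "causal (conv (B k) (component \<nu> k))" for k by (simp_all add: B_def)
    then show ?thesis using False by (simp add: component_def ext_def causal_def)
  next
    case True
    have "component Hp i t = ennreal w * (conv heaviside (component \<mu> i) (real n * t)
          + (\<Sum>k\<in>UNIV. conv (entry R i k) (conv heaviside (component \<mu> k)) (real n * t)))"
      using H(3)[of t i] True by (simp add: component_def ext_def Hp_def w_def)
    moreover have "(\<Sum>k\<in>UNIV. ennreal c * conv (B k) (component \<xi> k) t) = ennreal w * (\<Sum>k\<in>UNIV. conv (entry R i k) (component (primitive ?L) k) (real n * t))"
      "(\<Sum>k\<in>UNIV. ennreal c * conv (B k) (component \<nu> k) t) = ennreal w * (\<Sum>k\<in>UNIV. conv (entry R i k) (component x k) (real n * t))"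
      unfolding cxi cnu by (simp_all add: convB sum_distrib_left)
    moreover have "component \<xi> i t = ennreal w * component (primitive ?L) i (real n * t)" by (simp add: cxi)
    moreover have "ennreal w * (component (primitive ?L) i (real n * t) + (\<Sum>k\<in>UNIV. conv (entry R i k) (component (primitive ?L) k) (real n * t)))
       = ennreal w * ((conv heaviside (component \<mu> i) (real n * t) + (\<Sum>k\<in>UNIV. conv (entry R i k) (conv heaviside (component \<mu> k)) (real n * t)))
        + (\<Sum>k\<in>UNIV. conv (entry R i k) (component x k) (real n * t)))"
      by (rule arg_cong[OF hawkes_volterra_path_identity[OF par path R]])
    ultimately show ?thesis by (simp only: distrib_left)
  qed
  \<comment> \<open>two of the three integrations go to \<open>B\<close>, the third to its convolution partner\<close>
  define hh where "hh = conv heaviside heaviside"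
  have [measurable]: "hh \<in> borel_measurable borel" by (simp add: hh_def)
  have hhe: "hh = ext (\<lambda>u. u)" unfolding hh_def by (rule conv_heaviside_heaviside)
  have idnd: "nondecr (\<lambda>u. u)" by (simp add: nondecr_def)
  have triple: "conv (conv hh heaviside) (conv (B k) g) t = conv (ext (\<rho> k)) (conv heaviside g) t"
    if [measurable]: "g \<in> borel_measurable borel" for k g t
  proof -
    have "conv (conv hh heaviside) (conv (B k) g) = conv hh (conv (conv heaviside (B k)) g)" by (simp add: conv_assoc)
    also have "conv heaviside (B k) = conv (B k) heaviside" by (simp add: conv_commute)
    also have "conv hh (conv (conv (B k) heaviside) g) = conv (conv hh (B k)) (conv heaviside g)" by (simp add: conv_assoc)
    finally show ?thesis by (simp add: \<rho>e hh_def)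
  qed
  have J: "conv heaviside (component f k) = ext (\<lambda>u. LINT s:{0..u}|lborel. f s $ k)" if "nondecr (\<lambda>t. f t $ k)" for f :: "real \<Rightarrow> real^'d" and k
    unfolding component_def by (rule nondecr_conv_heaviside[OF that])
  have "conv (conv hh heaviside) (\<lambda>t. component \<xi> i t + (\<Sum>k\<in>UNIV. ennreal c * conv (B k) (component \<xi> k) t)) T
      = conv (conv hh heaviside) (\<lambda>t. component Hp i t + (\<Sum>k\<in>UNIV. ennreal c * conv (B k) (component \<nu> k) t)) T"
    by (simp only: base)
  then have "conv (conv hh heaviside) (component \<xi> i) T + (\<Sum>k\<in>UNIV. ennreal c * conv (ext (\<rho> k)) (conv heaviside (component \<xi> k)) T)
      = conv (conv hh heaviside) (component Hp i) T + (\<Sum>k\<in>UNIV. ennreal c * conv (ext (\<rho> k)) (conv heaviside (component \<nu> k)) T)"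
    by (simp add: conv_add_right conv_sum_right conv_cmult_right triple)
  then have E: "conv hh (conv heaviside (component \<xi> i)) T + (\<Sum>k\<in>UNIV. ennreal c * conv (ext (\<rho> k)) (conv heaviside (component \<xi> k)) T)
      = conv hh (conv heaviside (component Hp i)) T + (\<Sum>k\<in>UNIV. ennreal c * conv (ext (\<rho> k)) (conv heaviside (component \<nu> k)) T)"
    by (simp add: conv_assoc[of hh])
  define X1 where "X1 = (LINT u:{0..T}|lborel. (T - u) * (LINT s:{0..u}|lborel. \<xi> s $ i))"
  define X2 where "X2 = (LINT u:{0..T}|lborel. (T - u) * (LINT s:{0..u}|lborel. Hp s $ i))"
  define A where "A k = (LINT u:{0..T}|lborel. \<rho> k (T - u) * (LINT s:{0..u}|lborel. \<xi> s $ k))" for k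
  define C where "C k = (LINT u:{0..T}|lborel. \<rho> k (T - u) * (LINT s:{0..u}|lborel. \<nu> s $ k))" for k
  note ndI = nondecr_integral[OF xind] nondecr_integral[OF nund] nondecr_integral[OF Hnd]
  have E1: "conv hh (conv heaviside (component \<xi> i)) T = ennreal X1" "0 \<le> X1"
    unfolding hhe J[of \<xi>, OF xind] X1_def by (rule conv_nondecr(2,3)[OF idnd ndI(1)])+
  have E2: "conv hh (conv heaviside (component Hp i)) T = ennreal X2" "0 \<le> X2"
    unfolding hhe J[of Hp, OF Hnd] X2_def by (rule conv_nondecr(2,3)[OF idnd ndI(3)])+
  have EA: "conv (ext (\<rho> k)) (conv heaviside (component \<xi> k)) T = ennreal (A k)" "0 \<le> A k" for k
    unfolding J[of \<xi>, OF xind] A_def by (rule conv_nondecr(2,3)[OF \<rho>nd ndI(1)])+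
  have EC: "conv (ext (\<rho> k)) (conv heaviside (component \<nu> k)) T = ennreal (C k)" "0 \<le> C k" for k
    unfolding J[of \<nu>, OF nund] C_def by (rule conv_nondecr(2,3)[OF \<rho>nd ndI(2)])+
  have sums: "(\<Sum>k\<in>UNIV. ennreal c * ennreal (f k)) = ennreal (\<Sum>k\<in>UNIV. c * f k)" if "\<And>k. 0 \<le> f k" for f :: "'d \<Rightarrow> real"
    using that c by (simp add: ennreal_mult[symmetric])
  have "ennreal (X1 + (\<Sum>k\<in>UNIV. c * A k)) = ennreal (X2 + (\<Sum>k\<in>UNIV. c * C k))"
    using E unfolding E1(1) E2(1) EA(1) EC(1) sums[of A, OF EA(2)] sums[of C, OF EC(2)]
    using E1(2) E2(2) EA(2) EC(2) c by (simp add: ennreal_plus sum_nonneg)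
  then have real: "X1 + (\<Sum>k\<in>UNIV. c * A k) = X2 + (\<Sum>k\<in>UNIV. c * C k)"
    using E1(2) E2(2) EA(2) EC(2) c by (subst (asm) ennreal_inj) (auto intro!: add_nonneg_nonneg sum_nonneg)
  have mk: "m s $ k = c * (\<nu> s $ k - \<xi> s $ k)" for s k
  proof -
    have "m s $ k = (1 / c) * (x (real n * s) $ k - primitive ?L (real n * s) $ k)"
      by (simp add: m_def rescale_compensated_def compensated_def c_def)
    also have "\<dots> = c * (\<nu> s $ k - \<xi> s $ k)"
      unfolding nu xi cw[symmetric] by (simp add: algebra_simps)
    finally show ?thesis .
  qed
  have Im: "(LINT s:{0..u}|lborel. m s $ k) = c * ((LINT s:{0..u}|lborel. \<nu> s $ k) - (LINT s:{0..u}|lborel. \<xi> s $ k))" for u k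
    unfolding mk by (simp add: set_integral_diff(2) nondecr_set_integrable[OF nund] nondecr_set_integrable[OF xind])
  have "(LINT u:{0..T}|lborel. \<rho> k (T - u) * (LINT s:{0..u}|lborel. m s $ k)) = c * C k - c * A k" for k
  proof -
    have "(LINT u:{0..T}|lborel. \<rho> k (T - u) * (LINT s:{0..u}|lborel. m s $ k))
        = (LINT u:{0..T}|lborel. c * (\<rho> k (T - u) * (LINT s:{0..u}|lborel. \<nu> s $ k) - \<rho> k (T - u) * (LINT s:{0..u}|lborel. \<xi> s $ k)))"
      unfolding Im by (simp add: algebra_simps)
    also have "\<dots> = c * (LINT u:{0..T}|lborel. (\<rho> k (T - u) * (LINT s:{0..u}|lborel. \<nu> s $ k) - \<rho> k (T - u) * (LINT s:{0..u}|lborel. \<xi> s $ k)))"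
      by simp
    also have "(LINT u:{0..T}|lborel. (\<rho> k (T - u) * (LINT s:{0..u}|lborel. \<nu> s $ k) - \<rho> k (T - u) * (LINT s:{0..u}|lborel. \<xi> s $ k))) = C k - A k"
      unfolding C_def A_def
      by (rule set_integral_diff(2)[OF conv_nondecr(1)[OF \<rho>nd ndI(2)] conv_nondecr(1)[OF \<rho>nd ndI(1)]])
    finally show ?thesis by (simp add: right_diff_distrib)
  qed
  then show ?thesis
    using real unfolding X1_def[symmetric] X2_def[symmetric] by (simp add: sum_subtractf)
qed

section \<open>Recovering functions from their integrals\<close>

lemma right_continuous_tendsto: "continuous (at_right t) f \<longleftrightarrow> (f \<longlongrightarrow> f t) (at_right t)"
  for f :: "real \<Rightarrow> 'a::t2_space"
  by (simp add: continuous_within)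

text \<open>
  The functions that are convolved with a measure and then recovered from integrals of the result.
\<close>

definition pos_path :: "(real \<Rightarrow> real) \<Rightarrow> bool" where
  "pos_path f \<longleftrightarrow> cadlag f \<and> (\<forall>t\<ge>0. 0 \<le> f t)"

lemma pos_path_props:
  assumes "pos_path f"
  shows "(\<lambda>t. indicator {0..} t * f t) \<in> borel_measurable borel" "loc_bounded f" "\<And>T. set_integrable lborel {0..T} f"
    "\<And>t. 0 \<le> t \<Longrightarrow> 0 \<le> f t" "\<And>t. continuous (at_right t) f" "ext f \<in> borel_measurable borel"
proof -
  have c: "cadlag f" using assms by (simp add: pos_path_def)
  have "f \<in> borel_measurable borel" by (rule cadlag_borel_measurable[OF c])
  then show m: "(\<lambda>t. indicator {0..} t * f t) \<in> borel_measurable borel" by measurable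
  show "ext f \<in> borel_measurable borel" unfolding ext_def using m by simp
  show "loc_bounded f" unfolding loc_bounded_def
  proof
    fix T
    obtain B where "\<And>t. 0 \<le> t \<Longrightarrow> t \<le> T \<Longrightarrow> norm (f t) \<le> B" using cadlag_bounded[OF c, of 0 T] by metis
    then show "\<exists>B. \<forall>t. 0 \<le> t \<and> t \<le> T \<longrightarrow> \<bar>f t\<bar> \<le> B" by auto
  qed
  show "set_integrable lborel {0..T} f" for T by (rule cadlag_set_integrable[OF c])
  show "0 \<le> f t" if "0 \<le> t" for t using assms that by (simp add: pos_path_def)
  show "continuous (at_right t) f" for t using c by (simp add: cadlag_def)
qed

lemma loc_bounded_set_integrable:
  assumes m: "(\<lambda>t. indicator {0..} t * f t) \<in> borel_measurable borel" and b: "loc_bounded f"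
  shows "set_integrable lborel {0..T} f"
proof -
  obtain B where B: "\<And>t. 0 \<le> t \<Longrightarrow> t \<le> T \<Longrightarrow> \<bar>f t\<bar> \<le> B" using b unfolding loc_bounded_def by meson
  have i: "integrable lborel (\<lambda>t. indicator {0..T} t * B)"
    by (cases "0 \<le> T") (auto intro!: integrable_mult_left)
  have eq: "indicator {0..T} t *\<^sub>R f t = indicator {0..T} t * (indicator {0..} t * f t)" for t
    by (auto simp: indicator_def)
  show ?thesis
    unfolding set_integrable_def
  proof (rule Bochner_Integration.integrable_bound[OF i])
    show "(\<lambda>t. indicator {0..T} t *\<^sub>R f t) \<in> borel_measurable lborel"
      unfolding eq using m by measurable
    show "AE t in lborel. norm (indicator {0..T} t *\<^sub>R f t) \<le> norm (indicator {0..T} t * B)"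
    proof (rule AE_I2)
      fix t show "norm (indicator {0..T} t *\<^sub>R f t) \<le> norm (indicator {0..T} t * B)"
        using B[of t] by (cases "t \<in> {0..T}") auto
    qed
  qed
qed

lemma integral_nondecr:
  assumes f: "\<And>T. set_integrable lborel {0..T} f" "\<And>t. 0 \<le> t \<Longrightarrow> 0 \<le> f t"
  shows "nondecr (\<lambda>u. LINT s:{0..u}|lborel. f s)" "conv heaviside (ext f) = ext (\<lambda>u. LINT s:{0..u}|lborel. f s)"
proof -
  have e: "conv heaviside (ext f) t = ennreal (LINT s:{0..t}|lborel. f s)" for t
    by (rule conv_heaviside_ext[OF f])
  show "nondecr (\<lambda>u. LINT s:{0..u}|lborel. f s)"
  proof (rule nondecr_of_conv_heaviside[of "ext f"])
    fix t :: real assume t: "0 \<le> t"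
    show "0 \<le> (LINT s:{0..t}|lborel. f s)"
      unfolding set_lebesgue_integral_def using f(2) by (intro integral_nonneg_AE) (auto simp: indicator_def)
  qed (simp_all add: e)
  show "conv heaviside (ext f) = ext (\<lambda>u. LINT s:{0..u}|lborel. f s)"
  proof
    fix u show "conv heaviside (ext f) u = ext (\<lambda>u. LINT s:{0..u}|lborel. f s) u"
      unfolding e by (cases "0 \<le> u") (simp_all add: ext_def set_lebesgue_integral_def)
  qed
qed

lemma integral_right_continuous:
  fixes f :: "real \<Rightarrow> real"
  assumes f: "\<And>T. set_integrable lborel {0..T} f" and t: "0 \<le> t"
  shows "continuous (at_right t) (\<lambda>u. LINT s:{0..u}|lborel. f s)"
proof -
  have "continuous_on {0..t + 1} (\<lambda>u. integral {0..u} f)"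
    by (rule indefinite_integral_continuous_1[OF set_borel_integral_eq_integral(1)[OF f]])
  then have "continuous (at t within {0..t + 1}) (\<lambda>u. integral {0..u} f)"
    using t by (auto simp: continuous_on_eq_continuous_within)
  then have "((\<lambda>u. integral {0..u} f) \<longlongrightarrow> integral {0..t} f) (at t within {t..t + 1})"
    unfolding continuous_within by (rule tendsto_within_subset) (use t in auto)
  moreover have "at t within {t..t + 1} = at_right t" by (rule at_within_Icc_at_right) simp
  ultimately show ?thesis
    by (simp add: right_continuous_tendsto set_borel_integral_eq_integral(2)[OF f])
qed

text \<open>
  Equality at rational end points extends to all end points by continuity of the integral; a
  right-continuous function is then the right derivative of its integral.
\<close>

lemma equal_integrals_imp_equal:
  fixes f g :: "real \<Rightarrow> real"
  assumes f: "\<And>T. set_integrable lborel {0..T} f" and g: "\<And>T. set_integrable lborel {0..T} g"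
    and rc: "\<And>t. 0 \<le> t \<Longrightarrow> continuous (at_right t) f" "\<And>t. 0 \<le> t \<Longrightarrow> continuous (at_right t) g"
    and eq: "\<And>T. T \<in> \<rat> \<Longrightarrow> 0 \<le> T \<Longrightarrow> (LINT s:{0..T}|lborel. f s) = (LINT s:{0..T}|lborel. g s)"
    and t: "0 \<le> t"
  shows "f t = g t"
proof (rule ccontr)
  assume ne: "f t \<noteq> g t"
  define d where "d s = (f s - g s) * sgn (f t - g t)" for s
  have dt: "0 < d t" using ne by (simp add: d_def mult_sgn_abs abs_sgn[symmetric])
  have "((\<lambda>s. (f s - g s) * sgn (f t - g t)) \<longlongrightarrow> d t) (at_right t)"
    unfolding d_def using rc[OF t] by (intro tendsto_mult tendsto_diff tendsto_const) (simp_all add: right_continuous_tendsto)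
  then have "\<forall>\<^sub>F s in at_right t. d t / 2 < d s"
    unfolding d_def[symmetric] by (rule order_tendstoD) (use dt in simp)
  then obtain b where b: "t < b" "\<And>s. t < s \<Longrightarrow> s < b \<Longrightarrow> d t / 2 < d s"
    by (auto simp: eventually_at_right_field)
  obtain p where p: "p \<in> \<rat>" "t < p" "p < b" using Rats_dense_in_real[OF b(1)] by blast
  obtain r where r: "r \<in> \<rat>" "p < r" "r < b" using Rats_dense_in_real[OF p(3)] by blast
  have dI: "set_integrable lborel {0..T} d" for T
    unfolding d_def using set_integral_diff(1)[OF f[of T] g[of T]] by (rule set_integrable_mult_left)
  have z: "(LINT s:{0..T}|lborel. d s) = 0" if "T \<in> \<rat>" "0 \<le> T" for T
    unfolding d_def using eq[OF that] set_integral_diff(2)[OF f[of T] g[of T]] by simp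
  have dI2: "set_integrable lborel {p<..r} d"
    by (rule set_integrable_subset[OF dI[of r]]) (use p t in auto)
  have dI3: "set_integrable lborel {0..p} d" by (rule dI)
  have "{0..r} = {0..p} \<union> {p<..r}" using p r t by auto
  then have "(LINT s:{0..r}|lborel. d s) = (LINT s:{0..p}|lborel. d s) + (LINT s:{p<..r}|lborel. d s)"
    using set_integral_Un[OF _ dI3 dI2] by (simp add: ivl_disj_int)
  then have I0: "(LINT s:{p<..r}|lborel. d s) = 0" using z[OF p(1)] z[OF r(1)] p r t by auto
  have "(LINT s:{p<..r}|lborel. d t / 2) \<le> (LINT s:{p<..r}|lborel. d s)"
  proof (rule set_integral_mono)
    show "set_integrable lborel {p<..r} (\<lambda>s. d t / 2)"
      unfolding set_integrable_def using r by (simp add: integrable_mult_left)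
    show "d t / 2 \<le> d s" if "s \<in> {p<..r}" for s using b(2)[of s] that p r by auto
  qed (rule dI2)
  moreover have "(LINT s:{p<..r}|lborel. d t / 2) = (r - p) * (d t / 2)"
    unfolding set_lebesgue_integral_def using r by simp
  ultimately show False using I0 dt r by (simp add: mult_le_0_iff)
qed

section \<open>Convolution with a measure\<close>

definition mconv :: "real measure \<Rightarrow> (real \<Rightarrow> ennreal) \<Rightarrow> real \<Rightarrow> ennreal" where
  "mconv P f t = (\<integral>\<^sup>+s. f (t - s) \<partial>P)"

context
  fixes P :: "real measure"
  assumes sets_P: "sets P = sets borel" and P_neg: "emeasure P {..<0} = 0" and P_fin: "\<And>t. emeasure P {0..t} < \<infinity>"
begin

lemma potential_sigma_finite: "sigma_finite_measure P"
proof
  have "(\<Union>n::nat. {0..real n}) \<union> {..<0} = (UNIV :: real set)"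
    by (auto simp: not_less real_arch_simple)
  then show "\<exists>A. countable A \<and> A \<subseteq> sets P \<and> \<Union>A = space P \<and> (\<forall>a\<in>A. emeasure P a \<noteq> \<infinity>)"
    using P_neg P_fin sets_eq_imp_space_eq[OF sets_P]
    by (intro exI[of _ "insert {..<0} (range (\<lambda>n::nat. {0..real n}))"]) (auto simp: sets_P less_top[symmetric])
qed

lemma P_AE_nonneg: "AE s in P. 0 \<le> s"
  by (rule AE_I[of _ _ "{..<0}"]) (auto simp: P_neg sets_P)

lemma mconv_measurable:
  assumes [measurable]: "f \<in> borel_measurable borel"
  shows "mconv P f \<in> borel_measurable borel"
proof -
  interpret sigma_finite_measure P by (rule potential_sigma_finite)
  note [measurable_cong] = sets_P
  show ?thesis unfolding mconv_def by (rule borel_measurable_nn_integral) measurable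
qed

lemma conv_mconv:
  assumes f: "f \<in> borel_measurable borel" and g: "g \<in> borel_measurable borel"
  shows "conv g (mconv P f) = mconv P (conv g f)"
proof
  fix t
  note [measurable] = f g
  interpret sigma_finite_measure P by (rule potential_sigma_finite)
  interpret PP: pair_sigma_finite lborel P ..
  note [measurable_cong] = sets_P
  have "conv g (mconv P f) t = (\<integral>\<^sup>+u. (\<integral>\<^sup>+s. g (t - u) * f (u - s) \<partial>P) \<partial>lborel)"
    unfolding conv_def mconv_def by (simp add: nn_integral_cmult)
  also have "\<dots> = (\<integral>\<^sup>+s. (\<integral>\<^sup>+u. g (t - u) * f (u - s) \<partial>lborel) \<partial>P)"
    by (rule PP.Fubini'[symmetric]) measurable
  also have "\<dots> = (\<integral>\<^sup>+s. conv g f (t - s) \<partial>P)"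
  proof (rule nn_integral_cong)
    fix s
    have "(\<integral>\<^sup>+u. g (t - (s + u)) * f ((s + u) - s) \<partial>lborel) = (\<integral>\<^sup>+u. g (t - u) * f (u - s) \<partial>lborel)"
      by (rule nn_integral_lborel_shift) measurable
    then show "(\<integral>\<^sup>+u. g (t - u) * f (u - s) \<partial>lborel) = conv g f (t - s)"
      by (simp add: conv_def algebra_simps)
  qed
  finally show "conv g (mconv P f) t = mconv P (conv g f) t" by (simp add: mconv_def)
qed

lemma mconv_pos_path:
  assumes m: "(\<lambda>t. indicator {0..} t * f t) \<in> borel_measurable borel" and b: "loc_bounded f" and nn: "\<And>t. 0 \<le> t \<Longrightarrow> 0 \<le> f t"
  shows "set_integrable P {0..t} (\<lambda>s. f (t - s))"
    and "mconv P (ext f) t = ennreal (LINT s:{0..t}|P. f (t - s))"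
    and "0 \<le> (LINT s:{0..t}|P. f (t - s))"
proof -
  note [measurable_cong] = sets_P
  obtain B where B: "\<And>s. 0 \<le> s \<Longrightarrow> s \<le> t \<Longrightarrow> \<bar>f s\<bar> \<le> B" using b unfolding loc_bounded_def by meson
  have i: "integrable P (\<lambda>s. indicator {0..t} s * B)"
    using P_fin[of t] by (intro integrable_mult_left integrable_real_indicator) (auto simp: sets_P)
  have eq: "indicator {0..t} s *\<^sub>R f (t - s) = indicator {0..t} s * (indicator {0..} (t - s) * f (t - s))" for s
    by (auto simp: indicator_def)
  show I: "set_integrable P {0..t} (\<lambda>s. f (t - s))"
    unfolding set_integrable_def
  proof (rule Bochner_Integration.integrable_bound[OF i])
    show "(\<lambda>s. indicator {0..t} s *\<^sub>R f (t - s)) \<in> borel_measurable P"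
      unfolding eq using m by measurable
    show "AE s in P. norm (indicator {0..t} s *\<^sub>R f (t - s)) \<le> norm (indicator {0..t} s * B)"
    proof (rule AE_I2)
      fix s show "norm (indicator {0..t} s *\<^sub>R f (t - s)) \<le> norm (indicator {0..t} s * B)"
        using B[of "t - s"] by (cases "s \<in> {0..t}") auto
    qed
  qed
  show "0 \<le> (LINT s:{0..t}|P. f (t - s))"
    unfolding set_lebesgue_integral_def using nn by (intro integral_nonneg_AE) (auto simp: indicator_def)
  have "mconv P (ext f) t = (\<integral>\<^sup>+s. ennreal (indicator {0..t} s *\<^sub>R f (t - s)) \<partial>P)"
    unfolding mconv_def
    by (rule nn_integral_cong_AE, use P_AE_nonneg in eventually_elim) (auto simp: ext_def indicator_def)
  also have "\<dots> = ennreal (LINT s:{0..t}|P. f (t - s))"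
    unfolding set_lebesgue_integral_def
    using I by (intro nn_integral_eq_integral) (auto simp: set_integrable_def indicator_def nn)
  finally show "mconv P (ext f) t = ennreal (LINT s:{0..t}|P. f (t - s))" .
qed

lemma mconv_loc_bounded:
  assumes m: "(\<lambda>t. indicator {0..} t * f t) \<in> borel_measurable borel" and b: "loc_bounded f" and nn: "\<And>t. 0 \<le> t \<Longrightarrow> 0 \<le> f t"
  shows "loc_bounded (\<lambda>t. LINT s:{0..t}|P. f (t - s))"
  unfolding loc_bounded_def
proof
  fix T
  obtain B where B: "\<And>s. 0 \<le> s \<Longrightarrow> s \<le> T \<Longrightarrow> \<bar>f s\<bar> \<le> B" using b unfolding loc_bounded_def by meson
  have "\<bar>LINT s:{0..t}|P. f (t - s)\<bar> \<le> \<bar>B\<bar> * measure P {0..T}" if t: "0 \<le> t" "t \<le> T" for t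
  proof -
    note P' = mconv_pos_path[OF m b nn, of t]
    have "(LINT s:{0..t}|P. f (t - s)) \<le> (LINT s|P. indicator {0..T} s * \<bar>B\<bar>)"
      unfolding set_lebesgue_integral_def
    proof (rule integral_mono)
      show "integrable P (\<lambda>s. indicator {0..t} s *\<^sub>R f (t - s))" using P'(1) by (simp add: set_integrable_def)
      show "integrable P (\<lambda>s. indicator {0..T} s * \<bar>B\<bar>)"
        using P_fin[of T] by (intro integrable_mult_left integrable_real_indicator) (auto simp: sets_P)
      show "indicator {0..t} s *\<^sub>R f (t - s) \<le> indicator {0..T} s * \<bar>B\<bar>" for s
        using B[of "t - s"] t by (auto simp: indicator_def)
    qed
    also have "\<dots> = \<bar>B\<bar> * measure P {0..T}" using sets_P P_fin[of T] by simp
    finally show ?thesis using P'(3) by simp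
  qed
  then show "\<exists>B. \<forall>t. 0 \<le> t \<and> t \<le> T \<longrightarrow> \<bar>LINT s:{0..t}|P. f (t - s)\<bar> \<le> B" by blast
qed

text \<open>
  As \<open>f\<close> vanishes on the negative half-line, the range of integration near \<open>t\<close> can be enlarged to a fixed
  interval, on which \<open>t \<mapsto> f (t - s)\<close> is right-continuous for every \<open>s\<close>; then dominated convergence applies.
\<close>

lemma mconv_right_continuous:
  assumes f: "pos_path f" "\<And>t. t < 0 \<Longrightarrow> f t = 0"
  shows "continuous (at_right t) (\<lambda>t. LINT s:{0..t}|P. f (t - s))"
  unfolding right_continuous_tendsto
proof (rule tendsto_at_right_sequentially[where b = "t + 1"])
  show "t < t + 1" by simp
  fix S :: "nat \<Rightarrow> real" assume S: "\<And>n. t < S n" "\<And>n. S n < t + 1" "decseq S" "S \<longlonglongrightarrow> t"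
  note [measurable_cong] = sets_P
  have c: "cadlag f" using f(1) by (simp add: pos_path_def)
  have [measurable]: "f \<in> borel_measurable borel" by (rule cadlag_borel_measurable[OF c])
  obtain B where B: "\<And>s. 0 \<le> s \<Longrightarrow> s \<le> t + 1 \<Longrightarrow> norm (f s) \<le> B" "0 \<le> B" using cadlag_bounded[OF c, of 0 "t + 1"] by metis
  have eq: "AE s in P. indicator {0..u} s *\<^sub>R f (u - s) = f (u - s)" for u
    using P_AE_nonneg by eventually_elim (use f(2) in \<open>auto simp: indicator_def\<close>)
  have E: "(LINT s:{0..u}|P. f (u - s)) = (LINT s|P. f (u - s))" for u
    unfolding set_lebesgue_integral_def by (rule integral_cong_AE) (use eq in measurable)
  have "(\<lambda>n. LINT s|P. f (S n - s)) \<longlonglongrightarrow> (LINT s|P. f (t - s))"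
  proof (rule integral_dominated_convergence[where w = "\<lambda>s. indicator {0..t + 1} s * B"])
    show "integrable P (\<lambda>s. indicator {0..t + 1} s * B)"
      using P_fin[of "t + 1"] by (intro integrable_mult_left integrable_real_indicator) (auto simp: sets_P)
    show "AE s in P. (\<lambda>n. f (S n - s)) \<longlonglongrightarrow> f (t - s)"
    proof (rule AE_I2)
      fix s
      have "filterlim (\<lambda>n. S n - s) (at_right (t - s)) sequentially"
        unfolding filterlim_at
      proof
        show "(\<lambda>n. S n - s) \<longlonglongrightarrow> t - s" by (intro tendsto_intros S)
        show "\<forall>\<^sub>F n in sequentially. S n - s \<in> {t - s<..} \<and> S n - s \<noteq> t - s"
        proof (intro always_eventually allI)
          fix n show "S n - s \<in> {t - s<..} \<and> S n - s \<noteq> t - s" using S(1)[of n] by auto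
        qed
      qed
      then show "(\<lambda>n. f (S n - s)) \<longlonglongrightarrow> f (t - s)"
        using pos_path_props(5)[OF f(1), of "t - s"] unfolding right_continuous_tendsto
        by (rule filterlim_compose[rotated])
    qed
    show "AE s in P. norm (f (S n - s)) \<le> indicator {0..t + 1} s * B" for n
      using P_AE_nonneg
    proof eventually_elim
      case (elim s)
      show ?case
      proof (cases "s \<le> S n")
        case True
        then show ?thesis using B(1)[of "S n - s"] S(2)[of n] elim by (auto simp: indicator_def)
      next
        case False
        then show ?thesis using f(2)[of "S n - s"] B(2) by (auto simp: indicator_def)
      qed
    qed
  qed measurable
  then show "(\<lambda>n. LINT s:{0..S n}|P. f (S n - s)) \<longlonglongrightarrow> (LINT s:{0..t}|P. f (t - s))"
    unfolding E .
qed

text \<open>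
  Integrating the measure \<open>P\<close> twice; by monotonicity the result is a weight to which the lemmas on
  nondecreasing functions apply.
\<close>

lemma tail_integral:
  shows "ext (\<lambda>t. LINT s|P. max 0 (t - s)) = mconv P (conv heaviside heaviside)"
    and "nondecr (\<lambda>t. LINT s|P. max 0 (t - s))"
proof -
  note [measurable_cong] = sets_P
  have "nondecr (\<lambda>t. t)" by (simp add: nondecr_def)
  from nondecr_measurable[OF this] nondecr_loc_bounded[OF this] have idp: "(\<lambda>t :: real. indicator {0..} t * t) \<in> borel_measurable borel" "loc_bounded (\<lambda>t. t)" "\<And>t :: real. 0 \<le> t \<Longrightarrow> 0 \<le> t"
    by auto
  have "AE s in P. max 0 (t - s) = indicator {0..t} s *\<^sub>R (t - s)" for t
    using P_AE_nonneg by eventually_elim (auto simp: indicator_def)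
  then have E: "(LINT s|P. max 0 (t - s)) = (LINT s:{0..t}|P. t - s)" for t
    unfolding set_lebesgue_integral_def by (intro integral_cong_AE) measurable
  have e: "mconv P (conv heaviside heaviside) t = ennreal (LINT s|P. max 0 (t - s))" for t
    unfolding E conv_heaviside_heaviside by (rule mconv_pos_path(2)[OF idp])
  have nn: "0 \<le> (LINT s|P. max 0 (t - s))" for t by (intro integral_nonneg_AE) simp
  show "ext (\<lambda>t. LINT s|P. max 0 (t - s)) = mconv P (conv heaviside heaviside)"
  proof
    fix t
    show "ext (\<lambda>t. LINT s|P. max 0 (t - s)) t = mconv P (conv heaviside heaviside) t"
      unfolding e by (cases "0 \<le> t") (simp_all add: ext_def E set_lebesgue_integral_def)
  qed
  show "nondecr (\<lambda>t. LINT s|P. max 0 (t - s))"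
    unfolding nondecr_def
  proof (intro allI impI conjI nn)
    fix s t :: real assume st: "0 \<le> s" "s \<le> t"
    have "mconv P (conv heaviside heaviside) s \<le> mconv P (conv heaviside heaviside) t"
      unfolding mconv_def conv_heaviside_heaviside
      by (rule nn_integral_mono) (use st in \<open>auto simp: ext_def indicator_def intro!: ennreal_leI\<close>)
    then show "(LINT u|P. max 0 (s - u)) \<le> (LINT u|P. max 0 (t - u))"
      unfolding e using nn[of t] by (simp add: ennreal_le_iff)
  qed
qed

end

section \<open>Differentiating the integrated equation\<close>

lemma cadlag_max:
  assumes "cadlag f" shows "cadlag (\<lambda>t. max 0 (f t :: real))"
  unfolding cadlag_def
proof (intro allI conjI)
  fix t
  have "continuous (at_right t) f" using assms by (simp add: cadlag_def)
  then show "continuous (at_right t) (\<lambda>t. max 0 (f t))" by (intro continuous_intros)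
  obtain l where "(f \<longlongrightarrow> l) (at_left t)" using assms unfolding cadlag_def by blast
  then have "((\<lambda>t. max 0 (f t)) \<longlongrightarrow> max 0 l) (at_left t)" by (intro tendsto_max tendsto_const)
  then show "\<exists>l. ((\<lambda>t. max 0 (f t)) \<longlongrightarrow> l) (at_left t)" by blast
qed

lemma cadlag_uminus:
  assumes "cadlag f" shows "cadlag (\<lambda>t. - f t :: real)"
  unfolding cadlag_def
proof (intro allI conjI)
  fix t
  have "continuous (at_right t) f" using assms by (simp add: cadlag_def)
  then show "continuous (at_right t) (\<lambda>t. - f t)" by (intro continuous_intros)
  obtain l where "(f \<longlongrightarrow> l) (at_left t)" using assms unfolding cadlag_def by blast
  then have "((\<lambda>t. - f t) \<longlongrightarrow> - l) (at_left t)" by (intro tendsto_minus)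
  then show "\<exists>l. ((\<lambda>t. - f t) \<longlongrightarrow> l) (at_left t)" by blast
qed

text \<open>
  Split \<open>m = mp - mn\<close> into positive and negative part and move \<open>mn\<close> to the left. Both sides,
  \<open>F = \<xi> + P * mn\<close> and \<open>G = \<upsilon> + P * mp\<close>, are nonnegative and right-continuous, and by associativity of
  convolutions their triple integrals are the two sides of the assumed equation. Equality of integrals
  at rational times is then used three times to reach \<open>F = G\<close>.
\<close>

lemma volterra_from_triple_integrals:
  fixes \<xi> \<upsilon> :: "real \<Rightarrow> real" and m :: "'j::finite \<Rightarrow> real \<Rightarrow> real" and P :: "'j \<Rightarrow> real measure"
  assumes \<xi>: "pos_path \<xi>" and \<upsilon>: "pos_path \<upsilon>" and m: "\<And>j. cadlag (m j)" "\<And>j t. t < 0 \<Longrightarrow> m j t = 0"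
    and P: "\<And>j. sets (P j) = sets borel" "\<And>j. emeasure (P j) {..<0} = 0" "\<And>j t. emeasure (P j) {0..t} < \<infinity>"
    and eq: "\<And>T. T \<in> \<rat> \<Longrightarrow> 0 \<le> T \<Longrightarrow>
      (LINT u:{0..T}|lborel. (T - u) * (LINT s:{0..u}|lborel. \<xi> s))
      = (LINT u:{0..T}|lborel. (T - u) * (LINT s:{0..u}|lborel. \<upsilon> s))
        + (\<Sum>j\<in>UNIV. (LINT u:{0..T}|lborel. (LINT s|P j. max 0 (T - u - s)) * (LINT s:{0..u}|lborel. m j s)))"
    and t: "0 \<le> t"
  shows "\<xi> t = \<upsilon> t + (\<Sum>j\<in>UNIV. LINT s:{0..t}|P j. m j (t - s))"
proof -
  define mp where "mp j t = max 0 (m j t)" for j t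
  define mn where "mn j t = max 0 (- m j t)" for j t
  have mpn: "m j t = mp j t - mn j t" for j t by (simp add: mp_def mn_def)
  have mp0: "pos_path (mp j) \<and> (\<forall>t<0. mp j t = 0)" and mn0: "pos_path (mn j) \<and> (\<forall>t<0. mn j t = 0)" for j
    unfolding mp_def mn_def pos_path_def using m by (auto intro!: cadlag_max cadlag_uminus)
  note mp = mp0[THEN conjunct1] and mn = mn0[THEN conjunct1]
  define \<rho> where "\<rho> j t = (LINT s|P j. max 0 (t - s))" for j t
  define hh where "hh = conv heaviside heaviside"
  have hhm [measurable]: "hh \<in> borel_measurable borel" by (simp add: hh_def)
  have hhe: "hh = ext (\<lambda>u. u)" unfolding hh_def by (rule conv_heaviside_heaviside)
  have idnd: "nondecr (\<lambda>u. u)" by (simp add: nondecr_def)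
  have \<rho>e: "ext (\<rho> j) = mconv (P j) hh" and \<rho>nd: "nondecr (\<rho> j)" for j
    unfolding \<rho>_def hh_def by (rule tail_integral[OF P])+
  define I where "I f u = (LINT s:{0..u}|lborel. f s)" for f :: "real \<Rightarrow> real" and u
  have In: "nondecr (I f)" "conv heaviside (ext f) = ext (I f)"
    if f: "\<And>T. set_integrable lborel {0..T} f" "\<forall>t\<ge>0. 0 \<le> f t" for f
    unfolding I_def[abs_def] using integral_nondecr[of f] f by auto
  have Ipos: "nondecr (I f)" "conv heaviside (ext f) = ext (I f)" if "pos_path f" for f
    using In[OF pos_path_props(3)[OF that]] that by (auto simp: pos_path_def)
  have Indec: "nondecr (I f)" "conv heaviside (ext f) = ext (I f)" if "nondecr f" for f
    using In[OF nondecr_set_integrable[OF that]] nondecrD(1)[OF that] by auto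
  have mcm: "mconv (P j) g \<in> borel_measurable borel" if "g \<in> borel_measurable borel" for g j
    by (rule mconv_measurable[OF P that])
  define side where "side y v t = y t + (\<Sum>j\<in>UNIV. LINT s:{0..t}|P j. v j (t - s))"
    for y :: "real \<Rightarrow> real" and v t
  have side: "(\<And>T. set_integrable lborel {0..T} (side y v))"
      "(\<forall>t\<ge>0. 0 \<le> side y v t)"
      "(\<And>t. continuous (at_right t) (side y v))"
      "ext (side y v) = (\<lambda>t. ext y t + (\<Sum>j\<in>UNIV. mconv (P j) (ext (v j)) t))"
    if y: "pos_path y" and v0: "\<And>j. pos_path (v j) \<and> (\<forall>t<0. v j t = 0)" for y v
  proof -
    have v: "pos_path (v j)" "\<And>t. t < 0 \<Longrightarrow> v j t = 0" for j using v0[of j] by auto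
    note v' = pos_path_props(1,2,4)[OF v(1)]
    have nn: "0 \<le> (LINT s:{0..t}|P j. v j (t - s))" for j t by (rule mconv_pos_path(3)[OF P v'])
    have e: "mconv (P j) (ext (v j)) t = ennreal (LINT s:{0..t}|P j. v j (t - s))" for j t
      by (rule mconv_pos_path(2)[OF P v'])
    show "\<forall>t\<ge>0. 0 \<le> side y v t"
      unfolding side_def using pos_path_props(4)[OF y] nn by (auto intro!: add_nonneg_nonneg sum_nonneg)
    show "continuous (at_right t) (side y v)" for t
      unfolding side_def by (intro continuous_add continuous_sum pos_path_props(5)[OF y] mconv_right_continuous[OF P v])
    show E: "ext (side y v) = (\<lambda>t. ext y t + (\<Sum>j\<in>UNIV. mconv (P j) (ext (v j)) t))"
    proof
      fix t show "ext (side y v) t = ext y t + (\<Sum>j\<in>UNIV. mconv (P j) (ext (v j)) t)"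
      proof (cases "0 \<le> t")
        case True
        then show ?thesis
          using pos_path_props(4)[OF y True] nn[of _ t]
          by (simp add: ext_def side_def e ennreal_plus sum_nonneg)
      next
        case False
        then show ?thesis by (simp add: e) (simp add: ext_def set_lebesgue_integral_def)
      qed
    qed
    have "(\<lambda>t. LINT s:{0..t}|P j. v j (t - s)) = (\<lambda>t. enn2real (mconv (P j) (ext (v j)) t))" for j
      using nn by (simp add: e)
    then have "(\<lambda>t. LINT s:{0..t}|P j. v j (t - s)) \<in> borel_measurable borel" for j
      using mcm[OF pos_path_props(6)[OF v(1)], of j j] by simp
    then have sm: "(\<lambda>t. indicator {0..} t * (LINT s:{0..t}|P j. v j (t - s))) \<in> borel_measurable borel" for j
      by measurable
    show "set_integrable lborel {0..T} (side y v)" for T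
    proof -
      have "set_integrable lborel {0..T} (\<lambda>t. LINT s:{0..t}|P j. v j (t - s))" for j
        by (rule loc_bounded_set_integrable[OF sm mconv_loc_bounded[OF P v']])
      then have "set_integrable lborel {0..T} (\<lambda>t. \<Sum>j\<in>UNIV. LINT s:{0..t}|P j. v j (t - s))"
        unfolding set_integrable_def scaleR_sum_right by (intro Bochner_Integration.integrable_sum) auto
      then show ?thesis unfolding side_def by (intro set_integral_add pos_path_props(3)[OF y])
    qed
  qed
  have triple: "ennreal (I (I (I (side y v))) T)
      = ennreal (LINT u:{0..T}|lborel. (T - u) * I y u) + (\<Sum>j\<in>UNIV. ennreal (LINT u:{0..T}|lborel. \<rho> j (T - u) * I (v j) u))"
    if y: "pos_path y" and v0: "\<And>j. pos_path (v j) \<and> (\<forall>t<0. v j t = 0)" and T: "0 \<le> T" for y v T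
  proof -
    note v = v0[THEN conjunct1]
    note s = side[OF y v0]
    note [measurable] = pos_path_props(6)[OF y] pos_path_props(6)[OF v] mcm
    have [measurable]: "ext (side y v) \<in> borel_measurable borel" unfolding s(4) by measurable
    note n1 = In[OF s(1,2)]
    note n2 = Indec[OF n1(1)]
    note n3 = Indec[OF n2(1)]
    have "ennreal (I (I (I (side y v))) T) = ext (I (I (I (side y v)))) T" using T by (simp add: ext_def)
    also have "\<dots> = conv heaviside (conv heaviside (conv heaviside (ext (side y v)))) T"
      by (simp only: n1(2) n2(2) n3(2))
    also have "\<dots> = conv hh (conv heaviside (ext (side y v))) T"
      by (simp add: hh_def conv_assoc)
    also have "\<dots> = conv (conv hh heaviside) (ext (side y v)) T"
      by (simp add: conv_assoc)
    also have "\<dots> = conv (conv hh heaviside) (ext y) T + (\<Sum>j\<in>UNIV. conv (conv hh heaviside) (mconv (P j) (ext (v j))) T)"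
      unfolding s(4) by (simp add: conv_add_right conv_sum_right)
    finally have total: "ennreal (I (I (I (side y v))) T)
        = conv (conv hh heaviside) (ext y) T + (\<Sum>j\<in>UNIV. conv (conv hh heaviside) (mconv (P j) (ext (v j))) T)" .
    have yterm: "conv (conv hh heaviside) (ext y) T = ennreal (LINT u:{0..T}|lborel. (T - u) * I y u)"
    proof -
      have "conv (conv hh heaviside) (ext y) = conv (ext (\<lambda>u. u)) (ext (I y))"
        unfolding hhe[symmetric] Ipos(2)[OF y, symmetric] by (rule conv_assoc) measurable
      then show ?thesis by (simp add: conv_nondecr(2)[OF idnd Ipos(1)[OF y]])
    qed
    have mterm: "conv (conv hh heaviside) (mconv (P j) (ext (v j))) T = ennreal (LINT u:{0..T}|lborel. \<rho> j (T - u) * I (v j) u)" for j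
    proof -
      have "conv (conv hh heaviside) (mconv (P j) (ext (v j))) = mconv (P j) (conv (conv hh heaviside) (ext (v j)))"
        by (rule conv_mconv[OF P]) measurable
      also have "conv (conv hh heaviside) (ext (v j)) = conv hh (ext (I (v j)))"
        unfolding Ipos(2)[OF v, symmetric] by (rule conv_assoc) measurable
      also have "conv hh (ext (I (v j))) = conv (ext (I (v j))) hh"
        by (rule conv_commute) (simp_all add: nondecr_ext_measurable Ipos(1)[OF v])
      also have "mconv (P j) (conv (ext (I (v j))) hh) = conv (ext (I (v j))) (mconv (P j) hh)"
        by (rule conv_mconv[OF P, symmetric]) (simp_all add: nondecr_ext_measurable Ipos(1)[OF v])
      also have "\<dots> = conv (ext (\<rho> j)) (ext (I (v j)))"
        unfolding \<rho>e[symmetric] by (rule conv_commute) (simp_all add: nondecr_ext_measurable Ipos(1)[OF v] \<rho>nd)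
      finally show ?thesis by (simp add: conv_nondecr(2)[OF \<rho>nd Ipos(1)[OF v]])
    qed
    show ?thesis unfolding total yterm mterm ..
  qed
  define F where "F = side \<xi> mn"
  define G where "G = side \<upsilon> mp"
  note sF = side[of \<xi> mn, OF \<xi> mn0, folded F_def] and sG = side[of \<upsilon> mp, OF \<upsilon> mp0, folded G_def]
  have E3: "I (I (I F)) T = I (I (I G)) T" if T: "T \<in> \<rat>" "0 \<le> T" for T
  proof -
    have eq': "(LINT u:{0..T}|lborel. (T - u) * I \<xi> u) = (LINT u:{0..T}|lborel. (T - u) * I \<upsilon> u)
        + (\<Sum>j\<in>UNIV. LINT u:{0..T}|lborel. \<rho> j (T - u) * I (m j) u)"
      using eq[OF T] unfolding I_def \<rho>_def .
    have Im: "I (m j) u = I (mp j) u - I (mn j) u" for j u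
      unfolding I_def mpn by (rule set_integral_diff(2)) (rule pos_path_props(3)[OF mp] pos_path_props(3)[OF mn])+
    have "(LINT u:{0..T}|lborel. \<rho> j (T - u) * I (m j) u)
        = (LINT u:{0..T}|lborel. \<rho> j (T - u) * I (mp j) u) - (LINT u:{0..T}|lborel. \<rho> j (T - u) * I (mn j) u)" for j
      unfolding Im right_diff_distrib
      by (rule set_integral_diff(2)[OF conv_nondecr(1)[OF \<rho>nd Ipos(1)[OF mp]] conv_nondecr(1)[OF \<rho>nd Ipos(1)[OF mn]]])
    then have R: "(LINT u:{0..T}|lborel. (T - u) * I \<xi> u) + (\<Sum>j\<in>UNIV. LINT u:{0..T}|lborel. \<rho> j (T - u) * I (mn j) u)
        = (LINT u:{0..T}|lborel. (T - u) * I \<upsilon> u) + (\<Sum>j\<in>UNIV. LINT u:{0..T}|lborel. \<rho> j (T - u) * I (mp j) u)"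
      using eq' by (simp add: sum_subtractf)
    have "ennreal (I (I (I F)) T) = ennreal (I (I (I G)) T)"
      unfolding F_def G_def triple[of \<xi> mn T, OF \<xi> mn0 T(2)] triple[of \<upsilon> mp T, OF \<upsilon> mp0 T(2)]
      using R conv_nondecr(3)[OF \<rho>nd Ipos(1)[OF mp]] conv_nondecr(3)[OF \<rho>nd Ipos(1)[OF mn]]
        conv_nondecr(3)[OF idnd Ipos(1)[OF \<xi>]] conv_nondecr(3)[OF idnd Ipos(1)[OF \<upsilon>]]
      by (simp add: sum_nonneg flip: ennreal_plus)
    moreover have "0 \<le> I (I (I F)) T" "0 \<le> I (I (I G)) T"
      using nondecrD(1)[OF Indec(1)[OF Indec(1)[OF In(1)[OF sF(1,2)]]] T(2)]
        nondecrD(1)[OF Indec(1)[OF Indec(1)[OF In(1)[OF sG(1,2)]]] T(2)] by auto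
    ultimately show ?thesis by (simp add: ennreal_inj)
  qed
  note ndI = In(1)[OF sF(1,2)] In(1)[OF sG(1,2)]
  note ndII = Indec(1)[OF ndI(1)] Indec(1)[OF ndI(2)]
  have rcI: "continuous (at_right t) (I f)" if "\<And>T. set_integrable lborel {0..T} f" "0 \<le> t" for f t
    unfolding I_def[abs_def] by (rule integral_right_continuous[OF that])
  have E2: "I (I F) t = I (I G) t" if "0 \<le> t" for t
    by (rule equal_integrals_imp_equal[OF nondecr_set_integrable[OF ndII(1)] nondecr_set_integrable[OF ndII(2)]
          rcI[OF nondecr_set_integrable[OF ndI(1)]] rcI[OF nondecr_set_integrable[OF ndI(2)]] _ that])
       (use E3 in \<open>auto simp: I_def\<close>)
  have E1: "I F t = I G t" if "0 \<le> t" for t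
    by (rule equal_integrals_imp_equal[OF nondecr_set_integrable[OF ndI(1)] nondecr_set_integrable[OF ndI(2)]
          rcI[OF sF(1)] rcI[OF sG(1)] _ that])
       (use E2 in \<open>auto simp: I_def\<close>)
  have E0: "F t = G t"
    by (rule equal_integrals_imp_equal[OF sF(1) sG(1) sF(3) sG(3) _ t]) (use E1 in \<open>auto simp: I_def\<close>)
  have "(LINT s:{0..t}|P j. m j (t - s)) = (LINT s:{0..t}|P j. mp j (t - s)) - (LINT s:{0..t}|P j. mn j (t - s))" for j
    unfolding mpn
    by (rule set_integral_diff(2)[OF mconv_pos_path(1)[OF P pos_path_props(1,2,4)[OF mp]] mconv_pos_path(1)[OF P pos_path_props(1,2,4)[OF mn]]])
  then show ?thesis
    using E0 by (simp add: F_def G_def side_def sum_subtractf)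
qed

section \<open>Convergence of integrals over an interval\<close>

lemma bounded_interval_integrable:
  fixes g :: "real \<Rightarrow> real"
  assumes m: "(\<lambda>u. indicator {0..T} u * g u) \<in> borel_measurable borel"
    and b: "\<And>u. 0 \<le> u \<Longrightarrow> u \<le> T \<Longrightarrow> \<bar>g u\<bar> \<le> B"
  shows "set_integrable lborel {0..T} g"
proof -
  have i: "integrable lborel (\<lambda>t :: real. indicator {0..T} t * B)"
    by (intro integrable_mult_left integrable_real_indicator) (simp_all add: emeasure_lborel_Icc_eq sets_lborel)
  show ?thesis
    unfolding set_integrable_def
  proof (rule Bochner_Integration.integrable_bound[OF i])
    show "(\<lambda>t. indicator {0..T} t *\<^sub>R g t) \<in> borel_measurable lborel" using m by simp
    show "AE t in lborel. norm (indicator {0..T} t *\<^sub>R g t) \<le> norm (indicator {0..T} t * B)"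
    proof (rule AE_I2)
      fix t show "norm (indicator {0..T} t *\<^sub>R g t) \<le> norm (indicator {0..T} t * B)"
        using b[of t] by (cases "t \<in> {0..T}") auto
    qed
  qed
qed

lemma bounded_interval_convergence:
  fixes g :: "nat \<Rightarrow> real \<Rightarrow> real"
  assumes m: "\<And>n. (\<lambda>u. indicator {0..T} u * g n u) \<in> borel_measurable borel" "(\<lambda>u. indicator {0..T} u * g' u) \<in> borel_measurable borel"
    and b: "\<And>n u. 0 \<le> u \<Longrightarrow> u \<le> T \<Longrightarrow> \<bar>g n u\<bar> \<le> B"
    and lim: "AE u in lborel. 0 \<le> u \<longrightarrow> u \<le> T \<longrightarrow> (\<lambda>n. g n u) \<longlonglongrightarrow> g' u"
  shows "(\<lambda>n. LINT u:{0..T}|lborel. g n u) \<longlonglongrightarrow> (LINT u:{0..T}|lborel. g' u)"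
  unfolding set_lebesgue_integral_def
proof (rule integral_dominated_convergence[where w = "\<lambda>u. indicator {0..T} u * B"])
  show "integrable lborel (\<lambda>t. indicator {0..T} t * B)"
    by (intro integrable_mult_left integrable_real_indicator) (simp_all add: emeasure_lborel_Icc_eq sets_lborel)
  show "AE u in lborel. (\<lambda>n. indicator {0..T} u *\<^sub>R g n u) \<longlonglongrightarrow> indicator {0..T} u *\<^sub>R g' u"
    using lim by eventually_elim (auto simp: indicator_def)
  show "AE u in lborel. norm (indicator {0..T} u *\<^sub>R g n u) \<le> indicator {0..T} u * B" for n
    using b by (intro AE_I2) (auto simp: indicator_def)
qed (use m in auto)

lemma nondecr_interval_measurable:
  assumes "nondecr f"
  shows "(\<lambda>u. indicator {0..T} u * f u) \<in> borel_measurable borel" "(\<lambda>u. indicator {0..T} u * f (T - u)) \<in> borel_measurable borel"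
proof -
  note [measurable] = nondecr_measurable[OF assms]
  have eq: "(\<lambda>u. indicator {0..T} u * f u) = (\<lambda>u. indicator {0..T} u * (indicator {0..} u * f u))"
    "(\<lambda>u. indicator {0..T} u * f (T - u)) = (\<lambda>u. indicator {0..T} u * (indicator {0..} (T - u) * f (T - u)))"
    by (auto simp: fun_eq_iff indicator_def)
  show "(\<lambda>u. indicator {0..T} u * f u) \<in> borel_measurable borel" unfolding eq(1) by measurable
  show "(\<lambda>u. indicator {0..T} u * f (T - u)) \<in> borel_measurable borel" unfolding eq(2) by measurable
qed

text \<open>
  Convergence outside a countable set suffices for the integrals. A uniform bound on \<open>[0, T]\<close> comes from the
  convergence at a single point \<open>T' \<ge> T\<close> outside the exceptional set, by monotonicity.
\<close>

lemma nondecr_limit_double_integral: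
  fixes f :: "nat \<Rightarrow> real \<Rightarrow> real"
  assumes f: "\<And>n. nondecr (f n)" and y: "cadlag y" and D: "countable D"
    and lim: "\<And>t. t \<notin> D \<Longrightarrow> (\<lambda>n. f n t) \<longlonglongrightarrow> y t" and T: "0 \<le> T"
  shows "(\<lambda>n. LINT u:{0..T}|lborel. (T - u) * (LINT s:{0..u}|lborel. f n s)) \<longlonglongrightarrow> (LINT u:{0..T}|lborel. (T - u) * (LINT s:{0..u}|lborel. y s))"
proof -
  have "uncountable {T..T + 1}" by (simp add: uncountable_closed_interval)
  then obtain T' where T': "T' \<in> {T..T + 1}" "T' \<notin> D"
    using countable_subset[OF _ D, of "{T..T + 1}"] by blast
  have "bounded (range (\<lambda>n. f n T'))" by (rule convergent_imp_bounded[OF lim[OF T'(2)]])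
  then obtain B where B: "\<And>n. \<bar>f n T'\<bar> \<le> B" by (auto simp: bounded_iff)
  have fB: "0 \<le> f n s" "f n s \<le> B" if "0 \<le> s" "s \<le> T" for n s
    using nondecrD(1)[OF f[of n] that(1)] nondecrD(2)[OF f[of n] that(1), of T'] B[of n] that T' by (auto simp: abs_le_iff)
  have B0: "0 \<le> B" using B[of 0] by linarith
  have ae: "AE s in lborel. (\<lambda>n. f n s) \<longlonglongrightarrow> y s"
    by (rule AE_I'[OF countable_imp_null_set_lborel[OF D]]) (use lim in auto)
  have [measurable]: "y \<in> borel_measurable borel" by (rule cadlag_borel_measurable[OF y])
  have inner: "(\<lambda>n. LINT s:{0..u}|lborel. f n s) \<longlonglongrightarrow> (LINT s:{0..u}|lborel. y s)" if "0 \<le> u" "u \<le> T" for u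
  proof (rule bounded_interval_convergence[where B = B])
    show "\<bar>f n s\<bar> \<le> B" if "0 \<le> s" "s \<le> u" for n s using fB[of s n] that \<open>u \<le> T\<close> by auto
    show "AE s in lborel. 0 \<le> s \<longrightarrow> s \<le> u \<longrightarrow> (\<lambda>n. f n s) \<longlonglongrightarrow> y s" using ae by eventually_elim simp
  qed (use nondecr_interval_measurable[OF f] in auto)
  have If: "nondecr (\<lambda>u. LINT s:{0..u}|lborel. f n s)" for n by (rule nondecr_integral[OF f])
  have Ib: "(LINT s:{0..u}|lborel. f n s) \<le> B * T" if "0 \<le> u" "u \<le> T" for n u
  proof -
    have "(LINT s:{0..u}|lborel. f n s) \<le> (LINT s:{0..u}|lborel. B)"
      by (rule set_integral_mono[OF nondecr_set_integrable[OF f]]) (use fB that in \<open>auto simp: set_integrable_def\<close>)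
    also have "\<dots> = u * B" unfolding set_lebesgue_integral_def using that by simp
    also have "\<dots> \<le> T * B" using that B0 by (intro mult_right_mono)
    finally show ?thesis by (simp add: mult.commute)
  qed
  have ym: "(\<lambda>u. LINT s:{0..u}|lborel. y s) \<in> borel_measurable borel"
  proof -
    have eq: "indicator {0..u} s *\<^sub>R y s = indicator {z \<in> space (borel \<Otimes>\<^sub>M lborel). 0 \<le> snd z \<and> snd z \<le> fst z} (u, s) * y s" for u s
      by (auto simp: indicator_def space_pair_measure)
    show ?thesis
      unfolding set_lebesgue_integral_def eq by (rule lborel.borel_measurable_lebesgue_integral) measurable
  qed
  show ?thesis
  proof (rule bounded_interval_convergence[where B = "T * (B * T)"])
    show "\<bar>(T - u) * (LINT s:{0..u}|lborel. f n s)\<bar> \<le> T * (B * T)" if "0 \<le> u" "u \<le> T" for n u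
      using Ib[OF that, of n] nondecrD(1)[OF If[of n] that(1)] that T B0 unfolding abs_mult
      by (intro mult_mono) auto
    show "AE u in lborel. 0 \<le> u \<longrightarrow> u \<le> T \<longrightarrow> (\<lambda>n. (T - u) * (LINT s:{0..u}|lborel. f n s)) \<longlonglongrightarrow> (T - u) * (LINT s:{0..u}|lborel. y s)"
      by (intro AE_I2 impI tendsto_mult tendsto_const inner)
    have "(\<lambda>u. (T - u) * (indicator {0..T} u * (LINT s:{0..u}|lborel. f n s))) \<in> borel_measurable borel" for n
      using nondecr_interval_measurable(1)[OF If[of n], of T] by measurable
    then show "(\<lambda>u. indicator {0..T} u * ((T - u) * (LINT s:{0..u}|lborel. f n s))) \<in> borel_measurable borel" for n
      by (simp add: mult.left_commute)
    show "(\<lambda>u. indicator {0..T} u * ((T - u) * (LINT s:{0..u}|lborel. y s))) \<in> borel_measurable borel"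
      using ym by measurable
  qed
qed

section \<open>Functionals of limits in distribution\<close>

text \<open>
  The S-topology is the sequential topology of S-convergence, so sequential continuity is
  continuity.
\<close>

lemma S_continuous_mapI:
  assumes "\<And>fs f. (\<And>n. fs n \<in> cadlag_space E) \<Longrightarrow> f \<in> cadlag_space E \<Longrightarrow> S_converges fs f \<Longrightarrow> (\<lambda>n. F (fs n)) \<longlonglongrightarrow> F f"
  shows "continuous_map (S_topology E) euclideanreal F"
  unfolding continuous_map_def
proof (intro conjI allI impI)
  fix V :: "real set" assume "openin euclideanreal V"
  then have V: "open V" by simp
  show "openin (S_topology E) {x \<in> topspace (S_topology E). F x \<in> V}"
    unfolding openin_S_topology topspace_S_topology S_open_def
  proof (intro conjI allI impI)
    fix fs f assume *: "(\<forall>n. fs n \<in> cadlag_space E) \<and> f \<in> {x \<in> cadlag_space E. F x \<in> V} \<and> S_converges fs f"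
    then have "(\<lambda>n. F (fs n)) \<longlonglongrightarrow> F f" using assms by blast
    then have "\<forall>\<^sub>F n in sequentially. F (fs n) \<in> V"
      by (rule topological_tendstoD[OF _ V]) (use * in blast)
    then show "\<forall>\<^sub>F n in sequentially. fs n \<in> {x \<in> cadlag_space E. F x \<in> V}"
      by eventually_elim (use * in blast)
  qed blast
qed simp

lemma continuous_map_measurable:
  assumes X: "X \<in> measurable M (borel_of_topology S)" and f: "continuous_map S euclideanreal f"
  shows "(\<lambda>\<omega>. f (X \<omega>)) \<in> borel_measurable M"
proof -
  have sub: "{U. openin S U} \<subseteq> Pow (topspace S)" using openin_subset by auto
  have "f \<in> borel_measurable (borel_of_topology S)"
  proof (rule borel_measurableI)
    fix V :: "real set" assume "open V"
    then have "openin S {x \<in> topspace S. f x \<in> V}"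
      using f by (auto simp: continuous_map_def)
    moreover have "f -` V \<inter> space (borel_of_topology S) = {x \<in> topspace S. f x \<in> V}"
      by (auto simp: borel_of_topology_def space_measure_of[OF sub])
    ultimately show "f -` V \<inter> space (borel_of_topology S) \<in> sets (borel_of_topology S)"
      by (simp add: borel_of_topology_def sets_measure_of[OF sub] sigma_sets.Basic)
  qed
  from measurable_compose[OF X this] show ?thesis .
qed

text \<open>
  For fixed \<open>c\<close>, convergence in distribution of the bounded continuous functionals \<open>min 1 \<bar>\<Psi>\<bar>\<close> and
  \<open>min 1 (c J)\<close> turns the bound into \<open>E (min 1 \<bar>\<Psi>(X')\<bar>) \<le> E (min 1 (c J(X')))\<close>, and the right side
  tends to \<open>0\<close> with \<open>c\<close> by dominated convergence.
\<close>

lemma vanishing_functional_of_limit: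
  assumes conv: "converges_in_distribution (S_topology E) P X P' X'"
    and P: "\<And>n. n \<ge> 1 \<Longrightarrow> prob_space (P n)" and P': "prob_space P'"
    and \<Psi>: "\<And>fs f. (\<And>n. fs n \<in> cadlag_space E) \<Longrightarrow> f \<in> cadlag_space E \<Longrightarrow> S_converges fs f \<Longrightarrow> (\<lambda>n. \<Psi> (fs n)) \<longlonglongrightarrow> (\<Psi> f :: real)"
    and J: "\<And>fs f. (\<And>n. fs n \<in> cadlag_space E) \<Longrightarrow> f \<in> cadlag_space E \<Longrightarrow> S_converges fs f \<Longrightarrow> (\<lambda>n. J (fs n)) \<longlonglongrightarrow> (J f :: real)"
    and Jnn: "\<And>z. 0 \<le> J z" and ann: "\<And>n. 0 \<le> a n" and enn: "\<And>n. 0 \<le> e n" and alim: "a \<longlonglongrightarrow> 0" and elim: "e \<longlonglongrightarrow> 0"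
    and bound: "\<And>n \<omega> c. n \<ge> 1 \<Longrightarrow> \<omega> \<in> space (P n) \<Longrightarrow> X n \<omega> \<in> cadlag_space E \<Longrightarrow> 0 < c \<Longrightarrow>
       \<bar>\<Psi> (X n \<omega>)\<bar> \<le> a n + e n / c + c * J (X n \<omega>)"
  shows "AE \<omega> in P'. \<Psi> (X' \<omega>) = 0"
proof -
  let ?S = "S_topology E"
  have Xm: "\<forall>\<^sub>F n in sequentially. X n \<in> measurable (P n) (borel_of_topology ?S)"
    and X'm: "X' \<in> measurable P' (borel_of_topology ?S)"
    and lim: "\<And>f. continuous_map ?S euclideanreal f \<Longrightarrow> bounded (f ` topspace ?S) \<Longrightarrow>
        (\<lambda>n. LINT \<omega>|P n. f (X n \<omega>)) \<longlonglongrightarrow> (LINT \<omega>|P'. f (X' \<omega>))"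
    using conv by (auto simp: converges_in_distribution_def)
  define f1 where "f1 z = min 1 \<bar>\<Psi> z\<bar>" for z
  define f2 where "f2 c z = min 1 (c * J z)" for c z
  have f1c: "continuous_map ?S euclideanreal f1"
    unfolding f1_def by (intro S_continuous_mapI tendsto_min tendsto_rabs tendsto_const \<Psi>)
  have f2c: "continuous_map ?S euclideanreal (f2 c)" for c
    unfolding f2_def by (intro S_continuous_mapI tendsto_min tendsto_mult tendsto_const J)
  have f1b: "0 \<le> f1 z" "f1 z \<le> 1" for z by (auto simp: f1_def)
  have f2b: "0 \<le> f2 c z" "f2 c z \<le> 1" if "0 < c" for c z using Jnn that by (auto simp: f2_def)
  have f1bd: "bounded (f1 ` A)" for A using f1b by (intro boundedI[of _ 1]) auto
  have f2bd: "bounded (f2 c ` A)" if "0 < c" for c A using f2b[OF that] by (intro boundedI[of _ 1]) auto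
  have key: "(LINT \<omega>|P'. f1 (X' \<omega>)) \<le> (LINT \<omega>|P'. f2 c (X' \<omega>))" if c: "0 < c" for c
  proof -
    have "(\<lambda>n. a n + e n / c + (LINT \<omega>|P n. f2 c (X n \<omega>))) \<longlonglongrightarrow> 0 + 0 / c + (LINT \<omega>|P'. f2 c (X' \<omega>))"
      using c by (intro tendsto_add tendsto_divide tendsto_const alim elim lim f2c f2bd) auto
    then have R: "(\<lambda>n. a n + e n / c + (LINT \<omega>|P n. f2 c (X n \<omega>))) \<longlonglongrightarrow> (LINT \<omega>|P'. f2 c (X' \<omega>))" by simp
    have Lm: "(\<lambda>n. LINT \<omega>|P n. f1 (X n \<omega>)) \<longlonglongrightarrow> (LINT \<omega>|P'. f1 (X' \<omega>))"
      by (rule lim[OF f1c f1bd])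
    have "\<forall>\<^sub>F n in sequentially. (LINT \<omega>|P n. f1 (X n \<omega>)) \<le> a n + e n / c + (LINT \<omega>|P n. f2 c (X n \<omega>))"
      using Xm eventually_ge_at_top[of 1]
    proof eventually_elim
      case (elim n)
      interpret prob_space "P n" using P elim by blast
      have i1: "integrable (P n) (\<lambda>\<omega>. f1 (X n \<omega>))"
        by (rule integrable_const_bound[of _ 1]) (use f1b in \<open>auto intro: continuous_map_measurable[OF elim(1) f1c]\<close>)
      have i2: "integrable (P n) (\<lambda>\<omega>. f2 c (X n \<omega>))"
        by (rule integrable_const_bound[of _ 1]) (use f2b[OF c] in \<open>auto intro: continuous_map_measurable[OF elim(1) f2c]\<close>)
      have "(LINT \<omega>|P n. f1 (X n \<omega>)) \<le> (LINT \<omega>|P n. (a n + e n / c) + f2 c (X n \<omega>))"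
      proof (rule integral_mono[OF i1])
        show "integrable (P n) (\<lambda>\<omega>. (a n + e n / c) + f2 c (X n \<omega>))" using i2 by simp
        fix \<omega> assume \<omega>: "\<omega> \<in> space (P n)"
        have sub: "{U. openin ?S U} \<subseteq> Pow (topspace ?S)" using openin_subset by auto
        have "X n \<omega> \<in> cadlag_space E"
          using measurable_space[OF elim(1) \<omega>] space_measure_of[OF sub]
          unfolding borel_of_topology_def topspace_S_topology by simp
        from bound[OF elim(2) \<omega> this c] have "\<bar>\<Psi> (X n \<omega>)\<bar> \<le> a n + e n / c + c * J (X n \<omega>)" .
        moreover have "0 \<le> a n + e n / c" using ann[of n] enn[of n] c by simp
        ultimately show "f1 (X n \<omega>) \<le> (a n + e n / c) + f2 c (X n \<omega>)"
          unfolding f1_def f2_def by (simp add: min_def)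
      qed
      also have "\<dots> = (a n + e n / c) + (LINT \<omega>|P n. f2 c (X n \<omega>))"
        using i2 by (simp add: prob_space)
      finally show ?case .
    qed
    then show ?thesis by (rule tendsto_le[OF sequentially_bot R Lm])
  qed
  interpret P': prob_space P' by (rule P')
  have m1: "(\<lambda>\<omega>. f1 (X' \<omega>)) \<in> borel_measurable P'" by (rule continuous_map_measurable[OF X'm f1c])
  have m2: "(\<lambda>\<omega>. f2 c (X' \<omega>)) \<in> borel_measurable P'" for c by (rule continuous_map_measurable[OF X'm f2c])
  have "(\<lambda>k. LINT \<omega>|P'. f2 (inverse (real (Suc k))) (X' \<omega>)) \<longlonglongrightarrow> (LINT \<omega>|P'. 0)"
  proof (rule integral_dominated_convergence[where w = "\<lambda>_. 1"])
    show "AE \<omega> in P'. (\<lambda>k. f2 (inverse (real (Suc k))) (X' \<omega>)) \<longlonglongrightarrow> 0"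
    proof (rule AE_I2)
      fix \<omega>
      have "(\<lambda>k. min 1 (inverse (real (Suc k)) * J (X' \<omega>))) \<longlonglongrightarrow> min 1 (0 * J (X' \<omega>))"
        by (intro tendsto_min tendsto_mult tendsto_const LIMSEQ_inverse_real_of_nat)
      then show "(\<lambda>k. f2 (inverse (real (Suc k))) (X' \<omega>)) \<longlonglongrightarrow> 0" by (simp add: f2_def)
    qed
    show "AE \<omega> in P'. norm (f2 (inverse (real (Suc k))) (X' \<omega>)) \<le> 1" for k
      using f2b[of "inverse (real (Suc k))"] by (intro AE_I2) auto
  qed (use m2 in auto)
  moreover have "(LINT \<omega>|P'. f1 (X' \<omega>)) \<le> (LINT \<omega>|P'. f2 (inverse (real (Suc k))) (X' \<omega>))" for k
    by (rule key) simp
  ultimately have le0: "(LINT \<omega>|P'. f1 (X' \<omega>)) \<le> 0"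
    by (intro LIMSEQ_le_const[where x = 0 and a = "LINT \<omega>|P'. f1 (X' \<omega>)"]) auto
  have i1: "integrable P' (\<lambda>\<omega>. f1 (X' \<omega>))"
    by (rule P'.integrable_const_bound[of _ 1]) (use f1b m1 in auto)
  have "0 \<le> (LINT \<omega>|P'. f1 (X' \<omega>))" by (rule Bochner_Integration.integral_nonneg[OF f1b(1)])
  with le0 have "(LINT \<omega>|P'. f1 (X' \<omega>)) = 0" by simp
  then have "AE \<omega> in P'. f1 (X' \<omega>) = 0"
    using integral_nonneg_eq_0_iff_AE[OF i1] f1b by auto
  then show ?thesis by eventually_elim (auto simp: f1_def min_def split: if_splits)
qed

section \<open>Weighted running integrals\<close>

lemma running_integral_measurable:
  fixes f :: "real \<Rightarrow> 'a::euclidean_space"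
  assumes "cadlag f"
  shows "running_integral f b \<in> borel_measurable borel"
proof -
  have [measurable]: "(\<lambda>s. inner (f s) b) \<in> borel_measurable borel"
    by (rule cadlag_borel_measurable[OF cadlag_inner[OF assms]])
  have eq: "indicator {0..u} s *\<^sub>R inner (f s) b = indicator {z \<in> space (borel \<Otimes>\<^sub>M lborel). 0 \<le> snd z \<and> snd z \<le> fst z} (u, s) * inner (f s) b" for u s
    by (auto simp: indicator_def space_pair_measure)
  show ?thesis
    unfolding running_integral_def[abs_def] set_lebesgue_integral_def eq
    by (rule lborel.borel_measurable_lebesgue_integral) measurable
qed

lemma running_integral_bounded:
  fixes f :: "real \<Rightarrow> 'a::euclidean_space"
  assumes f: "cadlag f" and b: "b \<in> Basis"
  obtains C where "\<And>u. 0 \<le> u \<Longrightarrow> u \<le> T \<Longrightarrow> \<bar>running_integral f b u\<bar> \<le> C"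
proof -
  obtain B where B: "B \<ge> 0" "\<And>t. 0 \<le> t \<Longrightarrow> t \<le> T \<Longrightarrow> norm (f t) \<le> B" using cadlag_bounded[OF f] by blast
  have z: "cadlag (\<lambda>_ :: real. 0 :: 'a)" by (auto simp: cadlag_def)
  have "\<bar>running_integral f b u\<bar> \<le> B * T" if "0 \<le> u" "u \<le> T" for u
  proof -
    have "\<bar>running_integral f b u - running_integral (\<lambda>_. 0) b u\<bar> \<le> B * u"
      by (rule running_integral_close[OF f z b that(1)]) (use B that in auto)
    moreover have "running_integral (\<lambda>_. 0) b u = 0" by (simp add: running_integral_def)
    moreover have "B * u \<le> B * T" using B that by (intro mult_left_mono)
    ultimately show ?thesis by simp
  qed
  then show thesis by (rule that)
qed

text \<open>
  Pointwise convergence of the running integrals together with their uniform bound on \<open>[0, T]\<close>.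
\<close>

lemma S_converges_weighted_integral:
  fixes fs :: "nat \<Rightarrow> real \<Rightarrow> 'a::euclidean_space"
  assumes fs: "\<And>n. fs n \<in> cadlag_space E" and f: "f \<in> cadlag_space E" and S: "S_converges fs f"
    and b: "b \<in> Basis" and T: "0 \<le> T"
    and w: "(\<lambda>u. indicator {0..T} u * w u) \<in> borel_measurable borel" "\<And>u. 0 \<le> u \<Longrightarrow> u \<le> T \<Longrightarrow> \<bar>w u\<bar> \<le> W"
  shows "(\<lambda>n. LINT u:{0..T}|lborel. w u * running_integral (fs n) b u) \<longlonglongrightarrow> (LINT u:{0..T}|lborel. w u * running_integral f b u)"
    and "(\<lambda>n. LINT u:{0..T}|lborel. (running_integral (fs n) b u)\<^sup>2) \<longlonglongrightarrow> (LINT u:{0..T}|lborel. (running_integral f b u)\<^sup>2)"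
proof -
  obtain C where C: "\<And>n t. 0 \<le> t \<Longrightarrow> t \<le> T \<Longrightarrow> \<bar>running_integral (fs n) b t\<bar> \<le> C"
    using S_converges_running_integral_bounded[OF S fs b T] by blast
  have lim: "(\<lambda>n. running_integral (fs n) b u) \<longlonglongrightarrow> running_integral f b u" if "0 \<le> u" for u
    by (rule S_converges_running_integral[OF S fs f b that])
  have [measurable]: "running_integral (fs n) b \<in> borel_measurable borel" "running_integral f b \<in> borel_measurable borel" for n
    using fs f by (auto intro!: running_integral_measurable simp: cadlag_space_def)
  note [measurable] = w(1)
  have assoc: "(\<lambda>u. indicator {0..T} u * (w u * g u)) = (\<lambda>u. (indicator {0..T} u * w u) * g u)" for g
    by (simp add: mult.assoc)
  show "(\<lambda>n. LINT u:{0..T}|lborel. w u * running_integral (fs n) b u) \<longlonglongrightarrow> (LINT u:{0..T}|lborel. w u * running_integral f b u)"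
  proof (rule bounded_interval_convergence[where B = "W * C"])
    show "\<bar>w u * running_integral (fs n) b u\<bar> \<le> W * C" if "0 \<le> u" "u \<le> T" for n u
      unfolding abs_mult using w(2)[OF that] C[OF that, of n] by (intro mult_mono) auto
    show "(\<lambda>u. indicator {0..T} u * (w u * running_integral (fs n) b u)) \<in> borel_measurable borel" for n
      unfolding assoc by measurable
    show "(\<lambda>u. indicator {0..T} u * (w u * running_integral f b u)) \<in> borel_measurable borel"
      unfolding assoc by measurable
  qed (intro AE_I2 impI tendsto_mult tendsto_const lim)
  show "(\<lambda>n. LINT u:{0..T}|lborel. (running_integral (fs n) b u)\<^sup>2) \<longlonglongrightarrow> (LINT u:{0..T}|lborel. (running_integral f b u)\<^sup>2)"
  proof (rule bounded_interval_convergence[where B = "C\<^sup>2"])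
    show "\<bar>(running_integral (fs n) b u)\<^sup>2\<bar> \<le> C\<^sup>2" if "0 \<le> u" "u \<le> T" for n u
      using power_mono[OF C[OF that, of n], of 2] by simp
  qed (measurable, intro AE_I2 impI tendsto_power lim)
qed

text \<open>
  \<open>\<bar>d y\<bar> \<le> d\<^sup>2 / c + c y\<^sup>2\<close>. The parameter \<open>c\<close> separates the deterministic kernel error from the random
  running integrals.
\<close>

lemma integral_product_Young:
  fixes d y :: "real \<Rightarrow> real" and T :: real
  assumes d: "(\<lambda>u. indicator {0..T} u * d u) \<in> borel_measurable borel" "\<And>u. 0 \<le> u \<Longrightarrow> u \<le> T \<Longrightarrow> \<bar>d u\<bar> \<le> A"
    and y: "(\<lambda>u. indicator {0..T} u * y u) \<in> borel_measurable borel" "\<And>u. 0 \<le> u \<Longrightarrow> u \<le> T \<Longrightarrow> \<bar>y u\<bar> \<le> B" and c: "0 < (c :: real)"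
  shows "\<bar>LINT u:{0..T}|lborel. d u * y u\<bar> \<le> (LINT u:{0..T}|lborel. (d u)\<^sup>2) / c + c * (LINT u:{0..T}|lborel. (y u)\<^sup>2)"
proof -
  note [measurable] = d(1) y(1)
  have I: "set_integrable lborel {0..T} (\<lambda>u. p u * q u)"
    if m: "(\<lambda>u. indicator {0..T} u * p u) \<in> borel_measurable borel" "(\<lambda>u. indicator {0..T} u * q u) \<in> borel_measurable borel"
      and b: "\<And>u :: real. 0 \<le> u \<Longrightarrow> u \<le> T \<Longrightarrow> \<bar>p u\<bar> \<le> C" "\<And>u :: real. 0 \<le> u \<Longrightarrow> u \<le> T \<Longrightarrow> \<bar>q u\<bar> \<le> D" for p q :: "real \<Rightarrow> real" and C D :: real
  proof (rule bounded_interval_integrable[where B = "C * D"])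
    have "(\<lambda>u. indicator {0..T} u * (p u * q u)) = (\<lambda>u. (indicator {0..T} u * p u) * (indicator {0..T} u * q u))"
      by (auto simp: indicator_def)
    then show "(\<lambda>u. indicator {0..T} u * (p u * q u)) \<in> borel_measurable borel" using m by simp
    show "\<bar>p u * q u\<bar> \<le> C * D" if "0 \<le> u" "u \<le> T" for u
      unfolding abs_mult using b[OF that] by (intro mult_mono) auto
  qed
  have Idy: "set_integrable lborel {0..T} (\<lambda>u. d u * y u)" by (rule I[OF d(1) y(1) d(2) y(2)])
  have Idd: "set_integrable lborel {0..T} (\<lambda>u. (d u)\<^sup>2)" unfolding power2_eq_square by (rule I[OF d(1) d(1) d(2) d(2)])
  have Iyy: "set_integrable lborel {0..T} (\<lambda>u. (y u)\<^sup>2)" unfolding power2_eq_square by (rule I[OF y(1) y(1) y(2) y(2)])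
  have Y: "\<bar>p * q\<bar> \<le> p\<^sup>2 / c + c * q\<^sup>2" for p q :: real
  proof -
    have "0 \<le> (\<bar>p\<bar> - c * \<bar>q\<bar>)\<^sup>2 / c" using c by simp
    also have "\<dots> = p\<^sup>2 / c - 2 * \<bar>p * q\<bar> + c * q\<^sup>2"
      using c by (simp add: power2_eq_square abs_mult field_simps)
    finally show ?thesis using abs_ge_zero[of "p * q"] by linarith
  qed
  have Iu: "set_integrable lborel {0..T} (\<lambda>u. (d u)\<^sup>2 / c + c * (y u)\<^sup>2)"
    by (intro set_integral_add set_integrable_divide set_integrable_mult_right Idd Iyy)
  have "\<bar>LINT u:{0..T}|lborel. d u * y u\<bar> \<le> (LINT u:{0..T}|lborel. (d u)\<^sup>2 / c + c * (y u)\<^sup>2)"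
    unfolding set_lebesgue_integral_def
    by (intro order_trans[OF integral_abs_bound] integral_mono integrable_abs)
       (use Idy Iu Y in \<open>auto simp: set_integrable_def indicator_def\<close>)
  also have "\<dots> = (LINT u:{0..T}|lborel. (d u)\<^sup>2 / c) + (LINT u:{0..T}|lborel. c * (y u)\<^sup>2)"
    by (intro set_integral_add set_integrable_divide set_integrable_mult_right Idd Iyy)
  finally show ?thesis by simp
qed

lemma nondecr_kernel_integrable:
  assumes r: "nondecr r" and y: "(\<lambda>u. indicator {0..T} u * y u) \<in> borel_measurable borel" "\<And>u. 0 \<le> u \<Longrightarrow> u \<le> T \<Longrightarrow> \<bar>y u\<bar> \<le> B"
  shows "set_integrable lborel {0..T} (\<lambda>u. r (T - u) * y u)"
proof (rule bounded_interval_integrable[where B = "r T * B"])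
  have eq: "(\<lambda>u. indicator {0..T} u * (r (T - u) * y u)) = (\<lambda>u. (indicator {0..T} u * r (T - u)) * (indicator {0..T} u * y u))"
    by (auto simp: fun_eq_iff indicator_def)
  show "(\<lambda>u. indicator {0..T} u * (r (T - u) * y u)) \<in> borel_measurable borel"
    unfolding eq by (intro borel_measurable_times nondecr_interval_measurable[OF r] y(1))
  show "\<bar>r (T - u) * y u\<bar> \<le> r T * B" if u: "0 \<le> u" "u \<le> T" for u
    unfolding abs_mult
    using nondecrD(1)[OF r, of "T - u"] nondecrD(2)[OF r, of "T - u" T] y(2)[OF u] u by (intro mult_mono) auto
qed

text \<open>
  Replacing the kernels \<open>r\<close> by \<open>r'\<close> and the forcing \<open>k\<close> by \<open>k'\<close> in an equation satisfied by \<open>x\<close>: the defect is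
  controlled by Young's inequality for \<open>(r - r') y\<close>.
\<close>

lemma perturbed_kernel_bound:
  fixes r r' y :: "'j::finite \<Rightarrow> real \<Rightarrow> real"
  assumes r: "\<And>j. nondecr (r j)" and r': "\<And>j. nondecr (r' j)"
    and y: "\<And>j. (\<lambda>u. indicator {0..T} u * y j u) \<in> borel_measurable borel"
      "\<And>j u. 0 \<le> u \<Longrightarrow> u \<le> T \<Longrightarrow> \<bar>y j u\<bar> \<le> B j"
    and c: "0 < c" and x: "x = k + (\<Sum>j\<in>UNIV. LINT u:{0..T}|lborel. r j (T - u) * y j u)"
  shows "\<bar>x - k' - (\<Sum>j\<in>UNIV. LINT u:{0..T}|lborel. r' j (T - u) * y j u)\<bar>
    \<le> \<bar>k - k'\<bar> + (\<Sum>j\<in>UNIV. LINT u:{0..T}|lborel. (r j (T - u) - r' j (T - u))\<^sup>2) / c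
      + c * (\<Sum>j\<in>UNIV. LINT u:{0..T}|lborel. (y j u)\<^sup>2)"
proof -
  define D where "D j = (LINT u:{0..T}|lborel. (r j (T - u) - r' j (T - u)) * y j u)" for j
  have I: "set_integrable lborel {0..T} (\<lambda>u. r j (T - u) * y j u)" "set_integrable lborel {0..T} (\<lambda>u. r' j (T - u) * y j u)" for j
    by (rule nondecr_kernel_integrable[where B = "B j"], rule r r', rule y, rule y, assumption+)+
  have D: "D j = (LINT u:{0..T}|lborel. r j (T - u) * y j u) - (LINT u:{0..T}|lborel. r' j (T - u) * y j u)" for j
    unfolding D_def left_diff_distrib by (rule set_integral_diff(2)[OF I])
  have "x - k' - (\<Sum>j\<in>UNIV. LINT u:{0..T}|lborel. r' j (T - u) * y j u) = (k - k') + (\<Sum>j\<in>UNIV. D j)"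
    by (simp add: x D sum_subtractf)
  then have "\<bar>x - k' - (\<Sum>j\<in>UNIV. LINT u:{0..T}|lborel. r' j (T - u) * y j u)\<bar> \<le> \<bar>k - k'\<bar> + (\<Sum>j\<in>UNIV. \<bar>D j\<bar>)"
    using abs_triangle_ineq[of "k - k'" "\<Sum>j\<in>UNIV. D j"] sum_abs[of D UNIV] by linarith
  also have "\<bar>D j\<bar> \<le> (LINT u:{0..T}|lborel. (r j (T - u) - r' j (T - u))\<^sup>2) / c + c * (LINT u:{0..T}|lborel. (y j u)\<^sup>2)" for j
    unfolding D_def
  proof (rule integral_product_Young[where A = "r j T + r' j T" and B = "B j"])
    show "(\<lambda>u. indicator {0..T} u * (r j (T - u) - r' j (T - u))) \<in> borel_measurable borel"
      unfolding right_diff_distrib by (intro borel_measurable_diff nondecr_interval_measurable r r')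
    show "\<bar>r j (T - u) - r' j (T - u)\<bar> \<le> r j T + r' j T" if u: "0 \<le> u" "u \<le> T" for u
      using nondecrD(1)[OF r, of "T - u" j] nondecrD(2)[OF r, of "T - u" T j]
        nondecrD(1)[OF r', of "T - u" j] nondecrD(2)[OF r', of "T - u" T j] u by auto
  qed (use y c in auto)
  then have "\<bar>k - k'\<bar> + (\<Sum>j\<in>UNIV. \<bar>D j\<bar>) \<le> \<bar>k - k'\<bar> + (\<Sum>j\<in>UNIV. (LINT u:{0..T}|lborel. (r j (T - u) - r' j (T - u))\<^sup>2) / c + c * (LINT u:{0..T}|lborel. (y j u)\<^sup>2))"
    by (intro add_left_mono sum_mono)
  also have "\<dots> = \<bar>k - k'\<bar> + (\<Sum>j\<in>UNIV. LINT u:{0..T}|lborel. (r j (T - u) - r' j (T - u))\<^sup>2) / c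
      + c * (\<Sum>j\<in>UNIV. LINT u:{0..T}|lborel. (y j u)\<^sup>2)"
    by (simp add: sum.distrib sum_divide_distrib sum_distrib_left)
  finally show ?thesis .
qed

text \<open>
  By monotonicity the value at \<open>T\<close>, which converges, dominates on the whole interval.
\<close>

lemma nondecr_square_difference_limit:
  fixes r :: "nat \<Rightarrow> real \<Rightarrow> real"
  assumes r: "\<And>n. nondecr (r n)" and r': "nondecr r'" and lim: "\<And>t. 0 \<le> t \<Longrightarrow> (\<lambda>n. r n t) \<longlonglongrightarrow> r' t" and T: "0 \<le> T"
  shows "(\<lambda>n. LINT u:{0..T}|lborel. (r n (T - u) - r' (T - u))\<^sup>2) \<longlonglongrightarrow> 0"
proof -
  have "bounded (range (\<lambda>n. r n T))" by (rule convergent_imp_bounded[OF lim[OF T]])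
  then obtain C where C: "\<And>n. \<bar>r n T\<bar> \<le> C" by (auto simp: bounded_iff)
  have "(\<lambda>n. LINT u:{0..T}|lborel. (r n (T - u) - r' (T - u))\<^sup>2) \<longlonglongrightarrow> (LINT u:{0..T}|lborel. 0)"
  proof (rule bounded_interval_convergence[where B = "(C + r' T)\<^sup>2"])
    have eq: "(\<lambda>u. indicator {0..T} u * (r n (T - u) - r' (T - u))\<^sup>2) = (\<lambda>u. (indicator {0..T} u * r n (T - u) - indicator {0..T} u * r' (T - u))\<^sup>2)" for n
      by (auto simp: fun_eq_iff indicator_def)
    show "(\<lambda>u. indicator {0..T} u * (r n (T - u) - r' (T - u))\<^sup>2) \<in> borel_measurable borel" for n
      unfolding eq by (intro borel_measurable_power borel_measurable_diff nondecr_interval_measurable r r')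
    show "\<bar>(r n (T - u) - r' (T - u))\<^sup>2\<bar> \<le> (C + r' T)\<^sup>2" if u: "0 \<le> u" "u \<le> T" for n u
    proof -
      have "\<bar>r n (T - u) - r' (T - u)\<bar> \<le> C + r' T"
        using nondecrD(1)[OF r, of "T - u" n] nondecrD(2)[OF r, of "T - u" T n] C[of n]
          nondecrD(1)[OF r', of "T - u"] nondecrD(2)[OF r', of "T - u" T] u by auto
      from power_mono[OF this, of 2] show ?thesis by simp
    qed
    have "(\<lambda>n. (r n (T - u) - r' (T - u))\<^sup>2) \<longlonglongrightarrow> (r' (T - u) - r' (T - u))\<^sup>2" if "0 \<le> u" "u \<le> T" for u
      using that by (intro tendsto_power tendsto_diff tendsto_const lim) auto
    then show "AE u in lborel. 0 \<le> u \<longrightarrow> u \<le> T \<longrightarrow> (\<lambda>n. (r n (T - u) - r' (T - u))\<^sup>2) \<longlonglongrightarrow> 0"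
      by (intro AE_I2) simp
  qed simp
  then show ?thesis by simp
qed

section \<open>The limit equation\<close>

lemma cadlag_component: "cadlag f \<Longrightarrow> cadlag (\<lambda>t. f t $ i)" for f :: "real \<Rightarrow> real^'d"
  using cadlag_inner[of f "axis i 1"] by (simp add: inner_axis)

theorem theorem2p13:
  fixes P :: "nat \<Rightarrow> 'w measure" and F :: "nat \<Rightarrow> real \<Rightarrow> 'w measure"
    and N :: "nat \<Rightarrow> 'w \<Rightarrow> real \<Rightarrow> ('d::{finite, linorder}) rvec"
    and \<mu> :: "nat \<Rightarrow> real \<Rightarrow> 'd rvec"
    and \<phi> R :: "nat \<Rightarrow> real \<Rightarrow> 'd rmat"
    and \<theta> :: "nat \<Rightarrow> real"
    and l :: nat and K :: "'d rmat" and \<Phi> :: "real \<Rightarrow> 'd rmat"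
    and Q U :: "real Matrix.mat" and lp :: real
    and Pot :: "'d \<Rightarrow> 'd \<Rightarrow> real measure"
    and \<Upsilon> :: "real \<Rightarrow> 'd rvec"
    and P' :: "'v measure" and G :: "real \<Rightarrow> 'v measure"
    and \<Xi> M :: "'v \<Rightarrow> real \<Rightarrow> 'd rvec"
  assumes hawkes: "\<And>n. n \<ge> 1 \<Longrightarrow> hawkes_process (P n) (F n) (\<mu> n) (\<phi> n) (N n)"
    and resolvent: "\<And>n. n \<ge> 1 \<Longrightarrow> is_resolvent (\<phi> n) (R n)"
    and theta_pos: "\<And>n. n \<ge> 1 \<Longrightarrow> \<theta> n > 0"
    and theta_lim: "filterlim \<theta> at_top sequentially"
    and l_range: "1 \<le> l" "l \<le> CARD('d)"
    and K: "critical_matrix l K"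
    and kernel_lim: "(\<lambda>n. L1_norm_mat (\<phi> n)) \<longlonglongrightarrow> K"
    and Phi_cont: "continuous_on {0..} \<Phi>"
    and Phi_lim: "\<And>r. r \<ge> 0 \<Longrightarrow>
      (\<lambda>n. sqrt (real n * \<theta> n) *\<^sub>R (K - laplace (\<phi> n) (r / real n))) \<longlonglongrightarrow> \<Phi> r"
    and admissible: "admissible l K \<Phi> Q U lp"
    and potential: "potential_measure l \<Phi> Q U lp Pot"
    and potential_diag: "\<And>i j. i \<noteq> j \<Longrightarrow> potential_cumulative Pot 0 $ i $ j = 0"
    and Upsilon: "cadlag \<Upsilon>" "\<And>t. 0 \<le> \<Upsilon> t"
    and Upsilon_lim: "\<And>t. isCont \<Upsilon> t \<Longrightarrow>
      (\<lambda>n. primitive (rescaled_H n (\<theta> n) (\<mu> n) (R n)) t) \<longlonglongrightarrow> \<Upsilon> t"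
    and limit_space: "prob_space P'"
    and Xi: "\<And>\<omega>. \<omega> \<in> space P' \<Longrightarrow> \<Xi> \<omega> \<in> cadlag_space {0..} \<and> mono_on {0..} (\<Xi> \<omega>)"
    and M: "\<And>\<omega>. \<omega> \<in> space P' \<Longrightarrow> M \<omega> \<in> cadlag_space UNIV"
      "square_integrable_martingale P' G M"
    and limit: "converges_in_distribution
      (S_topology ({0..} \<times> {0..} \<times> (UNIV :: ('d rvec) set)))
      P (\<lambda>n \<omega> t.
        (primitive (rescale_intensity n (\<theta> n) (hawkes_intensity (\<mu> n) (\<phi> n) (N n \<omega>))) t,
         rescale_counting n (\<theta> n) (N n \<omega>) t,
         rescale_compensated n (\<theta> n) (compensated (\<mu> n) (\<phi> n) (N n \<omega>)) t))
      P' (\<lambda>\<omega> t. (\<Xi> \<omega> t, \<Xi> \<omega> t, M \<omega> t))"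
  shows "AE \<omega> in P'. \<forall>t\<ge>0. \<Xi> \<omega> t = \<Upsilon> t + potential_conv Pot (M \<omega>) t"
proof -
  define E :: "('d rvec \<times> 'd rvec \<times> 'd rvec) set" where "E = {0..} \<times> {0..} \<times> UNIV"
  define X where "X n \<omega> t =
        (primitive (rescale_intensity n (\<theta> n) (hawkes_intensity (\<mu> n) (\<phi> n) (N n \<omega>))) t,
         rescale_counting n (\<theta> n) (N n \<omega>) t,
         rescale_compensated n (\<theta> n) (compensated (\<mu> n) (\<phi> n) (N n \<omega>)) t)" for n \<omega> t
  define X' where "X' \<omega> t = (\<Xi> \<omega> t, \<Xi> \<omega> t, M \<omega> t)" for \<omega> t
  have conv: "converges_in_distribution (S_topology E) P X P' X'"
    using limit unfolding E_def X_def[abs_def] X'_def[abs_def] .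
  have prob: "prob_space (P n)" if "n \<ge> 1" for n
    using hawkes[OF that] by (simp add: hawkes_process_def)
  have par: "hawkes_parameters (\<mu> n) (\<phi> n)" if "n \<ge> 1" for n
    using hawkes[OF that] by (simp add: hawkes_process_def)
  have path: "counting_path (N n \<omega>)" if "n \<ge> 1" "\<omega> \<in> space (P n)" for n \<omega>
    using hawkes[OF that(1)] that(2) by (simp add: hawkes_process_def)
  have Rp: "loc_integrable_fun (R n)" "0 \<le> t \<Longrightarrow> 0 \<le> R n t" if "n \<ge> 1" for n t
    using resolvent[OF that] by (auto simp: is_resolvent_def)
  have \<mu>p: "loc_integrable_fun (\<mu> n)" "0 \<le> t \<Longrightarrow> 0 \<le> \<mu> n t" if "n \<ge> 1" for n t
    using par[OF that] by (auto simp: hawkes_parameters_def)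
  have Pot: "sets (Pot i j) = sets borel" "emeasure (Pot i j) {..<0} = 0" "emeasure (Pot i j) {0..t} < \<infinity>" for i j t
    using potential by (auto simp: potential_measure_def)
  \<comment> \<open>the basis vectors that read off a coordinate of the first and of the third path\<close>
  define bx :: "'d \<Rightarrow> 'd rvec \<times> 'd rvec \<times> 'd rvec" where "bx i = (axis i 1, 0, 0)" for i
  define bm :: "'d \<Rightarrow> 'd rvec \<times> 'd rvec \<times> 'd rvec" where "bm j = (0, 0, axis j 1)" for j
  have bx: "bx i \<in> Basis" and bm: "bm i \<in> Basis" for i
    by (auto simp: bx_def bm_def Basis_prod_def Basis_vec_def image_iff zero_prod_def)
  have rix: "running_integral z (bx i) u = (LINT s:{0..u}|lborel. fst (z s) $ i)"
    and rim: "running_integral z (bm i) u = (LINT s:{0..u}|lborel. snd (snd (z s)) $ i)" for z u i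
    by (simp_all add: running_integral_def bx_def bm_def inner_prod_def inner_axis)
  define \<rho> where "\<rho> i j t = (LINT s|Pot i j. max 0 (t - s))" for i j t
  \<comment> \<open>the value at \<open>n = 0\<close> keeps all functions nondecreasing\<close>
  define \<rho>n where "\<rho>n n i j = (if n \<ge> 1 then double_integral (entry (rescale_density n (\<theta> n) (R n)) i j) else (\<lambda>_. 0))" for n i j
  have \<rho>nd: "nondecr (\<rho> i j)" for i j
    unfolding \<rho>_def[abs_def] by (rule tail_integral(2)[OF Pot])
  have rescR: "loc_integrable_fun (rescale_density n (\<theta> n) (R n))" "0 \<le> t \<Longrightarrow> 0 \<le> rescale_density n (\<theta> n) (R n) t" if n: "n \<ge> 1" for n t
    by (rule loc_integrable_rescale_density[OF Rp(1)[OF n]]) (use n theta_pos[OF n] Rp(2)[OF n] in \<open>auto simp: rescale_density_def less_eq_vec_def\<close>)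
  have \<rho>nnd: "nondecr (\<rho>n n i j)" for n i j
    unfolding \<rho>n_def using double_integral_entry(1)[OF rescR] by (auto simp: nondecr_def)
  have \<rho>lim: "(\<lambda>n. \<rho>n n i j t) \<longlonglongrightarrow> \<rho> i j t" if t: "0 \<le> t" for i j t
  proof -
    have "(\<lambda>n. enn2real (conv (conv heaviside heaviside) (entry (rescale_density n (\<theta> n) (R n)) i j) t)) \<longlonglongrightarrow> \<rho> i j t"
      unfolding \<rho>_def
      by (rule resolvent_double_integral_convergence[OF _ _ resolvent theta_pos theta_lim l_range(2) K Phi_lim admissible potential t])
        (use par in \<open>auto simp: hawkes_parameters_def\<close>)
    moreover have "\<forall>\<^sub>F n in sequentially. enn2real (conv (conv heaviside heaviside) (entry (rescale_density n (\<theta> n) (R n)) i j) t) = \<rho>n n i j t"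
      using eventually_ge_at_top[of 1] by eventually_elim (simp add: \<rho>n_def double_integral_def)
    ultimately show ?thesis by (rule Lim_transform_eventually)
  qed
  define y where "y n i t = (if n \<ge> 1 then primitive (rescaled_H n (\<theta> n) (\<mu> n) (R n)) t $ i else 0)" for n i t
  have ynd: "nondecr (y n i)" for n i
  proof (cases "n \<ge> 1")
    case True
    show ?thesis
      unfolding y_def[abs_def] using True theta_pos[OF True]
      by (simp) (intro nondecr_primitive_component primitive_rescaled_H(1,2) \<mu>p[OF True] Rp[OF True]; simp)
  qed (simp add: y_def[abs_def] nondecr_def)
  have ylim: "(\<lambda>n. y n i t) \<longlonglongrightarrow> \<Upsilon> t $ i" if "t \<notin> {t. \<not> isCont \<Upsilon> t}" for i t
  proof -
    have "(\<lambda>n. primitive (rescaled_H n (\<theta> n) (\<mu> n) (R n)) t $ i) \<longlonglongrightarrow> \<Upsilon> t $ i"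
      using that by (intro tendsto_vec_nth Upsilon_lim) simp
    moreover have "\<forall>\<^sub>F n in sequentially. primitive (rescaled_H n (\<theta> n) (\<mu> n) (R n)) t $ i = y n i t"
      using eventually_ge_at_top[of 1] by eventually_elim (simp add: y_def)
    ultimately show ?thesis by (rule Lim_transform_eventually)
  qed
  have pathwise: "AE \<omega> in P'.
      (LINT u:{0..T}|lborel. (T - u) * (LINT s:{0..u}|lborel. \<Xi> \<omega> s $ i))
      = (LINT u:{0..T}|lborel. (T - u) * (LINT s:{0..u}|lborel. \<Upsilon> s $ i))
        + (\<Sum>j\<in>UNIV. LINT u:{0..T}|lborel. \<rho> i j (T - u) * (LINT s:{0..u}|lborel. M \<omega> s $ j))" if T: "0 \<le> T" for T i
  proof -
    define \<kappa> where "\<kappa> = (LINT u:{0..T}|lborel. (T - u) * (LINT s:{0..u}|lborel. \<Upsilon> s $ i))"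
    define \<kappa>n where "\<kappa>n n = (LINT u:{0..T}|lborel. (T - u) * (LINT s:{0..u}|lborel. y n i s))" for n
    define e where "e n = (\<Sum>j\<in>UNIV. LINT u:{0..T}|lborel. (\<rho>n n i j (T - u) - \<rho> i j (T - u))\<^sup>2)" for n
    define \<Psi> where "\<Psi> z = (LINT u:{0..T}|lborel. (T - u) * running_integral z (bx i) u) - \<kappa>
        - (\<Sum>j\<in>UNIV. LINT u:{0..T}|lborel. \<rho> i j (T - u) * running_integral z (bm j) u)" for z
    define J where "J z = (\<Sum>j\<in>UNIV. LINT u:{0..T}|lborel. (running_integral z (bm j) u)\<^sup>2)" for z
    have \<kappa>lim: "(\<lambda>n. \<bar>\<kappa>n n - \<kappa>\<bar>) \<longlonglongrightarrow> 0"
    proof -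
      have "\<kappa>n \<longlonglongrightarrow> \<kappa>"
        unfolding \<kappa>n_def[abs_def] \<kappa>_def
        by (rule nondecr_limit_double_integral[OF ynd cadlag_component[OF Upsilon(1)] cadlag_countable_discontinuities[OF Upsilon(1)] ylim T])
      then show ?thesis by (simp add: tendsto_rabs_zero LIM_zero)
    qed
    have elim: "e \<longlonglongrightarrow> 0"
    proof -
      have "e \<longlonglongrightarrow> (\<Sum>j\<in>(UNIV :: 'd set). 0)"
        unfolding e_def[abs_def] by (intro tendsto_sum nondecr_square_difference_limit \<rho>nnd \<rho>nd \<rho>lim T)
      then show ?thesis by simp
    qed
    have idm: "(\<lambda>u. indicator {0..T} u * (T - u)) \<in> borel_measurable borel" by measurable
    have \<Psi>lim: "(\<lambda>n. \<Psi> (fs n)) \<longlonglongrightarrow> \<Psi> f" and Jlim: "(\<lambda>n. J (fs n)) \<longlonglongrightarrow> J f"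
      if fs: "\<And>n. fs n \<in> cadlag_space E" and f: "f \<in> cadlag_space E" and S: "S_converges fs f" for fs f
    proof -
      have "(\<lambda>n. LINT u:{0..T}|lborel. (T - u) * running_integral (fs n) (bx i) u) \<longlonglongrightarrow> (LINT u:{0..T}|lborel. (T - u) * running_integral f (bx i) u)"
        by (rule S_converges_weighted_integral(1)[OF fs f S bx T idm, where W = T]) auto
      moreover have "(\<lambda>n. LINT u:{0..T}|lborel. \<rho> i j (T - u) * running_integral (fs n) (bm j) u) \<longlonglongrightarrow> (LINT u:{0..T}|lborel. \<rho> i j (T - u) * running_integral f (bm j) u)" for j
      proof (rule S_converges_weighted_integral(1)[OF fs f S bm T nondecr_interval_measurable(2)[OF \<rho>nd], where W = "\<rho> i j T"])
        show "\<bar>\<rho> i j (T - u)\<bar> \<le> \<rho> i j T" if "0 \<le> u" "u \<le> T" for u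
          using nondecrD(1)[OF \<rho>nd, of "T - u" i j] nondecrD(2)[OF \<rho>nd, of "T - u" T i j] that by simp
      qed
      ultimately show "(\<lambda>n. \<Psi> (fs n)) \<longlonglongrightarrow> \<Psi> f"
        unfolding \<Psi>_def by (intro tendsto_diff tendsto_sum tendsto_const)
      show "(\<lambda>n. J (fs n)) \<longlonglongrightarrow> J f"
        unfolding J_def by (intro tendsto_sum S_converges_weighted_integral(2)[OF fs f S bm T idm, where W = T]) auto
    qed
    have "AE \<omega> in P'. \<Psi> (X' \<omega>) = 0"
    proof (rule vanishing_functional_of_limit[OF conv prob limit_space \<Psi>lim Jlim _ _ _ \<kappa>lim elim])
      show "0 \<le> J z" for z unfolding J_def set_lebesgue_integral_def by (intro sum_nonneg integral_nonneg_AE) auto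
      show "0 \<le> \<bar>\<kappa>n n - \<kappa>\<bar>" for n by simp
      show "0 \<le> e n" for n unfolding e_def set_lebesgue_integral_def by (intro sum_nonneg integral_nonneg_AE) auto
      fix n \<omega> and c :: real
      assume n: "n \<ge> 1" and \<omega>: "\<omega> \<in> space (P n)" and Xc: "X n \<omega> \<in> cadlag_space E" and c: "0 < c"
      let ?z = "X n \<omega>"
      have cz: "cadlag ?z" using Xc by (simp add: cadlag_space_def)
      have "\<forall>j. \<exists>B. \<forall>u. 0 \<le> u \<longrightarrow> u \<le> T \<longrightarrow> \<bar>running_integral ?z (bm j) u\<bar> \<le> B"
        using running_integral_bounded[OF cz bm] by metis
      then obtain B where B: "\<And>j u. 0 \<le> u \<Longrightarrow> u \<le> T \<Longrightarrow> \<bar>running_integral ?z (bm j) u\<bar> \<le> B j" by metis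
      \<comment> \<open>the prelimit equation, with the prelimit forcing and kernels\<close>
      have identity: "(LINT u:{0..T}|lborel. (T - u) * running_integral ?z (bx i) u)
          = \<kappa>n n + (\<Sum>j\<in>UNIV. LINT u:{0..T}|lborel. \<rho>n n i j (T - u) * running_integral ?z (bm j) u)"
        using rescaled_path_identity[OF par[OF n] path[OF n \<omega>] resolvent[OF n] n theta_pos[OF n] T, of i] n
        by (simp add: rix rim X_def \<kappa>n_def y_def \<rho>n_def)
      have ym: "(\<lambda>u. indicator {0..T} u * running_integral ?z (bm j) u) \<in> borel_measurable borel" for j
        by (intro borel_measurable_times running_integral_measurable[OF cz]) simp
      show "\<bar>\<Psi> ?z\<bar> \<le> \<bar>\<kappa>n n - \<kappa>\<bar> + e n / c + c * J ?z"
        unfolding \<Psi>_def J_def e_def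
        by (rule perturbed_kernel_bound[OF \<rho>nnd \<rho>nd ym B c identity])
    qed
    then show ?thesis
      by eventually_elim (simp add: \<Psi>_def \<kappa>_def rix rim X'_def)
  qed
  have "AE \<omega> in P'. \<forall>T\<in>{T \<in> \<rat>. 0 \<le> T}. \<forall>i\<in>UNIV.
      (LINT u:{0..T}|lborel. (T - u) * (LINT s:{0..u}|lborel. \<Xi> \<omega> s $ i))
      = (LINT u:{0..T}|lborel. (T - u) * (LINT s:{0..u}|lborel. \<Upsilon> s $ i))
        + (\<Sum>j\<in>UNIV. LINT u:{0..T}|lborel. \<rho> i j (T - u) * (LINT s:{0..u}|lborel. M \<omega> s $ j))"
  proof -
    have cR: "countable {T :: real. T \<in> \<rat> \<and> 0 \<le> T}"
      by (rule countable_subset[OF _ countable_rat]) auto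
    show ?thesis
      unfolding AE_ball_countable[OF cR] AE_ball_countable[OF countable_finite[OF finite_class.finite_UNIV]]
      using pathwise by auto
  qed
  then show ?thesis
  proof (rule AE_mp, intro AE_I2 impI allI)
    fix \<omega> t assume \<omega>: "\<omega> \<in> space P'" and t: "(0 :: real) \<le> t"
      and eq: "\<forall>T\<in>{T \<in> \<rat>. 0 \<le> T}. \<forall>i\<in>UNIV.
      (LINT u:{0..T}|lborel. (T - u) * (LINT s:{0..u}|lborel. \<Xi> \<omega> s $ i))
      = (LINT u:{0..T}|lborel. (T - u) * (LINT s:{0..u}|lborel. \<Upsilon> s $ i))
        + (\<Sum>j\<in>UNIV. LINT u:{0..T}|lborel. \<rho> i j (T - u) * (LINT s:{0..u}|lborel. M \<omega> s $ j))"
    have "\<Xi> \<omega> t $ i = \<Upsilon> t $ i + (\<Sum>j\<in>UNIV. LINT s:{0..t}|Pot i j. M \<omega> (t - s) $ j)" for i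
    proof (rule volterra_from_triple_integrals[where P = "Pot i" and m = "\<lambda>j s. M \<omega> s $ j" and \<xi> = "\<lambda>s. \<Xi> \<omega> s $ i" and \<upsilon> = "\<lambda>s. \<Upsilon> s $ i", OF _ _ _ _ Pot _ t])
      show "pos_path (\<lambda>s. \<Xi> \<omega> s $ i)" "pos_path (\<lambda>s. \<Upsilon> s $ i)"
        using Xi[OF \<omega>] Upsilon by (auto simp: pos_path_def cadlag_space_def less_eq_vec_def intro: cadlag_component)
      show "cadlag (\<lambda>s. M \<omega> s $ j)" "t < 0 \<Longrightarrow> M \<omega> t $ j = 0" for j t
        using M(1)[OF \<omega>] by (auto simp: cadlag_space_def intro: cadlag_component)
      show "(LINT u:{0..T}|lborel. (T - u) * (LINT s:{0..u}|lborel. \<Xi> \<omega> s $ i))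
          = (LINT u:{0..T}|lborel. (T - u) * (LINT s:{0..u}|lborel. \<Upsilon> s $ i))
            + (\<Sum>j\<in>UNIV. LINT u:{0..T}|lborel. (LINT s|Pot i j. max 0 (T - u - s)) * (LINT s:{0..u}|lborel. M \<omega> s $ j))"
        if "T \<in> \<rat>" "0 \<le> T" for T
        using eq that by (simp add: \<rho>_def)
    qed
    then show "\<Xi> \<omega> t = \<Upsilon> t + potential_conv Pot (M \<omega>) t"
      by (simp add: vec_eq_iff potential_conv_def)
  qed
qed

end
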